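(* Let $r,n,p$ be positive integers with $p\mid r$ and $\gcd(p,n)=2$ (so $r$ and $n$ are even; put $r'=r/2$, $n'=n/2$). Let $M^1\subseteq M$ be the antisymmetric submodule of the Gelfand model $(M,\varrho)$ of $G(r,p,n)$, i.e. $M^1=\bigoplus_{v}\mathbb{C}C_v$ where $v$ runs over the antisymmetric absolute involutions of $G(r,n)/C_p$. Then, as $G(r,p,n)$-modules, $$(M^1,\varrho)\cong\bigoplus_{[\mu,\mu]}\rho^1_{[\mu,\mu]},$$ where the sum runs over all orbits $[\lambda]\in\mathrm{Fer}(r,1,p,n)$ whose elements are of the form $\lambda=(\mu,\mu)$ with $\mu\in\mathrm{Fer}(r',n')$ (one summand per orbit).
   Context: Notation. $\zeta_k=e^{2\pi i/k}$. $G(r,n)$ is the group of $n\times n$ monomial complex matrices whose nonzero entries are $r$-th roots of unity. For $g\in G(r,n)$ write $g=[\sigma_1^{z_1},\dots,\sigma_n^{z_n}]$ if the nonzero entry of row $j$ lies in column $\sigma_j$ and equals $\zeta_r^{z_j}$; put $z_j(g)=z_j\in\mathbb{Z}_r$, $z(g)=\sum_j z_j(g)\in\mathbb{Z}_r$ and $|g|=[\sigma_1,\dots,\sigma_n]\in S_n$ (identified with its permutation matrix). $G(r,p,n)=\{g\in G(r,n): z(g)\equiv 0 \bmod p\}$. $C_p$ is the group of scalar matrices generated by $\zeta_pI$, and $G(r,1,p,n)=G(r,n)/C_p$. An element $v\in G(r,n)/C_p$ is an absolute involution if $v\bar v=1$ (complex conjugation); it is symmetric (resp. antisymmetric) if every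 lift $\tilde v\in G(r,n)$ satisfies $\tilde v^T=\tilde v$ (resp. $\tilde v^T=-\tilde v$). Gelfand model. Let $M=\bigoplus_{v}\mathbb{C}C_v$ ($v$ over absolute involutions of $G(r,n)/C_p$, $C_v$ formal basis vectors). For $g\in G(r,p,n)$ and $v$ with lift $\tilde v$, put $\langle g,v\rangle=\sum_i z_i(g)z_i(\tilde v)\in\mathbb{Z}_r$, $a(g,v)=z_1(\tilde v)-z_{|g|^{-1}(1)}(\tilde v)\in\mathbb{Z}_r$, and $\mathrm{inv}_v(g)=\#\{\{i,j\}: |\tilde v|(i)=j\neq i,\ (j-i)(|g|(j)-|g|(i))<0\}$ (independent of the lift). Define $\varrho(g)C_v=\zeta_r^{\langle g,v\rangle}(-1)^{\mathrm{inv}_v(g)}C_{|g|v|g|^{-1}}$ if $v$ is symmetric and $\varrho(g)C_v=\zeta_r^{\langle g,v\rangle}\zeta_r^{a(g,v)}C_{|g|v|g|^{-1}}$ if $v$ is antisymmetric. This is a $G(r,p,n)$-module (a Gelfand model). Irreducible representations. $\mathrm{Fer}(r,n)$ is the set of $r$-tuples $\lambda=(\lambda^{(0)},\dots,\lambda^{(r-1)})$ of partitions with $\sum|\lambda^{(i)}|=n$. With $n_i=|\lambda^{(i)}|$, $\rho_\lambda=\mathrm{Ind}_{G(r,n_0)\times\cdots\times G(r,n_{r-1})}^{G(r,n)}\bigodot_i(\gamma_{n_i}^{\otimes i}\otimes\tilde\rho_{\lambda^{(i)}})$, where the subgroup is block diagonal, $\gamma_m(g)=\zeta_r^{z(g)}$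 on $G(r,m)$ and $\tilde\rho_{\lambda^{(i)}}(g)=\rho_{\lambda^{(i)}}(|g|)$ with $\rho_{\lambda^{(i)}}$ the Specht module of $S_{n_i}$. $\mathrm{Fer}(r,1,p,n)$ is the set of orbits $[\lambda]$ of $\mathrm{Fer}(r,n)$ under the shift $\lambda\mapsto(\lambda^{(r-r/p)},\dots,\lambda^{(r-1)},\lambda^{(0)},\dots,\lambda^{(r-1-r/p)})$. For $\mu\in\mathrm{Fer}(r',n')$ let $(\mu,\mu)=(\mu^{(0)},\dots,\mu^{(r'-1)},\mu^{(0)},\dots,\mu^{(r'-1)})\in\mathrm{Fer}(r,n)$. When $\gcd(p,n)=2$, the restriction of $\rho_{(\mu,\mu)}$ to $G(r,p,n)$ splits into two non-isomorphic irreducibles $\rho^0_{[\mu,\mu]},\rho^1_{[\mu,\mu]}$, labelled as follows. Let $\delta(g)=(-1)^{z(g)}$, and $(V,\rho_\mu)$ a realization of the $G(r,n')$-representation $\rho_{(\mu^{(0)},\dots,\mu^{(r'-1)},\emptyset,\dots,\emptyset)}$. Let $\Theta$ be the set of permutations $t=[t_1,\dots,t_n]\in S_n$ with $t_1<\dots<t_{n'}$ and $t_{n'+1}<\dots<t_n$, and $\hat t=[t_{n'+1},\dots,t_n,t_1,\dots,t_{n'}]$. For $x\in G(r,n)$, $t\in\Theta$ there are unique $t'\in\Theta$, $x_1,x_2\in G(r,n')$ with $xt=t'\,\mathrm{diag}(x_1,x_2)$. With $T$ the space with basis $\Theta$, $\rho_{(\mu,\mu)}$ is realized on $T\otimes V\otimes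 V$ by $x(t\otimes v_1\otimes v_2)=\delta(x_2)\,t'\otimes\rho_\mu(x_1)v_1\otimes\rho_\mu(x_2)v_2$. The map $S(t\otimes v_1\otimes v_2)=\hat t\otimes v_2\otimes v_1$ is an involution commuting with $G(r,p,n)$, and $\rho^0_{[\mu,\mu]}$ (resp. $\rho^1_{[\mu,\mu]}$) is the $G(r,p,n)$-representation on its $+1$ (resp. $-1$) eigenspace.
   Formalization: The nonzero entry of column j of g (not of row j) lies in row σ_j and equals ζ_r^{z_j}, with the usual matrix product; with rows, ϱ is not multiplicative (r=p=2, n=4, g=diag(1,−1,−1,1), h=(3 4)) and t' in xt=t'diag(x1,x2) is not unique. *)

theory Defs
  imports
    "HOL-Algebra.Generated_Groups"
    "HOL-Algebra.Product_Groups"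
    "HOL-Combinatorics.Permutations"
    "HOL-Library.Function_Algebras"
    "Jordan_Normal_Form.Matrix"
begin

text \<open>
  Indices are 0-based throughout: rows, columns, letters and components run over
  \<open>{0..<n}\<close> instead of \<open>{1..n}\<close>.
\<close>

section \<open>Representations on spaces of complex-valued functions\<close>

definition fscale :: "complex \<Rightarrow> ('b \<Rightarrow> complex) \<Rightarrow> 'b \<Rightarrow> complex" where
  "fscale c f = (\<lambda>x. c * f x)"

interpretation cfun: vector_space fscale
  by unfold_locales (auto simp: fscale_def fun_eq_iff algebra_simps)

definition basis_vec :: "'b \<Rightarrow> 'b \<Rightarrow> complex" where
  "basis_vec v = (\<lambda>u. if u = v then 1 else 0)"

text \<open>
  \<open>ract R g\<close> is a total function, but only its values on \<open>rspace R\<close>, for \<open>g\<close> in the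
  group under consideration, are meaningful.
\<close>

record ('g, 'b) rep =
  rspace :: "('b \<Rightarrow> complex) set"
  ract :: "'g \<Rightarrow> ('b \<Rightarrow> complex) \<Rightarrow> 'b \<Rightarrow> complex"

definition linear_map_on ::
    "('b \<Rightarrow> complex) set \<Rightarrow> (('b \<Rightarrow> complex) \<Rightarrow> 'c \<Rightarrow> complex) \<Rightarrow> bool" where
  "linear_map_on V f \<longleftrightarrow>
     (\<forall>x\<in>V. \<forall>y\<in>V. f (x + y) = f x + f y) \<and> (\<forall>c. \<forall>x\<in>V. f (fscale c x) = fscale c (f x))"

definition representation :: "('g, 'm) monoid_scheme \<Rightarrow> ('g, 'b) rep \<Rightarrow> bool" where
  "representation G R \<longleftrightarrow>
     cfun.subspace (rspace R) \<and>
     (\<forall>g\<in>carrier G. ract R g \<in> rspace R \<rightarrow> rspace R \<and> linear_map_on (rspace R) (ract R g)) \<and>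
     (\<forall>x\<in>rspace R. ract R \<one>\<^bsub>G\<^esub> x = x) \<and>
     (\<forall>g\<in>carrier G. \<forall>h\<in>carrier G. \<forall>x\<in>rspace R. ract R (g \<otimes>\<^bsub>G\<^esub> h) x = ract R g (ract R h x))"

definition rep_iso :: "('g, 'm) monoid_scheme \<Rightarrow> ('g, 'b) rep \<Rightarrow> ('g, 'c) rep \<Rightarrow> bool" where
  "rep_iso G R S \<longleftrightarrow>
     representation G R \<and> representation G S \<and>
     (\<exists>\<phi>. bij_betw \<phi> (rspace R) (rspace S) \<and> linear_map_on (rspace R) \<phi> \<and>
          (\<forall>g\<in>carrier G. \<forall>x\<in>rspace R. \<phi> (ract R g x) = ract S g (\<phi> x)))"

text \<open>Direct sum over a finite index set \<open>I\<close>.\<close>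

definition direct_sum_rep :: "'i set \<Rightarrow> ('i \<Rightarrow> ('g, 'b) rep) \<Rightarrow> ('g, 'i \<times> 'b) rep" where
  "direct_sum_rep I R =
     \<lparr> rspace = {f. (\<forall>i\<in>I. (\<lambda>b. f (i, b)) \<in> rspace (R i)) \<and> (\<forall>i b. i \<notin> I \<longrightarrow> f (i, b) = 0)},
       ract = (\<lambda>g f (i, b). if i \<in> I then ract (R i) g (\<lambda>b'. f (i, b')) b else 0) \<rparr>"

text \<open>
  External tensor product of representations \<open>R 0, \<dots>, R (k - 1)\<close> of groups
  \<open>G\<^sub>0, \<dots>, G\<^bsub>k-1\<^esub>\<close>, as a representation of the product group: the tensor
  \<open>v 0 \<otimes> \<dots> \<otimes> v (k - 1)\<close> is the function of \<open>k\<close> variables \<open>\<lambda>b. \<Prod>i<k. v i (b i)\<close>, and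
  \<open>apply_at i A\<close> applies the operator \<open>A\<close> to the \<open>i\<close>-th tensor factor.
\<close>

definition pure_tensor :: "nat \<Rightarrow> (nat \<Rightarrow> 'b \<Rightarrow> complex) \<Rightarrow> (nat \<Rightarrow> 'b) \<Rightarrow> complex" where
  "pure_tensor k v = (\<lambda>b. \<Prod>i<k. v i (b i))"

definition apply_at ::
    "nat \<Rightarrow> (('b \<Rightarrow> complex) \<Rightarrow> 'b \<Rightarrow> complex) \<Rightarrow>
     ((nat \<Rightarrow> 'b) \<Rightarrow> complex) \<Rightarrow> (nat \<Rightarrow> 'b) \<Rightarrow> complex" where
  "apply_at i A F = (\<lambda>b. A (\<lambda>c. F (b(i := c))) (b i))"

definition outer_tensor_rep ::
    "nat \<Rightarrow> (nat \<Rightarrow> ('g, 'b) rep) \<Rightarrow> (nat \<Rightarrow> 'g, nat \<Rightarrow> 'b) rep" where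
  "outer_tensor_rep k R =
     \<lparr> rspace = cfun.span {pure_tensor k v | v. \<forall>i<k. v i \<in> rspace (R i)},
       ract = (\<lambda>gs. fold (\<lambda>i. apply_at i (ract (R i) (gs i))) [0..<k]) \<rparr>"

text \<open>
  The representation of \<open>G\<close> induced from a representation \<open>W\<close> of \<open>K\<close> along an embedding
  \<open>\<iota>\<close> of \<open>K\<close> in \<open>G\<close>: functions \<open>f : G \<rightarrow> W\<close> with \<open>f (\<iota> k x) = k f(x)\<close>, on which \<open>G\<close> acts by
  right translation. Functions \<open>G \<rightarrow> W\<close> are uncurried and extended by 0 outside \<open>G\<close>.
\<close>

definition induced_rep ::
    "('g, 'm) monoid_scheme \<Rightarrow> ('k, 'l) monoid_scheme \<Rightarrow> ('k \<Rightarrow> 'g) \<Rightarrow> ('k, 'b) rep \<Rightarrow>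
     ('g, 'g \<times> 'b) rep" where
  "induced_rep G K \<iota> W =
     \<lparr> rspace = {f. (\<forall>x\<in>carrier G. (\<lambda>b. f (x, b)) \<in> rspace W) \<and>
                    (\<forall>x b. x \<notin> carrier G \<longrightarrow> f (x, b) = 0) \<and>
                    (\<forall>k\<in>carrier K. \<forall>x\<in>carrier G.
                       (\<lambda>b. f (\<iota> k \<otimes>\<^bsub>G\<^esub> x, b)) = ract W k (\<lambda>b. f (x, b)))},
       ract = (\<lambda>g f (x, b). if x \<in> carrier G then f (x \<otimes>\<^bsub>G\<^esub> g, b) else 0) \<rparr>"


section \<open>The groups\<close>

definition zeta :: "nat \<Rightarrow> complex" where
  "zeta k = exp (2 * of_real pi * \<i> / of_nat k)"

definition Grn :: "nat \<Rightarrow> nat \<Rightarrow> complex mat monoid" where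
  "Grn r n =
     \<lparr> carrier = {A \<in> carrier_mat n n.
         (\<forall>i<n. \<exists>!j. j < n \<and> A $$ (i, j) \<noteq> 0) \<and>
         (\<forall>j<n. \<exists>!i. i < n \<and> A $$ (i, j) \<noteq> 0) \<and>
         (\<forall>i<n. \<forall>j<n. A $$ (i, j) \<noteq> 0 \<longrightarrow> A $$ (i, j) ^ r = 1)},
       monoid.mult = (*), one = 1\<^sub>m n \<rparr>"

text \<open>
  \<open>perm_of g\<close> is the permutation \<open>|g|\<close> and \<open>zexp r g j\<close> is the representative of
  \<open>z\<^sub>j(g)\<close> in \<open>{0..<r}\<close>. Matrices act on column vectors: the nonzero entry of \<^emph>\<open>column\<close> \<open>j\<close> of
  \<open>g\<close> lies in \<^emph>\<open>row\<close> \<open>|g|(j)\<close> and equals \<open>\<zeta>\<^sub>r\<close> to the power \<open>z\<^sub>j(g)\<close>. This is the convention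
  for which \<open>|g h| = |g| \<circ> |h|\<close> for the matrix product \<open>g h\<close>. With rows and columns
  interchanged but the matrix product kept, the formulas below would not define an action on
  the Gelfand model, and \<open>shuffles_n n\<close> would not represent the left cosets of the block
  diagonal subgroup (equivalently, one could keep rows and reverse the matrix product). For (anti)symmetric lifts of absolute involutions the choice is
  immaterial.
\<close>

definition perm_of :: "complex mat \<Rightarrow> nat \<Rightarrow> nat" where
  "perm_of g j = (if j < dim_col g then THE i. i < dim_row g \<and> g $$ (i, j) \<noteq> 0 else j)"

definition zexp :: "nat \<Rightarrow> complex mat \<Rightarrow> nat \<Rightarrow> int" where
  "zexp r g j = (THE k. 0 \<le> k \<and> k < int r \<and> g $$ (perm_of g j, j) = zeta r powi k)"

definition zsum :: "nat \<Rightarrow> complex mat \<Rightarrow> int" where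
  "zsum r g = (\<Sum>j<dim_col g. zexp r g j)"

definition perm_mat :: "nat \<Rightarrow> (nat \<Rightarrow> nat) \<Rightarrow> complex mat" where
  "perm_mat n s = mat n n (\<lambda>(i, j). if i = s j then 1 else 0)"

definition Grpn :: "nat \<Rightarrow> nat \<Rightarrow> nat \<Rightarrow> complex mat monoid" where
  "Grpn r p n = (Grn r n)\<lparr>carrier := {g \<in> carrier (Grn r n). int p dvd zsum r g}\<rparr>"

definition Cp :: "nat \<Rightarrow> nat \<Rightarrow> nat \<Rightarrow> complex mat set" where
  "Cp r p n = generate (Grn r n) {zeta p \<cdot>\<^sub>m 1\<^sub>m n}"

text \<open>The projective group \<open>G(r,1,p,n)\<close>; its elements are cosets, i.e. the sets of all lifts.\<close>

definition Gproj :: "nat \<Rightarrow> nat \<Rightarrow> nat \<Rightarrow> complex mat set monoid" where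
  "Gproj r p n = Grn r n Mod Cp r p n"


section \<open>The Gelfand model\<close>

definition absolute_involutions :: "nat \<Rightarrow> nat \<Rightarrow> nat \<Rightarrow> complex mat set set" where
  "absolute_involutions r p n =
     {v \<in> carrier (Gproj r p n). v \<otimes>\<^bsub>Gproj r p n\<^esub> (map_mat cnj ` v) = \<one>\<^bsub>Gproj r p n\<^esub>}"

definition symmetric_coset :: "complex mat set \<Rightarrow> bool" where
  "symmetric_coset v \<longleftrightarrow> (\<forall>w\<in>v. transpose_mat w = w)"

definition antisymmetric_coset :: "complex mat set \<Rightarrow> bool" where
  "antisymmetric_coset v \<longleftrightarrow> (\<forall>w\<in>v. transpose_mat w = - w)"

definition z_pairing :: "nat \<Rightarrow> nat \<Rightarrow> complex mat \<Rightarrow> complex mat \<Rightarrow> int" where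
  "z_pairing r n g w = (\<Sum>i<n. zexp r g i * zexp r w i)"

definition a_exp :: "nat \<Rightarrow> complex mat \<Rightarrow> complex mat \<Rightarrow> int" where
  "a_exp r g w = zexp r w 0 - zexp r w (inv_into UNIV (perm_of g) 0)"

definition inv_count :: "nat \<Rightarrow> complex mat \<Rightarrow> complex mat \<Rightarrow> nat" where
  "inv_count n w g =
     card {{i, j} | i j. i < n \<and> j < n \<and> perm_of w i = j \<and> j \<noteq> i \<and>
             (int j - int i) * (int (perm_of g j) - int (perm_of g i)) < 0}"

text \<open>
  The lift of \<open>v\<close> is chosen arbitrarily; for \<open>g \<in> G(r,p,n)\<close> the coefficient does not depend
  on the choice.
\<close>

definition model_coeff :: "nat \<Rightarrow> nat \<Rightarrow> complex mat \<Rightarrow> complex mat set \<Rightarrow> complex" where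
  "model_coeff r n g v =
     (let w = (SOME w. w \<in> v) in
        zeta r powi z_pairing r n g w *
        (if symmetric_coset v then (-1) ^ inv_count n w g else zeta r powi a_exp r g w))"

definition model_conj :: "nat \<Rightarrow> nat \<Rightarrow> complex mat \<Rightarrow> complex mat set \<Rightarrow> complex mat set" where
  "model_conj r n g v =
     (let P = perm_mat n (perm_of g) in
        (\<lambda>w. P \<otimes>\<^bsub>Grn r n\<^esub> w \<otimes>\<^bsub>Grn r n\<^esub> inv\<^bsub>Grn r n\<^esub> P) ` v)"

definition gelfand_model :: "nat \<Rightarrow> nat \<Rightarrow> nat \<Rightarrow> (complex mat, complex mat set) rep" where
  "gelfand_model r p n =
     \<lparr> rspace = cfun.span (basis_vec ` absolute_involutions r p n),
       ract = (\<lambda>g f. \<Sum>v\<in>absolute_involutions r p n.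
                 fscale (f v * model_coeff r n g v) (basis_vec (model_conj r n g v))) \<rparr>"

definition antisymmetric_submodel ::
    "nat \<Rightarrow> nat \<Rightarrow> nat \<Rightarrow> (complex mat, complex mat set) rep" where
  "antisymmetric_submodel r p n = (gelfand_model r p n)
     \<lparr> rspace := cfun.span
         (basis_vec ` {v \<in> absolute_involutions r p n. antisymmetric_coset v}) \<rparr>"


section \<open>Specht modules\<close>

definition is_partition :: "nat list \<Rightarrow> bool" where
  "is_partition lam \<longleftrightarrow> sorted_wrt (\<ge>) lam \<and> (\<forall>k\<in>set lam. 0 < k)"

definition cells :: "nat list \<Rightarrow> (nat \<times> nat) set" where
  "cells lam = {(a, b). a < length lam \<and> b < lam ! a}"

definition tableaux :: "nat list \<Rightarrow> (nat \<times> nat \<Rightarrow> nat) set" where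
  "tableaux lam = {T. bij_betw T (cells lam) {..<sum_list lam}}"

definition tabloid :: "nat list \<Rightarrow> (nat \<times> nat \<Rightarrow> nat) \<Rightarrow> nat set list" where
  "tabloid lam T = map (\<lambda>a. T ` {c \<in> cells lam. fst c = a}) [0..<length lam]"

definition column_stabilizer :: "nat list \<Rightarrow> (nat \<times> nat \<Rightarrow> nat) \<Rightarrow> (nat \<Rightarrow> nat) set" where
  "column_stabilizer lam T =
     {\<pi>. \<pi> permutes {..<sum_list lam} \<and>
         (\<forall>b. \<pi> ` T ` {c \<in> cells lam. snd c = b} = T ` {c \<in> cells lam. snd c = b})}"

definition polytabloid :: "nat list \<Rightarrow> (nat \<times> nat \<Rightarrow> nat) \<Rightarrow> nat set list \<Rightarrow> complex" where
  "polytabloid lam T =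
     (\<Sum>\<pi>\<in>column_stabilizer lam T.
        fscale (of_int (sign \<pi>)) (basis_vec (map (image \<pi>) (tabloid lam T))))"

definition specht :: "nat list \<Rightarrow> (nat \<Rightarrow> nat, nat set list) rep" where
  "specht lam =
     \<lparr> rspace = cfun.span (polytabloid lam ` tableaux lam),
       ract = (\<lambda>w f t. f (map (image (inv_into UNIV w)) t)) \<rparr>"


section \<open>Irreducible representations\<close>

definition Fer :: "nat \<Rightarrow> nat \<Rightarrow> nat list list set" where
  "Fer r n = {lam. length lam = r \<and> (\<forall>a\<in>set lam. is_partition a) \<and>
                   (\<Sum>a\<leftarrow>lam. sum_list a) = n}"

text \<open>The representation \<open>\<gamma>\<^bsup>\<otimes>i\<^esup> \<otimes> \<rho>\<^sub>a\<close> of \<open>G(r,m)\<close>, where \<open>a\<close> is a partition of \<open>m\<close>.\<close>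

definition specht_twist :: "nat \<Rightarrow> nat \<Rightarrow> nat list \<Rightarrow> (complex mat, nat set list) rep" where
  "specht_twist r i a =
     \<lparr> rspace = rspace (specht a),
       ract = (\<lambda>g f. fscale ((zeta r powi zsum r g) ^ i) (ract (specht a) (perm_of g) f)) \<rparr>"

definition rho ::
    "nat \<Rightarrow> nat list list \<Rightarrow> (complex mat, complex mat \<times> (nat \<Rightarrow> nat set list)) rep" where
  "rho r lam =
     induced_rep (Grn r (\<Sum>a\<leftarrow>lam. sum_list a))
       (product_group {..<r} (\<lambda>i. Grn r (sum_list (lam ! i))))
       (\<lambda>gs. diag_block_mat (map gs [0..<r]))
       (outer_tensor_rep r (\<lambda>i. specht_twist r i (lam ! i)))"

definition shift :: "nat \<Rightarrow> nat \<Rightarrow> nat list list \<Rightarrow> nat list list" where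
  "shift r p lam = drop (r - r div p) lam @ take (r - r div p) lam"

definition Fer_orbit :: "nat \<Rightarrow> nat \<Rightarrow> nat list list \<Rightarrow> nat list list set" where
  "Fer_orbit r p lam = {(shift r p ^^ k) lam | k. True}"

definition Fer_proj :: "nat \<Rightarrow> nat \<Rightarrow> nat \<Rightarrow> nat list list set set" where
  "Fer_proj r p n = Fer_orbit r p ` Fer r n"

definition doubled_orbits :: "nat \<Rightarrow> nat \<Rightarrow> nat \<Rightarrow> nat list list set set" where
  "doubled_orbits r p n =
     {c \<in> Fer_proj r p n. \<forall>lam\<in>c. \<exists>mu\<in>Fer (r div 2) (n div 2). lam = mu @ mu}"


section \<open>The two constituents of a split representation\<close>

definition shuffles_n :: "nat \<Rightarrow> (nat \<Rightarrow> nat) set" where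
  "shuffles_n n =
     {t. t permutes {..<n} \<and> strict_mono_on {..<n div 2} t \<and> strict_mono_on {n div 2..<n} t}"

definition hat :: "nat \<Rightarrow> (nat \<Rightarrow> nat) \<Rightarrow> nat \<Rightarrow> nat" where
  "hat n t = (\<lambda>j. if j < n div 2 then t (j + n div 2)
                  else if j < n then t (j - n div 2) else t j)"

definition factor ::
    "nat \<Rightarrow> nat \<Rightarrow> complex mat \<Rightarrow> (nat \<Rightarrow> nat) \<Rightarrow> (nat \<Rightarrow> nat) \<times> complex mat \<times> complex mat" where
  "factor r n x t =
     (THE (t', x1, x2). t' \<in> shuffles_n n \<and>
        x1 \<in> carrier (Grn r (n div 2)) \<and> x2 \<in> carrier (Grn r (n div 2)) \<and>
        x * perm_mat n t = perm_mat n t' * diag_block_mat [x1, x2])"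

definition delta :: "nat \<Rightarrow> complex mat \<Rightarrow> complex" where
  "delta r g = (-1) powi zsum r g"

text \<open>
  \<open>tensor2 A B\<close> is the operator \<open>A \<otimes> B\<close> on functions of two variables, where the tensor
  \<open>v\<^sub>1 \<otimes> v\<^sub>2\<close> is the function \<open>\<lambda>(b, c). v\<^sub>1 b * v\<^sub>2 c\<close>.
\<close>

definition tensor2 ::
    "(('b \<Rightarrow> complex) \<Rightarrow> 'b \<Rightarrow> complex) \<Rightarrow> (('c \<Rightarrow> complex) \<Rightarrow> 'c \<Rightarrow> complex) \<Rightarrow>
     ('b \<times> 'c \<Rightarrow> complex) \<Rightarrow> 'b \<times> 'c \<Rightarrow> complex" where
  "tensor2 A B F = (\<lambda>(b, c). B (\<lambda>c'. A (\<lambda>b'. F (b', c')) b) c)"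

definition tensor_TVV :: "(nat \<Rightarrow> nat) \<Rightarrow> ('b \<Rightarrow> complex) \<Rightarrow> ('b \<Rightarrow> complex) \<Rightarrow>
    (nat \<Rightarrow> nat) \<times> 'b \<times> 'b \<Rightarrow> complex" where
  "tensor_TVV t v1 v2 = (\<lambda>(s, b, c). basis_vec t s * v1 b * v2 c)"

text \<open>
  The realization of \<open>\<rho>\<^bsub>(\<mu>,\<mu>)\<^esub>\<close> on \<open>T \<otimes> V \<otimes> V\<close>. A vector is \<open>F = (\<Sum>t. t \<otimes> F(t,_,_))\<close>, so that
  \<open>x F = (\<Sum>t. \<delta>(x\<^sub>2) t' \<otimes> (x\<^sub>1 \<otimes> x\<^sub>2) F(t,_,_))\<close>.
\<close>

definition rho_double ::
    "nat \<Rightarrow> nat \<Rightarrow> nat list list \<Rightarrow>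
     (complex mat, (nat \<Rightarrow> nat) \<times> (complex mat \<times> (nat \<Rightarrow> nat set list))
                                  \<times> (complex mat \<times> (nat \<Rightarrow> nat set list))) rep" where
  "rho_double r n mu =
     (let V = rho r (mu @ replicate (r div 2) []) in
     \<lparr> rspace = cfun.span {tensor_TVV t v1 v2 | t v1 v2.
                   t \<in> shuffles_n n \<and> v1 \<in> rspace V \<and> v2 \<in> rspace V},
       ract = (\<lambda>x F (s, b, c). \<Sum>t\<in>shuffles_n n.
                 case factor r n x t of (t', x1, x2) \<Rightarrow>
                   delta r x2 * basis_vec t' s *
                   tensor2 (ract V x1) (ract V x2) (\<lambda>(b', c'). F (t, b', c')) (b, c)) \<rparr>)"

text \<open>Since \<open>hat n\<close> is an involution, this map sends \<open>t \<otimes> v\<^sub>1 \<otimes> v\<^sub>2\<close> to \<open>hat n t \<otimes> v\<^sub>2 \<otimes> v\<^sub>1\<close>.\<close>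

definition S_map :: "nat \<Rightarrow> ((nat \<Rightarrow> nat) \<times> 'b \<times> 'b \<Rightarrow> complex) \<Rightarrow>
    (nat \<Rightarrow> nat) \<times> 'b \<times> 'b \<Rightarrow> complex" where
  "S_map n F = (\<lambda>(s, b, c). F (hat n s, c, b))"

text \<open>\<open>rho_split r n k mu\<close>, for \<open>k = 0, 1\<close>, is the restriction to the \<open>(-1)\<^sup>k\<close>-eigenspace of \<open>S\<close>.\<close>

definition rho_split ::
    "nat \<Rightarrow> nat \<Rightarrow> nat \<Rightarrow> nat list list \<Rightarrow>
     (complex mat, (nat \<Rightarrow> nat) \<times> (complex mat \<times> (nat \<Rightarrow> nat set list))
                                  \<times> (complex mat \<times> (nat \<Rightarrow> nat set list))) rep" where
  "rho_split r n k mu = (rho_double r n mu)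
     \<lparr> rspace := {F \<in> rspace (rho_double r n mu). S_map n F = fscale ((-1) ^ k) F} \<rparr>"

end

theory Submission
 imports Defs
begin

text \<open>A word assigns a colour in \<open>{0..<r}\<close> and a row to every position in \<open>{0..<n}\<close>. Functions on
 words carry the monomial action of \<open>G(r,n)\<close>, and antisymmetrizing along the columns of a
 multitableau gives vectors that span the irreducible constituents. For doubled shapes \<open>(\<mu>,\<mu>)\<close>,
 send a function on words to the function of the pairs \<open>(z, f)\<close>, where \<open>f\<close> is an involution that
 matches colour \<open>c\<close> with \<open>c + r/2\<close>, by summing over the rows that are constant on the cycles of \<open>f\<close>;
 this is a bijection, and the pairs are the antisymmetric matrices. Dividing by \<open>C\<^sub>p\<close> leaves, for each
 orbit, the functions on which the colour shift by \<open>r/2\<close> acts as \<open>-1\<close>. Cutting a word into its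
 colours below and above \<open>r/2\<close> identifies the same functions with \<open>T \<otimes> V \<otimes> V\<close>, where the colour shift
 becomes \<open>S\<close>.\<close>

text \<open>Neither dimensions nor characters are computed. A nonzero module of functions, on words
  or on matchings, always survives some row symmetrizer followed by a column antisymmetrizer, and
  this product sends the functions concerned to multiples of one explicit vector,
  \<open>evec\<close> or its image under \<open>Psi\<close>. Injectivity of \<open>Psi\<close>, and
  surjectivity through the annihilator of the image, both reduce to the fact that this one image is
  nonzero. The obstacle is to find a tableau inside an unknown module without a theory of shapes: it
  is overcome by the number \<open>ct2\<close>, twice the total content, which is an eigenvalue of
  the sum of transpositions and replaces the dominance order. The condition
  \<open>gcd p n = 2\<close> enters through total colours: among the shifts by multiples of r/p,
  only those by 0 and r/2 modulo r can fix a shape. The eigenvalue -1, which selects the constituent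
  with superscript 1, is the power zeta^(r/2); it appears because the exponent \<open>a_exp\<close>
  of the model is removed by dividing by the power of zeta given by the first colour, and this
  factor is not constant on cosets.\<close>

unbundle no m_inv_syntax

type_synonym wd = "(nat => nat) \<times> (nat => nat)"

abbreviation pairf :: "('a => 'b) => ('a => 'c) => 'a => 'b \<times> 'c" where
 "pairf f g \<equiv> \<lambda>x. (f x, g x)"

lemma sum_fun_apply: "(\<Sum>i\<in>A. f i) x = (\<Sum>i\<in>A. f i x)"
 by (induct A rule: infinite_finite_induct) auto

lemma fscale_apply [simp]: "fscale c f x = c * f x"
 by (simp add: fscale_def)

lemma subspace_sum: "cfun.subspace V ==> (\<And>i. i \<in> A ==> f i \<in> V) ==> (\<Sum>i\<in>A. f i) \<in> V"
 by (rule cfun.subspace_sum)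

section \<open>Young subgroups and their one-dimensional characters\<close>

definition St :: "nat set => (nat => 'c) => (nat => nat) set" where
 "St X ph = {pe. pe permutes X \<and> (\<forall>x\<in>X. ph (pe x) = ph x)}"

text \<open>\<open>False\<close> selects the trivial character and \<open>True\<close> the sign
  character, so that one notion of symmetrizer serves for rows and for columns.\<close>

definition eps :: "bool => (nat => nat) => complex" where
 "eps s pe = (if s then of_int (sign pe) else 1)"

lemma eps_id [simp]: "eps s id = 1"
 by (simp add: eps_def)

lemma eps_sq [simp]: "eps s pe * eps s pe = 1"
 by (simp add: eps_def flip: of_int_mult)

lemma eps_nz [simp]: "eps s pe \<noteq> 0"
 by (simp add: eps_def)

lemma eps_cases: "eps s pe = 1 \<or> eps s pe = -1"
 by (cases pe rule: sign_cases) (auto simp: eps_def)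

lemma St_permutes: "pe \<in> St X ph ==> pe permutes X"
 and St_fix: "pe \<in> St X ph ==> x \<in> X ==> ph (pe x) = ph x"
 by (auto simp: St_def)

lemma StI: "pe permutes X ==> (\<And>x. x \<in> X ==> ph (pe x) = ph x) ==> pe \<in> St X ph"
 by (auto simp: St_def)

lemma St_id [simp]: "id \<in> St X ph"
 by (auto simp: St_def permutes_id)

lemma St_comp: "pe \<in> St X ph ==> si \<in> St X ph ==> pe \<circ> si \<in> St X ph"
 by (auto simp: St_def permutes_compose permutes_in_image)

lemma St_inv: assumes "pe \<in> St X ph" shows "inv pe \<in> St X ph"
proof (rule StI)
 note p = St_permutes[OF assms]
 show "inv pe permutes X" by (rule permutes_inv[OF p])
 fix x assume x: "x \<in> X"
 hence "inv pe x \<in> X" by (simp add: permutes_in_image[OF permutes_inv[OF p]])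
 from St_fix[OF assms this] show "ph (inv pe x) = ph x" by (simp add: permutes_inverses[OF p])
qed

lemma St_transpose: "x \<in> X ==> y \<in> X ==> ph x = ph y ==> transpose x y \<in> St X ph"
 by (auto simp: St_def permutes_swap_id transpose_def)

lemma St_mono:
 assumes "\<And>x y. x \<in> X ==> y \<in> X ==> ph x = ph y ==> ps x = ps y"
 shows "St X ph \<subseteq> St X ps"
proof
 fix pe assume a: "pe \<in> St X ph"
 note p = St_permutes[OF a]
 show "pe \<in> St X ps"
 proof (rule StI[OF p])
  fix x assume x: "x \<in> X"
  show "ps (pe x) = ps x"
   by (rule assms[OF _ x St_fix[OF a x]]) (simp only: permutes_in_image[OF p] x)
 qed
qed

lemma St_cong:
 assumes "\<And>x y. x \<in> X ==> y \<in> X ==> ph x = ph y \<longleftrightarrow> ps x = ps y"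
 shows "St X ph = St X ps"
 by (rule antisym; rule St_mono) (metis assms)+

lemma finite_St: "finite X ==> finite (St X ph)"
 by (rule finite_subset[OF _ finite_permutations]) (auto simp: St_def)

lemma eps_comp: "finite X ==> pe permutes X ==> si permutes X ==> eps s (pe \<circ> si) = eps s pe * eps s si"
 by (auto simp: eps_def sign_compose permutes_imp_permutation)

lemma eps_inv: "finite X ==> pe permutes X ==> eps s (inv pe) = eps s pe"
 by (auto simp: eps_def sign_inverse permutes_imp_permutation)

lemma eps_transpose: "x \<noteq> y ==> eps s (transpose x y) = (if s then -1 else 1)"
 by (simp add: eps_def sign_swap_id)

lemma inv_comp: "pe permutes X ==> si permutes X ==> inv (pe \<circ> si) = inv si \<circ> inv pe"
 by (simp add: o_inv_distrib permutes_bij)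

lemma St_reindex_left: "finite X ==> ta \<in> St X ph ==> (\<Sum>pe\<in>St X ph. F (ta \<circ> pe)) = (\<Sum>pe\<in>St X ph. F pe)"
 for F :: "(nat => nat) => 'm::comm_monoid_add"
 by (rule sum.reindex_bij_witness[of _ "\<lambda>pe. inv ta \<circ> pe" "\<lambda>pe. ta \<circ> pe"])
   (auto intro: St_comp St_inv simp: fun_eq_iff permutes_inverses[OF St_permutes])

lemma St_reindex_right: "finite X ==> ta \<in> St X ph ==> (\<Sum>pe\<in>St X ph. F (pe \<circ> ta)) = (\<Sum>pe\<in>St X ph. F pe)"
 for F :: "(nat => nat) => 'm::comm_monoid_add"
 by (rule sum.reindex_bij_witness[of _ "\<lambda>pe. pe \<circ> inv ta" "\<lambda>pe. pe \<circ> ta"])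
   (auto intro: St_comp St_inv simp: fun_eq_iff permutes_inverses[OF St_permutes])

section \<open>Row and column symmetrizers of a permutation action\<close>

locale perm_act =
 fixes X :: "nat set" and act :: "(nat => nat) => 'o => 'o"
 assumes fin: "finite X"
  and act_id: "act id o' = o'"
  and act_comp: "pe permutes X ==> si permutes X ==> act (pe \<circ> si) o' = act pe (act si o')"
begin

definition L :: "(nat => nat) => ('o => complex) => 'o => complex" where
 "L pe f = (\<lambda>o'. f (act (inv pe) o'))"

text \<open>The sum is not divided by the group order, so it is idempotent only up to that factor;
  on semi-invariant vectors it is multiplication by the order, which is nonzero.\<close>

definition symm :: "bool => (nat => 'c) => ('o => complex) => 'o => complex" where
 "symm s ph f = (\<Sum>pe\<in>St X ph. fscale (eps s pe) (L pe f))"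

lemma L_id [simp]: "L id f = f"
 by (auto simp: L_def act_id)

lemma L_comp: "pe permutes X ==> si permutes X ==> L (pe \<circ> si) f = L pe (L si f)"
 by (auto simp: L_def inv_comp act_comp permutes_inv)

lemma L_add: "L pe (f + g) = L pe f + L pe g"
 and L_fscale: "L pe (fscale c f) = fscale c (L pe f)"
 and L_zero [simp]: "L pe 0 = 0"
 by (auto simp: L_def fun_eq_iff)

lemma L_sum: "L pe (\<Sum>i\<in>A. f i) = (\<Sum>i\<in>A. L pe (f i))"
 by (auto simp: L_def fun_eq_iff sum_fun_apply)

lemma act_inv: "pe permutes X ==> act pe (act (inv pe) o') = o'" "pe permutes X ==> act (inv pe) (act pe o') = o'"
 using act_comp[of pe "inv pe" o'] act_comp[of "inv pe" pe o']
 by (auto simp: permutes_inv permutes_inv_o act_id)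

lemma L_basis: "pe permutes X ==> L pe (basis_vec o') = basis_vec (act pe o')"
 by (auto simp: L_def basis_vec_def fun_eq_iff act_inv)

lemma symm_apply: "symm s ph f o' = (\<Sum>pe\<in>St X ph. eps s pe * f (act (inv pe) o'))"
 by (simp add: symm_def sum_fun_apply L_def)

lemma symm_add: "symm s ph (f + g) = symm s ph f + symm s ph g"
 by (auto simp: fun_eq_iff symm_apply algebra_simps sum.distrib)

lemma symm_fscale: "symm s ph (fscale c f) = fscale c (symm s ph f)"
 by (auto simp: fun_eq_iff symm_apply algebra_simps sum_distrib_left)

lemma symm_zero [simp]: "symm s ph 0 = 0"
 by (auto simp: fun_eq_iff symm_apply)

lemma symm_sum: "symm s ph (\<Sum>i\<in>A. f i) = (\<Sum>i\<in>A. symm s ph (f i))"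
 by (rule ext) (simp add: symm_apply sum_fun_apply sum_distrib_left sum.swap[of _ A])

lemma symm_L: assumes "ta \<in> St X ph" shows "symm s ph (L ta f) = fscale (eps s ta) (symm s ph f)"
proof -
 note p = St_permutes[OF assms]
 have "symm s ph (L ta f) = (\<Sum>pe\<in>St X ph. fscale (eps s ta * eps s (pe \<circ> ta)) (L (pe \<circ> ta) f))"
  unfolding symm_def
 proof (rule sum.cong[OF refl])
  fix pe assume "pe \<in> St X ph"
  hence q: "pe permutes X" by (rule St_permutes)
  have "eps s ta * eps s (pe \<circ> ta) = eps s pe"
   using eps_sq[of s ta] by (simp add: eps_comp[OF fin q p] del: eps_sq)
  thus "fscale (eps s pe) (L pe (L ta f)) = fscale (eps s ta * eps s (pe \<circ> ta)) (L (pe \<circ> ta) f)"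
   by (simp add: L_comp[OF q p])
 qed
 also have "... = (\<Sum>pe\<in>St X ph. fscale (eps s ta * eps s pe) (L pe f))"
  by (rule St_reindex_right[OF fin assms])
 also have "... = fscale (eps s ta) (symm s ph f)"
  by (auto simp: fun_eq_iff symm_def sum_fun_apply sum_distrib_left algebra_simps)
 finally show ?thesis .
qed

lemma L_symm: assumes "ta \<in> St X ph" shows "L ta (symm s ph f) = fscale (eps s ta) (symm s ph f)"
proof -
 note p = St_permutes[OF assms]
 have "L ta (symm s ph f) = (\<Sum>pe\<in>St X ph. fscale (eps s ta * eps s (ta \<circ> pe)) (L (ta \<circ> pe) f))"
  unfolding symm_def L_sum L_fscale
 proof (rule sum.cong[OF refl])
  fix pe assume "pe \<in> St X ph"
  hence q: "pe permutes X" by (rule St_permutes)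
  have "eps s ta * eps s (ta \<circ> pe) = eps s pe"
   using eps_sq[of s ta] by (simp add: eps_comp[OF fin p q] del: eps_sq)
  thus "fscale (eps s pe) (L ta (L pe f)) = fscale (eps s ta * eps s (ta \<circ> pe)) (L (ta \<circ> pe) f)"
   by (simp add: L_comp[OF p q])
 qed
 also have "... = (\<Sum>pe\<in>St X ph. fscale (eps s ta * eps s pe) (L pe f))"
  by (rule St_reindex_left[OF fin assms])
 also have "... = fscale (eps s ta) (symm s ph f)"
  by (auto simp: fun_eq_iff symm_def sum_fun_apply sum_distrib_left algebra_simps)
 finally show ?thesis .
qed

lemma symm_of_invariant:
 assumes "\<And>ta. ta \<in> St X ph ==> L ta f = fscale (eps s ta) f"
 shows "symm s ph f = fscale (of_nat (card (St X ph))) f"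
proof -
 have "symm s ph f = (\<Sum>pe\<in>St X ph. f)"
  unfolding symm_def by (rule sum.cong[OF refl]) (simp add: assms cfun.scale_scale)
 thus ?thesis by (simp add: fun_eq_iff sum_fun_apply)
qed

lemma card_St_nz: "(of_nat (card (St X ph)) :: complex) \<noteq> 0"
proof -
 have "card (St X ph) > 0" using finite_St[OF fin, of ph] St_id[of X ph] by (metis card_gt_0_iff empty_iff)
 thus ?thesis by simp
qed

text \<open>The transposition of \<open>x\<close> and \<open>y\<close> is absorbed by the two sums
  with opposite signs, so the composite equals its own negative. This is the classical reason why a
  nonzero product of a row and a column symmetrizer forces each row to meet each column at most
  once.\<close>

lemma symm_kill:
 assumes "x \<in> X" "y \<in> X" "x \<noteq> y" "ph x = ph y" "ps x = ps y"
 shows "symm s ph (symm (\<not> s) ps f) = 0"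
proof -
 let ?t = "transpose x y" and ?g = "symm (\<not> s) ps f"
 have t: "?t \<in> St X ph" "?t \<in> St X ps" using assms by (auto intro: St_transpose)
 have "fscale (eps s ?t) (symm s ph ?g) = symm s ph (L ?t ?g)" by (simp add: symm_L[OF t(1)])
 also have "... = fscale (eps (\<not> s) ?t) (symm s ph ?g)" by (simp add: L_symm[OF t(2)] symm_fscale)
 finally show ?thesis using assms(3) by (cases s) (auto simp: fun_eq_iff eps_transpose)
qed

text \<open>The same sign argument with a transposition that fixes the object itself: a word that
  repeats a letter within a column antisymmetrizes to zero.\<close>

lemma symm_basis_kill:
 assumes "x \<in> X" "y \<in> X" "x \<noteq> y" "ph x = ph y" "act (transpose x y) o' = o'"
 shows "symm True ph (basis_vec o') = 0"
proof -
 let ?t = "transpose x y"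
 have t: "?t \<in> St X ph" using assms by (auto intro: St_transpose)
 have "fscale (eps True ?t) (symm True ph (basis_vec o')) = symm True ph (L ?t (basis_vec o'))"
  by (simp add: symm_L[OF t(1)])
 also have "... = symm True ph (basis_vec o')" using assms by (simp add: L_basis permutes_swap_id)
 finally show ?thesis using assms(3) by (auto simp: fun_eq_iff eps_transpose)
qed

text \<open>Conjugation by \<open>g\<close> carries the stabiliser of \<open>ph\<close> to that of
  \<open>ph \<circ> inv g\<close> and keeps signs, so translating a symmetrizer only relabels the
  points.\<close>

lemma L_conj:
 assumes g: "g permutes X"
 shows "L g (symm s ph f) = symm s (ph \<circ> inv g) (L g f)"
proof -
 have gi: "inv g permutes X" by (rule permutes_inv[OF g])
 have "L g (symm s ph f) = (\<Sum>pe\<in>St X ph. fscale (eps s pe) (L (g \<circ> pe) f))"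
  unfolding symm_def L_sum L_fscale by (rule sum.cong[OF refl]) (simp add: L_comp g St_permutes)
 also have "... = (\<Sum>pe\<in>St X (ph \<circ> inv g). fscale (eps s pe) (L pe (L g f)))"
 proof (rule sum.reindex_bij_witness[of _ "\<lambda>pe. inv g \<circ> pe \<circ> g" "\<lambda>pe. g \<circ> pe \<circ> inv g"])
  fix pe assume a: "pe \<in> St X ph"
  note p = St_permutes[OF a]
  show "inv g \<circ> (g \<circ> pe \<circ> inv g) \<circ> g = pe" by (auto simp: fun_eq_iff permutes_inverses[OF g])
  show "g \<circ> pe \<circ> inv g \<in> St X (ph \<circ> inv g)"
   using a g gi p by (auto simp: St_def permutes_compose permutes_inverses permutes_in_image)
  have "eps s (g \<circ> pe \<circ> inv g) = eps s pe"
   using eps_sq[of s g] by (simp add: eps_comp[OF fin] g gi p permutes_compose eps_inv[OF fin])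
  moreover have "g \<circ> pe \<circ> inv g \<circ> g = g \<circ> pe" by (auto simp: fun_eq_iff permutes_inverses[OF g])
  ultimately show "fscale (eps s (g \<circ> pe \<circ> inv g)) (L (g \<circ> pe \<circ> inv g) (L g f)) = fscale (eps s pe) (L (g \<circ> pe) f)"
   using L_comp[of "g \<circ> pe \<circ> inv g" g f] by (simp add: g gi p permutes_compose)
 next
  fix pe assume a: "pe \<in> St X (ph \<circ> inv g)"
  note p = St_permutes[OF a]
  show "g \<circ> (inv g \<circ> pe \<circ> g) \<circ> inv g = pe" by (auto simp: fun_eq_iff permutes_inverses[OF g])
  show "inv g \<circ> pe \<circ> g \<in> St X ph"
  proof (rule StI)
   show "inv g \<circ> pe \<circ> g permutes X" by (intro permutes_compose p g gi)
   fix x assume "x \<in> X"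
   hence "(ph \<circ> inv g) (pe (g x)) = (ph \<circ> inv g) (g x)"
    using a g by (intro St_fix[OF a]) (simp add: permutes_in_image)
   thus "ph ((inv g \<circ> pe \<circ> g) x) = ph x" by (simp add: permutes_inverses[OF g])
  qed
 qed
 finally show ?thesis by (simp only: symm_def)
qed

lemma symm_in_submodule:
 assumes "cfun.subspace I" "\<And>pe. pe \<in> St X ph ==> L pe f \<in> I" shows "symm s ph f \<in> I"
 unfolding symm_def using assms by (intro cfun.subspace_sum cfun.subspace_scale) auto

end

section \<open>Contents of labellings and the tableau condition\<close>

definition pr2 :: "nat set => (nat => nat) => (nat => nat) => int" where
 "pr2 X z al = (\<Sum>x\<in>X. \<Sum>y\<in>X. if x \<noteq> y \<and> z x = z y \<and> al x = al y then 1 else 0)"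

text \<open>If \<open>al\<close> numbers the rows of a Young diagram in each colour,
  \<open>pr2\<close> is the sum of l(l-1) over the row lengths l, which is twice the sum of the
  column indices, and \<open>ct2\<close> is twice the sum of the contents (column minus row). The
  factor two comes from counting ordered pairs.\<close>

definition ct2 :: "nat set => (nat => nat) => (nat => nat) => int" where
 "ct2 X z al = pr2 X z al - 2 * (\<Sum>x\<in>X. int (al x))"

abbreviation inj3 :: "nat set => (nat => nat) => (nat => nat) => (nat => nat) => bool" where
 "inj3 X z rw cw \<equiv> inj_on (\<lambda>x. (z x, rw x, cw x)) X"

text \<open>No shape is given in advance: a tableau is a placement of the points in cells (colour,
  row, column) that is injective and closed under moving left in a row and up in a column. The shape
  is read off the filling.\<close>

definition tab :: "nat set => (nat => nat) => (nat => nat) => (nat => nat) => bool" where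
 "tab X z rw cw \<longleftrightarrow> inj3 X z rw cw \<and>
   (\<forall>y\<in>X. \<forall>j<cw y. \<exists>x\<in>X. z x = z y \<and> rw x = rw y \<and> cw x = j) \<and>
   (\<forall>y\<in>X. \<forall>i<rw y. \<exists>x\<in>X. z x = z y \<and> cw x = cw y \<and> rw x = i)"

lemma inj3D: "inj3 X z rw cw ==> x \<in> X ==> y \<in> X ==> z x = z y ==> rw x = rw y ==> cw x = cw y ==> x = y"
 by (drule inj_onD[where x=x and y=y]) auto

lemma inj3_swap: "inj3 X z rw cw ==> inj3 X z cw rw"
 by (auto simp: inj_on_def)

text \<open>Points of one row have distinct columns, so \<open>cw\<close> orders each pair in it;
  the pair is counted at its right-hand member, and it occurs twice in \<open>pr2\<close>.\<close>

lemma pr2_eq_left: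
 assumes fin: "finite X" and inj: "inj3 X z al cw"
 shows "pr2 X z al = 2 * (\<Sum>y\<in>X. int (card {x\<in>X. z x = z y \<and> al x = al y \<and> cw x < cw y}))"
proof -
 define A where "A x y = (if z x = z y \<and> al x = al y \<and> cw x < cw y then 1 else 0 :: int)" for x y
 have "pr2 X z al = (\<Sum>x\<in>X. \<Sum>y\<in>X. A x y + A y x)"
  unfolding pr2_def
 proof (intro sum.cong refl)
  fix x y assume "x \<in> X" "y \<in> X"
  thus "(if x \<noteq> y \<and> z x = z y \<and> al x = al y then 1 else 0) = A x y + A y x"
   using inj3D[OF inj, of x y] unfolding A_def
   by (cases "z x = z y \<and> al x = al y"; cases "cw x < cw y"; cases "cw y < cw x") auto
 qed
 also have "... = (\<Sum>x\<in>X. \<Sum>y\<in>X. A x y) + (\<Sum>x\<in>X. \<Sum>y\<in>X. A y x)" by (simp add: sum.distrib)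
 also have "(\<Sum>x\<in>X. \<Sum>y\<in>X. A x y) = (\<Sum>x\<in>X. \<Sum>y\<in>X. A y x)" by (rule sum.swap)
 finally have pr: "pr2 X z al = 2 * (\<Sum>x\<in>X. \<Sum>y\<in>X. A y x)" by simp
 have "(\<Sum>y\<in>X. A y x) = int (card {y\<in>X. z y = z x \<and> al y = al x \<and> cw y < cw x})" for x
  unfolding A_def by (subst sum.inter_filter[symmetric]) (use fin in \<open>auto simp del: sum_constant simp: card_eq_sum\<close>)
 thus ?thesis by (simp add: pr)
qed

text \<open>A point in column \<open>cw y\<close> has at most \<open>cw y\<close> points of its row
  in smaller columns, with equality exactly when all those columns are occupied. Summing over the
  points compares \<open>pr2\<close> with twice the sum of the columns.\<close>

lemma pr2_le:
 assumes fin: "finite X" and inj: "inj3 X z al cw"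
 shows "pr2 X z al \<le> 2 * (\<Sum>x\<in>X. int (cw x))"
  and "pr2 X z al = 2 * (\<Sum>x\<in>X. int (cw x)) \<longleftrightarrow> (\<forall>y\<in>X. \<forall>j<cw y. \<exists>x\<in>X. z x = z y \<and> al x = al y \<and> cw x = j)"
proof -
 define D where "D y = {x\<in>X. z x = z y \<and> al x = al y \<and> cw x < cw y}" for y
 have finD: "finite (D y)" for y using fin by (simp add: D_def)
 have injD: "inj_on cw (D y)" for y using inj by (auto simp: D_def inj_on_def)
 have sub: "cw ` D y \<subseteq> {..<cw y}" for y by (auto simp: D_def)
 have le: "card (D y) \<le> cw y" for y
  using card_mono[OF _ sub[of y]] card_image[OF injD[of y]] by simp
 have eq: "card (D y) = cw y \<longleftrightarrow> (\<forall>j<cw y. \<exists>x\<in>X. z x = z y \<and> al x = al y \<and> cw x = j)" for y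
 proof
  assume "card (D y) = cw y"
  hence "card (cw ` D y) = card {..<cw y}" by (simp only: card_image[OF injD] card_lessThan)
  hence im: "cw ` D y = {..<cw y}" by (rule card_subset_eq[OF finite_lessThan sub])
  show "\<forall>j<cw y. \<exists>x\<in>X. z x = z y \<and> al x = al y \<and> cw x = j"
  proof (intro allI impI)
   fix j assume "j < cw y"
   hence "j \<in> cw ` D y" by (simp add: im)
   thus "\<exists>x\<in>X. z x = z y \<and> al x = al y \<and> cw x = j" by (auto simp: D_def)
  qed
 next
  assume "\<forall>j<cw y. \<exists>x\<in>X. z x = z y \<and> al x = al y \<and> cw x = j"
  hence "{..<cw y} \<subseteq> cw ` D y" unfolding D_def by blast
  hence "cw ` D y = {..<cw y}" using sub[of y] by blast
  thus "card (D y) = cw y" using card_image[OF injD[of y]] by simp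
 qed
 have pr: "pr2 X z al = 2 * (\<Sum>y\<in>X. int (card (D y)))"
  unfolding D_def by (rule pr2_eq_left[OF fin inj])
 show "pr2 X z al \<le> 2 * (\<Sum>x\<in>X. int (cw x))"
  unfolding pr by (intro mult_left_mono sum_mono) (auto simp: le)
 have "pr2 X z al = 2 * (\<Sum>x\<in>X. int (cw x)) \<longleftrightarrow> (\<forall>y\<in>X. card (D y) = cw y)"
 proof
  assume "pr2 X z al = 2 * (\<Sum>x\<in>X. int (cw x))"
  hence "(\<Sum>y\<in>X. int (card (D y))) = (\<Sum>x\<in>X. int (cw x))" unfolding pr by simp
  from sum_mono_inv[OF this] show "\<forall>y\<in>X. card (D y) = cw y" using fin le by simp
 qed (simp add: pr)
 thus "pr2 X z al = 2 * (\<Sum>x\<in>X. int (cw x)) \<longleftrightarrow> (\<forall>y\<in>X. \<forall>j<cw y. \<exists>x\<in>X. z x = z y \<and> al x = al y \<and> cw x = j)"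
  by (simp add: eq)
qed

text \<open>Both estimates from \<open>pr2_le\<close>, one for rows and one for columns, are tight
  together exactly when the filling has no gaps in either direction. Cancelling contents therefore
  characterise tableaux, a numerical criterion that takes the place of comparing shapes in dominance
  order.\<close>

lemma inj3_ct2:
 assumes "finite X" "inj3 X z al cw"
 shows "ct2 X z al + ct2 X z cw \<le> 0" "ct2 X z al + ct2 X z cw = 0 \<longleftrightarrow> tab X z al cw"
proof -
 note a = pr2_le[OF assms] and b = pr2_le[OF assms(1) inj3_swap[OF assms(2)]]
 show "ct2 X z al + ct2 X z cw \<le> 0" using a(1) b(1) by (simp add: ct2_def)
 have "ct2 X z al + ct2 X z cw = 0 \<longleftrightarrow>
   pr2 X z al = 2 * (\<Sum>x\<in>X. int (cw x)) \<and> pr2 X z cw = 2 * (\<Sum>x\<in>X. int (al x))"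
  using a(1) b(1) by (auto simp: ct2_def)
 thus "ct2 X z al + ct2 X z cw = 0 \<longleftrightarrow> tab X z al cw"
  using assms(2) by (simp add: a(2) b(2) tab_def)
qed

lemma tab_ct2: "finite X ==> tab X z al cw ==> ct2 X z al + ct2 X z cw = 0"
 using inj3_ct2(2) by (auto simp: tab_def)

text \<open>Choosing a preimage of \<open>p x\<close> under \<open>q\<close> for each point gives a
  self-map of \<open>X\<close>; it is injective because \<open>p\<close> is, and finiteness makes it
  a permutation.\<close>

lemma permutes_of_images:
 assumes "finite X" "inj_on p X" "p ` X \<subseteq> q ` X"
 shows "\<exists>pe. pe permutes X \<and> (\<forall>x\<in>X. p x = q (pe x))"
proof -
 define pe where "pe x = (if x \<in> X then inv_into X q (p x) else x)" for x
 have 1: "pe x \<in> X \<and> p x = q (pe x)" if "x \<in> X" for x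
  using that assms(3) by (auto simp: pe_def f_inv_into_f image_subset_iff intro!: inv_into_into)
 have "inj_on pe X" using assms(2) 1 by (metis inj_on_def)
 hence "pe permutes X" using 1 assms(1) by (intro inj_imp_permutes) (auto simp: pe_def)
 thus ?thesis using 1 by blast
qed

text \<open>A finite set of naturals that is closed downwards is an initial segment, and injectivity
  of \<open>f\<close> determines its length.\<close>

lemma down_closed_image:
 fixes f :: "'a => nat"
 assumes "finite D" "inj_on f D" "\<And>y i. y \<in> D ==> i < f y ==> i \<in> f ` D"
 shows "f ` D = {..<card D}"
proof -
 obtain k where k: "f ` D = {..<k}"
 proof (cases "D = {}")
  case False
  let ?M = "Max (f ` D)"
  have M: "?M \<in> f ` D" using False assms(1) by simp
  have "f ` D = {..<Suc ?M}"
  proof (intro Set.set_eqI iffI)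
   fix i assume "i \<in> f ` D" thus "i \<in> {..<Suc ?M}" using assms(1) by (simp add: less_Suc_eq_le)
  next
   fix i assume "i \<in> {..<Suc ?M}"
   hence "i = ?M \<or> i < ?M" by auto
   thus "i \<in> f ` D" using M assms(3) by (metis imageE)
  qed
  thus ?thesis using that by blast
 qed (use that[of 0] in auto)
 thus ?thesis using card_image[OF assms(2)] by simp
qed

text \<open>Tabloids that no transposition of a column of the tableau fixes arise from the
 tableau by a column permutation, once their contents are comparable.\<close>

lemma column_permutation:
 assumes fin: "finite X" and T: "tab X z rw cw" and inj: "inj3 X z bw cw" and ct: "ct2 X z rw \<le> ct2 X z bw"
 shows "ct2 X z rw = ct2 X z bw" "\<exists>pe\<in>St X (pairf z cw). \<forall>x\<in>X. bw x = rw (pe x)"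
proof -
 show eq: "ct2 X z rw = ct2 X z bw"
  using ct inj3_ct2(1)[OF fin inj] tab_ct2[OF fin T] by linarith
 hence T': "tab X z bw cw" using inj3_ct2(2)[OF fin inj] tab_ct2[OF fin T] by simp
 have "(\<lambda>x. (z x, bw x, cw x)) ` X \<subseteq> (\<lambda>x. (z x, rw x, cw x)) ` X"
 proof clarify
  fix x assume x: "x \<in> X"
  let ?D = "{y\<in>X. z y = z x \<and> cw y = cw x}"
  \<comment> \<open>In a tableau the rows occurring in one column form an initial segment whose
    length is the number of its points. Hence \<open>rw\<close> and \<open>bw\<close> take the same
    set of rows in each column.\<close>
  have "f ` ?D = {..<card ?D}" if "tab X z f cw" for f
  proof (rule down_closed_image)
   show "finite ?D" using fin by simp
   show "inj_on f ?D" using that by (auto simp: tab_def inj_on_def)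
   fix y i assume "y \<in> ?D" "i < f y"
   moreover have "\<forall>y\<in>X. \<forall>i<f y. \<exists>x\<in>X. z x = z y \<and> cw x = cw y \<and> f x = i"
    using that unfolding tab_def by blast
   ultimately show "i \<in> f ` ?D" by fastforce
  qed
  from this[OF T] this[OF T'] have "rw ` ?D = bw ` ?D" by simp
  moreover have "bw x \<in> bw ` ?D" using x by blast
  ultimately obtain y where "y \<in> ?D" "bw x = rw y" by blast
  thus "(z x, bw x, cw x) \<in> (\<lambda>x. (z x, rw x, cw x)) ` X" by (intro image_eqI[of _ _ y]) auto
 qed
 from permutes_of_images[OF fin inj this] obtain pe where
  p: "pe permutes X" "\<And>x. x \<in> X ==> (z x, bw x, cw x) = (z (pe x), rw (pe x), cw (pe x))" by blast
 have "pe \<in> St X (pairf z cw)" by (rule StI[OF p(1)]) (drule p(2), simp only: prod.inject)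
 moreover have "\<forall>x\<in>X. bw x = rw (pe x)" using p(2) by blast
 ultimately show "\<exists>pe\<in>St X (pairf z cw). \<forall>x\<in>X. bw x = rw (pe x)" by blast
qed

lemma pr2_insert:
 assumes "finite X" "y \<notin> X"
 shows "pr2 (insert y X) z al = pr2 X z al + 2 * int (card {x\<in>X. z x = z y \<and> al x = al y})"
proof -
 have c: "(\<Sum>x\<in>X. if z x = z y \<and> al x = al y then 1 else 0) = int (card {x\<in>X. z x = z y \<and> al x = al y})"
  by (subst sum.inter_filter[symmetric]) (use assms in auto)
 have a: "(\<Sum>x\<in>X. if x \<noteq> y \<and> z x = z y \<and> al x = al y then 1 else 0) = int (card {x\<in>X. z x = z y \<and> al x = al y})"
  unfolding c[symmetric] using assms by (intro sum.cong) auto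
 have b: "(\<Sum>x\<in>X. if y \<noteq> x \<and> z y = z x \<and> al y = al x then 1 else 0) = int (card {x\<in>X. z x = z y \<and> al x = al y})"
  unfolding c[symmetric] using assms by (intro sum.cong) auto
 show ?thesis unfolding pr2_def by (simp only: sum.insert[OF assms] sum.distrib a b) simp
qed

text \<open>Leaving a row of length l loses 2(l-1) in \<open>pr2\<close>, joining a row of length at
  least l gains at least 2l, and the label sum drops because \<open>i < al y\<close>: both effects
  raise the content.\<close>

lemma ct2_move:
 assumes fin: "finite X" and y: "y \<in> X" and i: "i < al y"
  and le: "card {x\<in>X. z x = z y \<and> al x = al y} \<le> card {x\<in>X. z x = z y \<and> al x = i}"
 shows "ct2 X z al < ct2 X z (al(y := i))"
proof -
 define Y where "Y = X - {y}"
 have X: "X = insert y Y" "y \<notin> Y" "finite Y" using y fin by (auto simp: Y_def)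
 have p: "pr2 Y z (al(y := i)) = pr2 Y z al" using X(2) unfolding pr2_def by (intro sum.cong refl) auto
 have s: "(\<Sum>x\<in>Y. int ((al(y := i)) x)) = (\<Sum>x\<in>Y. int (al x))" using X(2) by (intro sum.cong refl) auto
 have "{x\<in>X. z x = z y \<and> al x = al y} = insert y {x\<in>Y. z x = z y \<and> al x = al y}" using X by auto
 hence 1: "card {x\<in>X. z x = z y \<and> al x = al y} = Suc (card {x\<in>Y. z x = z y \<and> al x = al y})" using X by simp
 have 2: "{x\<in>X. z x = z y \<and> al x = i} = {x\<in>Y. z x = z y \<and> (al(y := i)) x = (al(y := i)) y}" using X i by auto
 have 3: "card {x\<in>Y. z x = z y \<and> al x = al y} < card {x\<in>Y. z x = z y \<and> (al(y := i)) x = (al(y := i)) y}"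
  using le 1 2 by simp
 show ?thesis
  unfolding ct2_def X(1) pr2_insert[OF X(3,2)] p sum.insert[OF X(3,2)] s using 3 i by simp
qed

text \<open>Exchanging the names of two rows of one colour keeps \<open>pr2\<close> and gives the
  longer row the smaller label, which lowers the label sum.\<close>

lemma ct2_label_swap:
 assumes fin: "finite X" and y: "y \<in> X" and i: "i < al y"
  and less: "card {x\<in>X. z x = z y \<and> al x = i} < card {x\<in>X. z x = z y \<and> al x = al y}"
 shows "ct2 X z al < ct2 X z (\<lambda>x. if z x = z y then transpose i (al y) (al x) else al x)"
proof -
 define j t where "j = al y" and "t = transpose i j"
 let ?a = "\<lambda>x. if z x = z y then t (al x) else al x"
 let ?I = "{x\<in>X. z x = z y \<and> al x = i}" and ?J = "{x\<in>X. z x = z y \<and> al x = j}"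
 have t: "t a = t b \<longleftrightarrow> a = b" for a b unfolding t_def by (rule inj_eq) simp
 have rel: "z x = z y' \<and> ?a x = ?a y' \<longleftrightarrow> z x = z y' \<and> al x = al y'" for x y'
  by (cases "z x = z y"; cases "z y' = z y") (auto simp: t)
 have p: "pr2 X z ?a = pr2 X z al" unfolding pr2_def by (simp only: rel)
 have ij: "i \<noteq> j" using i by (simp add: j_def)
 have "(\<Sum>x\<in>X. int (?a x)) - (\<Sum>x\<in>X. int (al x)) =
   (\<Sum>x\<in>X. (if z x = z y \<and> al x = i then int j - int i else 0) + (if z x = z y \<and> al x = j then int i - int j else 0))"
  unfolding sum_subtractf[symmetric]
 proof (rule sum.cong[OF refl])
  fix x
  show "int (?a x) - int (al x) =
   (if z x = z y \<and> al x = i then int j - int i else 0) + (if z x = z y \<and> al x = j then int i - int j else 0)"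
   using ij by (cases "al x = i"; cases "al x = j") (auto simp: t_def)
 qed
 also have "... = (\<Sum>x\<in>?I. int j - int i) + (\<Sum>x\<in>?J. int i - int j)"
  unfolding sum.distrib by (simp only: sum.inter_filter[OF fin])
 also have "... = (int j - int i) * (int (card ?I) - int (card ?J))" by (simp add: algebra_simps)
 also have "... < 0" using less i by (intro mult_pos_neg) (auto simp: j_def)
 finally show ?thesis unfolding j_def[symmetric] t_def[symmetric] by (simp add: ct2_def p)
qed

text \<open>The bound allows a choice of maximal content although there are infinitely many
  labellings.\<close>

lemma ct2_le:
 assumes "finite X" shows "ct2 X z al \<le> int (card X * card X)"
proof -
 have "pr2 X z al \<le> (\<Sum>x\<in>X. \<Sum>y\<in>X. 1)" unfolding pr2_def by (intro sum_mono) auto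
 moreover have "(\<Sum>x\<in>X. int (al x)) \<ge> 0" by (rule sum_nonneg) simp
 ultimately show ?thesis by (simp add: ct2_def)
qed

lemma ct2_reindex:
 assumes g: "g permutes X" and z: "\<And>x. x \<in> X ==> z (g x) = z x"
 shows "ct2 X z (al \<circ> g) = ct2 X z al"
proof -
 have 1: "(\<Sum>x\<in>X. F (g x)) = (\<Sum>x\<in>X. F x)" for F :: "nat => int"
  unfolding sum.permute[OF g, of F] comp_def ..
 define H where "H x y = (if x \<noteq> y \<and> z x = z y \<and> al x = al y then 1 else 0 :: int)" for x y
 have "pr2 X z (al \<circ> g) = (\<Sum>x\<in>X. \<Sum>y\<in>X. H (g x) (g y))"
  unfolding pr2_def by (rule sum.cong[OF refl], rule sum.cong[OF refl])
   (simp add: H_def z inj_eq[OF permutes_inj[OF g]])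
 also have "... = (\<Sum>x\<in>X. \<Sum>y\<in>X. H (g x) y)" by (rule sum.cong[OF refl], rule 1)
 also have "... = (\<Sum>x\<in>X. \<Sum>y\<in>X. H x y)" by (rule 1[where F="\<lambda>x. \<Sum>y\<in>X. H x y"])
 finally have "pr2 X z (al \<circ> g) = pr2 X z al" by (simp only: pr2_def H_def)
 thus ?thesis using 1[of "\<lambda>x. int (al x)"] by (simp add: ct2_def)
qed

section \<open>Contents as eigenvalues of the sum of transpositions\<close>

context perm_act
begin

text \<open>Ordered pairs are summed, so this is twice the sum of all transpositions in the Young
  subgroup of \<open>z\<close>. That sum is central in the group algebra and acts on an irreducible
  constituent by its total content, whence the normalisation of \<open>ct2\<close>.\<close>

definition cas :: "(nat => nat) => ('o => complex) => 'o => complex" where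
 "cas z f = (\<Sum>y\<in>X. \<Sum>x\<in>{x\<in>X. x \<noteq> y \<and> z x = z y}. L (transpose x y) f)"

definition submodule :: "(nat => nat) => ('o => complex) set => bool" where
 "submodule z I \<longleftrightarrow> cfun.subspace I \<and> (\<forall>pe\<in>St X z. \<forall>f\<in>I. L pe f \<in> I)"

abbreviation maximal :: "bool => (nat => nat) => ('o => complex) set => (nat => nat) => bool" where
 "maximal s z I al \<equiv> (\<forall>al'. ct2 X z al < ct2 X z al' \<longrightarrow> (\<forall>u\<in>I. symm s (pairf z al') u = 0))"

lemma St_refine: "St X (pairf z al) \<subseteq> St X z"
 by (rule St_mono) auto

lemma submodule_symm: "submodule z I ==> u \<in> I ==> symm s (pairf z al) u \<in> I"
 using St_refine[of z al] by (intro symm_in_submodule) (auto simp: submodule_def)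

text \<open>If an earlier row were shorter than a later one, exchanging their labels would raise the
  content without changing the stabiliser, hence without changing the symmetrizer. Maximality
  forbids this.\<close>

lemma maximal_sorted:
 assumes max: "maximal s z I al" and u: "u \<in> I" "symm s (pairf z al) u \<noteq> 0"
  and y: "y \<in> X" "i < al y"
 shows "card {x\<in>X. z x = z y \<and> al x = al y} \<le> card {x\<in>X. z x = z y \<and> al x = i}"
proof (rule ccontr)
 define t where "t = transpose i (al y)"
 assume "\<not> ?thesis"
 hence "ct2 X z al < ct2 X z (\<lambda>x. if z x = z y then t (al x) else al x)"
  unfolding t_def by (intro ct2_label_swap fin y) simp
 hence "symm s (\<lambda>x. (z x, if z x = z y then t (al x) else al x)) u = 0" using max u(1) by blast
 moreover have t: "t a = t b \<longleftrightarrow> a = b" for a b unfolding t_def by (rule inj_eq) simp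
 have "St X (\<lambda>x. (z x, if z x = z y then t (al x) else al x)) = St X (pairf z al)"
  by (rule St_cong) (auto simp: t)
 ultimately show False using u(2) by (simp add: symm_def)
qed

text \<open>The left-hand side is invariant, up to sign, under the row group obtained by moving \<open>y\<close>
 to row \<open>i\<close>, so it vanishes by maximality.\<close>

lemma maximal_exchange:
 assumes sub: "submodule z I" and max: "maximal s z I al"
  and u: "u \<in> I" and nz: "symm s (pairf z al) u \<noteq> 0" and y: "y \<in> X" "i < al y"
 defines "v \<equiv> symm s (pairf z al) u"
 shows "(\<Sum>x\<in>{x\<in>X. z x = z y \<and> al x = i}. L (transpose x y) v) = fscale (- (if s then -1 else 1)) v"
proof -
 define al' where "al' = al(y := i)"
 let ?ph = "\<lambda>x. (z x, al' x)"
 define B where "B = {x\<in>X. ?ph x = ?ph y}"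
 \<comment> \<open>The transpositions of \<open>y\<close> with the points of \<open>B\<close>
   represent the cosets of the stabiliser of \<open>y\<close> in the enlarged row group, and
   \<open>v\<close> is semi-invariant under that stabiliser; hence \<open>w\<close> is
   semi-invariant under the whole group.\<close>
 define w where "w = (\<Sum>x\<in>B. fscale (eps s (transpose x y)) (L (transpose x y) v))"
 have vI: "v \<in> I" unfolding v_def by (rule submodule_symm[OF sub u])
 have Bt: "transpose x y \<in> St X ?ph" if "x \<in> B" for x
  using that y by (intro St_transpose) (auto simp: B_def)
 have "w \<in> I" unfolding w_def
  using sub vI Bt St_refine[of z al'] by (intro subspace_sum cfun.subspace_scale) (auto simp: submodule_def)
 moreover have "ct2 X z al < ct2 X z al'"
  unfolding al'_def by (rule ct2_move[OF fin y maximal_sorted[OF max u nz y]])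
 ultimately have 0: "symm s ?ph w = 0" using max by blast
 have inv: "L pe w = fscale (eps s pe) w" if p: "pe \<in> St X ?ph" for pe
 proof -
  note pp = St_permutes[OF p]
  have tm: "L pe (fscale (eps s (transpose x y)) (L (transpose x y) v)) =
    fscale (eps s pe * eps s (transpose (pe x) y)) (L (transpose (pe x) y) v)" if x: "x \<in> B" for x
  proof -
   let ?t = "transpose x y" and ?t' = "transpose (pe x) y"
   have x': "pe x \<in> B" "x \<in> X" using x St_fix[OF p, of x] by (auto simp: B_def permutes_in_image[OF pp])
   \<comment> \<open>\<open>si\<close> corrects \<open>pe\<close> so as to fix \<open>y\<close>; a
     permutation that preserves the new rows and fixes \<open>y\<close> also preserves the old
     ones.\<close>
   define si where "si = ?t' \<circ> pe \<circ> ?t"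
   have t: "?t permutes X" "?t' permutes X" using Bt[OF x] Bt[OF x'(1)] by (auto dest: St_permutes)
   have s1: "si \<in> St X ?ph" unfolding si_def by (intro St_comp Bt x x' p)
   have s2: "si y = y" by (simp add: si_def)
   have s3: "si \<in> St X (pairf z al)"
   proof (rule StI[OF St_permutes[OF s1]])
    fix a assume a: "a \<in> X"
    show "(z (si a), al (si a)) = (z a, al a)"
    proof (cases "a = y")
     case False
     hence "si a \<noteq> y" using s2 permutes_inj[OF St_permutes[OF s1]] by (metis injD)
     thus ?thesis using St_fix[OF s1 a] False by (simp add: al'_def)
    qed (simp add: s2)
   qed
   have "?t' \<circ> si = pe \<circ> ?t" by (simp add: si_def fun_eq_iff)
   hence "L pe (L ?t v) = L ?t' (L si v)"
    using L_comp[OF pp t(1), of v] L_comp[OF t(2) St_permutes[OF s3], of v] by simp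
   also have "L si v = fscale (eps s si) v" unfolding v_def by (rule L_symm[OF s3])
   also have "eps s si = eps s ?t' * eps s pe * eps s ?t"
    unfolding si_def using t pp by (simp add: eps_comp[OF fin] permutes_compose)
   finally have e: "L pe (L ?t v) = fscale (eps s ?t' * eps s pe * eps s ?t) (L ?t' v)"
    by (simp only: L_fscale)
   have "eps s ?t * (eps s ?t' * eps s pe * eps s ?t) = eps s pe * eps s ?t'"
    using eps_cases[of s ?t] by auto
   thus ?thesis unfolding L_fscale e cfun.scale_scale by (rule arg_cong)
  qed
  have "L pe w = (\<Sum>x\<in>B. fscale (eps s pe * eps s (transpose (pe x) y)) (L (transpose (pe x) y) v))"
   unfolding w_def L_sum by (rule sum.cong[OF refl tm])
  also have "... = (\<Sum>x\<in>B. fscale (eps s pe * eps s (transpose x y)) (L (transpose x y) v))"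
  proof (rule sum.reindex_bij_witness[of _ "inv pe" pe])
   fix x assume "x \<in> B"
   thus "inv pe (pe x) = x" "pe x \<in> B" "pe (inv pe x) = x" "inv pe x \<in> B"
    using St_fix[OF p, of x] St_fix[OF St_inv[OF p], of x]
    by (auto simp: B_def permutes_inverses[OF pp] permutes_in_image[OF pp] permutes_in_image[OF permutes_inv[OF pp]])
  qed simp
  also have "... = fscale (eps s pe) w"
   unfolding w_def cfun.scale_sum_right cfun.scale_scale ..
  finally show ?thesis .
 qed
 have "fscale (of_nat (card (St X ?ph))) w = 0"
  using symm_of_invariant[of ?ph w s, OF inv] 0 by simp
 hence w0: "w = 0" using card_St_nz[of ?ph] by (simp only: cfun.scale_eq_0_iff) auto
 let ?B = "{x\<in>X. z x = z y \<and> al x = i}"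
 have B: "B = insert y ?B" "y \<notin> ?B" "finite ?B"
 proof -
  have "x \<in> B \<longleftrightarrow> x = y \<or> x \<in> ?B" for x
   by (cases "x = y") (simp_all add: B_def al'_def y(1))
  thus "B = insert y ?B" by blast
  show "y \<notin> ?B" using y by simp
  show "finite ?B" using fin by simp
 qed
 define S where "S = (\<Sum>x\<in>?B. L (transpose x y) v)"
 have 1: "(\<Sum>x\<in>?B. fscale (eps s (transpose x y)) (L (transpose x y) v)) =
   (\<Sum>x\<in>?B. fscale (if s then -1 else 1) (L (transpose x y) v))"
 proof (rule sum.cong[OF refl])
  fix x assume "x \<in> ?B"
  hence "x \<noteq> y" using B(2) by blast
  from eps_transpose[OF this, of s] show "fscale (eps s (transpose x y)) (L (transpose x y) v) =
    fscale (if s then -1 else 1) (L (transpose x y) v)" by (rule arg_cong)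
 qed
 have 2: "fscale (eps s (transpose y y)) (L (transpose y y) v) = v"
  by (simp only: transpose_same eps_id L_id cfun.scale_one)
 have "w = v + (\<Sum>x\<in>?B. fscale (if s then -1 else 1) (L (transpose x y) v))"
  unfolding w_def B(1) sum.insert[OF B(3,2)] 1 2 ..
 also have "... = v + fscale (if s then -1 else 1) S" by (simp only: S_def cfun.scale_sum_right)
 finally have "v + fscale (if s then -1 else 1) S = 0" using w0 by simp
 hence "v x + (if s then -1 else 1) * S x = 0" for x by (metis fscale_apply plus_fun_apply zero_fun_apply)
 hence "S x = - (if s then -1 else 1) * v x" for x
  by (cases s) (simp_all add: add_eq_0_iff add.commute)
 hence "S = fscale (- (if s then -1 else 1)) v" by (simp add: fun_eq_iff)
 thus ?thesis by (simp only: S_def)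
qed

text \<open>Transpositions within a row contribute the sign once for every ordered pair, which gives
  \<open>pr2\<close>. For a point \<open>y\<close>, the exchange relation makes each of the
  \<open>al y\<close> earlier rows contribute minus the sign, and the pairs in reverse order
  contribute the same again. Together this is \<open>ct2\<close>.\<close>

lemma cas_maximal:
 assumes sub: "submodule z I" and max: "maximal s z I al" and u: "u \<in> I"
 defines "v \<equiv> symm s (pairf z al) u"
 shows "cas z v = fscale (of_int (ct2 X z al) * (if s then -1 else 1)) v"
proof (cases "v = 0")
 case True
 thus ?thesis by (simp only: cas_def L_zero sum.neutral_const cfun.scale_zero_right)
next
 case False
 define \<epsilon> :: complex where "\<epsilon> = (if s then -1 else 1)"
 define P where "P Q = (\<Sum>y\<in>X. \<Sum>x\<in>{x\<in>X. x \<noteq> y \<and> z x = z y \<and> Q x y}. L (transpose x y) v)"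
  for Q :: "nat => nat => bool"
 have split: "cas z v = P (\<lambda>x y. al x = al y) + (P (\<lambda>x y. al x < al y) + P (\<lambda>x y. al y < al x))"
  unfolding cas_def P_def sum.distrib[symmetric]
 proof (rule sum.cong[OF refl])
  fix y
  let ?A = "\<lambda>Q. {x\<in>X. x \<noteq> y \<and> z x = z y \<and> Q x y}"
  have 1: "{x\<in>X. x \<noteq> y \<and> z x = z y} = ?A (\<lambda>x y. al x = al y) \<union> (?A (\<lambda>x y. al x < al y) \<union> ?A (\<lambda>x y. al y < al x))"
   by auto
  show "(\<Sum>x\<in>{x\<in>X. x \<noteq> y \<and> z x = z y}. L (transpose x y) v) =
    (\<Sum>x\<in>?A (\<lambda>x y. al x = al y). L (transpose x y) v) +
    ((\<Sum>x\<in>?A (\<lambda>x y. al x < al y). L (transpose x y) v) + (\<Sum>x\<in>?A (\<lambda>x y. al y < al x). L (transpose x y) v))"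
   unfolding 1 using fin by (subst sum.union_disjoint, simp, simp, fastforce)+ simp
 qed
 have swap: "P (\<lambda>x y. al y < al x) = P (\<lambda>x y. al x < al y)"
 proof -
  have "P (\<lambda>x y. al y < al x) = (\<Sum>y\<in>X. \<Sum>x\<in>X. if x \<noteq> y \<and> z x = z y \<and> al y < al x then L (transpose x y) v else 0)"
   unfolding P_def using fin by (simp only: sum.inter_filter)
  also have "... = (\<Sum>x\<in>X. \<Sum>y\<in>X. if x \<noteq> y \<and> z x = z y \<and> al y < al x then L (transpose x y) v else 0)"
   by (rule sum.swap)
  also have "... = (\<Sum>x\<in>X. \<Sum>y\<in>X. if y \<noteq> x \<and> z y = z x \<and> al y < al x then L (transpose y x) v else 0)"
   by (rule sum.cong[OF refl], rule sum.cong[OF refl]) (metis transpose_commute)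
  also have "... = P (\<lambda>x y. al x < al y)"
   unfolding P_def using fin by (simp only: sum.inter_filter)
  finally show ?thesis .
 qed
 have eq: "P (\<lambda>x y. al x = al y) = fscale (of_int (pr2 X z al) * \<epsilon>) v"
 proof -
  have "P (\<lambda>x y. al x = al y) = (\<Sum>y\<in>X. \<Sum>x\<in>{x\<in>X. x \<noteq> y \<and> z x = z y \<and> al x = al y}. fscale \<epsilon> v)"
   unfolding P_def
  proof (intro sum.cong refl)
   fix y x assume "y \<in> X" "x \<in> {x\<in>X. x \<noteq> y \<and> z x = z y \<and> al x = al y}"
   hence t: "transpose x y \<in> St X (pairf z al)" "x \<noteq> y" by (auto intro: St_transpose)
   show "L (transpose x y) v = fscale \<epsilon> v"
    unfolding v_def L_symm[OF t(1)] eps_transpose[OF t(2)] \<epsilon>_def ..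
  qed
  also have "... = fscale (\<Sum>y\<in>X. \<Sum>x\<in>{x\<in>X. x \<noteq> y \<and> z x = z y \<and> al x = al y}. \<epsilon>) v"
   by (simp only: cfun.scale_sum_left)
  also have "(\<Sum>y\<in>X. \<Sum>x\<in>{x\<in>X. x \<noteq> y \<and> z x = z y \<and> al x = al y}. \<epsilon>) =
    (\<Sum>y\<in>X. \<Sum>x\<in>X. if x \<noteq> y \<and> z x = z y \<and> al x = al y then \<epsilon> else 0)"
   using fin by (simp only: sum.inter_filter)
  also have "... = of_int (pr2 X z al) * \<epsilon>"
   unfolding pr2_def of_int_sum sum_distrib_right
   by (subst sum.swap) (intro sum.cong refl, simp)
  finally show ?thesis .
 qed
 have less: "P (\<lambda>x y. al x < al y) = fscale (of_int (- (\<Sum>y\<in>X. int (al y))) * \<epsilon>) v"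
 proof -
  have "(\<Sum>x\<in>{x\<in>X. x \<noteq> y \<and> z x = z y \<and> al x < al y}. L (transpose x y) v) = fscale (of_int (- int (al y)) * \<epsilon>) v"
   if y: "y \<in> X" for y
  proof -
   have 1: "{x\<in>X. x \<noteq> y \<and> z x = z y \<and> al x < al y} = (\<Union>i\<in>{..<al y}. {x\<in>X. z x = z y \<and> al x = i})" by auto
   have "(\<Sum>x\<in>{x\<in>X. x \<noteq> y \<and> z x = z y \<and> al x < al y}. L (transpose x y) v) =
     (\<Sum>i\<in>{..<al y}. \<Sum>x\<in>{x\<in>X. z x = z y \<and> al x = i}. L (transpose x y) v)"
    unfolding 1 using fin by (intro sum.UNION_disjoint) auto
   also have "... = (\<Sum>i\<in>{..<al y}. fscale (- \<epsilon>) v)"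
    unfolding \<epsilon>_def v_def using False
    by (intro sum.cong refl maximal_exchange[OF sub max u]) (simp_all add: y v_def)
   also have "... = fscale (\<Sum>i\<in>{..<al y}. - \<epsilon>) v" by (simp only: cfun.scale_sum_left)
   also have "(\<Sum>i\<in>{..<al y}. - \<epsilon>) = of_int (- int (al y)) * \<epsilon>" by simp
   finally show ?thesis .
  qed
  hence "P (\<lambda>x y. al x < al y) = (\<Sum>y\<in>X. fscale (of_int (- int (al y)) * \<epsilon>) v)"
   unfolding P_def by (intro sum.cong refl) simp
  also have "... = fscale (\<Sum>y\<in>X. of_int (- int (al y)) * \<epsilon>) v" by (simp only: cfun.scale_sum_left)
  also have "(\<Sum>y\<in>X. of_int (- int (al y)) * \<epsilon>) = of_int (- (\<Sum>y\<in>X. int (al y))) * \<epsilon>"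
   by (simp add: sum_distrib_right sum_negf)
  finally show ?thesis .
 qed
 show ?thesis
  unfolding split swap eq less by (simp add: fun_eq_iff ct2_def \<epsilon>_def algebra_simps)
qed

text \<open>For \<open>al = id\<close> all labels differ, the stabiliser is trivial and the
  symmetrizer is the identity, so some labelling acts nontrivially; among those, bounded contents
  allow a maximal one.\<close>

lemma exists_maximal:
 assumes u: "u \<in> I" "u \<noteq> 0"
 shows "\<exists>al. maximal s z I al \<and> (\<exists>u\<in>I. symm s (pairf z al) u \<noteq> 0)"
proof -
 let ?P = "\<lambda>al. \<exists>u\<in>I. symm s (pairf z al) u \<noteq> 0"
 let ?m = "\<lambda>al. nat (int (card X * card X) - ct2 X z al)"
 have "pe = id" if "pe \<in> St X (pairf z id)" for pe
  using that by (auto simp: St_def fun_eq_iff dest: permutes_not_in)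
 hence "St X (pairf z id) = {id}" by auto
 hence "symm s (pairf z id) u = u" by (simp add: symm_def)
 hence "?P id" using u by auto
 from ex_has_least_nat[of ?P id ?m, OF this] obtain al where
  a: "?P al" "\<And>al'. ?P al' ==> ?m al \<le> ?m al'" by blast
 have "maximal s z I al"
 proof (intro allI impI ballI, rule ccontr)
  fix al' u assume h: "ct2 X z al < ct2 X z al'" "u \<in> I" "symm s (pairf z al') u \<noteq> 0"
  hence "?m al \<le> ?m al'" by (intro a(2)) auto
  thus False using h(1) ct2_le[OF fin, of z al'] by linarith
 qed
 thus ?thesis using a(1) by blast
qed

lemma cas_add: "cas z (f + g) = cas z f + cas z g"
 and cas_fscale: "cas z (fscale c f) = fscale c (cas z f)"
 and cas_zero: "cas z 0 = 0"
 by (simp_all only: cas_def L_add L_fscale L_zero sum.distrib cfun.scale_sum_right sum.neutral_const)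

text \<open>\<open>g\<close> permutes the pairs of equally coloured points, and conjugation by
  \<open>g\<close> carries each transposition to that of the image pair: the sum is central.\<close>

lemma cas_L:
 assumes g: "g \<in> St X z" shows "cas z (L g f) = L g (cas z f)"
proof -
 note p = St_permutes[OF g]
 have c: "transpose (g x) (g y) \<circ> g = g \<circ> transpose x y" for x y
  by (auto simp: fun_eq_iff transpose_def inj_eq[OF permutes_inj[OF p]])
 have "L g (cas z f) = (\<Sum>y\<in>X. \<Sum>x\<in>{x\<in>X. x \<noteq> y \<and> z x = z y}. L (transpose (g x) (g y)) (L g f))"
  unfolding cas_def L_sum
 proof (intro sum.cong refl)
  fix y x assume "y \<in> X" "x \<in> {x\<in>X. x \<noteq> y \<and> z x = z y}"
  thus "L g (L (transpose x y) f) = L (transpose (g x) (g y)) (L g f)"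
   using c[of x y] L_comp[OF p, of "transpose x y" f] L_comp[OF _ p, of "transpose (g x) (g y)" f]
   by (simp add: permutes_swap_id permutes_in_image[OF p])
 qed
 also have "... = (\<Sum>y\<in>X. \<Sum>x\<in>{x\<in>X. x \<noteq> g y \<and> z x = z (g y)}. L (transpose x (g y)) (L g f))"
 proof (rule sum.cong[OF refl])
  fix y assume y: "y \<in> X"
  show "(\<Sum>x\<in>{x\<in>X. x \<noteq> y \<and> z x = z y}. L (transpose (g x) (g y)) (L g f)) =
    (\<Sum>x\<in>{x\<in>X. x \<noteq> g y \<and> z x = z (g y)}. L (transpose x (g y)) (L g f))"
  proof (rule sum.reindex_bij_witness[of _ "inv g" g])
   fix x assume "x \<in> {x\<in>X. x \<noteq> y \<and> z x = z y}"
   thus "inv g (g x) = x" "g x \<in> {x\<in>X. x \<noteq> g y \<and> z x = z (g y)}"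
    using y by (auto simp: permutes_inverses[OF p] permutes_in_image[OF p] inj_eq[OF permutes_inj[OF p]] St_fix[OF g])
  next
   fix x assume "x \<in> {x\<in>X. x \<noteq> g y \<and> z x = z (g y)}"
   thus "g (inv g x) = x" "inv g x \<in> {x\<in>X. x \<noteq> y \<and> z x = z y}"
    using y by (auto simp: permutes_inverses[OF p] permutes_in_image[OF permutes_inv[OF p]] St_fix[OF g] St_fix[OF St_inv[OF g]])
  qed simp
 qed
 also have "... = cas z (L g f)"
  unfolding cas_def
  by (rule sum.permute[OF p, where g="\<lambda>y. \<Sum>x\<in>{x\<in>X. x \<noteq> y \<and> z x = z y}. L (transpose x y) (L g f)", unfolded comp_def, symmetric])
 finally show ?thesis by simp
qed

text \<open>Choose a row symmetrizer that does not kill \<open>I\<close>, of maximal content, and a column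
 antisymmetrizer that does not kill the submodule generated by its image, again of maximal
 content. The sum of all transpositions acts there by the content of the rows and by minus the
 content of the columns, so the contents are opposite and rows and columns fit into a tableau.\<close>

theorem young_symmetrizer_exists:
 assumes sub: "submodule z I" and u: "u \<in> I" "u \<noteq> 0"
 shows "\<exists>rw cw u. tab X z rw cw \<and> u \<in> I \<and>
  symm True (pairf z cw) (symm False (pairf z rw) u) \<noteq> 0"
proof -
 obtain al u1 where max: "maximal False z I al" and u1: "u1 \<in> I" "symm False (pairf z al) u1 \<noteq> 0"
  using exists_maximal[OF u, where s=False and z=z] by blast
 define a where "a = symm False (pairf z al)"
 \<comment> \<open>\<open>J\<close> is the submodule generated by the image of the row symmetrizer.
   Since \<open>cas\<close> is central, it acts on all of \<open>J\<close> by the scalar found on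
   that image.\<close>
 define J where "J = cfun.span {L g (a w) |g w. g \<in> St X z \<and> w \<in> I}"
 have subJ: "submodule z J"
  unfolding submodule_def
 proof (intro conjI ballI)
  show "cfun.subspace J" unfolding J_def by (rule cfun.subspace_span)
  fix pe f assume p: "pe \<in> St X z" and "f \<in> J"
  hence "f \<in> cfun.span {L g (a w) |g w. g \<in> St X z \<and> w \<in> I}" by (simp add: J_def)
  thus "L pe f \<in> J"
  proof (induction rule: cfun.span_induct_alt)
   case base thus ?case by (simp only: L_zero) (simp only: J_def cfun.span_zero)
  next
   case (step c x y)
   then obtain g w where g: "x = L g (a w)" "g \<in> St X z" "w \<in> I" by blast
   have "L pe x \<in> J" unfolding J_def g(1) L_comp[OF St_permutes[OF p] St_permutes[OF g(2)], symmetric]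
    by (rule cfun.span_base) (use St_comp[OF p g(2)] g(3) in blast)
   thus ?case using step(2) unfolding J_def L_add L_fscale by (intro cfun.span_add cfun.span_scale)
  qed
 qed
 have casJ: "cas z f = fscale (of_int (ct2 X z al)) f" if "f \<in> J" for f
  using that unfolding J_def
 proof (induction rule: cfun.span_induct_alt)
  case base thus ?case by (simp only: cas_zero cfun.scale_zero_right)
 next
  case (step c x y)
  then obtain g w where g: "x = L g (a w)" "g \<in> St X z" "w \<in> I" by blast
  have "cas z (a w) = fscale (of_int (ct2 X z al)) (a w)"
   using cas_maximal[OF sub max g(3)] unfolding a_def by simp
  hence "cas z x = fscale (of_int (ct2 X z al)) x" by (simp only: g(1) cas_L[OF g(2)] L_fscale)
  thus ?case using step(2) by (simp only: cas_add cas_fscale cfun.scale_right_distrib cfun.scale_left_commute)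
 qed
 have "a u1 \<in> J" unfolding J_def by (rule cfun.span_base) (use u1(1) St_id[of X z] in \<open>metis (mono_tags, lifting) L_id mem_Collect_eq\<close>)
 moreover have "a u1 \<noteq> 0" using u1 by (simp add: a_def)
 ultimately obtain cw u2 where max2: "maximal True z J cw" and u2: "u2 \<in> J" "symm True (pairf z cw) u2 \<noteq> 0"
  using exists_maximal[of "a u1" J, where s=True and z=z] by blast
 define b where "b = symm True (pairf z cw)"
 have bJ: "b u2 \<in> J" unfolding b_def by (rule submodule_symm[OF subJ u2(1)])
 \<comment> \<open>\<open>b u2\<close> lies in \<open>J\<close>, where \<open>cas\<close> is the row
   content, and it is also a column vector of maximal content, on which \<open>cas\<close> is minus
   the column content.\<close>
 have "fscale (of_int (ct2 X z al)) (b u2) = fscale (of_int (- ct2 X z cw)) (b u2)"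
  using cas_maximal[OF subJ max2 u2(1)] casJ[OF bJ] unfolding b_def by simp
 hence "(of_int (ct2 X z al) :: complex) = of_int (- ct2 X z cw)"
  using u2(2) by (metis b_def cfun.scale_cancel_right)
 hence "ct2 X z al = - ct2 X z cw" by (simp only: of_int_eq_iff)
 hence ct: "ct2 X z al + ct2 X z cw = 0" by simp
 have "\<exists>g w. g \<in> St X z \<and> w \<in> I \<and> b (L g (a w)) \<noteq> 0"
 proof (rule ccontr)
  assume n: "\<not> ?thesis"
  have "b f = 0" if "f \<in> J" for f
   using that unfolding J_def
  proof (induction rule: cfun.span_induct_alt)
   case base thus ?case by (simp only: b_def symm_zero)
  next
   case (step c x y)
   hence "b x = 0" using n by blast
   thus ?case using step(2) by (simp only: b_def symm_add symm_fscale) simp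
  qed
  thus False using u2 by (simp add: b_def)
 qed
 then obtain g w where g: "g \<in> St X z" and w: "w \<in> I" and nz: "b (L g (a w)) \<noteq> 0" by blast
 \<comment> \<open>The translation by \<open>g\<close> is absorbed into the row labelling; the
   colours do not change because \<open>g\<close> preserves them.\<close>
 define rw where "rw = al \<circ> inv g"
 note p = St_permutes[OF g] and gi = St_inv[OF g]
 have "L g (a w) = symm False ((pairf z al) \<circ> inv g) (L g w)" unfolding a_def by (rule L_conj[OF p])
 also have "... = symm False (pairf z rw) (L g w)"
 proof -
  have "St X ((pairf z al) \<circ> inv g) = St X (pairf z rw)"
   by (rule St_cong) (simp add: rw_def St_fix[OF gi])
  thus ?thesis by (simp only: symm_def)
 qed
 finally have nz': "b (symm False (pairf z rw) (L g w)) \<noteq> 0" using nz by simp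
 have ct': "ct2 X z rw = ct2 X z al" unfolding rw_def
  by (rule ct2_reindex[OF St_permutes[OF gi]]) (rule St_fix[OF gi])
 have inj: "inj3 X z rw cw"
 proof (rule inj_onI, rule ccontr)
  fix x y assume h: "x \<in> X" "y \<in> X" "(z x, rw x, cw x) = (z y, rw y, cw y)" "x \<noteq> y"
  hence "b (symm (\<not> True) (pairf z rw) (L g w)) = 0"
   unfolding b_def by (intro symm_kill[OF h(1,2,4)]) (use h(3) in simp_all)
  thus False using nz' by simp
 qed
 have "tab X z rw cw" using inj3_ct2(2)[OF fin inj] ct ct' by simp
 moreover have "L g w \<in> I" using sub g w by (simp add: submodule_def)
 ultimately show ?thesis using nz' unfolding b_def by blast
qed

end

section \<open>Functions on words\<close>

lemma St_comp_eq: assumes "pe \<in> St X z" shows "z \<circ> pe = z" "z \<circ> inv pe = z"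
proof -
 have "z \<circ> si = z" if "si \<in> St X z" for si
 proof
  fix x show "(z \<circ> si) x = z x"
   by (cases "x \<in> X") (simp_all add: St_fix[OF that] permutes_not_in[OF St_permutes[OF that]])
 qed
 from this[OF assms] this[OF St_inv[OF assms]] show "z \<circ> pe = z" "z \<circ> inv pe = z" by auto
qed

definition wact :: "(nat => nat) => wd => wd" where
 "wact pe = (\<lambda>(z, rw). (z \<circ> inv pe, rw \<circ> inv pe))"

text \<open>The second component is a self-map of the positions, not a label on them, and is
  therefore conjugated.\<close>

definition mact :: "(nat => nat) => wd => wd" where
 "mact pe = (\<lambda>(z, f). (z \<circ> inv pe, pe \<circ> f \<circ> inv pe))"

lemma wact_simp [simp]: "wact pe (z, rw) = (z \<circ> inv pe, rw \<circ> inv pe)"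
 and mact_simp [simp]: "mact pe (z, f) = (z \<circ> inv pe, pe \<circ> f \<circ> inv pe)"
 by (simp_all add: wact_def mact_def)

lemma perm_act_wact: "finite X ==> perm_act X wact"
 by unfold_locales (auto simp: inv_comp comp_assoc)

lemma perm_act_mact: "finite X ==> perm_act X mact"
 by unfold_locales (auto simp: inv_comp comp_assoc)

text \<open>\<open>s\<close> stands for r/2 and \<open>r\<close> abbreviates \<open>2 * s\<close>,
  so that the evenness of \<open>r\<close> is built in and no division occurs.\<close>

locale gel =
 fixes n s :: nat
 assumes s_pos: "0 < s"
begin

sublocale w: perm_act "{..<n}" wact by (rule perm_act_wact) simp
sublocale m: perm_act "{..<n}" mact by (rule perm_act_mact) simp

abbreviation X where "X \<equiv> {..<n}"
abbreviation r where "r \<equiv> 2 * s"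

text \<open>The polytabloid of a multitableau in word form: the positions are the entries, colour
  and row give the tabloid, \<open>cw\<close> the columns. The colour is part of the column label,
  so the column group is the product of the column groups of the components.\<close>

definition evec :: "(nat => nat) => (nat => nat) => (nat => nat) => wd => complex" where
 "evec z rw cw = w.symm True (pairf z cw) (basis_vec (z, rw))"

text \<open>Colours and rows are 0 from \<open>n\<close> on, so that a word is determined by its
  letters at the positions below \<open>n\<close> and equality of functions can be used.\<close>

definition Tab :: "(nat => nat) => (nat => nat) => (nat => nat) => bool" where
 "Tab z rw cw \<longleftrightarrow> tab X z rw cw \<and> (\<forall>x<n. z x < r) \<and> (\<forall>x\<ge>n. z x = 0 \<and> rw x = 0)"

text \<open>The lengths of all rows of all components. This function is what is called the shape of
  a word, in place of a tuple of partitions.\<close>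

definition cnt :: "(nat => nat) => (nat => nat) => nat => nat => nat" where
 "cnt z rw c i = card {x\<in>X. z x = c \<and> rw x = i}"

definition doubled :: "(nat => nat) => (nat => nat) => bool" where
 "doubled z rw \<longleftrightarrow> (\<forall>c<s. cnt z rw c = cnt z rw (c + s))"

definition Bsp :: "(wd => complex) set" where
 "Bsp = cfun.span {evec z rw cw |z rw cw. Tab z rw cw \<and> doubled z rw}"

text \<open>These pairs parametrise the antisymmetric monomial matrices: \<open>f\<close> is the
  permutation, \<open>z\<close> gives the exponents, and the jump by \<open>s\<close> along
  \<open>f\<close> is the factor -1 = zeta^s. The jump also excludes fixed points of
  \<open>f\<close> below \<open>n\<close>.\<close>

definition W :: "(wd) set" where
 "W = {(z, f). (\<forall>x<n. z x < r \<and> f x < n \<and> f (f x) = x \<and> z (f x) = (z x + s) mod r) \<and>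
        (\<forall>x\<ge>n. z x = 0 \<and> f x = x)}"

text \<open>Rows are bounded by \<open>n\<close> to keep the sum in \<open>Psi\<close> finite; the
  rows of a tableau with \<open>n\<close> entries satisfy the bound by
  \<open>tab_less_n\<close>.\<close>

definition Rw :: "(nat => nat) set" where
 "Rw = {rw. (\<forall>x<n. rw x < n) \<and> (\<forall>x\<ge>n. rw x = 0)}"

definition Psi :: "(wd => complex) => wd => complex" where
 "Psi x = (\<lambda>(z, f). if (z, f) \<in> W then \<Sum>rw\<in>{rw\<in>Rw. rw \<circ> f = rw}. x (z, rw) else 0)"

text \<open>The component of one colouring. It is stable only under permutations preserving that
  colouring, and this is the group to which the symmetrizers belong.\<close>

definition proj :: "(nat => nat) => (wd => complex) => wd => complex" where
 "proj z x = (\<lambda>o'. if fst o' = z then x o' else 0)"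

lemma Psi_add: "Psi (x + y) = Psi x + Psi y"
 and Psi_fscale: "Psi (fscale c x) = fscale c (Psi x)"
 and Psi_zero [simp]: "Psi 0 = 0"
 by (auto simp: Psi_def fun_eq_iff sum.distrib sum_distrib_left)

lemma Psi_sum: "Psi (\<Sum>i\<in>A. f i) = (\<Sum>i\<in>A. Psi (f i))"
 by (rule ext) (auto simp: Psi_def sum_fun_apply split: prod.split intro: sum.swap)

lemma proj_add: "proj z (x + y) = proj z x + proj z y"
 and proj_fscale: "proj z (fscale c x) = fscale c (proj z x)"
 and proj_zero [simp]: "proj z 0 = 0"
 and proj_proj: "proj z (proj z x) = proj z x"
 by (auto simp: proj_def fun_eq_iff)

lemma Psi_proj: "Psi (proj z x) = proj z (Psi x)"
 by (rule ext) (auto simp: Psi_def proj_def split: prod.split)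

lemma finite_Rw: "finite Rw"
proof -
 have "finite {rw. \<forall>x. (x \<in> X \<longrightarrow> rw x \<in> X) \<and> (x \<notin> X \<longrightarrow> rw x = 0)}"
  by (rule finite_set_of_finite_funs) auto
 thus ?thesis by (rule rev_finite_subset) (auto simp: Rw_def)
qed

lemma W_D: assumes "(z, f) \<in> W"
 shows "x < n ==> z x < r" "x < n ==> f x < n" "f (f x) = x"
  "x < n ==> z (f x) = (z x + s) mod r" "n \<le> x ==> z x = 0" "n \<le> x ==> f x = x"
 using assms by (auto simp: W_def not_less) (metis not_le)

lemma W_permutes: assumes "(z, f) \<in> W" shows "f permutes X"
proof (rule inj_imp_permutes)
 show "inj_on f X" by (rule inj_onI) (metis W_D(3)[OF assms])
qed (use W_D[OF assms] in \<open>auto simp: not_less\<close>)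

lemma finite_W: "finite W"
proof -
 have "finite {z :: nat => nat. \<forall>x. (x \<in> X \<longrightarrow> z x \<in> {..<r}) \<and> (x \<notin> X \<longrightarrow> z x = 0)}"
  by (rule finite_set_of_finite_funs) auto
 moreover have "finite {f. f permutes X}" by (rule finite_permutations) simp
 ultimately show ?thesis
  by (rule finite_subset[OF _ finite_cartesian_product, rotated])
    (auto intro: W_permutes W_D(1,5) simp: not_less)
qed

lemma add_s_mod: "c < r ==> (c + s) mod r = (if c < s then c + s else c - s)"
 by (auto simp: mod_if not_less)

lemma add_s_mod_invol: "c < r ==> ((c + s) mod r + s) mod r = c"
 by (auto simp: mod_if not_less)

lemma W_half: assumes "(z, f) \<in> W" "x < n" shows "z (f x) < s \<longleftrightarrow> \<not> z x < s"
 using W_D(1,4)[OF assms] by (auto simp: add_s_mod)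

lemma W_mact: assumes "(z, f) \<in> W" "pe permutes X" shows "mact pe (z, f) \<in> W"
proof -
 have i: "inv pe permutes X" by (rule permutes_inv[OF assms(2)])
 have "inv pe x < n \<longleftrightarrow> x < n" "pe x < n \<longleftrightarrow> x < n" for x
  using permutes_in_image[OF i, of x] permutes_in_image[OF assms(2), of x] by auto
 thus ?thesis
  using W_D[OF assms(1)] by (auto simp: W_def permutes_inverses[OF assms(2)] permutes_not_in[OF assms(2)] permutes_not_in[OF i] not_less)
qed

lemma W_mact_iff: assumes "pe permutes X" shows "mact pe o' \<in> W \<longleftrightarrow> o' \<in> W"
proof
 assume "mact pe o' \<in> W"
 hence "mact (inv pe) (mact pe o') \<in> W" using W_mact permutes_inv[OF assms] by (metis surj_pair)
 thus "o' \<in> W" by (simp only: m.act_inv[OF assms])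
qed (metis W_mact assms surj_pair)

lemma Rw_comp: assumes "pe permutes X" shows "rw \<circ> pe \<in> Rw \<longleftrightarrow> rw \<in> Rw"
proof -
 have "rw \<circ> pe \<in> Rw" if "rw \<in> Rw" "pe permutes X" for rw pe
  using that permutes_in_image[OF that(2)] by (auto simp: Rw_def permutes_not_in)
 from this[of rw pe] this[of "rw \<circ> pe" "inv pe"] show ?thesis
  using assms permutes_inv[OF assms] by (auto simp: comp_assoc permutes_inv_o)
qed

lemma Psi_L:
 assumes p: "pe permutes X" shows "Psi (w.L pe x) = m.L pe (Psi x)"
proof
 fix o' :: "wd"
 obtain z f where o': "o' = (z, f)" by (cases o')
 have i: "inv pe permutes X" by (rule permutes_inv[OF p])
 have ii: "inv (inv pe) = pe" by (rule permutes_inv_inv[OF p])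
 have "(\<Sum>rw\<in>{rw\<in>Rw. rw \<circ> f = rw}. x (z \<circ> pe, rw \<circ> pe)) = (\<Sum>rw\<in>{rw\<in>Rw. rw \<circ> (inv pe \<circ> f \<circ> pe) = rw}. x (z \<circ> pe, rw))"
 proof (rule sum.reindex_bij_witness[of _ "\<lambda>rw. rw \<circ> inv pe" "\<lambda>rw. rw \<circ> pe"])
  fix rw assume "rw \<in> {rw\<in>Rw. rw \<circ> f = rw}"
  thus "rw \<circ> pe \<in> {rw\<in>Rw. rw \<circ> (inv pe \<circ> f \<circ> pe) = rw}"
   by (auto simp: Rw_comp[OF p] fun_eq_iff permutes_inverses[OF p])
 next
  fix rw assume a: "rw \<in> {rw\<in>Rw. rw \<circ> (inv pe \<circ> f \<circ> pe) = rw}"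
  have e: "rw \<circ> (inv pe \<circ> f \<circ> pe) = rw" using a by blast
  have "rw (inv pe (f y)) = rw (inv pe y)" for y
   using fun_cong[OF e, of "inv pe y"] by (simp add: permutes_inverses(1)[OF p])
  thus "rw \<circ> inv pe \<in> {rw\<in>Rw. rw \<circ> f = rw}" using a by (auto simp: Rw_comp[OF i])
 qed (auto simp: fun_eq_iff permutes_inverses[OF p])
 thus "Psi (w.L pe x) o' = m.L pe (Psi x) o'"
  using W_mact_iff[OF i, of "(z, f)"] by (simp add: o' Psi_def w.L_def m.L_def ii)
qed

lemma Psi_symm: "Psi (w.symm t ph x) = m.symm t ph (Psi x)"
 unfolding w.symm_def m.symm_def Psi_sum Psi_fscale
 by (rule sum.cong[OF refl]) (simp add: Psi_L St_permutes)

definition compat :: "(nat => nat) => (nat => nat) => (wd) set" where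
 "compat z rw = {(z', f) \<in> W. z' = z \<and> rw \<circ> f = rw}"

text \<open>The dual description of \<open>Psi\<close>: a word goes to the sum of the matchings that
  join letters with equal row number. In this form it can be recognised as an orbit sum.\<close>

lemma Psi_basis: assumes "rw \<in> Rw" shows "Psi (basis_vec (z, rw)) = (\<Sum>w\<in>compat z rw. basis_vec w)"
proof
 fix o' :: "wd" obtain z' f where o': "o' = (z', f)" by (cases o')
 have fc: "finite (compat z rw)" by (rule finite_subset[OF _ finite_W]) (auto simp: compat_def)
 have fr: "finite {rw'\<in>Rw. rw' \<circ> f = rw'}" using finite_Rw by simp
 have e1: "(\<Sum>w\<in>compat z rw. basis_vec w) o' = (if o' \<in> compat z rw then 1 else 0)"
  using fc by (simp add: sum_fun_apply basis_vec_def)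
 have e2: "(\<Sum>rw'\<in>{rw'\<in>Rw. rw' \<circ> f = rw'}. basis_vec (z, rw) (z', rw')) = (if z' = z \<and> rw \<circ> f = rw then 1 else 0)"
 proof (cases "z' = z \<and> rw \<circ> f = rw")
  case True
  hence "(\<Sum>rw'\<in>{rw'\<in>Rw. rw' \<circ> f = rw'}. basis_vec (z, rw) (z', rw')) =
    (\<Sum>rw'\<in>{rw'\<in>Rw. rw' \<circ> f = rw'}. if rw' = rw then 1 else 0)"
   by (simp add: basis_vec_def)
  thus ?thesis using True fr assms by (simp add: sum.delta')
 next
  case False
  hence "(\<Sum>rw'\<in>{rw'\<in>Rw. rw' \<circ> f = rw'}. basis_vec (z, rw) (z', rw')) = 0"
   by (intro sum.neutral) (auto simp: basis_vec_def)
  thus ?thesis using False by simp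
 qed
 show "Psi (basis_vec (z, rw)) o' = (\<Sum>w\<in>compat z rw. basis_vec w) o'"
  unfolding e1 unfolding o' Psi_def prod.case e2 by (auto simp: compat_def)
qed

text \<open>The column of \<open>x\<close> contains a point in every row above it, so at least
  \<open>rw x + 1\<close> row numbers occur among \<open>n\<close> points.\<close>

lemma tab_less_n: assumes "tab X z rw cw" "x < n" shows "rw x < n"
proof -
 have "{..rw x} \<subseteq> rw ` X"
 proof
  fix i assume "i \<in> {..rw x}"
  then consider "i = rw x" | "i < rw x" by fastforce
  thus "i \<in> rw ` X"
  proof cases
   case 2
   hence "\<exists>y\<in>X. z y = z x \<and> cw y = cw x \<and> rw y = i" using assms unfolding tab_def by blast
   thus ?thesis by blast
  qed (use assms in simp)
 qed
 hence "card {..rw x} \<le> card (rw ` X)" by (intro card_mono) auto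
 also have "... \<le> n" using card_image_le[of X rw] by simp
 finally show ?thesis by simp
qed

lemma Tab_Rw: "Tab z rw cw ==> rw \<in> Rw"
 using tab_less_n by (auto simp: Tab_def Rw_def)

lemma cnt_comp: assumes "pe \<in> St X z" shows "cnt z (rw \<circ> pe) = cnt z rw"
proof (intro ext)
 fix c i
 note p = St_permutes[OF assms]
 have "bij_betw pe {x\<in>X. z x = c \<and> rw (pe x) = i} {x\<in>X. z x = c \<and> rw x = i}"
 proof (rule bij_betwI[where g="inv pe"])
  show "pe \<in> {x\<in>X. z x = c \<and> rw (pe x) = i} \<rightarrow> {x\<in>X. z x = c \<and> rw x = i}"
   using St_fix[OF assms] permutes_in_image[OF p] by auto
  show "inv pe \<in> {x\<in>X. z x = c \<and> rw x = i} \<rightarrow> {x\<in>X. z x = c \<and> rw (pe x) = i}"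
   using St_fix[OF St_inv[OF assms]] permutes_in_image[OF permutes_inv[OF p]] by (auto simp: permutes_inverses[OF p])
 qed (auto simp: permutes_inverses[OF p])
 thus "cnt z (rw \<circ> pe) c i = cnt z rw c i" by (auto simp: cnt_def dest: bij_betw_same_card)
qed

lemma evec_colour: assumes "z' \<noteq> z" shows "evec z rw cw (z', bw) = 0"
proof -
 have "eps True pe * basis_vec (z, rw) (wact (inv pe) (z', bw)) = 0" if p: "pe \<in> St X (pairf z cw)" for pe
 proof -
  have q: "pe \<in> St X z" using p w.St_refine by blast
  have "z' \<circ> pe = z ==> z' = z" using St_comp_eq(2)[OF q] permutes_inv_o(1)[OF St_permutes[OF q]]
   by (metis comp_assoc comp_id)
  thus ?thesis using assms by (auto simp: basis_vec_def permutes_inv_inv[OF St_permutes[OF q]])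
 qed
 thus ?thesis by (simp add: evec_def w.symm_apply)
qed

lemma proj_evec: "proj z' (evec z rw cw) = (if z' = z then evec z rw cw else 0)"
 by (auto simp: proj_def fun_eq_iff evec_colour)

lemma L_evec: assumes p: "pe permutes X"
 shows "w.L pe (evec z rw cw) = evec (z \<circ> inv pe) (rw \<circ> inv pe) (cw \<circ> inv pe)"
proof -
 have e: "(pairf z cw) \<circ> inv pe = (\<lambda>x. ((z \<circ> inv pe) x, (cw \<circ> inv pe) x))" by auto
 show ?thesis unfolding evec_def w.L_conj[OF p] e w.L_basis[OF p] by simp
qed

lemma tab_comp: assumes p: "pe permutes Y" and t: "tab Y z rw cw" shows "tab Y (z \<circ> pe) (rw \<circ> pe) (cw \<circ> pe)"
proof -
 have i: "inv pe permutes Y" by (rule permutes_inv[OF p])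
 have im: "pe ` Y = Y" by (rule permutes_image[OF p])
 have b: "\<exists>x\<in>Y. Q (pe x)" if "\<exists>x\<in>Y. Q x" for Q
  using that permutes_in_image[OF i] by (metis permutes_inverses(1)[OF p])
 have "inj_on ((\<lambda>x. (z x, rw x, cw x)) \<circ> pe) Y"
  using t permutes_inj_on[OF p] by (intro comp_inj_on) (auto simp: im tab_def)
 moreover have "\<exists>x\<in>Y. z (pe x) = z (pe y) \<and> rw (pe x) = rw (pe y) \<and> cw (pe x) = j" if "y \<in> Y" "j < cw (pe y)" for y j
  using t that permutes_in_image[OF p, of y] unfolding tab_def by (intro b) blast
 moreover have "\<exists>x\<in>Y. z (pe x) = z (pe y) \<and> cw (pe x) = cw (pe y) \<and> rw (pe x) = j" if "y \<in> Y" "j < rw (pe y)" for y j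
  using t that permutes_in_image[OF p, of y] unfolding tab_def by (intro b) blast
 ultimately show ?thesis unfolding tab_def comp_def by blast
qed

lemma Tab_comp: assumes p: "pe permutes X" and t: "Tab z rw cw" shows "Tab (z \<circ> pe) (rw \<circ> pe) (cw \<circ> pe)"
proof -
 have "pe x < n \<longleftrightarrow> x < n" for x using permutes_in_image[OF p, of x] by simp
 thus ?thesis using t tab_comp[OF p, of z rw cw] by (auto simp: Tab_def permutes_not_in[OF p])
qed

lemma cnt_comp2: assumes p: "pe permutes X" shows "cnt (z \<circ> pe) (rw \<circ> pe) = cnt z rw"
proof (intro ext)
 fix c i
 have "bij_betw pe {x\<in>X. z (pe x) = c \<and> rw (pe x) = i} {x\<in>X. z x = c \<and> rw x = i}"
 proof (rule bij_betwI[where g="inv pe"])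
  show "pe \<in> {x\<in>X. z (pe x) = c \<and> rw (pe x) = i} \<rightarrow> {x\<in>X. z x = c \<and> rw x = i}"
   using permutes_in_image[OF p] by auto
  show "inv pe \<in> {x\<in>X. z x = c \<and> rw x = i} \<rightarrow> {x\<in>X. z (pe x) = c \<and> rw (pe x) = i}"
   using permutes_in_image[OF permutes_inv[OF p]] by (auto simp: permutes_inverses[OF p])
 qed (auto simp: permutes_inverses[OF p])
 thus "cnt (z \<circ> pe) (rw \<circ> pe) c i = cnt z rw c i" by (auto simp: cnt_def dest: bij_betw_same_card)
qed

lemma doubled_comp: "pe permutes X ==> doubled (z \<circ> pe) (rw \<circ> pe) \<longleftrightarrow> doubled z rw"
 by (simp add: doubled_def cnt_comp2)

lemma Bsp_L: assumes p: "pe permutes X" and x: "x \<in> Bsp" shows "w.L pe x \<in> Bsp"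
 using x unfolding Bsp_def
proof (induction rule: cfun.span_induct_alt)
 case base thus ?case by (simp only: w.L_zero cfun.span_zero)
next
 case (step c x y)
 then obtain z rw cw where x: "x = evec z rw cw" "Tab z rw cw" "doubled z rw" by blast
 note i = permutes_inv[OF p]
 have b: "w.L pe x \<in> {evec z rw cw |z rw cw. Tab z rw cw \<and> doubled z rw}"
  unfolding x(1) L_evec[OF p] using Tab_comp[OF i x(2)] doubled_comp[OF i, of z rw] x(3) by blast
 show ?case unfolding w.L_add w.L_fscale
  by (rule cfun.span_add[OF cfun.span_scale[OF cfun.span_base[OF b]] step(2)])
qed

lemma Bsp_proj: assumes "x \<in> Bsp" shows "proj z x \<in> Bsp"
 using assms unfolding Bsp_def
proof (induction rule: cfun.span_induct_alt)
 case base thus ?case by (simp only: proj_zero cfun.span_zero)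
next
 case (step c x y)
 have "proj z x \<in> cfun.span {evec z rw cw |z rw cw. Tab z rw cw \<and> doubled z rw}"
  using step(1) by (auto simp: proj_evec cfun.span_base cfun.span_zero split: if_splits)
   (auto intro!: cfun.span_base simp: proj_evec)
 thus ?case using step(2) unfolding proj_add proj_fscale by (intro cfun.span_add cfun.span_scale)
qed

end

section \<open>Young symmetrizers applied to polytabloids\<close>

context gel
begin

text \<open>Packs two facts into one subspace, being a multiple of \<open>v\<close> and being
  nonzero only under \<open>Q\<close>, so that sums are treated by the closure rules.\<close>

lemma subspace_multiples: "cfun.subspace {fscale c v |c. c = 0 \<or> Q}"
proof (rule cfun.subspaceI)
 show "0 \<in> {fscale c v |c. c = 0 \<or> Q}"
  by (rule CollectI, rule exI[of _ 0]) (simp only: cfun.scale_zero_left simp_thms)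
next
 fix x y assume "x \<in> {fscale c v |c. c = 0 \<or> Q}" "y \<in> {fscale c v |c. c = 0 \<or> Q}"
 then obtain c d where "x = fscale c v" "y = fscale d v" "c = 0 \<or> Q" "d = 0 \<or> Q" by blast
 thus "x + y \<in> {fscale c v |c. c = 0 \<or> Q}"
  by (intro CollectI exI[of _ "c + d"] conjI) (simp only: cfun.scale_left_distrib, auto)
next
 fix c x assume "x \<in> {fscale c v |c. c = 0 \<or> Q}"
 then obtain d where "x = fscale d v" "d = 0 \<or> Q" by blast
 thus "fscale c x \<in> {fscale c v |c. c = 0 \<or> Q}"
  by (intro CollectI exI[of _ "c * d"] conjI) (simp only: cfun.scale_scale, auto)
qed

text \<open>The row and column sums of a tableau send polytabloids of its own shape to multiples of
  its own polytabloid and kill those of other shapes. If the result is nonzero, no row of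
  \<open>rw\<close> meets a column of \<open>\<eta>\<close> twice, so the content of
  \<open>rw\<close> is at most that of \<open>bw\<close>; \<open>column_permutation\<close> then
  shows that the surviving words arise from \<open>rw\<close> by column permutations.\<close>

lemma ba_evec:
 assumes P: "Tab z rw cw" and Q: "Tab z bw \<eta>"
 defines "a \<equiv> w.symm False (pairf z rw)" and "b \<equiv> w.symm True (pairf z cw)"
 shows "\<exists>c. b (a (evec z bw \<eta>)) = fscale c (evec z rw cw) \<and> (c = 0 \<or> cnt z bw = cnt z rw)"
proof (cases "b (a (evec z bw \<eta>)) = 0")
 case True
 thus ?thesis by (intro exI[of _ 0]) simp
next
 case nz: False
 have tP: "tab X z rw cw" and tQ: "tab X z bw \<eta>" using P Q by (auto simp: Tab_def)
 have inj: "inj3 X z rw \<eta>"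
 proof (rule inj_onI, rule ccontr)
  fix x y assume h: "x \<in> X" "y \<in> X" "(z x, rw x, \<eta> x) = (z y, rw y, \<eta> y)" "x \<noteq> y"
  hence "w.symm False (pairf z rw) (w.symm (\<not> False) (\<lambda>x. (z x, \<eta> x)) (basis_vec (z, bw))) = 0"
   by (intro w.symm_kill[OF h(1,2,4)]) (use h(3) in simp_all)
  hence "a (evec z bw \<eta>) = 0" by (simp add: a_def evec_def)
  thus False using nz by (simp add: b_def)
 qed
 have ct: "ct2 X z rw \<le> ct2 X z bw"
  using inj3_ct2(1)[OF _ inj] tab_ct2[OF _ tQ] by simp
 have one: "\<exists>c. b (basis_vec (z, bw \<circ> si)) = fscale c (evec z rw cw) \<and> (c = 0 \<or> cnt z bw = cnt z rw)"
  if s: "si \<in> St X z" for si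
 proof (cases "b (basis_vec (z, bw \<circ> si)) = 0")
  case True
  thus ?thesis by (intro exI[of _ 0]) simp
 next
  case False
  have inj': "inj3 X z (bw \<circ> si) cw"
  proof (rule inj_onI, rule ccontr)
   fix x y assume h: "x \<in> X" "y \<in> X" "(z x, (bw \<circ> si) x, cw x) = (z y, (bw \<circ> si) y, cw y)" "x \<noteq> y"
   have h3: "z x = z y" "bw (si x) = bw (si y)" using h(3) by simp_all
   have t: "transpose x y \<in> St X (\<lambda>x. (z x, (bw \<circ> si) x))"
    by (rule St_transpose[OF h(1,2)]) (simp only: h3 comp_def)
   have "wact (transpose x y) (z, bw \<circ> si) = (z, bw \<circ> si)"
    using St_comp_eq(2)[OF t] unfolding wact_simp by (simp only: fun_eq_iff comp_def prod.inject) simp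
   hence "b (basis_vec (z, bw \<circ> si)) = 0"
    unfolding b_def by (intro w.symm_basis_kill[OF h(1,2,4)]) (use h(3) in \<open>simp only: prod.inject\<close>)
   thus False using False by simp
  qed
  have "ct2 X z (bw \<circ> si) = ct2 X z bw"
   by (rule ct2_reindex[OF St_permutes[OF s]]) (rule St_fix[OF s])
  hence "ct2 X z rw \<le> ct2 X z (bw \<circ> si)" using ct by simp
  from column_permutation(2)[OF _ tP inj' this] obtain pe where
   p: "pe \<in> St X (pairf z cw)" "\<And>x. x \<in> X ==> (bw \<circ> si) x = rw (pe x)" by auto
  have pz: "pe \<in> St X z" using p(1) w.St_refine by blast
  have eq: "bw \<circ> si = rw \<circ> pe"
  proof
   fix x show "(bw \<circ> si) x = (rw \<circ> pe) x"
    using p(2)[of x] P Q permutes_not_in[OF St_permutes[OF s], of x] permutes_not_in[OF St_permutes[OF pz], of x]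
    by (cases "x < n") (auto simp: Tab_def)
  qed
  have "basis_vec (z, bw \<circ> si) = w.L (inv pe) (basis_vec (z, rw))"
   by (simp add: w.L_basis permutes_inv[OF St_permutes[OF pz]] permutes_inv_inv[OF St_permutes[OF pz]] eq St_comp_eq[OF pz])
  hence "b (basis_vec (z, bw \<circ> si)) = fscale (eps True (inv pe)) (evec z rw cw)"
   unfolding b_def evec_def using w.symm_L[OF St_inv[OF p(1)]] by simp
  moreover have "cnt z bw = cnt z rw"
   using cnt_comp[OF s, of bw] cnt_comp[OF pz, of rw] by (simp add: eq)
  ultimately show ?thesis by blast
 qed
 have exp: "b (a (evec z bw \<eta>)) = (\<Sum>h\<in>St X (pairf z rw). \<Sum>pe\<in>St X (\<lambda>x. (z x, \<eta> x)).
   fscale (eps True pe) (b (basis_vec (z, bw \<circ> inv (h \<circ> pe)))))"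
 proof -
  have "a (evec z bw \<eta>) = (\<Sum>h\<in>St X (pairf z rw). \<Sum>pe\<in>St X (\<lambda>x. (z x, \<eta> x)).
    fscale (eps True pe) (basis_vec (z, bw \<circ> inv (h \<circ> pe))))"
   unfolding a_def evec_def w.symm_sum[symmetric] w.symm_def[of False] w.symm_def[of True] w.L_sum w.L_fscale
    cfun.scale_sum_right
  proof (intro sum.cong refl)
   fix h pe assume h: "h \<in> St X (pairf z rw)" and p: "pe \<in> St X (\<lambda>x. (z x, \<eta> x))"
   have hz: "h \<in> St X z" "pe \<in> St X z" using h p w.St_refine by blast+
   note hp = hz[THEN St_permutes]
   have "w.L h (w.L pe (basis_vec (z, bw))) = basis_vec (z, bw \<circ> inv (h \<circ> pe))"
    by (simp add: w.L_comp[OF hp, symmetric] w.L_basis[OF permutes_compose[OF hp(2,1)]] St_comp_eq[OF St_comp[OF hz]])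
   thus "fscale (eps False h) (fscale (eps True pe) (w.L h (w.L pe (basis_vec (z, bw))))) =
     fscale (eps True pe) (basis_vec (z, bw \<circ> inv (h \<circ> pe)))"
    by (simp add: eps_def)
  qed
  thus ?thesis unfolding b_def by (simp only: w.symm_sum w.symm_fscale)
 qed
 have inS: "inv (h \<circ> pe) \<in> St X z" if "h \<in> St X (pairf z rw)" "pe \<in> St X (\<lambda>x. (z x, \<eta> x))" for h pe
  using that w.St_refine by (intro St_inv St_comp) blast+
 let ?D = "{fscale c (evec z rw cw) |c. c = 0 \<or> cnt z bw = cnt z rw}"
 have "b (a (evec z bw \<eta>)) \<in> ?D"
  unfolding exp
 proof (intro subspace_sum cfun.subspace_scale[OF subspace_multiples] subspace_multiples)
  fix h pe assume "h \<in> St X (pairf z rw)" "pe \<in> St X (\<lambda>x. (z x, \<eta> x))"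
  from one[OF inS[OF this]] show "b (basis_vec (z, bw \<circ> inv (h \<circ> pe))) \<in> ?D" by blast
 qed
 thus ?thesis by blast
qed

lemma doubled_cong: "cnt z bw = cnt z rw ==> doubled z bw \<longleftrightarrow> doubled z rw"
 by (simp add: doubled_def)

text \<open>Linear extension of \<open>ba_evec\<close>. The condition on the scalar persists because
  all generators of \<open>Bsp\<close> have doubled shape.\<close>

lemma ba_Bsp:
 assumes P: "Tab z rw cw" and x: "x \<in> Bsp"
 shows "\<exists>c. w.symm True (pairf z cw) (w.symm False (pairf z rw) (proj z x)) = fscale c (evec z rw cw) \<and>
  (c = 0 \<or> doubled z rw)"
 using x unfolding Bsp_def
proof (induction rule: cfun.span_induct_alt)
 case base
 thus ?case by (intro exI[of _ 0]) (simp only: proj_zero w.symm_zero cfun.scale_zero_left simp_thms)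
next
 case (step c x y)
 then obtain z' bw \<eta> where x: "x = evec z' bw \<eta>" "Tab z' bw \<eta>" "doubled z' bw" by blast
 have "\<exists>c. w.symm True (pairf z cw) (w.symm False (pairf z rw) (proj z x)) = fscale c (evec z rw cw) \<and>
  (c = 0 \<or> doubled z rw)"
 proof (cases "z' = z")
  case True
  from ba_evec[OF P x(2)[unfolded True]] obtain d where
   d: "w.symm True (pairf z cw) (w.symm False (pairf z rw) (evec z bw \<eta>)) = fscale d (evec z rw cw)"
    "d = 0 \<or> cnt z bw = cnt z rw" by blast
  have "d = 0 \<or> doubled z rw" using d(2) x(3) doubled_cong[of z bw rw] True by blast
  moreover have "proj z x = evec z bw \<eta>" by (subst x(1), subst proj_evec) (simp add: True)
  ultimately show ?thesis using d(1) by (intro exI[of _ d]) (simp only: simp_thms)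
 next
  case False
  hence "proj z x = 0" by (subst x(1), subst proj_evec) (simp add: not_sym)
  thus ?thesis by (intro exI[of _ 0]) (simp only: w.symm_zero cfun.scale_zero_left simp_thms)
 qed
 then obtain d where d: "w.symm True (pairf z cw) (w.symm False (pairf z rw) (proj z x)) = fscale d (evec z rw cw)"
  "d = 0 \<or> doubled z rw" by blast
 from step(2) obtain d' where d': "w.symm True (pairf z cw) (w.symm False (pairf z rw) (proj z y)) = fscale d' (evec z rw cw)"
  "d' = 0 \<or> doubled z rw" by blast
 have e: "w.symm True (pairf z cw) (w.symm False (pairf z rw) (proj z (fscale c x + y))) =
   fscale (c * d + d') (evec z rw cw)"
  by (simp only: proj_add proj_fscale w.symm_add w.symm_fscale d d' cfun.scale_scale cfun.scale_left_distrib)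
 have "c * d + d' = 0 \<or> doubled z rw" using d(2) d'(2) by auto
 thus ?case by (intro exI[of _ "c * d + d'"] conjI e)
qed

end

text \<open>The tableau conditions never relate cells of different colours, so they pass to a union
  of colour classes. It is applied to the colours below \<open>s\<close> and to those from
  \<open>s\<close> on.\<close>

lemma tab_restrict:
 assumes t: "tab Y z rw cw" and A: "A \<subseteq> Y" "\<And>x y. x \<in> A ==> y \<in> Y ==> z y = z x ==> y \<in> A"
 shows "tab A z rw cw"
 unfolding tab_def
proof (intro conjI ballI allI impI)
 show "inj3 A z rw cw" using t A(1) unfolding tab_def by (blast intro: inj_on_subset)
 fix y j assume y: "y \<in> A"
 { assume "j < cw y"
  then obtain x where "x \<in> Y" "z x = z y" "rw x = rw y" "cw x = j" using t y A(1) unfolding tab_def by blast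
  thus "\<exists>x\<in>A. z x = z y \<and> rw x = rw y \<and> cw x = j" using A(2)[OF y] by blast }
 { assume "j < rw y"
  then obtain x where "x \<in> Y" "z x = z y" "cw x = cw y" "rw x = j" using t y A(1) unfolding tab_def by blast
  thus "\<exists>x\<in>A. z x = z y \<and> cw x = cw y \<and> rw x = j" using A(2)[OF y] by blast }
qed

lemma ct2_bij:
 assumes b: "bij_betw f A A'" and z: "\<And>x y. x \<in> A ==> y \<in> A ==> z (f x) = z (f y) \<longleftrightarrow> z x = z y"
 shows "ct2 A z (rw \<circ> f) = ct2 A' z rw"
proof -
 have 1: "(\<Sum>x\<in>A'. F x) = (\<Sum>x\<in>A. F (f x))" for F :: "nat => int"
  by (rule sum.reindex_bij_betw[OF b, symmetric])
 have inj: "inj_on f A" using b by (rule bij_betw_imp_inj_on)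
 have "pr2 A z (rw \<circ> f) = pr2 A' z rw"
  unfolding pr2_def 1 comp_def
  by (rule sum.cong[OF refl], rule sum.cong[OF refl]) (simp add: z inj_on_eq_iff[OF inj])
 thus ?thesis by (simp add: ct2_def 1)
qed

section \<open>Young symmetrizers applied to matchings\<close>

context gel
begin

text \<open>The third component separates the points of \<open>A\<close>, so that the stabilizer fixes them.\<close>

definition hrow :: "nat set => (nat => nat) => (nat => nat) => nat => nat \<times> nat \<times> nat" where
 "hrow A z rw x = (z x, rw x, if x \<in> A then Suc x else 0)"

lemma St_hrow: "St X (hrow A z rw) \<subseteq> St X (pairf z rw)"
 by (rule St_mono) (simp add: hrow_def)

lemma St_hrow_fix: assumes "pe \<in> St X (hrow A z rw)" "x \<in> A" "x \<in> X" shows "pe x = x"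
 using St_fix[OF assms(1,3)] assms(2) by (simp add: hrow_def split: if_splits)

text \<open>The group behind \<open>hrow\<close> moves only points outside \<open>A\<close>, hence
  it commutes with the permutations supported in \<open>A\<close>.\<close>

lemma hrow_commute:
 assumes s: "si permutes A" and A: "A \<subseteq> X"
 shows "m.L si (m.symm t (hrow A z rw) u) = m.symm t (hrow A z rw) (m.L si u)"
proof -
 have sX: "si permutes X" by (rule permutes_subset[OF s A])
 have i: "inv si permutes A" by (rule permutes_inv[OF s])
 have "St X (hrow A z rw \<circ> inv si) = St X (hrow A z rw)"
 proof (rule St_cong)
  fix x y assume "x \<in> X" "y \<in> X"
  have q: "(inv si x \<in> A) = (x \<in> A)" for x by (rule permutes_in_image[OF i])
  have e: "(inv si x = inv si y) = (x = y)" for x y by (rule inj_eq[OF permutes_inj[OF i]])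
  show "(hrow A z rw \<circ> inv si) x = (hrow A z rw \<circ> inv si) y \<longleftrightarrow> hrow A z rw x = hrow A z rw y"
  proof (cases "x \<in> A \<or> y \<in> A")
   case True
   have "hrow A z rw x = hrow A z rw y \<longleftrightarrow> x = y" using True by (auto simp: hrow_def)
   moreover have "hrow A z rw (inv si x) = hrow A z rw (inv si y) \<longleftrightarrow> inv si x = inv si y"
    using True q[of x] q[of y] by (auto simp: hrow_def)
   ultimately show ?thesis by (simp add: e)
  next
   case False
   thus ?thesis using permutes_not_in[OF i, of x] permutes_not_in[OF i, of y] by simp
  qed
 qed
 thus ?thesis unfolding m.L_conj[OF sX] by (simp only: m.symm_def)
qed

text \<open>The full row sum is invariant under the subgroup fixing \<open>A\<close> pointwise and
  may be averaged over it once more. Each term is then the half symmetrizer of a single matching and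
  can be analysed on its own.\<close>

lemma row_via_half:
 "m.symm False (pairf z rw) (basis_vec (z, f)) =
  (\<Sum>h\<in>St X (pairf z rw). fscale (1 / of_nat (card (St X (hrow A z rw))))
   (m.symm False (hrow A z rw) (basis_vec (z, h \<circ> f \<circ> inv h))))"
proof -
 let ?a = "m.symm False (pairf z rw) (basis_vec (z, f))" and ?c = "of_nat (card (St X (hrow A z rw))) :: complex"
 have nz: "?c \<noteq> 0" by (rule m.card_St_nz)
 have "m.symm False (hrow A z rw) ?a = fscale ?c ?a"
  by (rule m.symm_of_invariant) (rule m.L_symm, use St_hrow in blast)
 hence "?a = fscale (1 / ?c) (m.symm False (hrow A z rw) ?a)" using nz by (simp add: cfun.scale_scale)
 also have "m.symm False (hrow A z rw) ?a = (\<Sum>h\<in>St X (pairf z rw). m.symm False (hrow A z rw) (basis_vec (z, h \<circ> f \<circ> inv h)))"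
  unfolding m.symm_def[of False "\<lambda>x. (z x, rw x)"] m.symm_sum
 proof (rule sum.cong[OF refl])
  fix h assume h: "h \<in> St X (pairf z rw)"
  have hz: "h \<in> St X z" using h m.St_refine by blast
  have "fscale (eps False h) (m.L h (basis_vec (z, f))) = basis_vec (z, h \<circ> f \<circ> inv h)"
   by (simp add: eps_def m.L_basis[OF St_permutes[OF hz]] St_comp_eq[OF hz])
  thus "m.symm False (hrow A z rw) (fscale (eps False h) (m.L h (basis_vec (z, f)))) =
    m.symm False (hrow A z rw) (basis_vec (z, h \<circ> f \<circ> inv h))" by simp
 qed
 finally show ?thesis by (simp only: cfun.scale_sum_right)
qed

lemma W_conj: assumes "(z, f) \<in> W" "h \<in> St X z" shows "(z, h \<circ> f \<circ> inv h) \<in> W"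
 using W_mact[OF assms(1) St_permutes[OF assms(2)]] by (simp add: St_comp_eq[OF assms(2)])

text \<open>Conjugating \<open>f\<close> by the transposition of two points of \<open>A\<close> has
  the same effect as conjugating by the transposition of their partners, which lie outside
  \<open>A\<close>. If the partners share a row, the latter is absorbed by the half symmetrizer; if
  the two points share a column, the former yields a sign. Both together force zero.\<close>

lemma half_inj:
 assumes w: "(z, f) \<in> W" and A: "A = {x\<in>X. z x < s} \<or> A = {x\<in>X. \<not> z x < s}"
  and nz: "m.symm True (pairf z cw) (m.symm False (hrow A z rw) (basis_vec (z, f))) \<noteq> 0"
 shows "inj3 A z (rw \<circ> f) cw"
proof (rule inj_onI, rule ccontr)
 fix x y assume h: "x \<in> A" "y \<in> A" "(z x, (rw \<circ> f) x, cw x) = (z y, (rw \<circ> f) y, cw y)" "x \<noteq> y"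
 have AX: "A \<subseteq> X" using A by auto
 have h3: "z x = z y" "rw (f x) = rw (f y)" "cw x = cw y" using h(3) by simp_all
 have xy: "x < n" "y < n" using h AX by auto
 have fX: "f x \<in> X" "f y \<in> X" using W_D(2)[OF w] xy by auto
 have fA: "f x \<notin> A" "f y \<notin> A" using A h(1,2) W_half[OF w xy(1)] W_half[OF w xy(2)] by auto
 let ?t = "transpose x y" and ?t' = "transpose (f x) (f y)"
 have zf: "z (f x) = z (f y)" using W_D(4)[OF w] xy h3(1) by simp
 have t': "?t' \<in> St X (hrow A z rw)" using fA h3 zf by (intro St_transpose[OF fX]) (simp add: hrow_def)
 have tz: "?t \<in> St X z" "?t' \<in> St X z" using h3 zf fX xy by (auto intro: St_transpose)
 have tA: "?t permutes A" using h(1,2) by (rule permutes_swap_id)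
 have tC: "?t \<in> St X (pairf z cw)" using h3 xy by (intro St_transpose) auto
 note tp = tz[THEN St_permutes]
 have ft: "f \<circ> ?t = ?t' \<circ> f"
 proof
  fix u show "(f \<circ> ?t) u = (?t' \<circ> f) u"
   by (cases "u = x"; cases "u = y") (simp_all add: inj_eq[OF permutes_inj[OF W_permutes[OF w]]] transpose_def)
 qed
 hence tf: "?t \<circ> f = f \<circ> ?t'"
 proof -
  have ff: "f \<circ> f = id" using W_D(3)[OF w] by (auto simp: fun_eq_iff)
  have "(f \<circ> f) \<circ> ?t \<circ> f = f \<circ> ?t' \<circ> (f \<circ> f)" using ft by (metis comp_assoc)
  thus ?thesis unfolding ff by simp
 qed
 have ii: "inv ?t = ?t" "inv ?t' = ?t'" by simp_all
 have "m.L ?t (basis_vec (z, f)) = m.L ?t' (basis_vec (z, f))"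
 proof -
  have comm: "?t \<circ> ?t' = ?t' \<circ> ?t"
   using h(1,2) fA by (intro swap_id_independent) auto
  have "?t \<circ> f \<circ> ?t = ?t \<circ> (f \<circ> ?t)" by (rule comp_assoc)
  also have "... = ?t \<circ> ?t' \<circ> f" unfolding ft comp_assoc ..
  also have "... = ?t' \<circ> (?t \<circ> f)" unfolding comm comp_assoc ..
  also have "... = ?t' \<circ> f \<circ> ?t'" unfolding tf comp_assoc ..
  finally have "?t \<circ> f \<circ> ?t = ?t' \<circ> f \<circ> ?t'" .
  thus ?thesis
   by (simp add: m.L_basis[OF tp(1)] m.L_basis[OF tp(2)] St_comp_eq[OF tz(1)] St_comp_eq[OF tz(2)] ii del: transpose_comp_eq)
 qed
 define u where "u = m.symm False (hrow A z rw) (basis_vec (z, f))"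
 have "m.L ?t u = m.symm False (hrow A z rw) (m.L ?t' (basis_vec (z, f)))"
  unfolding u_def hrow_commute[OF tA AX] \<open>m.L ?t (basis_vec (z, f)) = _\<close> ..
 also have "... = u" unfolding m.symm_L[OF t'] u_def by (simp add: eps_def)
 finally have tu: "m.L ?t u = u" .
 have "fscale (eps True ?t) (m.symm True (pairf z cw) u) = m.symm True (pairf z cw) u"
  using m.symm_L[OF tC, of True u] tu by simp
 hence "m.symm True (pairf z cw) u = 0"
  using h(4) by (auto simp: eps_transpose fun_eq_iff)
 thus False using nz by (simp add: u_def)
qed

text \<open>The subgroup fixing the lower half pointwise acts simply transitively on the compatible
  matchings: \<open>g\<close> is reached from \<open>f\<close> by the unique \<open>h\<close> that
  is the identity on \<open>A\<close> and \<open>g \<circ> f\<close> on the other half. The orbit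
  sum is therefore the image of the word under \<open>Psi\<close>, without a multiplicity.\<close>

lemma half_symm_compat:
 assumes w: "(z, f) \<in> compat z rw" and A: "A = {x\<in>X. z x < s}" and rho: "rw \<in> Rw"
 shows "m.symm False (hrow A z rw) (basis_vec (z, f)) = Psi (basis_vec (z, rw))"
proof -
 have wW: "(z, f) \<in> W" and rf: "\<And>x. rw (f x) = rw x" using w by (auto simp: compat_def fun_eq_iff)
 have toA: "f x \<in> A" if "x \<in> X" "x \<notin> A" for x
  using that W_half[OF wW, of x] W_D(2)[OF wW, of x] by (auto simp: A)
 have fromA: "f x \<in> X - A" if "x \<in> A" for x
  using that W_half[OF wW, of x] W_D(2)[OF wW, of x] by (auto simp: A)
 have AX: "A \<subseteq> X" by (auto simp: A)
 have "m.symm False (hrow A z rw) (basis_vec (z, f)) = (\<Sum>h\<in>St X (hrow A z rw). basis_vec (z, h \<circ> f \<circ> inv h))"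
  unfolding m.symm_def
 proof (rule sum.cong[OF refl])
  fix h assume "h \<in> St X (hrow A z rw)"
  hence hz: "h \<in> St X z" using St_hrow m.St_refine by blast
  show "fscale (eps False h) (m.L h (basis_vec (z, f))) = basis_vec (z, h \<circ> f \<circ> inv h)"
   by (simp add: eps_def m.L_basis[OF St_permutes[OF hz]] St_comp_eq[OF hz])
 qed
 also have "... = (\<Sum>w\<in>compat z rw. basis_vec w)"
 proof (rule sum.reindex_bij_witness[of _ "\<lambda>(z', g) x. if x \<in> X - A then g (f x) else x" "\<lambda>h. (z, h \<circ> f \<circ> inv h)"])
  fix h assume h: "h \<in> St X (hrow A z rw)"
  have hr: "h \<in> St X (pairf z rw)" using h St_hrow by blast
  hence hz: "h \<in> St X z" using m.St_refine by blast
  note p = St_permutes[OF h]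
  have fx: "h x = x" if "x \<in> A" for x using St_hrow_fix[OF h that] that AX by blast
  have hi: "inv h x = x" if "x \<in> A" for x using fx[OF that] permutes_inverses(2)[OF p, of x] by simp
  show "(case (z, h \<circ> f \<circ> inv h) of (z', g) => \<lambda>x. if x \<in> X - A then g (f x) else x) = h"
  proof
   fix x
   have "h (f (inv h (f x))) = h x" if "x \<in> X - A"
    using that hi[OF toA] W_D(3)[OF wW] by simp
   thus "(case (z, h \<circ> f \<circ> inv h) of (z', g) => \<lambda>x. if x \<in> X - A then g (f x) else x) x = h x"
    using fx[of x] permutes_not_in[OF p, of x] by auto
  qed
  have "rw (h x) = rw x" for x
   using St_fix[OF hr, of x] permutes_not_in[OF p, of x] by (cases "x \<in> X") auto
  moreover have "rw (inv h x) = rw x" for x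
   using St_fix[OF St_inv[OF hr], of x] permutes_not_in[OF permutes_inv[OF p], of x] by (cases "x \<in> X") auto
  ultimately show "(z, h \<circ> f \<circ> inv h) \<in> compat z rw"
   using W_conj[OF wW hz] by (auto simp: compat_def rf fun_eq_iff)
 next
  fix w assume w: "w \<in> compat z rw"
  then obtain g where g0: "w = (z, g)" "(z, g) \<in> W" "rw \<circ> g = rw" unfolding compat_def by auto
  note g = g0(1,2) fun_cong[OF g0(3), unfolded comp_apply]
  define h where "h x = (if x \<in> X - A then g (f x) else x)" for x
  have gA: "g x \<in> X - A" if "x \<in> A" for x
   using that W_half[OF g(2), of x] W_D(2)[OF g(2), of x] by (auto simp: A)
  have gB: "g x \<in> A" if "x \<in> X - A" for x
   using that W_half[OF g(2), of x] W_D(2)[OF g(2), of x] by (auto simp: A)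
  have hX: "h x \<in> X \<and> (h x \<in> A \<longleftrightarrow> x \<in> A)" if "x \<in> X" for x
   using that toA[of x] gA[of "f x"] by (auto simp: h_def)
  have injh: "inj_on h X"
  proof (rule inj_onI)
   fix x y assume xy: "x \<in> X" "y \<in> X" "h x = h y"
   hence "x \<in> A \<longleftrightarrow> y \<in> A" using hX by metis
   thus "x = y" using xy(3) xy(1,2) inj_eq[OF permutes_inj[OF W_permutes[OF g(2)]]] inj_eq[OF permutes_inj[OF W_permutes[OF wW]]]
    by (simp add: h_def split: if_splits)
  qed
  have hp: "h permutes X" using hX injh by (intro inj_imp_permutes) (auto simp: h_def)
  have "hrow A z rw (h x) = hrow A z rw x" if x: "x \<in> X" for x
  proof (cases "x \<in> A")
   case False
   have "z (g (f x)) = ((z x + s) mod r + s) mod r" using W_D(2,4)[OF g(2)] W_D(2,4)[OF wW] x by simp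
   hence "z (h x) = z x" using add_s_mod_invol W_D(1)[OF wW] x False by (simp add: h_def)
   moreover have "rw (h x) = rw x" using False x by (simp add: h_def g(3) rf)
   moreover have "h x \<notin> A" using hX[OF x] False by simp
   ultimately show ?thesis using False by (simp add: hrow_def)
  qed (simp add: h_def)
  hence hS: "h \<in> St X (hrow A z rw)" using hp by (auto simp: St_def)
  have hf: "h \<circ> f = g \<circ> h"
  proof
   fix x
   consider "x \<in> A" | "x \<in> X - A" | "x \<notin> X" by blast
   thus "(h \<circ> f) x = (g \<circ> h) x"
   proof cases
    case 1 thus ?thesis using fromA[OF 1] W_D(3)[OF wW] by (simp add: h_def)
   next
    case 2 thus ?thesis using toA[of x] W_D(3)[OF g(2)] by (simp add: h_def)
   next
    case 3
    hence "f x = x" "g x = x" using W_D(6)[OF wW, of x] W_D(6)[OF g(2), of x] by auto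
    thus ?thesis using 3 by (simp add: h_def)
   qed
  qed
  have hfi: "h \<circ> f \<circ> inv h = g"
   unfolding hf by (simp add: fun_eq_iff permutes_inverses[OF hp])
  have e: "(case (z, g) of (z', g) => \<lambda>x. if x \<in> X - A then g (f x) else x) = h" by (simp add: h_def fun_eq_iff)
  show "(case w of (z', g) => \<lambda>x. if x \<in> X - A then g (f x) else x) \<in> St X (hrow A z rw)" unfolding g(1) e by (rule hS)
  show "(z, (case w of (z', g) => \<lambda>x. if x \<in> X - A then g (f x) else x) \<circ> f \<circ> inv (case w of (z', g) => \<lambda>x. if x \<in> X - A then g (f x) else x)) = w"
   unfolding g(1) e hfi ..
 qed simp
 finally show ?thesis by (simp only: Psi_basis[OF rho])
qed

text \<open>A compatible \<open>f\<close> is a row-preserving bijection between the letters of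
  colour \<open>c\<close> and those of colour \<open>c + s\<close>.\<close>

lemma compat_doubled:
 assumes "(z, f) \<in> compat z rw" shows "doubled z rw"
 unfolding doubled_def
proof (intro allI impI ext)
 fix c i assume c: "c < s"
 have w: "(z, f) \<in> W" and rf: "\<And>x. rw (f x) = rw x" using assms by (auto simp: compat_def fun_eq_iff)
 have "bij_betw f {x\<in>X. z x = c \<and> rw x = i} {x\<in>X. z x = c + s \<and> rw x = i}"
 proof (rule bij_betwI[where g=f])
  show "f \<in> {x\<in>X. z x = c \<and> rw x = i} \<rightarrow> {x\<in>X. z x = c + s \<and> rw x = i}"
   using W_D(2,4)[OF w] c by (auto simp: rf)
  show "f \<in> {x\<in>X. z x = c + s \<and> rw x = i} \<rightarrow> {x\<in>X. z x = c \<and> rw x = i}"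
   using W_D(2,4)[OF w] c by (auto simp: rf mod_if)
 qed (use W_D(3)[OF w] in auto)
 thus "cnt z rw c i = cnt z rw (c + s) i" by (auto simp: cnt_def dest: bij_betw_same_card)
qed

text \<open>The analogue of \<open>ba_evec\<close> for matchings. Transporting rows along the
  matching compares the contents of the two colour halves; a column permutation of the lower half
  then turns the matching into one compatible with \<open>rw\<close>, whose half symmetrizer is
  \<open>Psi\<close> of the word.\<close>

lemma ba_matching:
 assumes w: "(z, f) \<in> W" and P: "Tab z rw cw"
 defines "a \<equiv> m.symm False (pairf z rw)" and "b \<equiv> m.symm True (pairf z cw)"
 shows "b (a (basis_vec (z, f))) \<in> {fscale c (Psi (evec z rw cw)) |c. c = 0 \<or> doubled z rw}"
proof (cases "b (a (basis_vec (z, f))) = 0")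
 case True
 show ?thesis unfolding True by (rule cfun.subspace_0[OF subspace_multiples])
next
 case nz: False
 define A1 A2 where "A1 = {x\<in>X. z x < s}" and "A2 = {x\<in>X. \<not> z x < s}"
 have AX: "A1 \<subseteq> X" "A2 \<subseteq> X" and finA: "finite A1" "finite A2" by (auto simp: A1_def A2_def)
 have tP: "tab X z rw cw" using P by (simp add: Tab_def)
 have t1: "tab A1 z rw cw" by (rule tab_restrict[OF tP]) (auto simp: A1_def)
 have t2: "tab A2 z rw cw" by (rule tab_restrict[OF tP]) (auto simp: A2_def)
 have bijf: "bij_betw g A1 A2" "bij_betw g A2 A1" if g: "(z, g) \<in> W" for g
 proof -
  have "g \<in> A1 \<rightarrow> A2" "g \<in> A2 \<rightarrow> A1" using W_half[OF g] W_D(2)[OF g] by (auto simp: A1_def A2_def)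
  thus "bij_betw g A1 A2" "bij_betw g A2 A1" using W_D(3)[OF g] by (auto intro!: bij_betwI[where g=g])
 qed
 have zeq: "z (g x) = z (g y) \<longleftrightarrow> z x = z y" if g: "(z, g) \<in> W" and "x < n" "y < n" for g x y
  using that(2,3) by (metis W_D(4)[OF g] W_D(1)[OF g] add_s_mod_invol)
 have expand: "b (a (basis_vec (z, f))) = (\<Sum>h\<in>St X (pairf z rw).
   fscale (1 / of_nat (card (St X (hrow A z rw)))) (b (m.symm False (hrow A z rw) (basis_vec (z, h \<circ> f \<circ> inv h)))))" for A
  unfolding a_def b_def row_via_half[of z rw f A] m.symm_sum m.symm_fscale ..
 have ex: "\<exists>h\<in>St X (pairf z rw). b (m.symm False (hrow A z rw) (basis_vec (z, h \<circ> f \<circ> inv h))) \<noteq> 0" for A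
 proof (rule ccontr)
  assume "\<not> ?thesis"
  hence "b (a (basis_vec (z, f))) = 0" unfolding expand[of A] by (intro sum.neutral) auto
  thus False using nz by simp
 qed
 \<comment> \<open>On \<open>A\<close> the rows seen through the matching are those of the other
   half. They meet the columns of \<open>A\<close> in distinct cells, so their content is at most
   that of the genuine rows of \<open>A\<close>.\<close>
 have ctle: "ct2 A' z rw \<le> ct2 A z rw" if AA: "A = A1 \<and> A' = A2 \<or> A = A2 \<and> A' = A1" for A A'
 proof -
  obtain h where h: "h \<in> St X (pairf z rw)" "b (m.symm False (hrow A z rw) (basis_vec (z, h \<circ> f \<circ> inv h))) \<noteq> 0"
   using ex by blast
  define g where "g = h \<circ> f \<circ> inv h"
  have g: "(z, g) \<in> W" unfolding g_def using h(1) m.St_refine by (intro W_conj[OF w]) blast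
  have "inj3 A z (rw \<circ> g) cw"
   using h(2) AA unfolding b_def g_def[symmetric] by (intro half_inj[OF g]) (auto simp: A1_def A2_def)
  hence "ct2 A z (rw \<circ> g) + ct2 A z cw \<le> 0" using AA finA by (intro inj3_ct2) auto
  moreover have "ct2 A z rw + ct2 A z cw = 0" using AA t1 t2 finA by (intro tab_ct2) auto
  moreover have "ct2 A z (rw \<circ> g) = ct2 A' z rw"
   using AA bijf[OF g] AX by (intro ct2_bij) (auto intro!: zeq[OF g])
  ultimately show ?thesis by simp
 qed
 \<comment> \<open>Information from the upper half: it supplies the inequality of contents under
   which \<open>column_permutation\<close> applies to the lower half.\<close>
 have ctle1: "ct2 A1 z rw \<le> ct2 A2 z rw" using ctle[of A2 A1] by simp
 have "b (m.symm False (hrow A1 z rw) (basis_vec (z, h \<circ> f \<circ> inv h))) \<in>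
   {fscale c (Psi (evec z rw cw)) |c. c = 0 \<or> doubled z rw}"
  if h: "h \<in> St X (pairf z rw)" for h
 proof (cases "b (m.symm False (hrow A1 z rw) (basis_vec (z, h \<circ> f \<circ> inv h))) = 0")
  case True
  show ?thesis unfolding True by (rule cfun.subspace_0[OF subspace_multiples])
 next
  case False
  define g where "g = h \<circ> f \<circ> inv h"
  have g: "(z, g) \<in> W" unfolding g_def using h m.St_refine by (intro W_conj[OF w]) blast
  have inj: "inj3 A1 z (rw \<circ> g) cw"
   using False unfolding b_def g_def[symmetric] by (intro half_inj[OF g]) (auto simp: A1_def)
  have "ct2 A1 z (rw \<circ> g) = ct2 A2 z rw"
   using bijf[OF g] AX by (intro ct2_bij) (auto intro!: zeq[OF g])
  hence "ct2 A1 z rw \<le> ct2 A1 z (rw \<circ> g)" using ctle1 by simp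
  from column_permutation(2)[OF finA(1) t1 inj this] obtain pe where
   p: "pe \<in> St A1 (pairf z cw)" "\<And>x. x \<in> A1 ==> rw (g x) = rw (pe x)" by auto
  note pA = St_permutes[OF p(1)]
  have pX: "pe permutes X" by (rule permutes_subset[OF pA AX(1)])
  have pS: "pe \<in> St X (pairf z cw)"
  proof (rule StI[OF pX])
   fix x show "(z (pe x), cw (pe x)) = (z x, cw x)"
    using St_fix[OF p(1), of x] permutes_not_in[OF pA, of x] by (cases "x \<in> A1") auto
  qed
  hence pz: "pe \<in> St X z" using m.St_refine by blast
  \<comment> \<open>Conjugation by \<open>pe\<close> moves points of \<open>A1\<close> only and puts
    each of them in the row of its partner; on \<open>A2\<close> the same follows because
    \<open>g'\<close> is an involution.\<close>
  define g' where "g' = pe \<circ> g \<circ> inv pe"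
  have g': "(z, g') \<in> W" unfolding g'_def by (rule W_conj[OF g pz])
  have r1: "rw (g' x) = rw x" if x: "x \<in> A1" for x
  proof -
   have i: "inv pe x \<in> A1" using x permutes_in_image[OF permutes_inv[OF pA]] by simp
   have "g (inv pe x) \<in> A2" using i bijf(1)[OF g] by (auto simp: bij_betw_def)
   hence "g (inv pe x) \<notin> A1" by (auto simp: A1_def A2_def)
   hence "g' x = g (inv pe x)" by (simp add: g'_def permutes_not_in[OF pA])
   thus ?thesis using p(2)[OF i] by (simp add: permutes_inverses[OF pA])
  qed
  have "rw (g' x) = rw x" for x
  proof -
   consider "x \<in> A1" | "x \<in> A2" | "x \<notin> X" by (auto simp: A1_def A2_def)
   thus ?thesis
   proof cases
    case 2
    hence "g' x \<in> A1" using bijf(2)[OF g'] by (auto simp: bij_betw_def)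
    from r1[OF this] show ?thesis using W_D(3)[OF g'] by simp
   next
    case 3
    thus ?thesis using W_D(6)[OF g', of x] by simp
   qed (rule r1)
  qed
  hence comp: "(z, g') \<in> compat z rw" using g' by (auto simp: compat_def fun_eq_iff)
  have pi: "inv pe permutes A1" by (rule permutes_inv[OF pA])
  have "inv pe \<circ> g' \<circ> pe = g" by (simp add: g'_def fun_eq_iff permutes_inverses[OF pA])
  hence "basis_vec (z, g) = m.L (inv pe) (basis_vec (z, g'))"
   by (simp add: m.L_basis[OF permutes_inv[OF pX]] permutes_inv_inv[OF pX] St_comp_eq[OF pz])
  hence "b (m.symm False (hrow A1 z rw) (basis_vec (z, g))) =
    b (m.L (inv pe) (m.symm False (hrow A1 z rw) (basis_vec (z, g'))))"
   by (simp only: hrow_commute[OF pi AX(1)])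
  also have "... = fscale (eps True (inv pe)) (b (Psi (basis_vec (z, rw))))"
   unfolding b_def m.symm_L[OF St_inv[OF pS]] half_symm_compat[OF comp A1_def Tab_Rw[OF P]] ..
  also have "b (Psi (basis_vec (z, rw))) = Psi (evec z rw cw)" unfolding b_def evec_def Psi_symm ..
  finally show ?thesis unfolding g_def using compat_doubled[OF comp] by blast
 qed
 thus ?thesis unfolding expand[of A1]
  by (intro subspace_sum cfun.subspace_scale[OF subspace_multiples] subspace_multiples)
qed

end

section \<open>Bijectivity of the map from words to matchings\<close>

lemma basis_expansion:
 assumes "finite D" "\<And>x. x \<notin> D ==> a x = 0"
 shows "a = (\<Sum>x\<in>D. fscale (a x) (basis_vec x))"
proof
 fix y
 have "(\<Sum>x\<in>D. fscale (a x) (basis_vec x)) y = (\<Sum>x\<in>D. if y = x then a x else 0)"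
  unfolding sum_fun_apply by (rule sum.cong[OF refl]) (simp add: basis_vec_def)
 thus "a y = (\<Sum>x\<in>D. fscale (a x) (basis_vec x)) y"
  using assms by (simp add: sum.delta')
qed

text \<open>A basis of \<open>V\<close> stays independent when \<open>v\<close> is added, so some
  linear functional vanishes on \<open>V\<close> but not at \<open>v\<close>; on functions supported
  in the finite set \<open>D\<close> it is given by its values on basis vectors.\<close>

lemma separating_functional:
 fixes V :: "('b => complex) set"
 assumes V: "cfun.subspace V" and v: "v \<notin> V" and fin: "finite D"
  and N: "\<And>a x. a \<in> insert v V ==> x \<notin> D ==> a x = 0"
 shows "\<exists>y. (\<forall>a\<in>V. (\<Sum>x\<in>D. y x * a x) = 0) \<and> (\<Sum>x\<in>D. y x * v x) \<noteq> 0"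
proof -
 interpret c: vector_space "(*) :: complex => complex => complex"
  by unfold_locales (auto simp: algebra_simps)
 interpret vp: vector_space_pair fscale "(*) :: complex => complex => complex" ..
 obtain B where B: "B \<subseteq> V" "cfun.independent B" "V \<subseteq> cfun.span B"
  using cfun.maximal_independent_subset by blast
 have "cfun.span B \<subseteq> V" using B(1) V by (simp add: cfun.span_minimal)
 hence "v \<notin> cfun.span B" using v by blast
 hence "cfun.independent (insert v B)" using B(2) by (rule cfun.independent_insertI)
 from vp.linear_independent_extend[OF this, of "\<lambda>x. if x = v then 1 else 0"] obtain g where
  g: "Vector_Spaces.linear fscale (*) g" "\<And>x. x \<in> insert v B ==> g x = (if x = v then 1 else 0)" by blast
 have gB: "g x = 0" if "x \<in> B" for x using g(2)[of x] that B(1) v by auto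
 have gV: "g a = 0" if "a \<in> V" for a
  by (rule vp.linear_eq_0_on_span[OF g(1) gB subsetD[OF B(3) that]])
 have ga: "g a = (\<Sum>x\<in>D. g (basis_vec x) * a x)" if "a \<in> insert v V" for a
 proof -
  have "a = (\<Sum>x\<in>D. fscale (a x) (basis_vec x))"
   by (rule basis_expansion[OF fin N[OF that]])
  hence "g a = g (\<Sum>x\<in>D. fscale (a x) (basis_vec x))" by simp
  also have "... = (\<Sum>x\<in>D. a x * g (basis_vec x))"
   by (simp only: vp.linear_sum[OF g(1)] vp.linear_scale[OF g(1)])
  finally show ?thesis by (simp add: mult.commute)
 qed
 have "(\<Sum>x\<in>D. g (basis_vec x) * a x) = 0" if "a \<in> V" for a
  using ga[of a] gV[OF that] that by simp
 moreover have "(\<Sum>x\<in>D. g (basis_vec x) * v x) \<noteq> 0"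
  using ga[of v] g(2)[of v] by simp
 ultimately show ?thesis by (intro exI[of _ "\<lambda>x. g (basis_vec x)"]) blast
qed

context gel
begin

text \<open>\<open>f\<close> exchanges the two colour halves, so \<open>pe\<close> is the product of
  its part \<open>si\<close> on the lower half and the conjugate of \<open>si\<close> by
  \<open>f\<close> on the upper half. Both factors have the same sign.\<close>

lemma sign_commuting:
 assumes w: "(z, f) \<in> W" and p: "pe \<in> St X z" and c: "\<And>x. pe (f x) = f (pe x)"
 shows "sign pe = 1"
proof -
 note pp = St_permutes[OF p] and fp = W_permutes[OF w]
 define A where "A = {x\<in>X. z x < s}"
 define si where "si x = (if x \<in> A then pe x else x)" for x
 have pA: "pe x \<in> A \<longleftrightarrow> x \<in> A" for x
  using St_fix[OF p, of x] permutes_in_image[OF pp, of x] by (auto simp: A_def)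
 have sp: "si permutes X"
 proof (rule inj_imp_permutes)
  show "inj_on si X" by (rule inj_onI) (auto simp: si_def pA inj_eq[OF permutes_inj[OF pp]] split: if_splits)
  show "si x \<in> X" if "x \<in> X" for x
   by (cases "x \<in> A") (use that permutes_in_image[OF pp, of x] in \<open>simp_all only: si_def if_True if_False\<close>)
 qed (auto simp: si_def A_def)
 have "pe = si \<circ> (f \<circ> si \<circ> f)"
 proof
  fix x
  consider "x \<in> A" | "x \<in> X - A" | "x \<notin> X" by blast
  thus "pe x = (si \<circ> (f \<circ> si \<circ> f)) x"
  proof cases
   case 1
   hence "f x \<notin> A" using W_half[OF w, of x] by (auto simp: A_def)
   thus ?thesis using 1 W_D(3)[OF w] by (simp add: si_def)
  next
   case 2
   hence "f x \<in> A" using W_half[OF w, of x] W_D(2)[OF w, of x] by (auto simp: A_def)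
   hence "f (si (f x)) = pe x" using c[of "f x"] W_D(3)[OF w] by (simp add: si_def)
   thus ?thesis using 2 pA[of x] by (simp add: si_def)
  next
   case 3
   hence "f x = x" "pe x = x" "x \<notin> A" using permutes_not_in[OF fp] permutes_not_in[OF pp] by (auto simp: A_def)
   thus ?thesis by (simp add: si_def)
  qed
 qed
 moreover have "permutation si" "permutation f"
  using sp fp by (auto intro: permutes_imp_permutation[of X])
 moreover have "f \<circ> f = id" using W_D(3)[OF w] by (auto simp: fun_eq_iff)
 ultimately have "sign pe = sign si * (sign f * sign si * sign f)"
  by (simp add: sign_compose permutation_compose)
 thus ?thesis by (simp add: mult_ac)
qed

text \<open>Colours \<open>c\<close> and \<open>c + s\<close> carry diagrams of the same shape, so a
  cell can be matched with the cell in the same row and column of the other colour.\<close>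

lemma matching_of_tableau:
 assumes P: "Tab z rw cw" and D: "doubled z rw"
 shows "\<exists>f. (z, f) \<in> W \<and> (\<forall>x\<in>X. rw (f x) = rw x \<and> cw (f x) = cw x)"
proof -
 have t: "tab X z rw cw" and zr: "\<And>x. x < n ==> z x < r" and z0: "\<And>x. n \<le> x ==> z x = 0" using P by (auto simp: Tab_def)
 have cs: "cnt z rw ((c + s) mod r) i = cnt z rw c i" if "c < r" for c i
 proof (cases "c < s")
  case True
  hence "cnt z rw c = cnt z rw (c + s)" using D by (simp only: doubled_def)
  thus ?thesis using True that by (simp add: add_s_mod)
 next
  case False
  hence "c - s < s" using that by simp
  hence "cnt z rw (c - s) = cnt z rw (c - s + s)" using D by (simp only: doubled_def)
  thus ?thesis using False that by (simp add: add_s_mod)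
 qed
 have rows: "cw ` {y\<in>X. z y = c \<and> rw y = i} = {..<cnt z rw c i}" for c i
  unfolding cnt_def
 proof (rule down_closed_image)
  show "inj_on cw {y\<in>X. z y = c \<and> rw y = i}"
   by (rule inj_onI) (use t in \<open>auto simp: tab_def dest: inj3D\<close>)
  fix y j assume "y \<in> {y\<in>X. z y = c \<and> rw y = i}" "j < cw y"
  moreover have "\<forall>y\<in>X. \<forall>j<cw y. \<exists>x\<in>X. z x = z y \<and> rw x = rw y \<and> cw x = j" using t unfolding tab_def by blast
  ultimately show "j \<in> cw ` {y\<in>X. z y = c \<and> rw y = i}" by fastforce
 qed simp
 let ?p = "\<lambda>x. ((z x + s) mod r, rw x, cw x)" and ?q = "\<lambda>x. (z x, rw x, cw x)"
 have inj: "inj_on ?p X"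
 proof (rule inj_onI)
  fix x y assume h: "x \<in> X" "y \<in> X" "?p x = ?p y"
  hence "z x = z y" using add_s_mod_invol[OF zr] by (metis lessThan_iff prod.inject)
  thus "x = y" using h t unfolding tab_def by (auto dest: inj3D)
 qed
 have im: "?p ` X \<subseteq> ?q ` X"
 proof (rule image_subsetI)
  fix x assume x: "x \<in> X"
  have "cw x \<in> cw ` {y\<in>X. z y = z x \<and> rw y = rw x}" using x by blast
  also have "... = cw ` {y\<in>X. z y = (z x + s) mod r \<and> rw y = rw x}"
   unfolding rows using cs[OF zr] x by simp
  finally obtain y where "y \<in> X" "z y = (z x + s) mod r" "rw y = rw x" "cw x = cw y" by blast
  thus "?p x \<in> ?q ` X" by (intro image_eqI[of _ _ y]) auto
 qed
 obtain f where f: "f permutes X" and fx: "\<And>x. x \<in> X ==> ?p x = ?q (f x)"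
  using permutes_of_images[OF _ inj im] by auto
 have f1: "z (f x) = (z x + s) mod r" "rw (f x) = rw x" "cw (f x) = cw x" if "x \<in> X" for x
  using fx[OF that] by auto
 have fX: "f x \<in> X" if "x \<in> X" for x using that by (simp only: permutes_in_image[OF f])
 have ff: "f (f x) = x" if x: "x \<in> X" for x
 proof -
  have "z (f (f x)) = z x" using f1(1)[OF fX[OF x]] f1(1)[OF x] add_s_mod_invol zr x by simp
  moreover have "rw (f (f x)) = rw x" "cw (f (f x)) = cw x" using f1(2,3) fX x by auto
  ultimately show ?thesis using t fX x unfolding tab_def by (auto intro: inj3D)
 qed
 have "(z, f) \<in> W" unfolding W_def using zr z0 fX ff f1(1) permutes_not_in[OF f] by auto
 thus ?thesis using f1 by blast
qed

text \<open>Evaluate at the matching that preserves rows and columns. A column permutation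
  contributes only if it conjugates the matching to one that still preserves rows; it then commutes
  with \<open>f\<close> and is even. So all contributions are 1, and the identity is among
  them.\<close>

lemma Psi_evec_nz:
 assumes P: "Tab z rw cw" and D: "doubled z rw"
 shows "Psi (evec z rw cw) \<noteq> 0"
proof -
 obtain f where w: "(z, f) \<in> W" and rf: "\<And>x. x \<in> X ==> rw (f x) = rw x" and gf: "\<And>x. x \<in> X ==> cw (f x) = cw x"
  using matching_of_tableau[OF P D] by blast
 have t: "tab X z rw cw" using P by (simp add: Tab_def)
 let ?C = "St X (pairf z cw)"
 have fX: "f x \<in> X" if "x \<in> X" for x using that W_D(2)[OF w] by simp
 have finc: "finite (compat z rw)" by (rule finite_subset[OF _ finite_W]) (auto simp: compat_def)
 have ind: "Psi (basis_vec (z, rw)) o' = (if o' \<in> compat z rw then 1 else 0)" for o'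
  unfolding Psi_basis[OF Tab_Rw[OF P]] sum_fun_apply using finc by (simp add: basis_vec_def)
 have tm: "eps True pe * Psi (basis_vec (z, rw)) (mact (inv pe) (z, f)) = (if mact (inv pe) (z, f) \<in> compat z rw then 1 else 0)"
  if p: "pe \<in> ?C" for pe
 proof (cases "mact (inv pe) (z, f) \<in> compat z rw")
  case True
  have pz: "pe \<in> St X z" using p w.St_refine by blast
  note pp = St_permutes[OF p]
  note i = permutes_inv[OF pp]
  have r: "rw (inv pe (f (pe x))) = rw x" for x
   using True by (auto simp: compat_def permutes_inv_inv[OF pp] fun_eq_iff)
  have "pe (f x) = f (pe x)" for x
  proof (cases "x \<in> X")
   case x: True
   have X1: "pe x \<in> X" "f (pe x) \<in> X" "inv pe (f (pe x)) \<in> X" "f x \<in> X"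
    using x fX permutes_in_image[OF pp, of x] permutes_in_image[OF i, of "f (pe x)"] by auto
   have e1: "z (inv pe (f (pe x))) = z (f x)"
    using St_fix[OF St_inv[OF pz] X1(2)] W_D(4)[OF w] St_fix[OF pz x] x X1(1) by auto
   have e2: "cw (inv pe (f (pe x))) = cw (f x)"
    using St_fix[OF St_inv[OF p] X1(2)] St_fix[OF p x] gf[OF X1(1)] gf[OF x] by simp
   have e3: "rw (inv pe (f (pe x))) = rw (f x)" using r rf[OF x] by simp
   have "inj3 X z rw cw" using t by (simp add: tab_def)
   from inj3D[OF this X1(3,4) e1 e3 e2] show ?thesis by (metis permutes_inverses(1)[OF pp])
  next
   case False
   thus ?thesis using permutes_not_in[OF pp] permutes_not_in[OF W_permutes[OF w]] by simp
  qed
  hence "sign pe = 1" by (rule sign_commuting[OF w pz])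
  thus ?thesis using True by (simp add: ind eps_def)
 qed (simp add: ind)
 have fC: "finite ?C" by (rule finite_St) simp
 define S where "S = {pe\<in>?C. mact (inv pe) (z, f) \<in> compat z rw}"
 have "Psi (evec z rw cw) (z, f) = (\<Sum>pe\<in>?C. if mact (inv pe) (z, f) \<in> compat z rw then 1 else 0)"
  unfolding evec_def Psi_symm m.symm_apply by (rule sum.cong[OF refl tm])
 also have "... = of_nat (card S)"
  unfolding S_def by (subst sum.inter_filter[symmetric, OF fC]) simp
 also have "... \<noteq> 0"
 proof -
  have "rw (f x) = rw x" for x using rf[of x] W_D(6)[OF w, of x] by (cases "x \<in> X") auto
  hence "mact (inv id) (z, f) \<in> compat z rw" using w by (auto simp: compat_def fun_eq_iff)
  hence "id \<in> S" unfolding S_def using St_id by blast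
  moreover have "finite S" unfolding S_def by (rule finite_subset[OF _ fC]) blast
  ultimately show ?thesis by auto
 qed
 finally show ?thesis by auto
qed

lemma subspace_Bsp: "cfun.subspace Bsp"
 unfolding Bsp_def by (rule cfun.subspace_span)

lemma wL_proj: assumes "pe \<in> St X z" shows "w.L pe (proj z x) = proj z (w.L pe x)"
proof -
 have "z' \<circ> pe = z \<longleftrightarrow> z' = z" for z'
 proof
  assume "z' \<circ> pe = z"
  hence "z' \<circ> pe \<circ> inv pe = z \<circ> inv pe" by simp
  thus "z' = z" using St_comp_eq[OF assms] by (simp add: comp_assoc permutes_inv_o[OF St_permutes[OF assms]])
 qed (simp add: St_comp_eq[OF assms])
 thus ?thesis by (auto simp: fun_eq_iff w.L_def proj_def permutes_inv_inv[OF St_permutes[OF assms]] split_beta wact_def)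
qed

lemma mL_proj: assumes "pe \<in> St X z" shows "m.L pe (proj z x) = proj z (m.L pe x)"
proof -
 have "z' \<circ> pe = z \<longleftrightarrow> z' = z" for z'
 proof
  assume "z' \<circ> pe = z"
  hence "z' \<circ> pe \<circ> inv pe = z \<circ> inv pe" by simp
  thus "z' = z" using St_comp_eq[OF assms] by (simp add: comp_assoc permutes_inv_o[OF St_permutes[OF assms]])
 qed (simp add: St_comp_eq[OF assms])
 thus ?thesis by (auto simp: fun_eq_iff m.L_def proj_def permutes_inv_inv[OF St_permutes[OF assms]] split_beta mact_def)
qed

text \<open>Resetting the rows outside the positions to 0 changes neither the stabiliser nor,
  therefore, the symmetrizer.\<close>

lemma tab_Tab:
 assumes t: "tab X z rw cw" and z: "\<And>x. x < n ==> z x < r" "\<And>x. n \<le> x ==> z x = 0"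
 shows "\<exists>rw'. Tab z rw' cw \<and> St X (pairf z rw') = St X (pairf z rw)"
proof -
 let ?rw = "\<lambda>x. if x \<in> X then rw x else 0"
 have "tab X z ?rw cw" using t unfolding tab_def inj_on_def by auto
 moreover have "St X (\<lambda>x. (z x, ?rw x)) = St X (pairf z rw)" by (rule St_cong) simp
 ultimately show ?thesis using z by (intro exI[of _ ?rw]) (auto simp: Tab_def)
qed

text \<open>The part of the kernel in one colouring is a module for the Young subgroup of that
  colouring. If it were nonzero, a pair of symmetrizers would produce from it a nonzero multiple of
  some doubled \<open>evec\<close> that is killed by \<open>Psi\<close>.\<close>

theorem Psi_injective:
 assumes x: "x \<in> Bsp" and 0: "Psi x = 0"
 shows "x = 0"
proof (rule ccontr)
 assume "x \<noteq> 0"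
 then obtain z bw where nz: "x (z, bw) \<noteq> 0" by (auto simp: fun_eq_iff)
 have supp: "(\<forall>x<n. z x < r) \<and> (\<forall>x\<ge>n. z x = 0)" if "y \<in> Bsp" "y (z, bw) \<noteq> 0" for y
 proof (rule ccontr)
  assume neg: "\<not> ?thesis"
  have "y (z, bw) = 0" using that(1) unfolding Bsp_def
  proof (induction rule: cfun.span_induct_alt)
   case (step c x y)
   then obtain z' rw cw where "x = evec z' rw cw" "Tab z' rw cw" by blast
   hence "x (z, bw) = 0" using evec_colour[of z z' rw cw bw] neg by (cases "z = z'") (auto simp: Tab_def)
   thus ?case using step by simp
  qed simp
  thus False using that(2) by simp
 qed
 let ?I = "{proj z y |y. y \<in> Bsp \<and> Psi y = 0}"
 have sub: "w.submodule z ?I"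
  unfolding w.submodule_def
 proof (intro conjI ballI)
  show "cfun.subspace ?I"
  proof (rule cfun.subspaceI)
   show "0 \<in> ?I" using cfun.subspace_0[OF subspace_Bsp] Psi_zero proj_zero by (metis (mono_tags, lifting) mem_Collect_eq)
  next
   fix a b assume "a \<in> ?I" "b \<in> ?I"
   then obtain a' b' where "a = proj z a'" "b = proj z b'" "a' \<in> Bsp" "b' \<in> Bsp" "Psi a' = 0" "Psi b' = 0" by blast
   thus "a + b \<in> ?I" using cfun.subspace_add[OF subspace_Bsp, of a' b']
    by (intro CollectI exI[of _ "a' + b'"] conjI) (simp_all only: proj_add Psi_add add_0_left)
  next
   fix c a assume "a \<in> ?I"
   then obtain a' where "a = proj z a'" "a' \<in> Bsp" "Psi a' = 0" by blast
   thus "fscale c a \<in> ?I" using cfun.subspace_scale[OF subspace_Bsp, of a' c]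
    by (intro CollectI exI[of _ "fscale c a'"] conjI) (simp_all only: proj_fscale Psi_fscale cfun.scale_zero_right)
  qed
  fix pe f assume p: "pe \<in> St X z" and "f \<in> ?I"
  then obtain y where "f = proj z y" "y \<in> Bsp" "Psi y = 0" by blast
  thus "w.L pe f \<in> ?I"
   using Bsp_L[OF St_permutes[OF p], of y] Psi_L[OF St_permutes[OF p], of y]
   by (intro CollectI exI[of _ "w.L pe y"] conjI) (simp_all only: wL_proj[OF p] m.L_zero)
 qed
 have "proj z x \<in> ?I" using x 0 by blast
 moreover have "proj z x \<noteq> 0" using nz by (auto simp: fun_eq_iff proj_def)
 ultimately obtain rw0 cw u where t: "tab X z rw0 cw" and u: "u \<in> ?I"
  and ne: "w.symm True (pairf z cw) (w.symm False (pairf z rw0) u) \<noteq> 0"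
  using w.young_symmetrizer_exists[OF sub] by blast
 obtain rw where P: "Tab z rw cw" and St: "St X (pairf z rw) = St X (pairf z rw0)"
  using tab_Tab[OF t] supp[OF x nz] by blast
 have ne': "w.symm True (pairf z cw) (w.symm False (pairf z rw) u) \<noteq> 0"
  using ne by (simp only: w.symm_def St not_False_eq_True)
 obtain y where y: "u = proj z y" "y \<in> Bsp" "Psi y = 0" using u by blast
 from ba_Bsp[OF P y(2)] obtain c where
  c: "w.symm True (pairf z cw) (w.symm False (pairf z rw) u) = fscale c (evec z rw cw)" "c = 0 \<or> doubled z rw"
  unfolding y(1) by blast
 have c0: "c \<noteq> 0" using ne' unfolding c(1) by (metis cfun.scale_zero_left)
 have "fscale c (Psi (evec z rw cw)) = 0"
  unfolding Psi_fscale[symmetric] c(1)[symmetric] Psi_symm y(1) Psi_proj y(3) proj_zero m.symm_zero ..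
 hence "Psi (evec z rw cw) = 0" using c0 by (simp only: cfun.scale_eq_0_iff simp_thms)
 thus False using Psi_evec_nz[OF P] c(2) c0 by blast
qed

lemma evec_real: "evec z rw cw o' \<in> \<real>"
 unfolding evec_def w.symm_apply by (rule sum_in_Reals) (auto simp: eps_def basis_vec_def)

lemma Psi_real: "(\<And>o'. x o' \<in> \<real>) ==> Psi x o' \<in> \<real>"
 by (cases o') (auto simp: Psi_def intro!: sum_in_Reals)

text \<open>The annihilator of the image under the pairing on \<open>W\<close> is again a module.
  Symmetrizers would turn a nonzero element into a nonzero multiple of some
  \<open>Psi (evec z rw cw)\<close> orthogonal to the image; but this vector is real and lies in the
  image, so its pairing with itself is a positive sum of squares.\<close>

theorem Psi_surjective:
 assumes a: "\<And>o'. o' \<notin> W ==> a o' = 0"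
 shows "\<exists>x\<in>Bsp. Psi x = a"
proof (rule ccontr)
 assume "\<not> ?thesis"
 hence nin: "a \<notin> Psi ` Bsp" by blast
 have subP: "cfun.subspace (Psi ` Bsp)"
 proof (rule cfun.subspaceI)
  show "0 \<in> Psi ` Bsp" using cfun.subspace_0[OF subspace_Bsp] Psi_zero by (metis imageI)
  show "x + y \<in> Psi ` Bsp" if xy: "x \<in> Psi ` Bsp" "y \<in> Psi ` Bsp" for x y
  proof -
   from xy obtain x' y' where "x = Psi x'" "y = Psi y'" "x' \<in> Bsp" "y' \<in> Bsp" by blast
   thus ?thesis using cfun.subspace_add[OF subspace_Bsp, of x' y'] Psi_add[of x' y'] by (metis imageI)
  qed
  show "fscale c x \<in> Psi ` Bsp" if xy: "x \<in> Psi ` Bsp" for c x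
  proof -
   from xy obtain x' where "x = Psi x'" "x' \<in> Bsp" by blast
   thus ?thesis using cfun.subspace_scale[OF subspace_Bsp, of x' c] Psi_fscale[of c x'] by (metis imageI)
  qed
 qed
 have off: "b o' = 0" if "b \<in> insert a (Psi ` Bsp)" "o' \<notin> W" for b o'
  using that a by (cases o') (auto simp: Psi_def)
 have "\<exists>y. (\<forall>b\<in>Psi ` Bsp. (\<Sum>o'\<in>W. y o' * b o') = 0) \<and> (\<Sum>o'\<in>W. y o' * a o') \<noteq> 0"
  by (rule separating_functional[OF subP nin finite_W]) (rule off)
 then obtain y where y0: "\<forall>b\<in>Psi ` Bsp. (\<Sum>o'\<in>W. y o' * b o') = 0" and ya: "(\<Sum>o'\<in>W. y o' * a o') \<noteq> 0"
  by (elim exE conjE)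
 define Y where "Y = {y. (\<forall>o'. o' \<notin> W \<longrightarrow> y o' = 0) \<and> (\<forall>b\<in>Psi ` Bsp. (\<Sum>o'\<in>W. y o' * b o') = 0)}"
 have "\<exists>o'\<in>W. y o' \<noteq> 0"
 proof (rule ccontr)
  assume "\<not> ?thesis"
  hence "(\<Sum>o'\<in>W. y o' * a o') = 0" by (intro sum.neutral) simp
  thus False using ya by simp
 qed
 then obtain o1 where "o1 \<in> W" "y o1 \<noteq> 0" by blast
 then obtain z f where zf: "(z, f) \<in> W" "y (z, f) \<noteq> 0" by (cases o1) auto
 define y' where "y' = (\<lambda>o'. if o' \<in> W then y o' else 0)"
 have sumW: "(\<Sum>o'\<in>W. y1 o' * proj z b o') = (\<Sum>o'\<in>W. proj z y1 o' * b o')" for y1 b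
  by (rule sum.cong[OF refl]) (simp add: proj_def)
 have projB: "proj z b \<in> Psi ` Bsp" if "b \<in> Psi ` Bsp" for b
 proof -
  from that obtain x where "b = Psi x" "x \<in> Bsp" by blast
  thus ?thesis using Bsp_proj[of x z] by (auto simp flip: Psi_proj)
 qed
 have y'Y: "y' \<in> Y"
  unfolding Y_def
 proof (intro CollectI conjI allI impI ballI)
  fix b assume "b \<in> Psi ` Bsp"
  have "(\<Sum>o'\<in>W. y' o' * b o') = (\<Sum>o'\<in>W. y o' * b o')"
   by (rule sum.cong[OF refl]) (simp add: y'_def)
  thus "(\<Sum>o'\<in>W. y' o' * b o') = 0" using y0 \<open>b \<in> Psi ` Bsp\<close> by metis
 qed (simp add: y'_def)
 have pY: "proj z y1 \<in> Y" if "y1 \<in> Y" for y1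
 proof -
  have "(\<Sum>o'\<in>W. proj z y1 o' * b o') = 0" if "b \<in> Psi ` Bsp" for b
   using projB[OF that] \<open>y1 \<in> Y\<close> unfolding sumW[symmetric] Y_def by blast
  moreover have "proj z y1 o' = 0" if "o' \<notin> W" for o'
   using that \<open>y1 \<in> Y\<close> by (cases o') (auto simp: Y_def proj_def)
  ultimately show ?thesis unfolding Y_def by blast
 qed
 let ?I = "{y1\<in>Y. proj z y1 = y1}"
 have subY: "cfun.subspace Y"
 proof (rule cfun.subspaceI)
  show "0 \<in> Y" by (simp add: Y_def)
  show "x + y \<in> Y" if "x \<in> Y" "y \<in> Y" for x y
  proof -
   have 1: "\<forall>o'. o' \<notin> W \<longrightarrow> (x + y) o' = 0" using that by (simp add: Y_def)
   have 2: "(\<Sum>o'\<in>W. (x + y) o' * b o') = (\<Sum>o'\<in>W. x o' * b o') + (\<Sum>o'\<in>W. y o' * b o')" for b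
    by (simp only: plus_fun_apply distrib_right sum.distrib)
   have 3: "\<forall>b\<in>Psi ` Bsp. (\<Sum>o'\<in>W. (x + y) o' * b o') = 0" unfolding 2 using that unfolding Y_def by simp
   show ?thesis unfolding Y_def using 1 3 by blast
  qed
  show "fscale c x \<in> Y" if "x \<in> Y" for c x
  proof -
   have 1: "\<forall>o'. o' \<notin> W \<longrightarrow> fscale c x o' = 0" using that by (simp add: Y_def)
   have 2: "(\<Sum>o'\<in>W. fscale c x o' * b o') = c * (\<Sum>o'\<in>W. x o' * b o')" for b
    by (simp only: fscale_apply mult.assoc sum_distrib_left)
   have 3: "\<forall>b\<in>Psi ` Bsp. (\<Sum>o'\<in>W. fscale c x o' * b o') = 0" unfolding 2 using that unfolding Y_def by simp
   show ?thesis unfolding Y_def using 1 3 by blast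
  qed
 qed
 have sub: "m.submodule z ?I"
  unfolding m.submodule_def
 proof (intro conjI ballI)
  show "cfun.subspace ?I"
   by (rule cfun.subspaceI) (simp_all only: mem_Collect_eq proj_add proj_fscale proj_zero cfun.subspace_0[OF subY] cfun.subspace_add[OF subY] cfun.subspace_scale[OF subY] simp_thms)
  fix pe y1 assume p: "pe \<in> St X z" and y1: "y1 \<in> ?I"
  note pp = St_permutes[OF p]
  note i = permutes_inv[OF pp]
  have "m.L pe y1 \<in> Y"
   unfolding Y_def
  proof (intro CollectI conjI allI impI ballI)
   fix o' assume "o' \<notin> W"
   moreover have "\<forall>o'. o' \<notin> W \<longrightarrow> y1 o' = 0" using y1 unfolding Y_def by blast
   ultimately show "m.L pe y1 o' = 0" using W_mact_iff[OF i, of o'] unfolding m.L_def by blast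
  next
   fix b assume "b \<in> Psi ` Bsp"
   then obtain x where x: "b = Psi x" "x \<in> Bsp" by blast
   have "(\<Sum>o'\<in>W. m.L pe y1 o' * b o') = (\<Sum>o'\<in>W. y1 o' * m.L (inv pe) b o')"
    by (rule sum.reindex_bij_witness[of _ "mact pe" "mact (inv pe)"])
      (auto simp: m.act_inv[OF pp] W_mact_iff[OF i] W_mact_iff[OF pp] m.L_def permutes_inv_inv[OF pp])
   also have "m.L (inv pe) b = Psi (w.L (inv pe) x)" unfolding x(1) Psi_L[OF i] ..
   also have "(\<Sum>o'\<in>W. y1 o' * Psi (w.L (inv pe) x) o') = 0" using y1 Bsp_L[OF i x(2)] by (auto simp: Y_def)
   finally show "(\<Sum>o'\<in>W. m.L pe y1 o' * b o') = 0" .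
  qed
  moreover have "proj z (m.L pe y1) = m.L pe y1" using y1 mL_proj[OF p, of y1] by simp
  ultimately show "m.L pe y1 \<in> ?I" by blast
 qed
 have "proj z y' \<in> ?I" using pY[OF y'Y] by (simp add: proj_proj)
 moreover have "proj z y' \<noteq> 0"
 proof
  assume "proj z y' = 0"
  from fun_cong[OF this, of "(z, f)"] show False using zf by (simp add: proj_def y'_def)
 qed
 ultimately obtain rw0 cw u where t: "tab X z rw0 cw" and u: "u \<in> ?I"
  and ne: "m.symm True (pairf z cw) (m.symm False (pairf z rw0) u) \<noteq> 0"
  using m.young_symmetrizer_exists[OF sub] by blast
 obtain rw where P: "Tab z rw cw" and St: "St X (pairf z rw) = St X (pairf z rw0)"
  using tab_Tab[OF t] W_D(1,5)[OF zf(1)] by blast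
 define v where "v = m.symm True (pairf z cw) (m.symm False (pairf z rw) u)"
 have v0: "v \<noteq> 0" using ne by (simp only: v_def m.symm_def St not_False_eq_True)
 have vI: "v \<in> ?I" unfolding v_def by (intro m.submodule_symm[OF sub] u)
 let ?D = "{fscale c (Psi (evec z rw cw)) |c. c = 0 \<or> doubled z rw}"
 have usum: "u = (\<Sum>o'\<in>W. fscale (u o') (basis_vec o'))"
  by (rule basis_expansion[OF finite_W]) (use u in \<open>unfold Y_def, blast\<close>)
 have "v = (\<Sum>o'\<in>W. fscale (u o') (m.symm True (pairf z cw) (m.symm False (pairf z rw) (basis_vec o'))))"
  unfolding v_def by (subst usum) (simp only: m.symm_sum m.symm_fscale)
 also have "... \<in> ?D"
 proof (rule subspace_sum[OF subspace_multiples])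
  fix o' assume o: "o' \<in> W"
  obtain z' g where zg: "o' = (z', g)" by (cases o')
  show "fscale (u o') (m.symm True (pairf z cw) (m.symm False (pairf z rw) (basis_vec o'))) \<in> ?D"
  proof (cases "z' = z")
   case True
   show ?thesis using ba_matching[OF _ P, of g] o unfolding zg True
    by (intro cfun.subspace_scale[OF subspace_multiples])
  next
   case False
   have "proj z u o' = 0" using False by (simp add: proj_def zg)
   moreover have "proj z u = u" using u by blast
   ultimately have "u o' = 0" by (simp only:)
   thus ?thesis by (simp only: cfun.scale_zero_left cfun.subspace_0[OF subspace_multiples])
  qed
 qed
 finally obtain c where c: "v = fscale c (Psi (evec z rw cw))" "c = 0 \<or> doubled z rw" by blast
 have c0: "c \<noteq> 0" using v0 c(1) by (metis cfun.scale_zero_left)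
 hence D: "doubled z rw" using c(2) by blast
 \<comment> \<open>The pairing is bilinear, without conjugation; it is positive on \<open>e\<close>
   because \<open>e\<close> takes real values.\<close>
 define e where "e = Psi (evec z rw cw)"
 have "evec z rw cw \<in> Bsp" unfolding Bsp_def by (rule cfun.span_base) (use P D in blast)
 hence eB: "e \<in> Psi ` Bsp" by (simp add: e_def)
 have "(\<Sum>o'\<in>W. v o' * e o') = 0" using vI eB by (auto simp: Y_def)
 hence "c * (\<Sum>o'\<in>W. e o' * e o') = 0" by (simp add: c(1) e_def sum_distrib_left mult.assoc)
 hence s0: "(\<Sum>o'\<in>W. e o' * e o') = 0" using c0 by simp
 have er: "e o' = of_real (Re (e o'))" for o'
  using Psi_real[of "evec z rw cw" o', OF evec_real] by (simp add: e_def)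
 have "(\<Sum>o'\<in>W. e o' * e o') = (\<Sum>o'\<in>W. of_real (Re (e o') * Re (e o')))"
  by (rule sum.cong[OF refl]) (metis er of_real_mult)
 also have "... = of_real (\<Sum>o'\<in>W. Re (e o') * Re (e o'))" by (rule of_real_sum[symmetric])
 finally have "(of_real (\<Sum>o'\<in>W. Re (e o') * Re (e o')) :: complex) = 0" unfolding s0 by (rule sym)
 hence s1: "(\<Sum>o'\<in>W. Re (e o') * Re (e o')) = 0" by (simp only: of_real_eq_0_iff)
 have "Re (e o') * Re (e o') = 0" if "o' \<in> W" for o'
  by (rule sum_nonneg_0[OF finite_W _ s1 that]) (rule zero_le_square)
 hence "e o' = 0" if "o' \<in> W" for o' using that er[of o'] by (metis mult_eq_0_iff of_real_0)
 moreover have "e o' = 0" if "o' \<notin> W" for o' using off[of e o'] eB that by blast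
 ultimately have "e = 0" by (auto simp: fun_eq_iff)
 thus False using Psi_evec_nz[OF P D] by (simp add: e_def)
qed

end

section \<open>Monomial matrices\<close>

text \<open>The entry \<open>c j\<close> sits in column \<open>j\<close>, as for
  \<open>perm_of\<close>; with this convention the permutation of a product is the composite in the
  same order.\<close>

definition monm :: "nat => (nat => nat) => (nat => complex) => complex mat" where
 "monm n pe c = mat n n (\<lambda>(i, j). if i = pe j then c j else 0)"

text \<open>Working with the entry itself instead of its exponent \<open>zexp\<close> makes products
  exact and avoids reductions modulo \<open>r\<close>.\<close>

definition ent :: "complex mat => nat => complex" where
 "ent g j = g $$ (perm_of g j, j)"

lemma mono_carrier_mat [simp]: "monm n pe c \<in> carrier_mat n n"
 and dim_mono [simp]: "dim_row (monm n pe c) = n" "dim_col (monm n pe c) = n"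
 by (auto simp: monm_def)

lemma mono_index [simp]: "i < n ==> j < n ==> monm n pe c $$ (i, j) = (if i = pe j then c j else 0)"
 by (simp add: monm_def)

lemma permutes_less: "pe permutes {..<n} ==> pe x < n \<longleftrightarrow> x < (n::nat)"
 using permutes_in_image[of pe "{..<n}" x] by simp

lemma mono_cong: "(\<And>j. j < n ==> pe j = si j \<and> c j = d j) ==> monm n pe c = monm n si d"
 by (rule eq_matI) auto

lemma mono_mult:
 assumes s: "si permutes {..<n}"
 shows "monm n pe c * monm n si d = monm n (pe \<circ> si) (\<lambda>j. c (si j) * d j)"
proof (rule eq_matI)
 fix i j assume "i < dim_row (monm n (pe \<circ> si) (\<lambda>j. c (si j) * d j))" "j < dim_col (monm n (pe \<circ> si) (\<lambda>j. c (si j) * d j))"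
 hence ij: "i < n" "j < n" by auto
 have sj: "si j < n" using ij by (simp add: permutes_less[OF s])
 have "(monm n pe c * monm n si d) $$ (i, j) = (\<Sum>k<n. monm n pe c $$ (i, k) * monm n si d $$ (k, j))"
  using ij by (simp add: scalar_prod_def atLeast0LessThan)
 also have "... = (\<Sum>k<n. if k = si j then (if i = pe k then c k else 0) * d j else 0)"
  using ij by (intro sum.cong) auto
 also have "... = (if i = pe (si j) then c (si j) else 0) * d j" using sj by simp
 finally show "(monm n pe c * monm n si d) $$ (i, j) = monm n (pe \<circ> si) (\<lambda>j. c (si j) * d j) $$ (i, j)"
  using ij by simp
qed auto

lemma mono_one: "monm n id (\<lambda>_. 1) = 1\<^sub>m n"
 by (rule eq_matI) auto

lemma perm_mat_mono: "perm_mat n s = monm n s (\<lambda>_. 1)"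
 by (simp add: perm_mat_def monm_def)

lemma smult_mono: "a \<cdot>\<^sub>m monm n pe c = monm n pe (\<lambda>j. a * c j)"
 by (rule eq_matI) auto

lemma transpose_mono: assumes "pe permutes {..<n}" shows "transpose_mat (monm n pe c) = monm n (inv pe) (c \<circ> inv pe)"
 by (rule eq_matI) (auto simp: permutes_inverses[OF assms])

lemma Grn_simps [simp]: "monoid.mult (Grn r n) = (*)" "monoid.one (Grn r n) = 1\<^sub>m n"
 by (auto simp: Grn_def)

lemma root_nz: "0 < r ==> a ^ r = 1 ==> a \<noteq> (0::complex)"
 by (auto simp: power_0_left)

lemma mono_in_Grn:
 assumes p: "pe permutes {..<n}" and c: "\<And>j. j < n ==> c j ^ r = 1" and r: "0 < r"
 shows "monm n pe c \<in> carrier (Grn r n)"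
proof -
 have i: "inv pe permutes {..<n}" by (rule permutes_inv[OF p])
 have nz: "c j \<noteq> 0" if "j < n" for j using root_nz[OF r c[OF that]] .
 have "\<exists>!j. j < n \<and> monm n pe c $$ (i, j) \<noteq> 0" if "i < n" for i
 proof (rule ex1I[of _ "inv pe i"])
  show "inv pe i < n \<and> monm n pe c $$ (i, inv pe i) \<noteq> 0"
   using that nz by (simp add: permutes_less[OF i] permutes_inverses[OF p])
  show "j = inv pe i" if "j < n \<and> monm n pe c $$ (i, j) \<noteq> 0" for j
   using that \<open>i < n\<close> by (auto simp: permutes_inverses[OF p] split: if_splits)
 qed
 moreover have "\<exists>!i. i < n \<and> monm n pe c $$ (i, j) \<noteq> 0" if "j < n" for j
 proof (rule ex1I[of _ "pe j"])
  show "pe j < n \<and> monm n pe c $$ (pe j, j) \<noteq> 0" using that nz by (simp add: permutes_less[OF p])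
  show "i = pe j" if "i < n \<and> monm n pe c $$ (i, j) \<noteq> 0" for i
   using that \<open>j < n\<close> by (auto split: if_splits)
 qed
 ultimately show ?thesis using c by (auto simp: Grn_def)
qed

lemma perm_of_mono:
 assumes p: "pe permutes {..<n}" and nz: "\<And>j. j < n ==> c j \<noteq> 0"
 shows "perm_of (monm n pe c) = pe"
proof
 fix j
 show "perm_of (monm n pe c) j = pe j"
 proof (cases "j < n")
  case True
  have "(THE i. i < n \<and> monm n pe c $$ (i, j) \<noteq> 0) = pe j"
  proof (rule the_equality)
   show "pe j < n \<and> monm n pe c $$ (pe j, j) \<noteq> 0" using True nz by (simp add: permutes_less[OF p])
   show "i = pe j" if "i < n \<and> monm n pe c $$ (i, j) \<noteq> 0" for i
    using that True by (auto split: if_splits)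
  qed
  thus ?thesis using True by (simp add: perm_of_def)
 qed (use p in \<open>simp add: perm_of_def permutes_not_in\<close>)
qed

lemma ent_mono:
 assumes p: "pe permutes {..<n}" and nz: "\<And>j. j < n ==> c j \<noteq> 0" and "j < n"
 shows "ent (monm n pe c) j = c j"
proof -
 have "perm_of (monm n pe c) = pe" by (rule perm_of_mono[OF p]) (rule nz)
 thus ?thesis using assms(3) by (simp add: ent_def permutes_less[OF p])
qed

lemma Grn_mono:
 assumes g: "g \<in> carrier (Grn r n)"
 shows "g \<in> carrier_mat n n" "perm_of g permutes {..<n}" "\<And>j. j < n ==> ent g j ^ r = 1" "g = monm n (perm_of g) (ent g)"
proof -
 show gc: "g \<in> carrier_mat n n" using g by (auto simp: Grn_def)
 have dim: "dim_row g = n" "dim_col g = n" using gc by auto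
 have r1: "\<exists>!j. j < n \<and> g $$ (i, j) \<noteq> 0" if "i < n" for i using g that by (simp add: Grn_def)
 have r2: "\<exists>!i. i < n \<and> g $$ (i, j) \<noteq> 0" if "j < n" for j using g that by (simp add: Grn_def)
 have th: "perm_of g j < n \<and> g $$ (perm_of g j, j) \<noteq> 0" if "j < n" for j
  using theI'[OF r2[OF that]] that by (simp add: perm_of_def dim)
 have uniq: "i = perm_of g j" if "i < n" "j < n" "g $$ (i, j) \<noteq> 0" for i j
  using r2[OF that(2)] th[OF that(2)] that(1,3) by blast
 show p: "perm_of g permutes {..<n}"
 proof (rule inj_imp_permutes)
  show "inj_on (perm_of g) {..<n}"
  proof (rule inj_onI)
   fix x y assume h: "x \<in> {..<n}" "y \<in> {..<n}" "perm_of g x = perm_of g y"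
   thus "x = y" using th[of x] th[of y] r1[of "perm_of g x"] by auto
  qed
  show "perm_of g x = x" if "x \<notin> {..<n}" for x using that by (simp add: perm_of_def dim)
 qed (use th in auto)
 show "ent g j ^ r = 1" if "j < n" for j
  using g th[OF that] that by (auto simp: Grn_def ent_def)
 show "g = monm n (perm_of g) (ent g)"
 proof (rule eq_matI)
  fix i j assume "i < dim_row (monm n (perm_of g) (ent g))" "j < dim_col (monm n (perm_of g) (ent g))"
  thus "g $$ (i, j) = monm n (perm_of g) (ent g) $$ (i, j)"
   using uniq[of i j] by (auto simp: ent_def)
 qed (auto simp: dim)
qed

lemma perm_of_ge: "g \<in> carrier (Grn r n) ==> n \<le> j ==> perm_of g j = j"
 using permutes_not_in[OF Grn_mono(2), of g r n j] by simp

lemma Grn_eqI: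
 assumes "g \<in> carrier (Grn r n)" "h \<in> carrier (Grn r n)" "perm_of g = perm_of h" "\<And>j. j < n ==> ent g j = ent h j"
 shows "g = h"
 using Grn_mono(4)[OF assms(1)] Grn_mono(4)[OF assms(2)] mono_cong[of n "perm_of g" "perm_of h" "ent g" "ent h"] assms(3,4) by simp

locale grn =
 fixes r n :: nat
 assumes r_pos: "0 < r"
begin

lemma ent_nz: "g \<in> carrier (Grn r n) ==> j < n ==> ent g j \<noteq> 0"
 using root_nz[OF r_pos] Grn_mono(3) by blast

lemma mono_Grn:
 assumes "pe permutes {..<n}" "\<And>j. j < n ==> c j ^ r = 1"
 shows "monm n pe c \<in> carrier (Grn r n)" "perm_of (monm n pe c) = pe" "\<And>j. j < n ==> ent (monm n pe c) j = c j"
 using assms mono_in_Grn[OF assms r_pos] perm_of_mono[OF assms(1)] ent_mono[OF assms(1)] root_nz[OF r_pos assms(2)] by auto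

lemma mult_Grn:
 assumes g: "g \<in> carrier (Grn r n)" and h: "h \<in> carrier (Grn r n)"
 shows "g * h \<in> carrier (Grn r n)" "perm_of (g * h) = perm_of g \<circ> perm_of h"
  "\<And>j. j < n ==> ent (g * h) j = ent g (perm_of h j) * ent h j"
proof -
 note G = Grn_mono[OF g] and H = Grn_mono[OF h]
 have e: "g * h = monm n (perm_of g \<circ> perm_of h) (\<lambda>j. ent g (perm_of h j) * ent h j)"
  using mono_mult[OF H(2), of "perm_of g" "ent g" "ent h"] G(4) H(4) by simp
 have p: "perm_of g \<circ> perm_of h permutes {..<n}" by (rule permutes_compose[OF H(2) G(2)])
 have c: "(ent g (perm_of h j) * ent h j) ^ r = 1" if "j < n" for j
  using that by (simp add: power_mult_distrib G(3) H(3) permutes_less[OF H(2)])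
 show "g * h \<in> carrier (Grn r n)" "perm_of (g * h) = perm_of g \<circ> perm_of h"
  "\<And>j. j < n ==> ent (g * h) j = ent g (perm_of h j) * ent h j"
  unfolding e using mono_Grn[OF p c] by auto
qed

lemma one_Grn: "1\<^sub>m n \<in> carrier (Grn r n)" "perm_of (1\<^sub>m n) = id" "\<And>j. j < n ==> ent (1\<^sub>m n) j = 1"
 using mono_Grn[of id "\<lambda>_. 1"] by (auto simp: mono_one permutes_id)

lemma inverse_Grn:
 assumes g: "g \<in> carrier (Grn r n)"
 defines "h \<equiv> monm n (inv (perm_of g)) (\<lambda>j. inverse (ent g (inv (perm_of g) j)))"
 shows "h \<in> carrier (Grn r n)" "h * g = 1\<^sub>m n" "g * h = 1\<^sub>m n"
proof -
 note G = Grn_mono[OF g]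
 have i: "inv (perm_of g) permutes {..<n}" by (rule permutes_inv[OF G(2)])
 have h: "h \<in> carrier (Grn r n)" "perm_of h = inv (perm_of g)" "\<And>j. j < n ==> ent h j = inverse (ent g (inv (perm_of g) j))"
  unfolding h_def using mono_Grn[OF i, of "\<lambda>j. inverse (ent g (inv (perm_of g) j))"] G(3)
  by (auto simp: power_inverse permutes_less[OF i])
 show "h \<in> carrier (Grn r n)" by (rule h)
 show "h * g = 1\<^sub>m n"
  by (rule Grn_eqI[OF mult_Grn(1)[OF h(1) g] one_Grn(1)])
    (simp_all add: mult_Grn[OF h(1) g] one_Grn h permutes_inv_o[OF G(2)] permutes_less[OF G(2)] permutes_inverses[OF G(2)] ent_nz[OF g])
 show "g * h = 1\<^sub>m n"
  by (rule Grn_eqI[OF mult_Grn(1)[OF g h(1)] one_Grn(1)])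
    (simp_all add: mult_Grn[OF g h(1)] one_Grn h permutes_inv_o[OF G(2)] permutes_less[OF i] ent_nz[OF g])
qed

lemma group_Grn: "group (Grn r n)"
proof (rule groupI)
 fix x y z assume "x \<in> carrier (Grn r n)" "y \<in> carrier (Grn r n)" "z \<in> carrier (Grn r n)"
 note c = this[THEN Grn_mono(1)]
 show "x \<otimes>\<^bsub>Grn r n\<^esub> y \<otimes>\<^bsub>Grn r n\<^esub> z = x \<otimes>\<^bsub>Grn r n\<^esub> (y \<otimes>\<^bsub>Grn r n\<^esub> z)"
  using c by simp
next
 fix x assume "x \<in> carrier (Grn r n)"
 thus "\<exists>y\<in>carrier (Grn r n). y \<otimes>\<^bsub>Grn r n\<^esub> x = \<one>\<^bsub>Grn r n\<^esub>"
  using inverse_Grn by (metis Grn_simps)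
qed (auto simp: mult_Grn one_Grn dest: Grn_mono(1))

lemma m_inv_Grn: "g \<in> carrier (Grn r n) ==> m_inv (Grn r n) g = monm n (inv (perm_of g)) (\<lambda>j. inverse (ent g (inv (perm_of g) j)))"
 using group.inv_equality[OF group_Grn, of _ g] inverse_Grn[of g] by simp

lemma finite_roots: "finite {a::complex. a ^ r = 1}"
 using finite_roots_unity[of r] r_pos by simp

lemma finite_Grn: "finite (carrier (Grn r n))"
proof -
 let ?F = "{c. \<forall>j. (j \<in> {..<n} \<longrightarrow> c j \<in> {a::complex. a ^ r = 1}) \<and> (j \<notin> {..<n} \<longrightarrow> c j = 0)}"
 have "finite ?F" by (rule finite_set_of_finite_funs) (auto simp: finite_roots)
 hence fin: "finite ((\<lambda>(pe, c). monm n pe c) ` ({pe. pe permutes {..<n}} \<times> ?F))"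
  by (intro finite_imageI finite_cartesian_product finite_permutations) auto
 have mem: "g \<in> (\<lambda>(pe, c). monm n pe c) ` ({pe. pe permutes {..<n}} \<times> ?F)" if g: "g \<in> carrier (Grn r n)" for g
 proof (rule image_eqI[of _ _ "(perm_of g, \<lambda>j. if j < n then ent g j else 0)"])
  show "g = (\<lambda>(pe, c). monm n pe c) (perm_of g, \<lambda>j. if j < n then ent g j else 0)"
   using Grn_mono(4)[OF g] mono_cong[of n "perm_of g" "perm_of g" "ent g" "\<lambda>j. if j < n then ent g j else 0"] by simp
 qed (use Grn_mono(2,3)[OF g] in auto)
 show ?thesis by (rule finite_subset[OF subsetI fin]) (rule mem)
qed

lemma zeta_pow: "zeta r ^ r = 1" "zeta r \<noteq> 0"
proof -
 have "zeta r ^ r = exp (of_nat r * (2 * of_real pi * \<i> / of_nat r))"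
  by (simp only: zeta_def exp_of_nat_mult)
 thus "zeta r ^ r = 1" using r_pos by simp
qed (simp add: zeta_def)

lemma zeta_cis: "zeta r ^ k = cis (2 * pi * real k / real r)"
proof -
 have "zeta r = cis (2 * pi / real r)" by (simp add: zeta_def cis_conv_exp mult_ac)
 thus ?thesis by (simp add: DeMoivre mult_ac)
qed

lemma root_eq_zeta: "a ^ r = 1 ==> \<exists>k<r. a = zeta r ^ k"
 using bij_betw_roots_unity[OF r_pos] by (auto simp: bij_betw_def zeta_cis)

lemma zeta_inj: "k < r ==> l < r ==> zeta r ^ k = zeta r ^ l ==> k = l"
 using bij_betw_roots_unity[OF r_pos] by (auto simp: bij_betw_def zeta_cis dest: inj_onD)

lemma zeta_mod: "zeta r ^ (k mod r) = zeta r ^ k"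
proof -
 have "zeta r ^ k = zeta r ^ (k mod r + r * (k div r))" by simp
 also have "... = zeta r ^ (k mod r)" by (simp only: power_add power_mult zeta_pow power_one mult_1_right)
 finally show ?thesis by simp
qed

lemma zexp_ent:
 assumes g: "g \<in> carrier (Grn r n)" and j: "j < n"
 shows "0 \<le> zexp r g j" "zexp r g j < int r" "zeta r powi zexp r g j = ent g j"
proof -
 let ?P = "\<lambda>k::int. 0 \<le> k \<and> k < int r \<and> g $$ (perm_of g j, j) = zeta r powi k"
 obtain k where k: "k < r" "ent g j = zeta r ^ k" using root_eq_zeta[OF Grn_mono(3)[OF g j]] by blast
 have "\<exists>!k. ?P k"
 proof (rule ex1I[of _ "int k"])
  show "?P (int k)" using k by (simp add: ent_def)
  fix l assume l: "?P l"
  then obtain l' where l': "l = int l'" using nonneg_int_cases by blast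
  hence "zeta r ^ l' = zeta r ^ k" using l k by (simp add: ent_def)
  thus "l = int k" using zeta_inj[of l' k] l l' k by simp
 qed
 from theI'[OF this] show "0 \<le> zexp r g j" "zexp r g j < int r" "zeta r powi zexp r g j = ent g j"
  by (auto simp: zexp_def ent_def)
qed

lemma zeta_powi_sum: "zeta r powi (\<Sum>i\<in>A. f i) = (\<Prod>i\<in>A. zeta r powi f i)"
 by (induct A rule: infinite_finite_induct) (simp_all add: power_int_add zeta_pow)

lemma zsum_ent: assumes g: "g \<in> carrier (Grn r n)" shows "zeta r powi zsum r g = (\<Prod>j<n. ent g j)"
proof -
 have "dim_col g = n" using Grn_mono(1)[OF g] by auto
 hence "zeta r powi zsum r g = (\<Prod>j<n. zeta r powi zexp r g j)"
  by (simp add: zsum_def zeta_powi_sum)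
 also have "... = (\<Prod>j<n. ent g j)" by (rule prod.cong) (auto simp: zexp_ent[OF g])
 finally show ?thesis .
qed

text \<open>The scalar by which \<open>g\<close> acts on words that have colouring \<open>z\<close>
  after the move: the letter arriving at \<open>perm_of g j\<close> comes from \<open>j\<close>, and
  a letter of colour c is multiplied by the c-th power of the entry.\<close>

definition wt :: "complex mat => (nat => nat) => complex" where
 "wt g z = (\<Prod>j<n. ent g j ^ z (perm_of g j))"

text \<open>The cocycle identity that makes weighted translation an action.\<close>

lemma wt_mult:
 assumes g: "g \<in> carrier (Grn r n)" and h: "h \<in> carrier (Grn r n)"
 shows "wt (g * h) z = wt g z * wt h (z \<circ> perm_of g)"
proof -
 have "wt (g * h) z = (\<Prod>j<n. ent g (perm_of h j) ^ z (perm_of g (perm_of h j))) * (\<Prod>j<n. ent h j ^ z (perm_of g (perm_of h j)))"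
  unfolding wt_def prod.distrib[symmetric]
  by (rule prod.cong) (auto simp: mult_Grn[OF g h] power_mult_distrib)
 also have "(\<Prod>j<n. ent g (perm_of h j) ^ z (perm_of g (perm_of h j))) = (\<Prod>j<n. ent g j ^ z (perm_of g j))"
  using prod.permute[OF Grn_mono(2)[OF h], of "\<lambda>j. ent g j ^ z (perm_of g j)"] by (simp add: comp_def)
 finally show ?thesis by (simp add: wt_def comp_def)
qed

lemma wt_one: "wt (1\<^sub>m n) z = 1"
 by (simp add: wt_def one_Grn)

lemma wt_nz: "g \<in> carrier (Grn r n) ==> wt g z \<noteq> 0"
 by (auto simp: wt_def ent_nz)

end

section \<open>The antisymmetric submodel\<close>

locale gelp = gel n s for n s +
 fixes p :: nat
 assumes n_pos: "0 < n" and p_dvd: "p dvd 2 * s" and p_even: "even p"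
begin

sublocale grn "2 * s" n using s_pos by unfold_locales simp

definition d where "d = r div p"

lemma r_eq: "r = d * p"
 using p_dvd by (simp add: d_def)

lemma s_eq: "s = d * (p div 2)"
proof -
 obtain k where "p = 2 * k" using p_even by blast
 thus ?thesis using r_eq by simp
qed

lemma dp_pos: "0 < d" "0 < p"
 using r_eq s_pos by (auto intro: Nat.gr0I)

lemma zeta_s: "zeta r ^ s = -1"
proof -
 have "(zeta r ^ s)\<^sup>2 = 1" using zeta_pow(1) by (simp add: power_mult[symmetric] mult.commute)
 moreover have "zeta r ^ s \<noteq> 1"
  using zeta_inj[of s 0] s_pos by auto
 ultimately show ?thesis by (simp add: power2_eq_1_iff)
qed

lemma zeta_p: "zeta p = zeta r ^ d"
proof -
 have "zeta r ^ d = exp (of_nat d * (2 * of_real pi * \<i> / of_nat r))"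
  by (simp only: zeta_def exp_of_nat_mult)
 also have "of_nat d * (2 * of_real pi * \<i> / of_nat r) = 2 * of_real pi * \<i> / (of_nat p :: complex)"
  unfolding r_eq using dp_pos by (simp add: field_simps)
 finally show ?thesis by (simp add: zeta_def)
qed

text \<open>Multiplying a lift by zeta^k adds \<open>k\<close> to all its exponents. The second
  component is arbitrary, so the same shift is available for words and for matchings; values outside
  the positions stay put to keep the normalisation.\<close>

definition ZW :: "nat => (nat => nat) \<times> 'x => (nat => nat) \<times> 'x" where
 "ZW k = (\<lambda>(z, x). (\<lambda>y. if y < n then (z y + k) mod r else z y, x))"

lemma ZW_simp [simp]: "ZW k (z, x) = (\<lambda>y. if y < n then (z y + k) mod r else z y, x)"
 by (simp add: ZW_def)

lemma ZW_add: "ZW k (ZW l o') = ZW (k + l) o'"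
 by (cases o') (auto simp: fun_eq_iff mod_simps ac_simps)

lemma ZW_mod: "ZW (k mod r) o' = ZW k o'"
 by (cases o') (auto simp: fun_eq_iff mod_simps)

lemma ZW_W: "w \<in> W ==> ZW k w \<in> W"
proof (cases w)
 fix z f assume "w \<in> W" "w = (z, f)"
 hence w: "(z, f) \<in> W" by simp
 have "((z x + s) mod r + k) mod r = ((z x + k) mod r + s) mod r" for x by (simp add: mod_simps ac_simps)
 thus ?thesis using W_D[OF w] s_pos \<open>w = (z, f)\<close> by (simp add: W_def not_less)
qed

lemma ZW_0: "(\<And>x. x < n ==> fst o' x < r) ==> ZW 0 o' = o'"
 by (cases o') (auto simp: fun_eq_iff)

lemma ZW_r: "(\<And>x. x < n ==> fst o' x < r) ==> ZW (r * k) o' = o'"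
 by (cases o') (auto simp: fun_eq_iff)

lemma W_less: "w \<in> W ==> x < n ==> fst w x < r"
 using W_D(1) by (cases w) auto

definition mw :: "wd => complex mat" where
 "mw = (\<lambda>(z, f). monm n f (\<lambda>j. zeta r ^ z j))"

lemma mw_Grn: assumes "(z, f) \<in> W"
 shows "mw (z, f) \<in> carrier (Grn r n)" "perm_of (mw (z, f)) = f" "\<And>j. j < n ==> ent (mw (z, f)) j = zeta r ^ z j"
 using mono_Grn[OF W_permutes[OF assms], of "\<lambda>j. zeta r ^ z j"] zeta_pow(1)
 by (auto simp: mw_def power_mult[symmetric] mult.commute[of _ r]) (simp_all add: power_mult)

lemma mw_inj: "w \<in> W ==> w' \<in> W ==> mw w = mw w' ==> w = w'"
proof -
 assume w: "w \<in> W" "w' \<in> W" and e: "mw w = mw w'"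
 obtain z f where zf: "w = (z, f)" by (cases w)
 obtain z' f' where zf': "w' = (z', f')" by (cases w')
 note M = mw_Grn[OF w(1)[unfolded zf]] and M' = mw_Grn[OF w(2)[unfolded zf']]
 have "f = f'" using M(2) M'(2) e by (simp add: zf zf')
 moreover have "z j = z' j" for j
 proof (cases "j < n")
  case True
  hence "zeta r ^ z j = zeta r ^ z' j" using M(3) M'(3) e by (simp add: zf zf')
  thus ?thesis using zeta_inj W_D(1) w True by (simp add: zf zf')
 next
  case False
  thus ?thesis using W_D(5)[OF w(1)[unfolded zf], of j] W_D(5)[OF w(2)[unfolded zf'], of j] by simp
 qed
 ultimately show "w = w'" by (auto simp: zf zf')
qed

lemma mw_ZW: "mw (ZW k w) = (zeta r ^ k) \<cdot>\<^sub>m mw w"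
proof -
 obtain z f where w: "w = (z, f)" by (cases w)
 have "zeta r ^ ((z j + k) mod r) = zeta r ^ k * zeta r ^ z j" for j
  unfolding zeta_mod power_add by (rule mult.commute)
 thus ?thesis unfolding w mw_def ZW_simp prod.case smult_mono by (intro mono_cong) simp
qed

lemma zexp_mw: assumes w: "(z, f) \<in> W" and j: "j < n" shows "zexp r (mw (z, f)) j = int (z j)"
proof -
 note Z = zexp_ent[OF mw_Grn(1)[OF w] j]
 obtain k where k: "zexp r (mw (z, f)) j = int k" using Z(1) nonneg_int_cases by blast
 hence "zeta r ^ k = zeta r ^ z j" using Z(3) mw_Grn(3)[OF w j] by simp
 thus ?thesis using zeta_inj[of k "z j"] Z(2) k W_D(1)[OF w j] by simp
qed

text \<open>All lifts of one element: \<open>Cp r p n\<close> is generated by the scalar zeta^d with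
  \<open>d = r div p\<close>, so the lifts differ by colour shifts through multiples of
  \<open>d\<close>. Letting \<open>k\<close> run through all naturals repeats lifts but needs no
  bound.\<close>

definition co :: "wd => complex mat set" where
 "co w = {mw (ZW (d * k) w) |k. True}"

lemma smult_one_mult: "a \<in> carrier_mat n n ==> (c \<cdot>\<^sub>m 1\<^sub>m n) * a = (c::complex) \<cdot>\<^sub>m a"
 using mult_smult_assoc_mat[of "1\<^sub>m n" n n a n c] by simp

lemma smult_1 [simp]: "(1::complex) \<cdot>\<^sub>m A = A"
 by (rule eq_matI) auto

lemma Cp_eq: "Cp r p n = {(zeta r ^ (d * k)) \<cdot>\<^sub>m 1\<^sub>m n |k. True}"
proof (rule antisym)
 let ?S = "{(zeta r ^ (d * k)) \<cdot>\<^sub>m (1\<^sub>m n :: complex mat) |k. True}"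
 have one: "1\<^sub>m n = (zeta r ^ (d * 0)) \<cdot>\<^sub>m (1\<^sub>m n :: complex mat)" by simp
 have sc: "(a \<cdot>\<^sub>m 1\<^sub>m n) * (b \<cdot>\<^sub>m 1\<^sub>m n) = (a * b) \<cdot>\<^sub>m (1\<^sub>m n :: complex mat)" for a b
  by (rule eq_matI) (auto simp: smult_one_mult)
 have car: "(zeta r ^ k) \<cdot>\<^sub>m (1\<^sub>m n) \<in> carrier (Grn r n)" for k
 proof -
  have "(zeta r ^ k) \<cdot>\<^sub>m 1\<^sub>m n = monm n id (\<lambda>_. zeta r ^ k)" by (rule eq_matI) auto
  moreover have "(zeta r ^ k) ^ r = 1" using zeta_pow(1) by (metis power_mult mult.commute power_one)
  ultimately show ?thesis using mono_Grn(1)[of id "\<lambda>_. zeta r ^ k"] by (simp add: permutes_id)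
 qed
 show "Cp r p n \<subseteq> ?S"
 proof
  fix x assume "x \<in> Cp r p n"
  thus "x \<in> ?S" unfolding Cp_def zeta_p
  proof (induct rule: generate.induct)
   case one thus ?case using \<open>1\<^sub>m n = _\<close> by (auto intro: exI[of _ 0])
  next
   case (incl h) thus ?case by (auto intro!: exI[of _ 1])
  next
   case (inv h)
   have h: "h = (zeta r ^ d) \<cdot>\<^sub>m 1\<^sub>m n" using inv by simp
   \<comment> \<open>The exponent \<open>d * (p - 1)\<close> stands for \<open>- d\<close> modulo
     \<open>r\<close>, since \<open>d * p = r\<close>.\<close>
   have "zeta r ^ (d * (p - 1)) * zeta r ^ d = 1"
   proof -
    have "d * (p - 1) + d = r" using dp_pos r_eq by (simp add: algebra_simps)
    thus ?thesis by (simp add: power_add[symmetric] zeta_pow)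
   qed
   hence "(zeta r ^ (d * (p - 1))) \<cdot>\<^sub>m 1\<^sub>m n * h = 1\<^sub>m n" by (simp only: h sc) (simp add: smult_one_mult)
   hence "m_inv (Grn r n) h = (zeta r ^ (d * (p - 1))) \<cdot>\<^sub>m 1\<^sub>m n"
    using group.inv_equality[OF group_Grn, of "(zeta r ^ (d * (p - 1))) \<cdot>\<^sub>m 1\<^sub>m n" h] car h by simp
   thus ?case by blast
  next
   case (eng h1 h2)
   then obtain k l where "h1 = (zeta r ^ (d * k)) \<cdot>\<^sub>m 1\<^sub>m n" "h2 = (zeta r ^ (d * l)) \<cdot>\<^sub>m 1\<^sub>m n" by blast
   hence "h1 \<otimes>\<^bsub>Grn r n\<^esub> h2 = (zeta r ^ (d * (k + l))) \<cdot>\<^sub>m 1\<^sub>m n"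
    by (simp only: Grn_simps sc) (simp only: power_add distrib_left)
   thus ?case by blast
  qed
 qed
 have "(zeta r ^ (d * k)) \<cdot>\<^sub>m 1\<^sub>m n \<in> Cp r p n" for k
 proof (induct k)
  case 0
  have "1\<^sub>m n \<in> Cp r p n" unfolding Cp_def using generate.one[of "Grn r n"] by simp
  thus ?case by (simp only: one[symmetric])
 next
  case (Suc k)
  have "(zeta r ^ d) \<cdot>\<^sub>m 1\<^sub>m n \<in> Cp r p n" unfolding Cp_def zeta_p by (rule generate.incl) simp
  from generate.eng[OF this[unfolded Cp_def] Suc[unfolded Cp_def]]
  have "((zeta r ^ d) \<cdot>\<^sub>m 1\<^sub>m n) * ((zeta r ^ (d * k)) \<cdot>\<^sub>m 1\<^sub>m n) \<in> Cp r p n" by (simp only: Grn_simps Cp_def)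
  thus ?case unfolding sc power_add[symmetric] by (simp add: add.commute)
 qed
 thus "?S \<subseteq> Cp r p n" by blast
qed

lemma Cp_coset: assumes "a \<in> carrier (Grn r n)"
 shows "r_coset (Grn r n) (Cp r p n) a = {(zeta r ^ (d * k)) \<cdot>\<^sub>m a |k. True}"
 using Grn_mono(1)[OF assms] by (auto simp: r_coset_def Cp_eq smult_one_mult)

lemma co_coset: assumes "w \<in> W" shows "co w = r_coset (Grn r n) (Cp r p n) (mw w)"
proof -
 have "mw w \<in> carrier (Grn r n)" using mw_Grn(1) assms by (cases w) auto
 thus ?thesis by (simp only: Cp_coset co_def mw_ZW)
qed

lemma carrier_Gproj: "carrier (Gproj r p n) = r_coset (Grn r n) (Cp r p n) ` carrier (Grn r n)"
 by (auto simp: Gproj_def FactGroup_def RCOSETS_def)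

lemma mult_Gproj: "u \<otimes>\<^bsub>Gproj r p n\<^esub> v = {a * b |a b. a \<in> u \<and> b \<in> v}"
 by (auto simp: Gproj_def FactGroup_def set_mult_def)

lemma one_Gproj: "\<one>\<^bsub>Gproj r p n\<^esub> = Cp r p n"
 by (simp add: Gproj_def FactGroup_def)

lemma uminus_mono: "- monm n pe c = monm n pe (\<lambda>j. - c j)"
 by (rule eq_matI) auto

text \<open>\<open>f\<close> is an involution, so transposing keeps the pattern of the matrix, and
  passing to the partner adds \<open>s\<close> to the exponent, which multiplies the entry by
  -1.\<close>

lemma mw_antisym: assumes "w \<in> W" shows "transpose_mat (mw w) = - mw w"
proof -
 obtain z f where zf: "w = (z, f)" by (cases w)
 have w: "(z, f) \<in> W" using assms zf by simp
 have i: "inv f = f" using W_D(3)[OF w] by (intro inv_equality) auto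
 have "zeta r ^ z (f j) = - (zeta r ^ z j)" if "j < n" for j
  unfolding W_D(4)[OF w that] zeta_mod power_add zeta_s by simp
 thus ?thesis
  unfolding zf mw_def prod.case transpose_mono[OF W_permutes[OF w]] uminus_mono i by (intro mono_cong) simp
qed

definition AS where "AS = {v \<in> absolute_involutions r p n. antisymmetric_coset v}"

lemma cnj_zeta: "cnj (zeta r ^ k) * zeta r ^ k = 1"
proof -
 have "zeta r ^ k * cnj (zeta r ^ k) = of_real ((cmod (zeta r ^ k))\<^sup>2)" by (rule complex_norm_square[symmetric])
 moreover have "cmod (zeta r ^ k) = 1" by (simp add: zeta_cis)
 ultimately show ?thesis by (simp add: mult.commute)
qed

text \<open>Conjugation inverts roots of unity, with \<open>(r - 1) * l\<close> standing for
  \<open>- l\<close> modulo \<open>r\<close>; the exponents of \<open>w\<close> cancel up to the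
  jump by \<open>s\<close> between partners.\<close>

lemma mw_cnj: assumes "w \<in> W"
 shows "mw (ZW k w) * map_mat cnj (mw (ZW l w)) = (zeta r ^ (k + s + (r - 1) * l)) \<cdot>\<^sub>m 1\<^sub>m n"
proof -
 obtain z f where zf: "w = (z, f)" by (cases w)
 have w: "(z, f) \<in> W" using assms zf by simp
 have m: "map_mat cnj (monm n f c) = monm n f (\<lambda>j. cnj (c j))" for c by (rule eq_matI) auto
 have ff: "f \<circ> f = id" using W_D(3)[OF w] by auto
 have cl: "cnj (zeta r ^ l) = zeta r ^ ((r - 1) * l)"
 proof -
  have "(r - 1) * l + l = r * l" using s_pos by (simp add: algebra_simps)
  hence "zeta r ^ ((r - 1) * l) * zeta r ^ l = (zeta r ^ r) ^ l"
   by (simp only: power_add[symmetric] power_mult[symmetric])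
  hence "zeta r ^ ((r - 1) * l) * zeta r ^ l = 1" by (simp only: zeta_pow power_one)
  thus ?thesis using cnj_zeta[of l] zeta_pow(2) by (metis mult_right_cancel power_not_zero)
 qed
 have "mw (ZW k w) * map_mat cnj (mw (ZW l w)) =
   monm n id (\<lambda>j. zeta r ^ k * zeta r ^ z (f j) * cnj (zeta r ^ l * zeta r ^ z j))"
  unfolding mw_ZW unfolding zf mw_def prod.case smult_mono m mono_mult[OF W_permutes[OF w]] ff ..
 also have "... = monm n id (\<lambda>j. zeta r ^ (k + s + (r - 1) * l))"
 proof (rule mono_cong, intro conjI refl)
  fix j assume j: "j < n"
  have "zeta r ^ k * zeta r ^ z (f j) * cnj (zeta r ^ l * zeta r ^ z j) =
    zeta r ^ k * zeta r ^ s * cnj (zeta r ^ l) * (cnj (zeta r ^ z j) * zeta r ^ z j)"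
   unfolding W_D(4)[OF w j] zeta_mod power_add complex_cnj_mult by (simp only: mult_ac)
  also have "... = zeta r ^ (k + s + (r - 1) * l)" unfolding cnj_zeta cl power_add by simp
  finally show "zeta r ^ k * zeta r ^ z (f j) * cnj (zeta r ^ l * zeta r ^ z j) = zeta r ^ (k + s + (r - 1) * l)" .
 qed
 also have "... = (zeta r ^ (k + s + (r - 1) * l)) \<cdot>\<^sub>m 1\<^sub>m n" by (rule eq_matI) auto
 finally show ?thesis .
qed

text \<open>\<open>s\<close> is a multiple of \<open>d\<close> because \<open>p\<close> is even, so
  the scalar produced by \<open>mw_cnj\<close> lies in \<open>Cp r p n\<close>. This is why
  antisymmetric matrices give absolute involutions.\<close>

lemma co_AS: assumes w: "w \<in> W" shows "co w \<in> AS"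
proof -
 have "mw w \<in> carrier (Grn r n)" using mw_Grn(1) w by (cases w) auto
 hence "co w \<in> carrier (Gproj r p n)" by (simp add: carrier_Gproj co_coset[OF w])
 moreover have "antisymmetric_coset (co w)"
  unfolding antisymmetric_coset_def co_def using mw_antisym[OF ZW_W[OF w]] by blast
 moreover have "co w \<otimes>\<^bsub>Gproj r p n\<^esub> (map_mat cnj ` co w) = \<one>\<^bsub>Gproj r p n\<^esub>"
  unfolding mult_Gproj one_Gproj
 proof (rule antisym)
  show "{a * b |a b. a \<in> co w \<and> b \<in> map_mat cnj ` co w} \<subseteq> Cp r p n"
  proof clarify
   fix a b b' assume "a \<in> co w" "b' \<in> co w"
   then obtain k l where "a = mw (ZW (d * k) w)" "b' = mw (ZW (d * l) w)" by (auto simp: co_def)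
   hence "a * map_mat cnj b' = (zeta r ^ (d * k + s + (r - 1) * (d * l))) \<cdot>\<^sub>m 1\<^sub>m n" by (simp only: mw_cnj[OF w])
   also have "d * k + s + (r - 1) * (d * l) = d * (k + p div 2 + (r - 1) * l)"
    using s_eq by (simp add: algebra_simps)
   finally show "a * map_mat cnj b' \<in> Cp r p n" unfolding Cp_eq by blast
  qed
  show "Cp r p n \<subseteq> {a * b |a b. a \<in> co w \<and> b \<in> map_mat cnj ` co w}"
  proof
   fix x assume "x \<in> Cp r p n"
   then obtain k where k: "x = (zeta r ^ (d * k)) \<cdot>\<^sub>m 1\<^sub>m n" unfolding Cp_eq by blast
   \<comment> \<open>The extra shift by \<open>p div 2\<close> multiples of \<open>d\<close>, which
     is \<open>s\<close>, cancels the sign coming from the partners, so every scalar of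
     \<open>Cp r p n\<close> is reached.\<close>
   have "mw (ZW (d * (k + p div 2)) w) * map_mat cnj (mw (ZW (d * 0) w)) = (zeta r ^ (d * (k + p div 2) + s + (r - 1) * (d * 0))) \<cdot>\<^sub>m 1\<^sub>m n"
    by (rule mw_cnj[OF w])
   also have "d * (k + p div 2) + s + (r - 1) * (d * 0) = d * k + (s + s)"
    using s_eq by (simp add: algebra_simps)
   also have "zeta r ^ (d * k + (s + s)) = zeta r ^ (d * k)" by (simp add: power_add zeta_s)
   finally have e: "x = mw (ZW (d * (k + p div 2)) w) * map_mat cnj (mw (ZW (d * 0) w))" by (simp only: k)
   have "mw (ZW (d * (k + p div 2)) w) \<in> co w" "mw (ZW (d * 0) w) \<in> co w" unfolding co_def by blast+
   thus "x \<in> {a * b |a b. a \<in> co w \<and> b \<in> map_mat cnj ` co w}" using e by blast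
  qed
 qed
 ultimately show ?thesis by (simp add: AS_def absolute_involutions_def)
qed

text \<open>Conversely, if the transpose of a lift is its negative, comparing patterns shows that
  the permutation is its own inverse, and comparing entries shows that partners have opposite
  entries; in exponents this is the jump by \<open>s\<close>.\<close>

lemma AS_eq: "AS = co ` W"
proof
 show "AS \<subseteq> co ` W"
 proof
  fix v assume v: "v \<in> AS"
  then obtain a where a: "a \<in> carrier (Grn r n)" "v = r_coset (Grn r n) (Cp r p n) a"
   by (auto simp: AS_def absolute_involutions_def carrier_Gproj)
  have "(zeta r ^ (d * 0)) \<cdot>\<^sub>m a \<in> v" unfolding a(2) Cp_coset[OF a(1)] by blast
  hence "a \<in> v" by (simp add: smult_one_mult)
  hence t: "transpose_mat a = - a" using v by (simp add: AS_def antisymmetric_coset_def)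
  define f where "f = perm_of a"
  note A = Grn_mono[OF a(1), folded f_def]
  have fi: "inv f permutes X" by (rule permutes_inv[OF A(2)])
  have nz: "ent a j \<noteq> 0" if "j < n" for j using ent_nz[OF a(1) that] .
  define c where "c = ent a"
  have a_eq: "a = monm n f c" using A(4) by (simp only: c_def)
  have "monm n (inv f) (c \<circ> inv f) = monm n f (\<lambda>j. - c j)"
   using t unfolding a_eq transpose_mono[OF A(2)] uminus_mono .
  hence e: "monm n (inv f) (ent a \<circ> inv f) = monm n f (\<lambda>j. - ent a j)" by (simp only: c_def)
  have "perm_of (monm n (inv f) (ent a \<circ> inv f)) = inv f"
   by (rule perm_of_mono[OF fi]) (simp add: nz permutes_less[OF fi])
  moreover have "perm_of (monm n f (\<lambda>j. - ent a j)) = f" by (rule perm_of_mono[OF A(2)]) (simp add: nz)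
  ultimately have ff: "inv f = f" using e by simp
  have ffx: "f (f x) = x" for x using permutes_inverses(1)[OF A(2), of x] by (simp add: ff)
  have cf: "ent a (f j) = - ent a j" if j: "j < n" for j
  proof -
   have "monm n (inv f) (ent a \<circ> inv f) $$ (f j, j) = monm n f (\<lambda>j. - ent a j) $$ (f j, j)" by (simp only: e)
   thus ?thesis using j by (simp add: permutes_less[OF A(2)] ff)
  qed
  define z where "z j = (if j < n then nat (zexp r a j) else 0)" for j
  have z: "z j < r" "ent a j = zeta r ^ z j" if "j < n" for j
  proof -
   note Z = zexp_ent[OF a(1) that]
   show "z j < r" using Z(1,2) that by (simp add: z_def)
   have "zexp r a j = int (z j)" using Z(1) that by (simp add: z_def)
   thus "ent a j = zeta r ^ z j" using Z(3) by simp
  qed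
  have "z (f j) = (z j + s) mod r" if j: "j < n" for j
  proof (rule zeta_inj)
   show "zeta r ^ z (f j) = zeta r ^ ((z j + s) mod r)"
    using cf[OF j] z(2)[OF j] z(2)[of "f j"] j by (simp add: zeta_mod power_add zeta_s permutes_less[OF A(2)])
  qed (use z(1) j s_pos in \<open>auto simp: permutes_less[OF A(2)]\<close>)
  hence w: "(z, f) \<in> W"
   using z(1) ffx permutes_not_in[OF A(2)] by (auto simp: W_def permutes_less[OF A(2)] z_def)
  have "mw (z, f) = monm n f (ent a)" unfolding mw_def prod.case by (rule mono_cong) (simp add: z(2))
  from trans[OF this A(4)[symmetric]] have "mw (z, f) = a" .
  hence "v = co (z, f)" by (simp add: co_coset[OF w] a(2))
  thus "v \<in> co ` W" using w by blast
 qed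
qed (auto intro: co_AS)

lemma finite_AI: "finite (absolute_involutions r p n)"
 by (rule finite_subset[of _ "carrier (Gproj r p n)"]) (auto simp: absolute_involutions_def carrier_Gproj finite_Grn)

lemma co_eq_iff: assumes "w \<in> W" "w' \<in> W" shows "co w = co w' \<longleftrightarrow> (\<exists>k. w' = ZW (d * k) w)"
proof
 assume e: "co w = co w'"
 have "mw (ZW (d * 0) w') \<in> co w'" unfolding co_def by blast
 hence "mw (ZW (d * 0) w') \<in> co w" by (simp only: e)
 then obtain k where "mw (ZW (d * 0) w') = mw (ZW (d * k) w)" unfolding co_def by blast
 hence "mw w' = mw (ZW (d * k) w)" using ZW_0[OF W_less[OF assms(2)]] by simp
 thus "\<exists>k. w' = ZW (d * k) w" using mw_inj[OF assms(2) ZW_W[OF assms(1)]] by blast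
next
 assume "\<exists>k. w' = ZW (d * k) w"
 then obtain k where k: "w' = ZW (d * k) w" by blast
 \<comment> \<open>\<open>(p - 1) * k\<close> plays the role of \<open>- k\<close> modulo
   \<open>p\<close>.\<close>
 have "ZW (d * l) w = ZW (d * (l + (p - 1) * k)) w'" for l
 proof -
  obtain p' where p': "p = Suc p'" using dp_pos by (cases p) auto
  have "d * (l + (p - 1) * k) + d * k = d * l + r * k" unfolding r_eq p' by (simp add: algebra_simps)
  hence "ZW (d * (l + (p - 1) * k)) w' = ZW (d * l) (ZW (r * k) w)" unfolding k ZW_add by simp
  thus ?thesis using ZW_r[OF W_less[OF assms(1)]] by simp
 qed
 hence "mw (ZW (d * l) w) = mw (ZW (d * (l + (p - 1) * k)) w')" for l by (simp only:)
 hence 1: "mw (ZW (d * l) w) \<in> co w'" for l unfolding co_def by blast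
 have "ZW (d * l) w' = ZW (d * (l + k)) w" for l unfolding k ZW_add distrib_left ..
 hence "mw (ZW (d * l) w') = mw (ZW (d * (l + k)) w)" for l by (simp only:)
 hence "mw (ZW (d * l) w') \<in> co w" for l unfolding co_def by blast
 hence "co w' \<subseteq> co w" unfolding co_def[of w'] by blast
 moreover have "co w \<subseteq> co w'" using 1 unfolding co_def[of w] by blast
 ultimately show "co w = co w'" by blast
qed

end

section \<open>Descent from matrices to cosets\<close>

context gelp
begin

text \<open>Dividing by zeta to the power of the first exponent turns the twist zeta^a(g,v) of the
  antisymmetric action into a coboundary. The factor is not constant on a coset: a shift of all
  colours by \<open>d * k\<close> changes it by zeta^(d k), and this is where the sign of the
  eigenspace comes from.\<close>

definition q :: "(wd => complex) => complex mat set => complex" where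
 "q a = (\<Sum>w\<in>W. fscale (a w * inverse (zeta r ^ fst w 0)) (basis_vec (co w)))"

text \<open>Actions on functions of matrices (\<open>nact\<close>) and of words
  (\<open>eact\<close>). Both use the same weight, which depends on the colours only, so
  \<open>Psi\<close> intertwines them.\<close>

definition nact where "nact g a = (\<lambda>o'. wt g (fst o') * m.L (perm_of g) a o')"
definition eact where "eact g ph = (\<lambda>o'. wt g (fst o') * w.L (perm_of g) ph o')"

lemma q_add: "q (a + b) = q a + q b"
 unfolding q_def by (simp only: plus_fun_apply distrib_right cfun.scale_left_distrib sum.distrib)

lemma q_fscale: "q (fscale c a) = fscale c (q a)"
 unfolding q_def by (simp only: fscale_apply mult.assoc cfun.scale_sum_right cfun.scale_scale)

lemma q_zero [simp]: "q 0 = 0"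
 unfolding q_def by (simp only: zero_fun_apply mult_zero_left cfun.scale_zero_left sum.neutral_const)

lemma Psi_eact: assumes "g \<in> carrier (Grn r n)" shows "Psi (eact g ph) = nact g (Psi ph)"
proof -
 have "Psi (\<lambda>o'. h (fst o') * y o') = (\<lambda>o'. h (fst o') * Psi y o')" for h y
  by (rule ext) (auto simp: Psi_def sum_distrib_left split: prod.split)
 thus ?thesis unfolding eact_def nact_def Psi_L[OF Grn_mono(2)[OF assms], symmetric] .
qed

abbreviation gact where "gact \<equiv> ract (gelfand_model r p n)"

lemma gact_def: "gact g f = (\<Sum>v\<in>absolute_involutions r p n.
  fscale (f v * model_coeff r n g v) (basis_vec (model_conj r n g v)))"
 by (simp add: gelfand_model_def)

lemma gact_add: "gact g (a + b) = gact g a + gact g b"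
 unfolding gact_def by (simp only: plus_fun_apply distrib_right cfun.scale_left_distrib sum.distrib)

lemma gact_fscale: "gact g (fscale c a) = fscale c (gact g a)"
 unfolding gact_def by (simp only: fscale_apply mult.assoc cfun.scale_sum_right cfun.scale_scale)

lemma gact_zero [simp]: "gact g 0 = 0"
 unfolding gact_def by (simp only: zero_fun_apply mult_zero_left cfun.scale_zero_left sum.neutral_const)

lemma gact_sum: "gact g (\<Sum>i\<in>A. f i) = (\<Sum>i\<in>A. gact g (f i))"
proof (induct A rule: infinite_finite_induct)
 case (insert x F) show ?case by (simp only: sum.insert[OF insert(1,2)] gact_add insert(3))
next
 case (infinite A) show ?case by (simp only: sum.infinite[OF infinite] gact_zero)
qed (simp only: sum.empty gact_zero)

lemma gact_basis: assumes "v \<in> absolute_involutions r p n"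
 shows "gact g (basis_vec v) = fscale (model_coeff r n g v) (basis_vec (model_conj r n g v))"
proof -
 have "gact g (basis_vec v) = (\<Sum>u\<in>absolute_involutions r p n. if u = v then fscale (model_coeff r n g v) (basis_vec (model_conj r n g v)) else 0)"
  unfolding gact_def
 proof (rule sum.cong[OF refl])
  fix u
  show "fscale (basis_vec v u * model_coeff r n g u) (basis_vec (model_conj r n g u)) =
    (if u = v then fscale (model_coeff r n g v) (basis_vec (model_conj r n g v)) else 0)"
  proof (cases "u = v")
   case True thus ?thesis by (simp add: basis_vec_def)
  next
   case False
   hence "basis_vec v u = 0" by (simp add: basis_vec_def)
   thus ?thesis using False by (simp only: mult_zero_left cfun.scale_zero_left if_False)
  qed
 qed
 thus ?thesis using finite_AI assms by (simp only: sum.delta if_True)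
qed

text \<open>Conjugation by a permutation matrix is \<open>mact\<close> on the pair, and it commutes
  with shifting all colours, hence passes to cosets.\<close>

lemma model_conj_co:
 assumes g: "g \<in> carrier (Grn r n)" and w: "w \<in> W"
 shows "model_conj r n g (co w) = co (mact (perm_of g) w)"
proof -
 define pe where "pe = perm_of g"
 have p: "pe permutes X" using Grn_mono(2)[OF g] by (simp add: pe_def)
 have i: "inv pe permutes X" by (rule permutes_inv[OF p])
 have P: "monm n pe (\<lambda>_. 1) \<in> carrier (Grn r n)" "perm_of (monm n pe (\<lambda>_. 1)) = pe"
  "\<And>j. j < n ==> ent (monm n pe (\<lambda>_. 1)) j = 1"
  using mono_Grn[OF p, of "\<lambda>_. 1"] by auto
 have Pi: "m_inv (Grn r n) (monm n pe (\<lambda>_. 1)) = monm n (inv pe) (\<lambda>_. 1)"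
  unfolding m_inv_Grn[OF P(1)] P(2) by (rule mono_cong) (simp add: P(3) permutes_less[OF i])
 have one: "monm n pe (\<lambda>_. 1) * mw u * monm n (inv pe) (\<lambda>_. 1) = mw (mact pe u)" if "u \<in> W" for u
 proof -
  obtain z f where u: "u = (z, f)" by (cases u)
  hence zf: "(z, f) \<in> W" using that by simp
  show ?thesis unfolding u mw_def prod.case mact_simp mono_mult[OF W_permutes[OF zf]] mono_mult[OF i]
   by (rule mono_cong) simp
 qed
 have comm: "mact pe (ZW k w) = ZW k (mact pe w)" for k
  by (cases w) (auto simp: fun_eq_iff permutes_less[OF i])
 have "model_conj r n g (co w) = (\<lambda>u. monm n pe (\<lambda>_. 1) * u * monm n (inv pe) (\<lambda>_. 1)) ` co w"
  unfolding model_conj_def Let_def perm_mat_mono pe_def[symmetric] Pi Grn_simps ..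
 also have "... = {monm n pe (\<lambda>_. 1) * mw (ZW (d * k) w) * monm n (inv pe) (\<lambda>_. 1) |k. True}"
  unfolding co_def by blast
 also have "... = co (mact pe w)"
  unfolding one[OF ZW_W[OF w]] comm co_def ..
 finally show ?thesis by (simp only: pe_def)
qed

text \<open>Divisibility of the exponent sum by \<open>p\<close> makes the product of the entries a
  power of zeta^p, and \<open>d * p = r\<close>.\<close>

lemma prod_ent_d:
 assumes "g \<in> carrier (Grpn r p n)"
 shows "g \<in> carrier (Grn r n)" "(\<Prod>j<n. ent g j) ^ d = 1"
proof -
 show g: "g \<in> carrier (Grn r n)" using assms by (simp add: Grpn_def)
 obtain t where t: "zsum r g = int p * t" using assms by (auto simp: Grpn_def dvd_def)
 have "(\<Prod>j<n. ent g j) ^ d = (zeta r powi zsum r g) powi int d"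
  by (simp add: zsum_ent[OF g])
 also have "... = zeta r powi (zsum r g * int d)" by (rule power_int_mult[symmetric])
 also have "zsum r g * int d = int r * t"
 proof -
  have ri: "int r = int d * int p" using r_eq by (metis of_nat_mult)
  show ?thesis unfolding t ri by (simp only: mult_ac)
 qed
 also have "zeta r powi (int r * t) = 1" using zeta_pow(1) by (simp only: power_int_mult power_int_of_nat) simp
 finally show "(\<Prod>j<n. ent g j) ^ d = 1" .
qed

lemma ent_pow_mod: assumes "g \<in> carrier (Grn r n)" "j < n" shows "ent g j ^ (k mod r) = ent g j ^ k"
proof -
 have "ent g j ^ k = ent g j ^ (k mod r + r * (k div r))" by simp
 also have "... = ent g j ^ (k mod r)" using Grn_mono(3)[OF assms] by (simp only: power_add power_mult power_one mult_1_right)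
 finally show ?thesis by simp
qed

text \<open>The chosen lift differs from \<open>w\<close> by \<open>d * k\<close> in every colour.
  In the pairing this costs a power of the \<open>d\<close>-th power of the product of entries,
  which is 1 on G(r,p,n), and in \<open>a_exp\<close> it cancels from the difference. What remains
  of \<open>a_exp\<close> is the quotient of the normalising factors of \<open>q\<close> before and
  after the move.\<close>

lemma model_coeff_co:
 assumes g: "g \<in> carrier (Grpn r p n)" and w: "w \<in> W"
 shows "model_coeff r n g (co w) * inverse (zeta r ^ fst w 0) =
  wt g (fst (mact (perm_of g) w)) * inverse (zeta r ^ fst (mact (perm_of g) w) 0)"
proof -
 note G = prod_ent_d[OF g]
 define pe where "pe = perm_of g"
 have p: "pe permutes X" using Grn_mono(2)[OF G(1)] by (simp add: pe_def)
 have i: "inv pe permutes X" by (rule permutes_inv[OF p])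
 define u where "u = (SOME u. u \<in> co w)"
 have "mw (ZW (d * 0) w) \<in> co w" unfolding co_def by blast
 hence "u \<in> co w" unfolding u_def by (rule someI)
 then obtain k where k: "u = mw (ZW (d * k) w)" unfolding co_def by blast
 obtain z f where w': "w = (z, f)" by (cases w)
 define z1 where "z1 = (\<lambda>y. if y < n then (z y + d * k) mod r else z y)"
 have u: "u = mw (z1, f)" by (simp add: k w' z1_def)
 have W1: "(z1, f) \<in> W" using ZW_W[OF w, of "d * k"] by (simp add: w' z1_def)
 \<comment> \<open>\<open>model_coeff\<close> branches on symmetry. A lift that is both symmetric
   and antisymmetric would have a vanishing entry where a root of unity stands.\<close>
 have nsym: "\<not> symmetric_coset (co w)"
 proof
  assume "symmetric_coset (co w)"
  hence "transpose_mat u = u" using \<open>u \<in> co w\<close> by (simp add: symmetric_coset_def)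
  hence e: "u = - u" using mw_antisym[OF W1] by (simp add: u)
  have i0: "f 0 < n" using W_D(2)[OF W1] n_pos by simp
  have "u $$ (f 0, 0) = (- u) $$ (f 0, 0)" by (rule arg_cong[OF e])
  hence "u $$ (f 0, 0) = - (u $$ (f 0, 0))" using i0 n_pos by (simp add: u mw_def)
  hence "zeta r ^ z1 0 = - (zeta r ^ z1 0)" using i0 n_pos by (simp add: u mw_def)
  thus False using zeta_pow(2) by simp
 qed
 have pair: "zeta r powi z_pairing r n g u = (\<Prod>j<n. ent g j ^ z j)"
 proof -
  have "zeta r powi z_pairing r n g u = (\<Prod>j<n. zeta r powi (zexp r g j * zexp r u j))"
   by (simp only: z_pairing_def zeta_powi_sum)
  also have "... = (\<Prod>j<n. ent g j ^ z j * ent g j ^ (d * k))"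
  proof (rule prod.cong[OF refl])
   fix j assume "j \<in> X"
   hence j: "j < n" by simp
   have "zeta r powi (zexp r g j * zexp r u j) = ent g j ^ z1 j"
    unfolding u zexp_mw[OF W1 j] power_int_mult zexp_ent(3)[OF G(1) j] by simp
   also have "... = ent g j ^ (z j + d * k)" using j by (simp add: z1_def ent_pow_mod[OF G(1) j])
   finally show "zeta r powi (zexp r g j * zexp r u j) = ent g j ^ z j * ent g j ^ (d * k)" by (simp add: power_add)
  qed
  also have "... = (\<Prod>j<n. ent g j ^ z j) * ((\<Prod>j<n. ent g j) ^ d) ^ k"
   by (simp add: prod.distrib prod_power_distrib power_mult)
  finally show ?thesis by (simp add: G(2))
 qed
 have wtg: "wt g (z \<circ> inv pe) = (\<Prod>j<n. ent g j ^ z j)"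
  unfolding wt_def by (rule prod.cong[OF refl]) (simp add: pe_def[symmetric] permutes_inverses[OF p])
 have i0: "inv pe 0 < n" using n_pos by (simp add: permutes_less[OF i])
 have zz: "zeta r ^ z1 y = zeta r ^ z y * zeta r ^ (d * k)" if "y < n" for y
  using that by (simp add: z1_def zeta_mod power_add)
 have aexp: "zeta r powi a_exp r g u = zeta r ^ z 0 * inverse (zeta r ^ z (inv pe 0))"
 proof -
  have "zeta r powi a_exp r g u = zeta r ^ z1 0 / zeta r ^ z1 (inv pe 0)"
   unfolding a_exp_def u pe_def[symmetric] zexp_mw[OF W1 n_pos] zexp_mw[OF W1 i0]
   using zeta_pow(2) by (simp add: power_int_diff)
  thus ?thesis using zz[OF n_pos] zz[OF i0] zeta_pow(2) by (simp add: field_simps)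
 qed
 have "model_coeff r n g (co w) = (\<Prod>j<n. ent g j ^ z j) * (zeta r ^ z 0 * inverse (zeta r ^ z (inv pe 0)))"
  unfolding model_coeff_def Let_def u_def[symmetric] pair aexp using nsym by simp
 thus ?thesis
  using zeta_pow(2) by (simp add: w' pe_def[symmetric] wtg)
qed

lemma q_nact:
 assumes g: "g \<in> carrier (Grpn r p n)"
 shows "q (nact g a) = gact g (q a)"
proof -
 note G = prod_ent_d(1)[OF g]
 define pe where "pe = perm_of g"
 have p: "pe permutes X" using Grn_mono(2)[OF G] by (simp add: pe_def)
 have "q (nact g a) = (\<Sum>w\<in>W. fscale (nact g a (mact pe w) * inverse (zeta r ^ fst (mact pe w) 0)) (basis_vec (co (mact pe w))))"
  unfolding q_def
  by (rule sum.reindex_bij_witness[of _ "mact pe" "mact (inv pe)"])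
    (simp_all only: m.act_inv[OF p] W_mact_iff[OF p] W_mact_iff[OF permutes_inv[OF p]])
 also have "... = (\<Sum>w\<in>W. fscale (a w * inverse (zeta r ^ fst w 0)) (gact g (basis_vec (co w))))"
 proof (rule sum.cong[OF refl])
  fix w assume w: "w \<in> W"
  have ai: "co w \<in> absolute_involutions r p n" using co_AS[OF w] by (simp add: AS_def)
  have "nact g a (mact pe w) = wt g (fst (mact pe w)) * a w"
   unfolding nact_def pe_def[symmetric] m.L_def m.act_inv[OF p] ..
  hence "nact g a (mact pe w) * inverse (zeta r ^ fst (mact pe w) 0) =
    a w * inverse (zeta r ^ fst w 0) * model_coeff r n g (co w)"
   using model_coeff_co[OF g w, folded pe_def] by (simp only: mult_ac)
  thus "fscale (nact g a (mact pe w) * inverse (zeta r ^ fst (mact pe w) 0)) (basis_vec (co (mact pe w))) =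
    fscale (a w * inverse (zeta r ^ fst w 0)) (gact g (basis_vec (co w)))"
   unfolding gact_basis[OF ai] model_conj_co[OF G w, folded pe_def] cfun.scale_scale by (rule arg_cong)
 qed
 also have "... = gact g (q a)" unfolding q_def gact_sum gact_fscale ..
 finally show ?thesis .
qed

definition shz :: "nat => (nat => nat) => nat => nat" where
 "shz k z = (\<lambda>y. if y < n then (z y + k) mod r else z y)"

lemma ZW_shz: "ZW k (z, x) = (shz k z, x)"
 by (simp add: shz_def)

text \<open>Pullback along the colour shift, cut off to colours below \<open>r\<close>: without the
  cut-off, reduction modulo \<open>r\<close> would identify different words.\<close>

definition Zf :: "nat => ((nat => nat) \<times> 'x => complex) => (nat => nat) \<times> 'x => complex" where
 "Zf k ph = (\<lambda>o'. if \<forall>x<n. fst o' x < r then ph (ZW k o') else 0)"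

lemma Zf_add: "Zf k (a + b) = Zf k a + Zf k b"
 and Zf_fscale: "Zf k (fscale c a) = fscale c (Zf k a)"
 and Zf_zero [simp]: "Zf k 0 = 0"
 by (auto simp: Zf_def fun_eq_iff)

lemma evec_formula: "evec z rw cw (z', bw) = (if z' = z then
  (\<Sum>pe\<in>St X (pairf z cw). eps True pe * (if bw \<circ> pe = rw then 1 else 0)) else 0)"
proof (cases "z' = z")
 case True
 have "evec z rw cw (z, bw) = (\<Sum>pe\<in>St X (pairf z cw). eps True pe * (if bw \<circ> pe = rw then 1 else 0))"
  unfolding evec_def w.symm_apply
 proof (rule sum.cong[OF refl])
  fix pe assume p: "pe \<in> St X (pairf z cw)"
  hence pz: "pe \<in> St X z" using w.St_refine by blast
  have "wact (inv pe) (z, bw) = (z, bw \<circ> pe)"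
   by (simp add: permutes_inv_inv[OF St_permutes[OF pz]] St_comp_eq[OF pz])
  thus "eps True pe * basis_vec (z, rw) (wact (inv pe) (z, bw)) = eps True pe * (if bw \<circ> pe = rw then 1 else 0)"
   by (simp add: basis_vec_def)
 qed
 thus ?thesis using True by simp
next
 case False
 thus ?thesis using evec_colour by simp
qed

text \<open>\<open>r - k mod r\<close> is an inverse of \<open>k\<close> modulo \<open>r\<close>
  that stays within the naturals.\<close>

lemma shift_back: assumes "a < r" shows "((a + k) mod r + (r - k mod r)) mod r = a"
proof -
 have "((a + k) mod r + (r - k mod r)) mod r = (a + k + (r - k mod r)) mod r" by (rule mod_add_left_eq)
 also have "a + k + (r - k mod r) = a + (k div r + 1) * r"
 proof -
  have "k mod r < r" using s_pos by simp
  thus ?thesis using div_mult_mod_eq[of k r] by (simp add: algebra_simps)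
 qed
 also have "(a + (k div r + 1) * r) mod r = a" using assms by (simp only: mod_mult_self1 mod_less)
 finally show ?thesis .
qed

end

section \<open>Colour shifts of shapes and of functions\<close>

context gelp
begin

lemma shz_less: "x < n ==> shz k z x < r"
 using s_pos by (simp add: shz_def)

lemma shz_shz: "shz k (shz l z) = shz (k + l) z"
 by (auto simp: shz_def fun_eq_iff mod_simps ac_simps)

lemma shz_back: "(\<And>x. x < n ==> z x < r) ==> shz (r - k mod r) (shz k z) = z"
 by (auto simp: shz_def fun_eq_iff shift_back)

lemma shz_eq_iff: assumes "\<And>x. x < n ==> z x < r" "x < n" "y < n" shows "shz k z x = shz k z y \<longleftrightarrow> z x = z y"
proof
 note a = shift_back[OF assms(1)[OF assms(2)], of k] shift_back[OF assms(1)[OF assms(3)], of k]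
 assume "shz k z x = shz k z y"
 hence "(z x + k) mod r = (z y + k) mod r" using assms(2,3) by (simp add: shz_def)
 thus "z x = z y" by (metis a)
qed (simp add: shz_def assms)

lemma Tab_colour: "Tab z rw cw ==> x < n ==> z x < r"
 by (simp add: Tab_def)

lemma Tab_shz: assumes P: "Tab z rw cw" shows "Tab (shz k z) rw cw"
proof -
 note e = shz_eq_iff[OF Tab_colour[OF P]]
 have t: "tab X z rw cw" using P by (simp add: Tab_def)
 have "tab X (shz k z) rw cw"
  unfolding tab_def
 proof (intro conjI ballI allI impI)
  show "inj3 X (shz k z) rw cw"
   by (rule inj_onI) (use t e in \<open>auto simp: tab_def dest: inj3D\<close>)
 next
  fix y j assume y: "y \<in> X" "j < cw y"
  then obtain x where "x \<in> X" "z x = z y" "rw x = rw y" "cw x = j" using t unfolding tab_def by blast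
  thus "\<exists>x\<in>X. shz k z x = shz k z y \<and> rw x = rw y \<and> cw x = j" using e y by auto
 next
  fix y j assume y: "y \<in> X" "j < rw y"
  then obtain x where "x \<in> X" "z x = z y" "cw x = cw y" "rw x = j" using t unfolding tab_def by blast
  thus "\<exists>x\<in>X. shz k z x = shz k z y \<and> cw x = cw y \<and> rw x = j" using e y by auto
 qed
 thus ?thesis using P s_pos by (auto simp: Tab_def shz_def)
qed

lemma cnt_shz: assumes z: "\<And>x. x < n ==> z x < r" and c: "c < r" shows "cnt (shz k z) rw ((c + k) mod r) = cnt z rw c"
proof
 fix i
 have "(z x + k) mod r = (c + k) mod r \<longleftrightarrow> z x = c" if "x < n" for x
  using shift_back[OF z[OF that], of k] shift_back[OF c, of k] by metis
 hence "{x \<in> X. shz k z x = (c + k) mod r \<and> rw x = i} = {x \<in> X. z x = c \<and> rw x = i}"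
  by (auto simp: shz_def)
 thus "cnt (shz k z) rw ((c + k) mod r) i = cnt z rw c i" by (simp add: cnt_def)
qed

text \<open>The cyclic form is visibly invariant under shifting all colours, whereas the definition
  singles out the colours below \<open>s\<close>.\<close>

lemma doubled_iff: "doubled z rw \<longleftrightarrow> (\<forall>c<r. cnt z rw ((c + s) mod r) = cnt z rw c)"
proof
 assume D: "doubled z rw"
 show "\<forall>c<r. cnt z rw ((c + s) mod r) = cnt z rw c"
 proof (intro allI impI)
  fix c assume c: "c < r"
  show "cnt z rw ((c + s) mod r) = cnt z rw c"
  proof (cases "c < s")
   case True
   thus ?thesis using D c by (simp add: doubled_def add_s_mod)
  next
   case False
   hence "c - s < s" using c by simp
   hence "cnt z rw (c - s) = cnt z rw (c - s + s)" using D by (simp only: doubled_def)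
   thus ?thesis using False c by (simp add: add_s_mod)
  qed
 qed
next
 assume a: "\<forall>c<r. cnt z rw ((c + s) mod r) = cnt z rw c"
 show "doubled z rw"
  unfolding doubled_def
 proof (intro allI impI)
  fix c assume "c < s"
  hence c: "c < r" "(c + s) mod r = c + s" by auto
  from a[rule_format, OF c(1)] show "cnt z rw c = cnt z rw (c + s)" unfolding c(2) by (rule sym)
 qed
qed

lemma doubled_shz: assumes z: "\<And>x. x < n ==> z x < r" and D: "doubled z rw" shows "doubled (shz k z) rw"
 unfolding doubled_iff
proof (intro allI impI)
 fix c assume c: "c < r"
 define b where "b = (c + (r - k mod r)) mod r"
 have b: "b < r" using s_pos by (simp add: b_def)
 have "((b + k) mod r) = c"
 proof -
  have "k mod r < r" using s_pos by simp
  hence "c + (r - k mod r) + k = c + (k div r + 1) * r" using div_mult_mod_eq[of k r] by (simp add: algebra_simps)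
  hence "(b + k) mod r = (c + (k div r + 1) * r) mod r" unfolding b_def by (simp only: mod_add_left_eq)
  thus ?thesis using c by (simp only: mod_mult_self1 mod_less)
 qed
 moreover have "((b + s) mod r + k) mod r = ((b + k) mod r + s) mod r" by (simp add: mod_simps ac_simps)
 moreover have "cnt (shz k z) rw (((b + s) mod r + k) mod r) = cnt z rw ((b + s) mod r)"
  using s_pos by (intro cnt_shz z) auto
 moreover have "cnt z rw ((b + s) mod r) = cnt z rw b" using D b by (simp add: doubled_iff)
 moreover have "cnt z rw b = cnt (shz k z) rw ((b + k) mod r)" by (rule cnt_shz[OF z b, symmetric])
 ultimately show "cnt (shz k z) rw ((c + s) mod r) = cnt (shz k z) rw c" by simp
qed

lemma cnt_shz_s: assumes z: "\<And>x. x < n ==> z x < r" and D: "doubled z rw" shows "cnt (shz s z) rw = cnt z rw"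
proof
 fix c
 show "cnt (shz s z) rw c = cnt z rw c"
 proof (cases "c < r")
  case True
  have "cnt (shz s z) rw ((c + s) mod r) = cnt z rw ((c + s) mod r)" using cnt_shz[OF z True] D True by (simp add: doubled_iff)
  moreover have "doubled (shz s z) rw" by (rule doubled_shz[OF z D])
  ultimately show ?thesis using D True by (simp add: doubled_iff)
 next
  case False
  have "{x \<in> X. shz s z x = c \<and> rw x = i} = {}" "{x \<in> X. z x = c \<and> rw x = i} = {}" for i
   using False shz_less z by fastforce+
  thus ?thesis unfolding cnt_def by (simp only:)
 qed
qed

text \<open>Pulling back moves the support in the opposite direction, hence the complementary shift
  \<open>r - k mod r\<close>.\<close>

lemma Zf_evec: assumes P: "Tab z rw cw" shows "Zf k (evec z rw cw) = evec (shz (r - k mod r) z) rw cw"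
proof
 fix o' :: "wd"
 obtain z' bw where o': "o' = (z', bw)" by (cases o')
 note zr = Tab_colour[OF P]
 let ?l = "r - k mod r"
 have S: "St X (\<lambda>x. (shz ?l z x, cw x)) = St X (pairf z cw)"
  by (rule St_cong) (auto simp: shz_eq_iff[OF zr])
 show "Zf k (evec z rw cw) o' = evec (shz ?l z) rw cw o'"
 proof (cases "\<forall>x<n. z' x < r")
  case True
  have "shz k z' = z \<longleftrightarrow> z' = shz ?l z"
  proof
   assume "shz k z' = z" thus "z' = shz ?l z" using shz_back[of z' k] True by auto
  next
   assume e: "z' = shz ?l z"
   have "shz k (shz ?l z) = shz ?l (shz k z)" by (simp add: shz_shz add.commute)
   thus "shz k z' = z" using shz_back[OF zr] e by simp
  qed
  thus ?thesis using True by (simp add: Zf_def o' ZW_shz evec_formula S del: ZW_simp)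
 next
  case False
  hence "z' \<noteq> shz ?l z" using shz_less by blast
  hence "evec (shz ?l z) rw cw o' = 0" unfolding o' by (rule evec_colour)
  moreover have "Zf k (evec z rw cw) o' = 0" using False by (simp only: Zf_def o' fst_conv if_False)
  ultimately show ?thesis by simp
 qed
qed

lemma Zf_Bsp: assumes "ph \<in> Bsp" shows "Zf k ph \<in> Bsp"
 using assms unfolding Bsp_def
proof (induction rule: cfun.span_induct_alt)
 case base thus ?case by (simp only: Zf_zero cfun.span_zero)
next
 case (step c x y)
 then obtain z rw cw where x: "x = evec z rw cw" "Tab z rw cw" "doubled z rw" by blast
 have b: "Zf k x \<in> {evec z rw cw |z rw cw. Tab z rw cw \<and> doubled z rw}"
  unfolding x(1) Zf_evec[OF x(2)] using Tab_shz[OF x(2)] doubled_shz[OF Tab_colour[OF x(2)] x(3)] by blast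
 show ?case unfolding Zf_add Zf_fscale
  by (rule cfun.span_add[OF cfun.span_scale[OF cfun.span_base[OF b]] step(2)])
qed

lemma Psi_Zf: "w \<in> W ==> Psi (Zf k ph) w = Psi ph (ZW k w)"
proof -
 assume w: "w \<in> W"
 obtain z f where zf: "w = (z, f)" by (cases w)
 have "(shz k z, f) \<in> W" using ZW_W[OF w, of k] by (simp add: zf ZW_shz del: ZW_simp)
 moreover have "\<forall>x<n. z x < r" using W_less[OF w] by (simp add: zf)
 ultimately show ?thesis using w by (simp add: zf Psi_def Zf_def ZW_shz del: ZW_simp)
qed

text \<open>The lifts in a coset are the \<open>p\<close> distinct shifts of one of them by
  multiples of \<open>d\<close>, and the normalising factors vary along it by zeta^(-d k). So
  \<open>q\<close> sums over the coset against a character of the group of scalars.\<close>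

lemma q_at: assumes w: "w \<in> W"
 shows "q a (co w) * zeta r ^ fst w 0 = (\<Sum>k<p. inverse (zeta r ^ (d * k)) * a (ZW (d * k) w))"
proof -
 have inj: "inj_on (\<lambda>k. ZW (d * k) w) {..<p}"
 proof (rule inj_onI)
  fix k l assume kl: "k \<in> {..<p}" "l \<in> {..<p}" "ZW (d * k) w = ZW (d * l) w"
  hence "(fst w 0 + d * k) mod r = (fst w 0 + d * l) mod r"
   using n_pos by (cases w) (auto simp: fun_eq_iff dest: spec[of _ 0])
  hence "(d * k + fst w 0) mod r = (d * l + fst w 0) mod r" by (simp only: add.commute)
  moreover have "d * k < r" "d * l < r" using kl r_eq dp_pos by auto
  ultimately have "d * k = d * l" using shift_back by metis
  thus "k = l" using dp_pos by simp
 qed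
 have "w' \<in> (\<lambda>k. ZW (d * k) w) ` {..<p}" if "w' \<in> W" "co w = co w'" for w'
 proof -
  have "\<exists>k. w' = ZW (d * k) w" using co_eq_iff[OF w that(1)] that(2) by blast
  then obtain k where k: "w' = ZW (d * k) w" by blast
  have "d * (k mod p) = (d * k) mod r" by (simp only: r_eq mult_mod_right)
  hence "w' = ZW (d * (k mod p)) w" using ZW_mod k by metis
  thus ?thesis using dp_pos by auto
 qed
 moreover have "ZW (d * k) w \<in> W \<and> co w = co (ZW (d * k) w)" for k
  using ZW_W[OF w] co_eq_iff[OF w ZW_W[OF w]] by blast
 ultimately have set: "{w'\<in>W. co w' = co w} = (\<lambda>k. ZW (d * k) w) ` {..<p}" by (auto simp: eq_commute[of _ "co w"])
 have "q a (co w) = (\<Sum>w'\<in>W. if co w' = co w then a w' * inverse (zeta r ^ fst w' 0) else 0)"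
  unfolding q_def sum_fun_apply by (rule sum.cong[OF refl]) (auto simp: basis_vec_def)
 also have "... = (\<Sum>w'\<in>{w'\<in>W. co w' = co w}. a w' * inverse (zeta r ^ fst w' 0))"
  by (rule sum.inter_filter[OF finite_W, symmetric])
 also have "... = (\<Sum>k<p. a (ZW (d * k) w) * inverse (zeta r ^ fst (ZW (d * k) w) 0))"
  unfolding set by (rule sum.reindex[OF inj, unfolded comp_def])
 also have "... = (\<Sum>k<p. a (ZW (d * k) w) * (inverse (zeta r ^ (d * k)) * inverse (zeta r ^ fst w 0)))"
 proof (rule sum.cong[OF refl])
  fix k
  have "zeta r ^ fst (ZW (d * k) w) 0 = zeta r ^ fst w 0 * zeta r ^ (d * k)"
   using n_pos by (cases w) (simp add: zeta_mod power_add)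
  thus "a (ZW (d * k) w) * inverse (zeta r ^ fst (ZW (d * k) w) 0) =
    a (ZW (d * k) w) * (inverse (zeta r ^ (d * k)) * inverse (zeta r ^ fst w 0))" by (simp add: mult_ac)
 qed
 finally have qe: "q a (co w) = (\<Sum>k<p. a (ZW (d * k) w) * (inverse (zeta r ^ (d * k)) * inverse (zeta r ^ fst w 0)))" .
 have nz: "zeta r ^ fst w 0 \<noteq> 0" using zeta_pow(2) by simp
 have gen: "a * (i * inverse Z) * Z = i * a" if "Z \<noteq> 0" for a i Z :: complex
  using that by simp
 show ?thesis unfolding qe sum_distrib_right by (rule sum.cong[OF refl], rule gen[OF nz])
qed

text \<open>Because of that character, shifting the colours by \<open>d * k\<close> before the
  descent only multiplies the result by a root of unity. One shape from each orbit therefore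
  suffices for the image.\<close>

lemma q_Zf: assumes a: "\<And>w. w \<in> W ==> b w = a (ZW (d * k) w)"
 shows "q b = fscale (zeta r ^ (d * k)) (q a)"
proof -
 have inv: "ZW (r - (d * k) mod r) (ZW (d * k) w) = w" "ZW (d * k) (ZW (r - (d * k) mod r) w) = w" if "w \<in> W" for w
 proof -
  show "ZW (r - (d * k) mod r) (ZW (d * k) w) = w"
   using shz_back[of "fst w" "d * k"] W_less[OF that] by (cases w) (simp add: ZW_shz del: ZW_simp)
  thus "ZW (d * k) (ZW (r - (d * k) mod r) w) = w" by (simp only: ZW_add add.commute)
 qed
 have "fscale (zeta r ^ (d * k)) (q a) = (\<Sum>w\<in>W. fscale (zeta r ^ (d * k) * (a w * inverse (zeta r ^ fst w 0))) (basis_vec (co w)))"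
  by (simp only: q_def cfun.scale_sum_right cfun.scale_scale)
 also have "... = (\<Sum>w\<in>W. fscale (b w * inverse (zeta r ^ fst w 0)) (basis_vec (co w)))"
 proof (rule sum.reindex_bij_witness[of _ "ZW (d * k)" "ZW (r - (d * k) mod r)"])
  fix w assume w: "w \<in> W"
  show "ZW (d * k) (ZW (r - (d * k) mod r) w) = w" by (rule inv(2)[OF w])
  show "ZW (r - (d * k) mod r) w \<in> W" by (rule ZW_W[OF w])
  let ?w = "ZW (r - (d * k) mod r) w"
  have W': "?w \<in> W" by (rule ZW_W[OF w])
  have c: "co ?w = co w" using co_eq_iff[OF W' w] inv(2)[OF w] by metis
  have "zeta r ^ fst (ZW (d * k) ?w) 0 = zeta r ^ fst ?w 0 * zeta r ^ (d * k)"
   using n_pos by (cases ?w) (simp add: zeta_mod power_add)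
  hence "zeta r ^ fst w 0 = zeta r ^ fst ?w 0 * zeta r ^ (d * k)" by (simp only: inv(2)[OF w])
  hence "b ?w * inverse (zeta r ^ fst ?w 0) = zeta r ^ (d * k) * (a w * inverse (zeta r ^ fst w 0))"
   using a[OF W'] zeta_pow(2) by (simp add: inv(2)[OF w])
  thus "fscale (b ?w * inverse (zeta r ^ fst ?w 0)) (basis_vec (co ?w)) =
    fscale (zeta r ^ (d * k) * (a w * inverse (zeta r ^ fst w 0))) (basis_vec (co w))"
   by (simp only: c)
 next
  fix w assume w: "w \<in> W"
  show "ZW (r - (d * k) mod r) (ZW (d * k) w) = w" by (rule inv(1)[OF w])
  show "ZW (d * k) w \<in> W" by (rule ZW_W[OF w])
 qed
 finally show ?thesis by (simp only: q_def)
qed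

section \<open>Spaces of prescribed shapes and the map to the submodel\<close>

definition SpK where "SpK K = cfun.span {evec z rw cw |z rw cw. Tab z rw cw \<and> cnt z rw \<in> K}"
text \<open>The eigenvalue is -1 because the shift by \<open>s\<close>, a multiple of
  \<open>d\<close>, becomes multiplication by zeta^s = -1 on cosets.\<close>

definition EK where "EK K = {ph \<in> SpK K. Zf s ph = fscale (-1) ph}"

lemma SpK_support: assumes "ph \<in> SpK K" "ph (z, bw) \<noteq> 0"
 shows "(\<forall>x<n. z x < r) \<and> (\<forall>x\<ge>n. z x = 0 \<and> bw x = 0) \<and> (\<forall>x<n. bw x < n) \<and> cnt z bw \<in> K"
proof (rule ccontr)
 assume neg: "\<not> ?thesis"
 have "ph (z, bw) = 0" using assms(1) unfolding SpK_def
 proof (induction rule: cfun.span_induct_alt)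
  case (step c x y)
  then obtain z' rw cw where x: "x = evec z' rw cw" "Tab z' rw cw" "cnt z' rw \<in> K" by blast
  have "x (z, bw) = 0"
  proof (rule ccontr)
   assume nz: "x (z, bw) \<noteq> 0"
   hence z: "z = z'" using evec_colour x(1) by metis
   have "\<exists>pe\<in>St X (pairf z' cw). bw \<circ> pe = rw"
   proof (rule ccontr)
    assume "\<not> ?thesis"
    hence "x (z, bw) = 0" unfolding x(1) evec_formula by (auto intro!: sum.neutral)
    thus False using nz by simp
   qed
   then obtain pe where p: "pe \<in> St X (pairf z' cw)" "bw \<circ> pe = rw" by blast
   have pz: "pe \<in> St X z'" using p(1) w.St_refine by blast
   note pp = St_permutes[OF pz]
   have b: "bw = rw \<circ> inv pe" using p(2) permutes_inv_o[OF pp] by (metis comp_assoc comp_id)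
   have c: "cnt z bw = cnt z' rw" unfolding z b by (rule cnt_comp[OF St_inv[OF pz]])
   have "\<forall>x\<ge>n. bw x = 0"
    using x(2) permutes_not_in[OF permutes_inv[OF pp]] by (auto simp: b Tab_def)
   moreover have "\<forall>x<n. bw x < n"
    using Tab_Rw[OF x(2)] permutes_less[OF permutes_inv[OF pp]] by (auto simp: b Rw_def)
   moreover have "(\<forall>x<n. z x < r) \<and> (\<forall>x\<ge>n. z x = 0)" using x(2) by (auto simp: z Tab_def)
   ultimately show False using neg c x(3) by auto
  qed
  thus ?case using step by simp
 qed simp
 thus False using assms(2) by simp
qed

text \<open>The total colour is the sum of c times the number of letters of colour c in each row, so
  it depends on the shape alone.\<close>

lemma sum_colours: assumes e: "cnt z bw = cnt z' bw" and z: "\<And>x. x < n ==> z x < r" "\<And>x. x < n ==> z' x < r"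
 shows "(\<Sum>x<n. z x) = (\<Sum>x<n. z' x)"
proof -
 have "(\<Sum>x<n. z x) = (\<Sum>c<r. \<Sum>i\<in>bw ` X. c * cnt z bw c i)" if z: "\<And>x. x < n ==> z x < r" for z
 proof -
  have "(\<Sum>x<n. z x) = (\<Sum>c<r. \<Sum>x\<in>{x\<in>X. z x = c}. z x)"
   by (rule sum.group[symmetric]) (use z in auto)
  also have "... = (\<Sum>c<r. \<Sum>i\<in>bw ` X. \<Sum>x\<in>{x\<in>{x\<in>X. z x = c}. bw x = i}. z x)"
   by (rule sum.cong[OF refl], rule sum.group[symmetric]) auto
  also have "... = (\<Sum>c<r. \<Sum>i\<in>bw ` X. c * cnt z bw c i)"
  proof (intro sum.cong refl)
   fix c i
   have "(\<Sum>x\<in>{x\<in>{x\<in>X. z x = c}. bw x = i}. z x) = (\<Sum>x\<in>{x\<in>X. z x = c \<and> bw x = i}. c)"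
    by (rule sum.cong) auto
   thus "(\<Sum>x\<in>{x\<in>{x\<in>X. z x = c}. bw x = i}. z x) = c * cnt z bw c i" by (simp add: cnt_def)
  qed
  finally show ?thesis .
 qed
 from this[OF z(1)] this[OF z(2)] show ?thesis by (simp add: e)
qed

lemma Bsp_SpK: assumes "\<And>z rw cw. Tab z rw cw ==> cnt z rw \<in> K ==> doubled z rw" shows "SpK K \<subseteq> Bsp"
 unfolding SpK_def Bsp_def by (rule cfun.span_mono) (use assms in blast)

end

text \<open>\<open>K\<close> is a transversal of the doubled shapes: all its tableaux are doubled
  (\<open>K1\<close>), every doubled shape can be shifted into \<open>K\<close> (\<open>K2\<close>),
  and shapes in \<open>K\<close> that are shifts of each other coincide (\<open>K3\<close>).\<close>

locale gelK = gelp +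
 fixes K :: "(nat => nat => nat) set"
 assumes K1: "\<And>z rw cw. Tab z rw cw ==> cnt z rw \<in> K ==> doubled z rw"
  and K2: "\<And>z rw cw. Tab z rw cw ==> doubled z rw ==> \<exists>k. cnt (shz (d * k) z) rw \<in> K"
  and K3: "\<And>z bw k. (\<And>x. x < n ==> z x < r) ==> (\<And>x. x < n ==> bw x < n) ==> cnt z bw \<in> K ==>
   cnt (shz (d * k) z) bw \<in> K ==> cnt (shz (d * k) z) bw = cnt z bw"
  and gcd: "gcd p n = 2"
begin

text \<open>The shift by \<open>d * k\<close> adds \<open>n * d * k\<close> to the total colour
  modulo \<open>r\<close>, while equal shapes have equal totals. So \<open>d * p\<close> divides
  \<open>n * d * k\<close>, and \<open>gcd p n = 2\<close> leaves only the multiples of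
  \<open>p div 2\<close>.\<close>

lemma stabiliser:
 assumes z: "\<And>x. x < n ==> z x < r" and e: "cnt (shz (d * k) z) bw = cnt z bw"
 shows "p div 2 dvd k"
proof -
 have "(\<Sum>x<n. shz (d * k) z x) = (\<Sum>x<n. z x)"
  by (rule sum_colours[OF e]) (use shz_less z in auto)
 moreover have "(\<Sum>x<n. shz (d * k) z x) mod r = (\<Sum>x<n. z x + d * k) mod r"
  by (subst (1 2) mod_sum_eq[symmetric]) (rule arg_cong[of _ _ "\<lambda>u. u mod r"], rule sum.cong, auto simp: shz_def)
 ultimately have "((\<Sum>x<n. z x) + n * (d * k)) mod r = (\<Sum>x<n. z x) mod r" by (simp add: sum.distrib)
 hence "r dvd n * (d * k)" by (metis add_diff_cancel_left' le_add1 mod_eq_dvd_iff_nat)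
 hence "d * p dvd d * (n * k)" by (simp only: r_eq mult.left_commute)
 hence "p dvd n * k" using dp_pos by simp
 moreover obtain p' where p': "p = 2 * p'" using p_even by blast
 moreover obtain n' where n': "n = 2 * n'" using gcd by (metis dvdE gcd_dvd2)
 ultimately have "p' dvd n' * k" by (simp add: mult.assoc)
 moreover have "coprime p' n'"
 proof -
  have "gcd p n = 2 * gcd p' n'" unfolding p' n' by (rule gcd_mult_distrib_nat[symmetric])
  thus ?thesis using gcd by (simp add: coprime_iff_gcd_eq_1)
 qed
 ultimately have "p' dvd k" by (simp add: coprime_dvd_mult_right_iff)
 thus ?thesis by (simp add: p')
qed

definition Theta where "Theta ph = q (Psi ph)"

lemma EK_Bsp: "ph \<in> EK K ==> ph \<in> Bsp"
 using Bsp_SpK[of K] K1 by (auto simp: EK_def)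

text \<open>Vanishing on all cosets means that \<open>Psi\<close> kills the sum \<open>ph'\<close>
  of the shifts of \<open>ph\<close> weighted by the character, so \<open>ph' = 0\<close>. At a
  given word only the shifts by 0 and by \<open>s\<close> keep the shape in \<open>K\<close>; in the
  second term the character value -1 and the eigenvalue -1 cancel, so \<open>ph\<close> is counted
  twice.\<close>

theorem Theta_injective: assumes E: "ph \<in> EK K" and 0: "Theta ph = 0" shows "ph = 0"
proof (rule ccontr)
 assume "ph \<noteq> 0"
 then obtain z bw where nz: "ph (z, bw) \<noteq> 0" by (auto simp: fun_eq_iff)
 have Sp: "ph \<in> SpK K" and anti: "Zf s ph = fscale (-1) ph" using E by (auto simp: EK_def)
 note supp = SpK_support[OF Sp nz]
 define ph' where "ph' = (\<Sum>k<p. fscale (inverse (zeta r ^ (d * k))) (Zf (d * k) ph))"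
 have B: "ph' \<in> Bsp" unfolding ph'_def
  by (intro subspace_sum[OF subspace_Bsp] cfun.subspace_scale[OF subspace_Bsp] Zf_Bsp EK_Bsp E)
 have "Psi ph' = 0"
 proof
  fix w :: "wd"
  show "Psi ph' w = 0 w"
  proof (cases "w \<in> W")
   case True
   have "Psi ph' w = (\<Sum>k<p. inverse (zeta r ^ (d * k)) * Psi ph (ZW (d * k) w))"
    unfolding ph'_def Psi_sum Psi_fscale sum_fun_apply fscale_apply Psi_Zf[OF True] ..
   also have "... = q (Psi ph) (co w) * zeta r ^ fst w 0" by (rule q_at[OF True, symmetric])
   also have "... = 0" using 0 by (simp add: Theta_def)
   finally show ?thesis by simp
  next
   case False
   thus ?thesis by (cases w) (simp add: Psi_def)
  qed
 qed
 from Psi_injective[OF B this] have "ph' (z, bw) = 0" by simp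
 hence sum0: "(\<Sum>k<p. inverse (zeta r ^ (d * k)) * Zf (d * k) ph (z, bw)) = 0"
  by (simp only: ph'_def sum_fun_apply fscale_apply)
 \<comment> \<open>\<open>K3\<close> improves membership in \<open>K\<close> to equality of shapes,
   and \<open>stabiliser\<close> then excludes every other \<open>k\<close> below
   \<open>p\<close>.\<close>
 have vanish: "Zf (d * k) ph (z, bw) = 0" if k: "k < p" "k \<noteq> 0" "k \<noteq> p div 2" for k
 proof (rule ccontr)
  assume "Zf (d * k) ph (z, bw) \<noteq> 0"
  hence "ph (shz (d * k) z, bw) \<noteq> 0" by (auto simp: Zf_def ZW_shz simp del: ZW_simp split: if_splits)
  from SpK_support[OF Sp this] have "cnt (shz (d * k) z) bw \<in> K" by blast
  hence "cnt (shz (d * k) z) bw = cnt z bw" using supp by (intro K3) auto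
  hence "p div 2 dvd k" using supp by (intro stabiliser) auto
  then obtain l where l: "k = p div 2 * l" by blast
  obtain p' where p': "p = 2 * p'" using p_even by blast
  have "p div 2 = p'" using p' by simp
  hence kl: "k = p' * l" using l by simp
  have "p' * l < p' * 2" using k(1) by (simp only: kl p' mult.commute)
  hence "l < 2" by simp
  hence "l = 0 \<or> l = 1" by auto
  thus False using k(2,3) kl \<open>p div 2 = p'\<close> by auto
 qed
 have h: "0 < p div 2" "p div 2 < p" using p_even dp_pos by (auto elim!: evenE)
 have "(\<Sum>k<p. inverse (zeta r ^ (d * k)) * Zf (d * k) ph (z, bw)) =
   (\<Sum>k\<in>{0, p div 2}. inverse (zeta r ^ (d * k)) * Zf (d * k) ph (z, bw))"
  by (rule sum.mono_neutral_right) (use h vanish in auto)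
 also have "... = Zf 0 ph (z, bw) - Zf s ph (z, bw)"
  using h s_eq zeta_s by simp
 also have "Zf 0 ph (z, bw) = ph (z, bw)" using supp ZW_0[of "(z, bw)"] by (simp add: Zf_def)
 also have "Zf s ph (z, bw) = - ph (z, bw)" by (simp add: anti)
 finally show False using sum0 nz by simp
qed

lemma Theta_add: "Theta (a + b) = Theta a + Theta b"
 and Theta_fscale: "Theta (fscale c a) = fscale c (Theta a)"
 by (simp_all only: Theta_def Psi_add Psi_fscale q_add q_fscale)

lemma subspace_EK: "cfun.subspace (EK K)"
proof (rule cfun.subspaceI)
 note S = cfun.subspace_span[of "{evec z rw cw |z rw cw. Tab z rw cw \<and> cnt z rw \<in> K}", folded SpK_def]
 show "0 \<in> EK K" using cfun.subspace_0[OF S] by (simp only: EK_def mem_Collect_eq Zf_zero cfun.scale_zero_right simp_thms)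
 show "x + y \<in> EK K" if "x \<in> EK K" "y \<in> EK K" for x y
  using that cfun.subspace_add[OF S, of x y] by (simp only: EK_def mem_Collect_eq Zf_add cfun.scale_right_distrib simp_thms)
 show "fscale c x \<in> EK K" if "x \<in> EK K" for c x
  using that cfun.subspace_scale[OF S, of x c] by (simp only: EK_def mem_Collect_eq Zf_fscale cfun.scale_left_commute[of c] simp_thms)
qed

text \<open>By \<open>Psi_surjective\<close> all basis vectors of cosets are reached from
  \<open>Bsp\<close>, so it is enough to move a generator of \<open>Bsp\<close> into
  \<open>EK K\<close>: shifting its shape into \<open>K\<close> costs a scalar, and projecting to
  the -1 eigenspace is invisible after the descent.\<close>

theorem Theta_image: "Theta ` EK K = cfun.span (basis_vec ` AS)"
proof (rule antisym)
 show "Theta ` EK K \<subseteq> cfun.span (basis_vec ` AS)"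
 proof
  fix y assume "y \<in> Theta ` EK K"
  then obtain ph where y: "y = (\<Sum>w\<in>W. fscale (Psi ph w * inverse (zeta r ^ fst w 0)) (basis_vec (co w)))"
   unfolding Theta_def q_def by blast
  show "y \<in> cfun.span (basis_vec ` AS)"
   unfolding y by (rule cfun.span_sum, rule cfun.span_scale, rule cfun.span_base, rule imageI, rule co_AS)
 qed
 have subT: "cfun.subspace (Theta ` EK K)"
 proof (rule cfun.subspaceI)
  have "Theta 0 = 0" by (simp only: Theta_def Psi_zero q_zero)
  thus "0 \<in> Theta ` EK K" using cfun.subspace_0[OF subspace_EK] by (metis imageI)
  show "x + y \<in> Theta ` EK K" if xy: "x \<in> Theta ` EK K" "y \<in> Theta ` EK K" for x y
  proof -
   from xy obtain x' y' where "x = Theta x'" "y = Theta y'" "x' \<in> EK K" "y' \<in> EK K" by blast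
   thus ?thesis using cfun.subspace_add[OF subspace_EK, of x' y'] Theta_add[of x' y'] by (metis imageI)
  qed
  show "fscale c x \<in> Theta ` EK K" if xy: "x \<in> Theta ` EK K" for c x
  proof -
   from xy obtain x' where "x = Theta x'" "x' \<in> EK K" by blast
   thus ?thesis using cfun.subspace_scale[OF subspace_EK, of x' c] Theta_fscale[of c x'] by (metis imageI)
  qed
 qed
 have gen: "Theta (evec z rw cw) \<in> Theta ` EK K" if P: "Tab z rw cw" and D: "doubled z rw" for z rw cw
 proof -
  obtain k where k: "cnt (shz (d * k) z) rw \<in> K" using K2[OF P D] by blast
  define z' where "z' = shz (d * k) z"
  note zr = Tab_colour[OF P]
  have P': "Tab z' rw cw" unfolding z'_def by (rule Tab_shz[OF P])
  have D': "doubled z' rw" unfolding z'_def by (rule doubled_shz[OF zr D])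
  have "Zf (d * k) (evec z' rw cw) = evec z rw cw"
  proof -
   have "shz (r - (d * k) mod r) z' = z" unfolding z'_def by (rule shz_back) (rule zr)
   thus ?thesis by (simp only: Zf_evec[OF P'])
  qed
  hence "Theta (evec z rw cw) = fscale (zeta r ^ (d * k)) (Theta (evec z' rw cw))"
   unfolding Theta_def by (intro q_Zf) (metis Psi_Zf)
  moreover have "Theta (evec z' rw cw) \<in> Theta ` EK K"
  proof -
   define e where "e = evec z' rw cw"
   \<comment> \<open>The projection of \<open>e\<close> to the -1 eigenspace. Since
     \<open>Zf s e\<close> has image \<open>- Theta e\<close>, both terms contribute one half of
     \<open>Theta e\<close>.\<close>
   define ph where "ph = fscale (1/2) (e + fscale (-1) (Zf s e))"
   have Ze: "Zf s e = evec (shz s z') rw cw"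
    unfolding e_def Zf_evec[OF P'] using s_pos by simp
   have ZZe: "Zf s (Zf s e) = e"
   proof -
    have "shz (r - s mod r) (shz s z') = z'" by (rule shz_back) (rule Tab_colour[OF P'])
    thus ?thesis unfolding Ze unfolding Zf_evec[OF Tab_shz[OF P']] e_def by (simp only:)
   qed
   have "e \<in> SpK K" unfolding SpK_def e_def by (rule cfun.span_base) (use P' k z'_def in blast)
   moreover have "Zf s e \<in> SpK K"
   proof -
    have "Tab (shz s z') rw cw" by (rule Tab_shz[OF P'])
    moreover have "cnt (shz s z') rw \<in> K"
     using cnt_shz_s[OF Tab_colour[OF P'] D'] k by (simp add: z'_def)
    ultimately show ?thesis unfolding SpK_def Ze by (intro cfun.span_base) blast
   qed
   ultimately have "ph \<in> SpK K" unfolding ph_def SpK_def by (intro cfun.span_scale cfun.span_add)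
   moreover have "Zf s ph = fscale (-1) ph"
    unfolding ph_def Zf_fscale Zf_add ZZe
    by (rule ext) (simp only: fscale_apply plus_fun_apply, simp add: algebra_simps)
   ultimately have E: "ph \<in> EK K" by (simp add: EK_def)
   have "Theta (Zf s e) = fscale (zeta r ^ (d * (p div 2))) (Theta e)"
    unfolding Theta_def
   proof (rule q_Zf)
    show "Psi (Zf s e) w = Psi e (ZW (d * (p div 2)) w)" if w: "w \<in> W" for w
     unfolding s_eq[symmetric] by (rule Psi_Zf[OF w])
   qed
   hence "Theta (Zf s e) = fscale (-1) (Theta e)" by (simp only: s_eq[symmetric] zeta_s)
   hence "Theta ph = Theta e"
    unfolding ph_def Theta_fscale Theta_add
    by (intro ext) (simp only: fscale_apply plus_fun_apply, simp)
   thus ?thesis using E unfolding e_def by (metis imageI)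
  qed
  ultimately show ?thesis using cfun.subspace_scale[OF subT] by simp
 qed
 have all: "Theta b \<in> Theta ` EK K" if "b \<in> Bsp" for b
  using that unfolding Bsp_def
 proof (induction rule: cfun.span_induct_alt)
  case base
  have T0: "Theta 0 = 0" by (simp only: Theta_def Psi_zero q_zero)
  show ?case unfolding T0 by (rule cfun.subspace_0[OF subT])
 next
  case (step c x y)
  hence "Theta x \<in> Theta ` EK K" using gen by blast
  thus ?case unfolding Theta_add Theta_fscale
   by (rule cfun.subspace_add[OF subT cfun.subspace_scale[OF subT] step(2)])
 qed
 show "cfun.span (basis_vec ` AS) \<subseteq> Theta ` EK K"
 proof (rule cfun.span_minimal[OF _ subT])
  show "basis_vec ` AS \<subseteq> Theta ` EK K"
  proof clarify
   fix v assume "v \<in> AS"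
   then obtain w where w: "w \<in> W" "v = co w" unfolding AS_eq by blast
   have ex: "\<exists>x\<in>Bsp. Psi x = fscale (zeta r ^ fst w 0) (basis_vec w)"
   proof (rule Psi_surjective)
    fix u assume "u \<notin> W"
    hence "u \<noteq> w" using w(1) by blast
    thus "fscale (zeta r ^ fst w 0) (basis_vec w) u = 0" by (simp add: basis_vec_def)
   qed
   obtain b where b: "b \<in> Bsp" "Psi b = fscale (zeta r ^ fst w 0) (basis_vec w)"
    using ex by blast
   have "q (basis_vec w) = (\<Sum>u\<in>W. if u = w then fscale (inverse (zeta r ^ fst w 0)) (basis_vec v) else 0)"
    unfolding q_def
   proof (rule sum.cong[OF refl])
    fix u
    show "fscale (basis_vec w u * inverse (zeta r ^ fst u 0)) (basis_vec (co u)) =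
      (if u = w then fscale (inverse (zeta r ^ fst w 0)) (basis_vec v) else 0)"
    proof (cases "u = w")
     case True thus ?thesis by (simp add: basis_vec_def w(2))
    next
     case False
     hence "basis_vec w u = 0" by (simp add: basis_vec_def)
     thus ?thesis using False by (simp only: mult_zero_left cfun.scale_zero_left if_False)
    qed
   qed
   hence "q (basis_vec w) = fscale (inverse (zeta r ^ fst w 0)) (basis_vec v)"
    using finite_W w(1) by (simp only: sum.delta if_True)
   hence "Theta b = basis_vec v"
    using zeta_pow(2) by (simp add: Theta_def b(2) q_fscale cfun.scale_scale)
   thus "basis_vec v \<in> Theta ` EK K" using all[OF b(1)] by simp
  qed
 qed
qed

lemma Theta_eact: assumes "g \<in> carrier (Grpn r p n)" shows "Theta (eact g ph) = gact g (Theta ph)"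
 unfolding Theta_def Psi_eact[OF prod_ent_d(1)[OF assms]] q_nact[OF assms] ..

end

section \<open>Polytabloids and induced representations\<close>

text \<open>The product, over the classes of \<open>C\<close>, of the determinants of the 0/1
  matrices that compare the labels \<open>ta\<close> and \<open>R\<close>. Values of
  \<open>evec\<close> and of polytabloids are both of this form, which is how the two are
  identified.\<close>

definition pdet :: "nat set => (nat => 'r) => (nat => 'r) => (nat => 'c) => complex" where
 "pdet Y ta R C = (\<Sum>pe\<in>{pe. pe permutes Y}. if \<forall>y\<in>Y. C (pe y) = C y \<and> ta (pe y) = R y then of_int (sign pe) else 0)"

lemma pdet_cong:
 assumes "Y = Y'" "\<And>y. y \<in> Y ==> ta y = ta' y" "\<And>y. y \<in> Y ==> R y = R' y" "\<And>x y. x \<in> Y ==> y \<in> Y ==> C x = C y \<longleftrightarrow> C' x = C' y"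
 shows "pdet Y ta R C = pdet Y' ta' R' C'"
 unfolding pdet_def assms(1)[symmetric]
proof (rule sum.cong[OF refl])
 fix pe assume "pe \<in> {pe. pe permutes Y}"
 hence i: "pe y \<in> Y \<longleftrightarrow> y \<in> Y" for y by (simp add: permutes_in_image)
 have "(\<forall>y\<in>Y. C (pe y) = C y \<and> ta (pe y) = R y) \<longleftrightarrow> (\<forall>y\<in>Y. C' (pe y) = C' y \<and> ta' (pe y) = R' y)"
  by (rule ball_cong[OF refl]) (simp add: assms(2-4) i)
 thus "(if \<forall>y\<in>Y. C (pe y) = C y \<and> ta (pe y) = R y then of_int (sign pe) else 0 :: complex) =
   (if \<forall>y\<in>Y. C' (pe y) = C' y \<and> ta' (pe y) = R' y then of_int (sign pe) else 0)" by (simp only:)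
qed

lemma pdet_empty [simp]: "pdet {} ta R C = 1"
 by (simp add: pdet_def)

lemma pdet_reindex:
 assumes f: "inj_on f Y" and fin: "finite Y"
 shows "pdet (f ` Y) ta R C = pdet Y (ta \<circ> f) (R \<circ> f) (C \<circ> f)"
proof -
 let ?h = "\<lambda>pe x. if x \<in> f ` Y then f (pe (inv_into Y f x)) else x"
 have h: "?h pe = map_permutation Y f pe" for pe
  by (auto simp: map_permutation_def restrict_id_def fun_eq_iff)
 have "pdet (f ` Y) ta R C = (\<Sum>pe\<in>{pe. pe permutes Y}. if \<forall>y\<in>f ` Y. C (?h pe y) = C y \<and> ta (?h pe y) = R y then of_int (sign (?h pe)) else 0)"
  unfolding pdet_def
  by (rule sum.reindex_bij_betw[OF bij_betw_permutations[OF inj_on_imp_bij_betw[OF f]], symmetric])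
 also have "... = pdet Y (ta \<circ> f) (R \<circ> f) (C \<circ> f)"
  unfolding pdet_def
 proof (rule sum.cong[OF refl])
  fix pe assume p: "pe \<in> {pe. pe permutes Y}"
  have hy: "?h pe (f y) = f (pe y)" if "y \<in> Y" for y using that f by simp
  have "(\<forall>y\<in>f ` Y. C (?h pe y) = C y \<and> ta (?h pe y) = R y) \<longleftrightarrow>
    (\<forall>y\<in>Y. (C \<circ> f) (pe y) = (C \<circ> f) y \<and> (ta \<circ> f) (pe y) = (R \<circ> f) y)"
   unfolding ball_simps(9) by (rule ball_cong[OF refl]) (simp only: hy comp_apply)
  moreover have "sign (?h pe) = sign pe" unfolding h using p fin f by (intro sign_map_permutation) auto
  ultimately show "(if \<forall>y\<in>f ` Y. C (?h pe y) = C y \<and> ta (?h pe y) = R y then of_int (sign (?h pe)) else 0 :: complex) =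
    (if \<forall>y\<in>Y. (C \<circ> f) (pe y) = (C \<circ> f) y \<and> (ta \<circ> f) (pe y) = (R \<circ> f) y then of_int (sign pe) else 0)" by (simp only:)
 qed
 finally show ?thesis .
qed

text \<open>No class of \<open>C\<close> meets both parts, so each contributing permutation is a
  product of one on \<open>Y\<close> and one on \<open>Y'\<close>, and signs multiply.\<close>

lemma pdet_Un:
 assumes fin: "finite Y" "finite Y'" and disj: "Y \<inter> Y' = {}"
  and sep: "\<And>x y. x \<in> Y ==> y \<in> Y' ==> C x \<noteq> C y"
 shows "pdet (Y \<union> Y') ta R C = pdet Y ta R C * pdet Y' ta R C"
proof -
 let ?P = "\<lambda>Y pe. \<forall>y\<in>Y. C (pe y) = C y \<and> ta (pe y) = R y"
 let ?S = "{pe. pe permutes (Y \<union> Y') \<and> (\<forall>y\<in>Y. pe y \<in> Y)}"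
 have memY: "pe y \<in> Y \<longleftrightarrow> y \<in> Y" "pe y \<in> Y' \<longleftrightarrow> y \<in> Y'" if p: "pe \<in> ?S" for pe y
 proof -
  have pU: "pe permutes (Y \<union> Y')" and pY: "\<And>y. y \<in> Y ==> pe y \<in> Y" using p by auto
  have im: "pe ` Y = Y"
   by (rule card_subset_eq[OF fin(1)]) (use pY card_image[OF permutes_inj_on[OF pU, of Y]] in auto)
  show 1: "pe y \<in> Y \<longleftrightarrow> y \<in> Y" for y
   using im inj_image_mem_iff[OF permutes_inj[OF pU], of y Y] by simp
  show "pe y \<in> Y' \<longleftrightarrow> y \<in> Y'" using 1[of y] permutes_in_image[OF pU, of y] disj by blast
 qed
 have finS: "finite {pe. pe permutes (Y \<union> Y')}" using fin by (simp add: finite_permutations)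
 have "pdet (Y \<union> Y') ta R C = (\<Sum>pe\<in>?S. if ?P (Y \<union> Y') pe then of_int (sign pe) else 0)"
  unfolding pdet_def
 proof (rule sum.mono_neutral_right[OF finS])
  show "\<forall>pe\<in>{pe. pe permutes (Y \<union> Y')} - ?S. (if ?P (Y \<union> Y') pe then of_int (sign pe) else 0 :: complex) = 0"
  proof
   fix pe assume "pe \<in> {pe. pe permutes (Y \<union> Y')} - ?S"
   then obtain y where y: "y \<in> Y" "pe y \<notin> Y" "pe permutes (Y \<union> Y')" by blast
   hence "pe y \<in> Y'" using permutes_in_image[OF y(3), of y] by blast
   hence "C (pe y) \<noteq> C y" using sep[OF y(1)] by metis
   thus "(if ?P (Y \<union> Y') pe then of_int (sign pe) else 0 :: complex) = 0" using y(1) by auto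
  qed
 qed auto
 also have "... = (\<Sum>(a, b)\<in>{pe. pe permutes Y} \<times> {pe. pe permutes Y'}.
   (if ?P Y a then of_int (sign a) else 0) * (if ?P Y' b then of_int (sign b) else 0))"
 proof (rule sum.reindex_bij_witness[of _ "\<lambda>(a, b). a \<circ> b" "\<lambda>pe. (\<lambda>x. if x \<in> Y then pe x else x, \<lambda>x. if x \<in> Y' then pe x else x)"])
  fix pe assume p: "pe \<in> ?S"
  hence pU: "pe permutes (Y \<union> Y')" by blast
  define a b where "a x = (if x \<in> Y then pe x else x)" and "b x = (if x \<in> Y' then pe x else x)" for x
  have ab: "(\<lambda>x. if x \<in> Y then pe x else x, \<lambda>x. if x \<in> Y' then pe x else x) = (a, b)" by (simp add: a_def b_def fun_eq_iff)
  have inj: "pe x = pe y ==> x = y" for x y using permutes_inj[OF pU] by (auto dest: injD)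
  have pa: "a permutes Y"
   by (rule inj_imp_permutes) (use memY[OF p] inj fin in \<open>auto simp: a_def inj_on_def\<close>)
  have pb: "b permutes Y'"
   by (rule inj_imp_permutes) (use memY[OF p] inj fin in \<open>auto simp: b_def inj_on_def\<close>)
  have comp: "a \<circ> b = pe"
  proof
   fix x
   consider "x \<in> Y" | "x \<in> Y'" | "x \<notin> Y \<union> Y'" by blast
   thus "(a \<circ> b) x = pe x"
   proof cases
    case 1
    hence "x \<notin> Y'" using disj by blast
    thus ?thesis using 1 by (simp add: a_def b_def)
   next
    case 2
    hence "pe x \<notin> Y" using memY(2)[OF p, of x] disj by blast
    thus ?thesis using 2 by (simp add: a_def b_def)
   next
    case 3
    thus ?thesis using permutes_not_in[OF pU] by (simp add: a_def b_def)
   qed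
  qed
  show "(case (\<lambda>x. if x \<in> Y then pe x else x, \<lambda>x. if x \<in> Y' then pe x else x) of (a, b) => a \<circ> b) = pe"
   unfolding ab by (simp add: comp)
  show "(\<lambda>x. if x \<in> Y then pe x else x, \<lambda>x. if x \<in> Y' then pe x else x) \<in> {pe. pe permutes Y} \<times> {pe. pe permutes Y'}"
   unfolding ab using pa pb by simp
  have sg: "sign pe = sign a * sign b"
   unfolding comp[symmetric] using pa pb fin by (intro sign_compose) (auto intro: permutes_imp_permutation)
  have "?P Y a \<longleftrightarrow> ?P Y pe" by (rule ball_cong[OF refl]) (simp add: a_def)
  moreover have "?P Y' b \<longleftrightarrow> ?P Y' pe" by (rule ball_cong[OF refl]) (simp add: b_def)
  moreover have "?P (Y \<union> Y') pe \<longleftrightarrow> ?P Y pe \<and> ?P Y' pe" by (rule ball_Un)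
  ultimately show "(case (\<lambda>x. if x \<in> Y then pe x else x, \<lambda>x. if x \<in> Y' then pe x else x) of
    (a, b) => (if ?P Y a then of_int (sign a) else 0) * (if ?P Y' b then of_int (sign b) else 0)) =
    (if ?P (Y \<union> Y') pe then of_int (sign pe) else 0 :: complex)"
   unfolding ab prod.case by (simp add: sg)
 next
  fix ab assume "ab \<in> {pe. pe permutes Y} \<times> {pe. pe permutes Y'}"
  then obtain a b where ab: "ab = (a, b)" "a permutes Y" "b permutes Y'" by blast
  have aY: "a x \<in> Y \<longleftrightarrow> x \<in> Y" "b x \<in> Y' \<longleftrightarrow> x \<in> Y'" for x using ab by (auto simp: permutes_in_image)
  have a0: "a x = x" if "x \<in> Y'" for x using that disj permutes_not_in[OF ab(2)] by blast
  have b0: "b x = x" if "x \<in> Y" for x using that disj permutes_not_in[OF ab(3)] by blast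
  have "a \<circ> b permutes (Y \<union> Y')"
   by (rule permutes_compose) (use ab(2,3) in \<open>auto intro: permutes_subset\<close>)
  thus "(case ab of (a, b) => a \<circ> b) \<in> ?S" using aY b0 by (simp add: ab(1))
  have 1: "(if x \<in> Y then (a \<circ> b) x else x) = a x" for x using b0 permutes_not_in[OF ab(2)] by auto
  have 2: "(if x \<in> Y' then (a \<circ> b) x else x) = b x" for x using a0 aY(2) permutes_not_in[OF ab(3)] by auto
  show "(\<lambda>x. if x \<in> Y then (case ab of (a, b) => a \<circ> b) x else x, \<lambda>x. if x \<in> Y' then (case ab of (a, b) => a \<circ> b) x else x) = ab"
   unfolding ab(1) prod.case 1 2 ..
 qed
 also have "... = pdet Y ta R C * pdet Y' ta R C"
  unfolding pdet_def sum_product by (rule sum.cartesian_product[symmetric])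
 finally show ?thesis .
qed

lemma pdet_UN:
 assumes fin: "finite I" "\<And>c. c \<in> I ==> finite (Y c)"
  and sep: "\<And>c c' x y. c \<in> I ==> c' \<in> I ==> c \<noteq> c' ==> x \<in> Y c ==> y \<in> Y c' ==> C x \<noteq> C y"
 shows "pdet (\<Union>c\<in>I. Y c) ta R C = (\<Prod>c\<in>I. pdet (Y c) ta R C)"
 using fin(1) fin(2) sep
proof (induct I rule: finite_induct)
 case (insert i I)
 have "pdet (Y i \<union> (\<Union>c\<in>I. Y c)) ta R C = pdet (Y i) ta R C * pdet (\<Union>c\<in>I. Y c) ta R C"
 proof (rule pdet_Un)
  show "finite (Y i)" "finite (\<Union>c\<in>I. Y c)" using insert by auto
  show s: "C x \<noteq> C y" if "x \<in> Y i" "y \<in> (\<Union>c\<in>I. Y c)" for x y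
  proof -
   from that(2) obtain c where c: "c \<in> I" "y \<in> Y c" by blast
   show ?thesis by (rule insert.prems(2)[of i c]) (use that(1) c insert.hyps(2) in auto)
  qed
  show "Y i \<inter> (\<Union>c\<in>I. Y c) = {}" using s by blast
 qed
 moreover have "pdet (\<Union>c\<in>I. Y c) ta R C = (\<Prod>c\<in>I. pdet (Y c) ta R C)"
 proof (rule insert.hyps(3))
  show "finite (Y c)" if "c \<in> I" for c using insert.prems(1)[of c] that by simp
  show "C x \<noteq> C y" if "c \<in> I" "c' \<in> I" "c \<noteq> c'" "x \<in> Y c" "y \<in> Y c'" for c c' x y
   by (rule insert.prems(2)[of c c']) (use that in auto)
 qed
 ultimately show ?case using insert.hyps by simp
qed simp

text \<open>The column group reappears as a condition inside the summand, with the pair of colour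
  and column as the label to be preserved.\<close>

lemma (in gel) evec_pdet:
 assumes "\<And>x. n \<le> x ==> rw x = 0" "\<And>x. n \<le> x ==> bw x = 0"
 shows "evec z rw cw (z, bw) = pdet X bw rw (pairf z cw)"
proof -
 have "evec z rw cw (z, bw) = (\<Sum>pe\<in>St X (pairf z cw). if \<forall>y\<in>X. bw (pe y) = rw y then of_int (sign pe) else 0)"
  unfolding evec_def w.symm_apply
 proof (rule sum.cong[OF refl])
  fix pe assume p: "pe \<in> St X (pairf z cw)"
  hence pz: "pe \<in> St X z" using w.St_refine by blast
  note pp = St_permutes[OF pz]
  have "wact (inv pe) (z, bw) = (z, bw \<circ> pe)"
   by (simp add: permutes_inv_inv[OF pp] St_comp_eq[OF pz])
  moreover have "bw \<circ> pe = rw \<longleftrightarrow> (\<forall>y\<in>X. bw (pe y) = rw y)"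
  proof
   assume a: "\<forall>y\<in>X. bw (pe y) = rw y"
   show "bw \<circ> pe = rw"
   proof
    fix x show "(bw \<circ> pe) x = rw x"
     using a assms[of x] permutes_not_in[OF pp, of x] by (cases "x < n") auto
   qed
  qed auto
  ultimately show "eps True pe * basis_vec (z, rw) (wact (inv pe) (z, bw)) = (if \<forall>y\<in>X. bw (pe y) = rw y then of_int (sign pe) else 0)"
   by (auto simp: basis_vec_def eps_def)
 qed
 also have "... = pdet X bw rw (pairf z cw)"
  unfolding pdet_def
 proof (rule sum.mono_neutral_cong_left)
  show "finite {pe. pe permutes X}" by (simp add: finite_permutations)
  show "St X (pairf z cw) \<subseteq> {pe. pe permutes X}" by (auto dest: St_permutes)
  show "\<forall>pe\<in>{pe. pe permutes X} - St X (pairf z cw).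
    (if \<forall>y\<in>X. (z (pe y), cw (pe y)) = (z y, cw y) \<and> bw (pe y) = rw y then of_int (sign pe) else 0 :: complex) = 0"
  proof
   fix pe assume p: "pe \<in> {pe. pe permutes X} - St X (pairf z cw)"
   hence "\<not> (\<forall>y\<in>X. (z (pe y), cw (pe y)) = (z y, cw y))" unfolding St_def by blast
   hence "\<not> (\<forall>y\<in>X. (z (pe y), cw (pe y)) = (z y, cw y) \<and> bw (pe y) = rw y)" by blast
   thus "(if \<forall>y\<in>X. (z (pe y), cw (pe y)) = (z y, cw y) \<and> bw (pe y) = rw y then of_int (sign pe) else 0 :: complex) = 0"
    by (simp only: if_False)
  qed
  show "(if \<forall>y\<in>X. bw (pe y) = rw y then of_int (sign pe) else 0 :: complex) =
    (if \<forall>y\<in>X. (z (pe y), cw (pe y)) = (z y, cw y) \<and> bw (pe y) = rw y then of_int (sign pe) else 0)"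
   if p: "pe \<in> St X (pairf z cw)" for pe
  proof -
   have "(\<forall>y\<in>X. (z (pe y), cw (pe y)) = (z y, cw y) \<and> bw (pe y) = rw y) \<longleftrightarrow> (\<forall>y\<in>X. bw (pe y) = rw y)"
    using St_fix[OF p] by blast
   thus ?thesis by (simp only:)
  qed
 qed
 finally show ?thesis .
qed

lemma (in gel) evec_shift_perm:
 assumes p: "pe permutes {..<n}"
 shows "evec z rw cw (z' \<circ> pe, bw \<circ> pe) = evec (z \<circ> inv pe) (rw \<circ> inv pe) (cw \<circ> inv pe) (z', bw)"
proof -
 have "w.L pe (evec z rw cw) (z', bw) = evec z rw cw (z' \<circ> pe, bw \<circ> pe)"
  by (simp add: w.L_def permutes_inv_inv[OF p])
 thus ?thesis unfolding L_evec[OF p] ..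
qed

section \<open>Block coordinates and block diagonal monomial matrices\<close>

fun bcol :: "nat list => nat => nat" where
 "bcol [] y = 0"
| "bcol (k # ks) y = (if y < k then 0 else Suc (bcol ks (y - k)))"

fun bloc :: "nat list => nat => nat" where
 "bloc [] y = y"
| "bloc (k # ks) y = (if y < k then y else bloc ks (y - k))"

definition off :: "nat list => nat => nat" where
 "off ns c = sum_list (take c ns)"

lemma block_split:
 assumes "y < sum_list ns"
 shows "bcol ns y < length ns" "bloc ns y < ns ! bcol ns y" "off ns (bcol ns y) + bloc ns y = y"
proof -
 have "bcol ns y < length ns \<and> bloc ns y < ns ! bcol ns y \<and> off ns (bcol ns y) + bloc ns y = y"
  using assms
 proof (induct ns arbitrary: y)
  case (Cons k ks)
  show ?case
  proof (cases "y < k")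
   case True
   thus ?thesis by (simp add: off_def)
  next
   case False
   hence "y - k < sum_list ks" using Cons.prems by simp
   note IH = Cons.hyps[OF this]
   hence "k + off ks (bcol ks (y - k)) + bloc ks (y - k) = y" using False by linarith
   moreover have "off (k # ks) (bcol (k # ks) y) = k + off ks (bcol ks (y - k))" using False by (simp add: off_def)
   moreover have "bloc (k # ks) y = bloc ks (y - k)" "bcol (k # ks) y = Suc (bcol ks (y - k))" using False by simp_all
   ultimately show ?thesis using IH by (simp only: nth_Cons_Suc length_Cons Suc_less_eq simp_thms)
  qed
 qed simp
 thus "bcol ns y < length ns" "bloc ns y < ns ! bcol ns y" "off ns (bcol ns y) + bloc ns y = y" by auto
qed

lemma block_join:
 assumes "c < length ns" "l < ns ! c"
 shows "bcol ns (off ns c + l) = c" "bloc ns (off ns c + l) = l" "off ns c + l < sum_list ns"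
proof -
 have "bcol ns (off ns c + l) = c \<and> bloc ns (off ns c + l) = l \<and> off ns c + l < sum_list ns"
  using assms
 proof (induct ns arbitrary: c)
  case (Cons k ks)
  show ?case
  proof (cases c)
   case 0
   thus ?thesis using Cons.prems by (simp add: off_def)
  next
   case (Suc c')
   have o: "off (k # ks) c + l = k + (off ks c' + l)" by (simp add: Suc off_def)
   show ?thesis using Cons.hyps[of c'] Cons.prems unfolding o by (simp add: Suc)
  qed
 qed simp
 thus "bcol ns (off ns c + l) = c" "bloc ns (off ns c + l) = l" "off ns c + l < sum_list ns" by auto
qed

lemma diag_block_index:
 assumes "length gs = length ns" "\<And>c. c < length ns ==> gs ! c \<in> carrier_mat (ns ! c) (ns ! c)"
 shows "diag_block_mat gs \<in> carrier_mat (sum_list ns) (sum_list ns)"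
  and "\<And>i j. i < sum_list ns ==> j < sum_list ns ==> diag_block_mat gs $$ (i, j) =
   (if bcol ns i = bcol ns j then (gs ! bcol ns j) $$ (bloc ns i, bloc ns j) else 0)"
proof -
 have "diag_block_mat gs \<in> carrier_mat (sum_list ns) (sum_list ns) \<and>
  (\<forall>i j. i < sum_list ns \<longrightarrow> j < sum_list ns \<longrightarrow> diag_block_mat gs $$ (i, j) =
   (if bcol ns i = bcol ns j then (gs ! bcol ns j) $$ (bloc ns i, bloc ns j) else 0))"
  using assms
 proof (induct ns arbitrary: gs)
  case Nil
  thus ?case by simp
 next
  case (Cons k ks)
  then obtain A As where gs: "gs = A # As" "length As = length ks" by (cases gs) auto
  have A: "A \<in> carrier_mat k k" using Cons.prems(2)[of 0] gs by simp
  have "As ! c \<in> carrier_mat (ks ! c) (ks ! c)" if "c < length ks" for c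
   using Cons.prems(2)[of "Suc c"] that gs by simp
  from Cons.hyps[OF gs(2) this] have IH: "diag_block_mat As \<in> carrier_mat (sum_list ks) (sum_list ks)"
   "\<And>i j. i < sum_list ks ==> j < sum_list ks ==> diag_block_mat As $$ (i, j) =
    (if bcol ks i = bcol ks j then (As ! bcol ks j) $$ (bloc ks i, bloc ks j) else 0)" by auto
  have dims: "dim_row A = k" "dim_col A = k" "dim_row (diag_block_mat As) = sum_list ks" "dim_col (diag_block_mat As) = sum_list ks"
   using A IH(1) by auto
  show ?case
  proof (intro conjI allI impI)
   show "diag_block_mat gs \<in> carrier_mat (sum_list (k # ks)) (sum_list (k # ks))"
    unfolding gs diag_block_mat.simps Let_def by (rule carrier_matI) (simp_all add: dims)
   fix i j assume ij: "i < sum_list (k # ks)" "j < sum_list (k # ks)"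
   show "diag_block_mat gs $$ (i, j) = (if bcol (k # ks) i = bcol (k # ks) j then (gs ! bcol (k # ks) j) $$ (bloc (k # ks) i, bloc (k # ks) j) else 0)"
   proof -
    have i': "\<not> i < k ==> i - k < sum_list ks" and j': "\<not> j < k ==> j - k < sum_list ks" using ij by auto
    have "diag_block_mat gs $$ (i, j) = (if i < k then if j < k then A $$ (i, j) else 0
      else if j < k then 0 else diag_block_mat As $$ (i - k, j - k))"
     unfolding gs diag_block_mat.simps Let_def using ij i' j' by (simp add: dims)
    thus ?thesis
     by (cases "i < k"; cases "j < k") (simp_all add: gs IH(2) i' j')
   qed
  qed
 qed
 thus "diag_block_mat gs \<in> carrier_mat (sum_list ns) (sum_list ns)"
  and "\<And>i j. i < sum_list ns ==> j < sum_list ns ==> diag_block_mat gs $$ (i, j) =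
   (if bcol ns i = bcol ns j then (gs ! bcol ns j) $$ (bloc ns i, bloc ns j) else 0)" by auto
qed

definition bperm :: "nat list => (nat => nat => nat) => nat => nat" where
 "bperm ns si y = (if y < sum_list ns then off ns (bcol ns y) + si (bcol ns y) (bloc ns y) else y)"

lemma bperm_permutes:
 assumes s: "\<And>c. c < length ns ==> si c permutes {..<ns ! c}"
 shows "bperm ns si permutes {..<sum_list ns}"
  and "\<And>y. y < sum_list ns ==> bcol ns (bperm ns si y) = bcol ns y \<and> bloc ns (bperm ns si y) = si (bcol ns y) (bloc ns y)"
proof -
 have m: "bcol ns (bperm ns si y) = bcol ns y \<and> bloc ns (bperm ns si y) = si (bcol ns y) (bloc ns y) \<and> bperm ns si y < sum_list ns"
  if "y < sum_list ns" for y
 proof -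
  note B = block_split[OF that]
  have "si (bcol ns y) (bloc ns y) < ns ! bcol ns y" using B(1,2) permutes_less[OF s[OF B(1)]] by blast
  from block_join[OF B(1) this] show ?thesis using that by (simp add: bperm_def)
 qed
 thus "\<And>y. y < sum_list ns ==> bcol ns (bperm ns si y) = bcol ns y \<and> bloc ns (bperm ns si y) = si (bcol ns y) (bloc ns y)" by blast
 show "bperm ns si permutes {..<sum_list ns}"
 proof (rule inj_imp_permutes)
  show "inj_on (bperm ns si) {..<sum_list ns}"
  proof (rule inj_onI)
   fix x y assume h: "x \<in> {..<sum_list ns}" "y \<in> {..<sum_list ns}" "bperm ns si x = bperm ns si y"
   hence xy: "x < sum_list ns" "y < sum_list ns" by auto
   have c: "bcol ns x = bcol ns y" using m[OF xy(1)] m[OF xy(2)] h(3) by metis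
   have "si (bcol ns y) (bloc ns x) = si (bcol ns y) (bloc ns y)" using m[OF xy(1)] m[OF xy(2)] h(3) c by metis
   hence "bloc ns x = bloc ns y" using permutes_inj[OF s[OF block_split(1)[OF xy(2)]]] by (auto dest: injD)
   thus "x = y" using block_split(3)[OF xy(1)] block_split(3)[OF xy(2)] c by metis
  qed
 qed (use m in \<open>auto simp: bperm_def\<close>)
qed

lemma diag_block_mono:
 assumes r: "0 < r" and gs: "length gs = length ns" "\<And>c. c < length ns ==> gs ! c \<in> carrier (Grn r (ns ! c))"
 defines "D \<equiv> diag_block_mat gs"
 shows "D \<in> carrier (Grn r (sum_list ns))" "perm_of D = bperm ns (\<lambda>c. perm_of (gs ! c))"
  "\<And>y. y < sum_list ns ==> ent D y = ent (gs ! bcol ns y) (bloc ns y)"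
proof -
 interpret grn r "sum_list ns" using r by unfold_locales
 note G = gs(2)[THEN Grn_mono(1)]
 have DI: "diag_block_mat gs $$ (i, j) = (if bcol ns i = bcol ns j then (gs ! bcol ns j) $$ (bloc ns i, bloc ns j) else 0)"
  if "i < sum_list ns" "j < sum_list ns" for i j
  by (rule diag_block_index(2)[OF gs(1) _ that]) (rule G)
 have DC: "diag_block_mat gs \<in> carrier_mat (sum_list ns) (sum_list ns)"
  by (rule diag_block_index(1)[OF gs(1)]) (rule G)
 define si where "si c = perm_of (gs ! c)" for c
 have s: "si c permutes {..<ns ! c}" if "c < length ns" for c
  unfolding si_def by (rule Grn_mono(2)[OF gs(2)[OF that]])
 have P: "bperm ns si permutes {..<sum_list ns}"
  "\<And>y. y < sum_list ns ==> bcol ns (bperm ns si y) = bcol ns y \<and> bloc ns (bperm ns si y) = si (bcol ns y) (bloc ns y)"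
  by (rule bperm_permutes, erule s, rule bperm_permutes, erule s)
 define e where "e y = ent (gs ! bcol ns y) (bloc ns y)" for y
 have er: "e y ^ r = 1" if "y < sum_list ns" for y
  unfolding e_def using block_split[OF that] Grn_mono(3)[OF gs(2)] by blast
 have D: "D = monm (sum_list ns) (bperm ns si) e"
 proof (rule eq_matI)
  fix i j assume "i < dim_row (monm (sum_list ns) (bperm ns si) e)" "j < dim_col (monm (sum_list ns) (bperm ns si) e)"
  hence ij: "i < sum_list ns" "j < sum_list ns" by auto
  note Bi = block_split[OF ij(1)] and Bj = block_split[OF ij(2)]
  let ?c = "bcol ns j"
  have g: "gs ! ?c = monm (ns ! ?c) (si ?c) (ent (gs ! ?c))" unfolding si_def by (rule Grn_mono(4)[OF gs(2)[OF Bj(1)]])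
  have iff: "i = bperm ns si j \<longleftrightarrow> bcol ns i = ?c \<and> bloc ns i = si ?c (bloc ns j)"
  proof
   assume "i = bperm ns si j"
   thus "bcol ns i = ?c \<and> bloc ns i = si ?c (bloc ns j)" using P(2)[OF ij(2)] by (simp only:)
  next
   assume "bcol ns i = ?c \<and> bloc ns i = si ?c (bloc ns j)"
   hence "off ns ?c + si ?c (bloc ns j) = i" using Bi(3) by (simp only:)
   thus "i = bperm ns si j" using ij(2) by (simp only: bperm_def if_True)
  qed
  have "(gs ! ?c) $$ (bloc ns i, bloc ns j) = (if bloc ns i = si ?c (bloc ns j) then e j else 0)" if "bcol ns i = ?c"
   by (subst g) (use that Bi(2) Bj(2) in \<open>simp add: e_def\<close>)
  hence "(if bcol ns i = ?c then (gs ! ?c) $$ (bloc ns i, bloc ns j) else 0) =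
    (if bcol ns i = ?c \<and> bloc ns i = si ?c (bloc ns j) then e j else 0)" by presburger
  thus "D $$ (i, j) = monm (sum_list ns) (bperm ns si) e $$ (i, j)"
   unfolding D_def DI[OF ij] mono_index[OF ij] iff .
 qed (use DC in \<open>auto simp: D_def\<close>)
 have M: "monm (sum_list ns) (bperm ns si) e \<in> carrier (Grn r (sum_list ns))"
  "perm_of (monm (sum_list ns) (bperm ns si) e) = bperm ns si"
  "\<And>y. y < sum_list ns ==> ent (monm (sum_list ns) (bperm ns si) e) y = e y"
  by (rule mono_Grn[OF P(1)], erule er, rule mono_Grn[OF P(1)], erule er, rule mono_Grn[OF P(1)], erule er)
 show "D \<in> carrier (Grn r (sum_list ns))" "perm_of D = bperm ns (\<lambda>c. perm_of (gs ! c))"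
  "\<And>y. y < sum_list ns ==> ent D y = ent (gs ! bcol ns y) (bloc ns y)"
  unfolding D using M by (simp_all add: si_def[abs_def] e_def)
qed

text \<open>A monomial matrix is block diagonal as soon as its permutation preserves the blocks;
  permutation and entries of each block are read off after subtracting the offset.\<close>

lemma block_factorisation:
 assumes r: "0 < r" and g: "g \<in> carrier (Grn r (sum_list ns))"
  and b: "\<And>y. y < sum_list ns ==> bcol ns (perm_of g y) = bcol ns y"
 shows "\<exists>gs. length gs = length ns \<and> (\<forall>c<length ns. gs ! c \<in> carrier (Grn r (ns ! c))) \<and> g = diag_block_mat gs"
proof -
 interpret grn r "sum_list ns" using r by unfold_locales
 note G = Grn_mono[OF g]
 define si where "si c l = (if l < ns ! c then bloc ns (perm_of g (off ns c + l)) else l)" for c l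
 define gs where "gs = map (\<lambda>c. monm (ns ! c) (si c) (\<lambda>l. ent g (off ns c + l))) [0..<length ns]"
 have key: "perm_of g (off ns c + l) = off ns c + si c l \<and> si c l < ns ! c" if "c < length ns" "l < ns ! c" for c l
 proof -
  note J = block_join[OF that]
  have lt: "perm_of g (off ns c + l) < sum_list ns" using J(3) by (simp add: permutes_less[OF G(2)])
  have "bcol ns (perm_of g (off ns c + l)) = c" using b[OF J(3)] J(1) by simp
  thus ?thesis using block_split[OF lt] that(2) by (simp add: si_def)
 qed
 have s: "si c permutes {..<ns ! c}" if "c < length ns" for c
 proof (rule inj_imp_permutes)
  show "inj_on (si c) {..<ns ! c}"
  proof (rule inj_onI)
   fix x y assume h: "x \<in> {..<ns ! c}" "y \<in> {..<ns ! c}" "si c x = si c y"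
   hence xy: "x < ns ! c" "y < ns ! c" by auto
   have "perm_of g (off ns c + x) = perm_of g (off ns c + y)"
   proof -
    have "off ns c + si c x = off ns c + si c y" unfolding h(3) ..
    thus ?thesis by (simp only: conjunct1[OF key[OF that xy(1)]] conjunct1[OF key[OF that xy(2)]])
   qed
   from injD[OF permutes_inj[OF G(2)] this] show "x = y" by (rule add_left_imp_eq)
  qed
  show "si c x \<in> {..<ns ! c}" if "x \<in> {..<ns ! c}" for x using key[OF \<open>c < length ns\<close>] that by simp
 qed (auto simp: si_def)
 have gc: "gs ! c \<in> carrier (Grn r (ns ! c)) \<and> perm_of (gs ! c) = si c \<and> (\<forall>l<ns ! c. ent (gs ! c) l = ent g (off ns c + l))"
  if c: "c < length ns" for c
 proof -
  interpret h: grn r "ns ! c" using r by unfold_locales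
  have "ent g (off ns c + l) ^ r = 1" if "l < ns ! c" for l using G(3) block_join(3)[OF c that] by blast
  note M = this
  have e: "gs ! c = monm (ns ! c) (si c) (\<lambda>l. ent g (off ns c + l))" using c by (simp add: gs_def)
  show ?thesis unfolding e
   by (intro conjI allI impI h.mono_Grn(1,2,3)[OF s[OF c]] M)
 qed
 have len: "length gs = length ns" by (simp add: gs_def)
 have D: "diag_block_mat gs \<in> carrier (Grn r (sum_list ns))"
  "perm_of (diag_block_mat gs) = bperm ns (\<lambda>c. perm_of (gs ! c))"
  "\<And>y. y < sum_list ns ==> ent (diag_block_mat gs) y = ent (gs ! bcol ns y) (bloc ns y)"
  by (rule diag_block_mono[OF r len], use gc in blast)+
 have "g = diag_block_mat gs"
 proof (rule Grn_eqI[OF g D(1)])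
  show "perm_of g = perm_of (diag_block_mat gs)"
  proof
   fix y show "perm_of g y = perm_of (diag_block_mat gs) y"
   proof (cases "y < sum_list ns")
    case True
    note B = block_split[OF True]
    have "perm_of (diag_block_mat gs) y = off ns (bcol ns y) + si (bcol ns y) (bloc ns y)"
     using gc[OF B(1)] True by (simp add: D(2) bperm_def)
    thus ?thesis using conjunct1[OF key[OF B(1,2)]] unfolding B(3) by simp
   next
    case False
    thus ?thesis using perm_of_ge[OF g, of y] by (simp add: D(2) bperm_def)
   qed
  qed
  show "ent g j = ent (diag_block_mat gs) j" if "j < sum_list ns" for j
  proof -
   note B = block_split[OF that]
   have "ent (gs ! bcol ns j) (bloc ns j) = ent g (off ns (bcol ns j) + bloc ns j)" using gc[OF B(1)] B(2) by blast
   thus ?thesis unfolding D(3)[OF that] B(3) ..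
  qed
 qed
 thus ?thesis using len gc by blast
qed

section \<open>Tabloids as row functions\<close>

definition tbl :: "nat list => (nat => nat) => nat set list" where
 "tbl a ta = map (\<lambda>i. {y. y < sum_list a \<and> ta y = i}) [0..<length a]"

definition valid :: "nat list => (nat => nat) => bool" where
 "valid a ta \<longleftrightarrow> (\<forall>y<sum_list a. ta y < length a)"

text \<open>A left inverse of \<open>tbl\<close>: in a tabloid of this form exactly one row contains
  \<open>y\<close>, and \<open>LEAST\<close> selects it.\<close>

definition rowof :: "nat set list => nat => nat" where
 "rowof t y = (LEAST i. i < length t \<and> y \<in> t ! i)"

definition rowT :: "nat list => (nat \<times> nat => nat) => nat => nat" where
 "rowT a T y = fst (inv_into (cells a) T y)"

definition colT :: "nat list => (nat \<times> nat => nat) => nat => nat" where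
 "colT a T y = snd (inv_into (cells a) T y)"

lemma rowof_tbl: assumes "valid a ta" "y < sum_list a" shows "rowof (tbl a ta) y = ta y"
 unfolding rowof_def
proof (rule Least_equality)
 show "ta y < length (tbl a ta) \<and> y \<in> tbl a ta ! ta y" using assms by (simp add: tbl_def valid_def)
 show "ta y \<le> i" if "i < length (tbl a ta) \<and> y \<in> tbl a ta ! i" for i using that by (auto simp: tbl_def)
qed

lemma tbl_cong: "(\<And>y. y < sum_list a ==> ta y = si y) ==> tbl a ta = tbl a si"
 by (auto simp: tbl_def)

lemma tbl_eq_iff: assumes "valid a ta" "valid a si"
 shows "tbl a ta = tbl a si \<longleftrightarrow> (\<forall>y<sum_list a. ta y = si y)"
proof
 assume e: "tbl a ta = tbl a si"
 show "\<forall>y<sum_list a. ta y = si y"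
 proof (intro allI impI)
  fix y assume y: "y < sum_list a"
  show "ta y = si y" using rowof_tbl[OF assms(1) y] rowof_tbl[OF assms(2) y] unfolding e by simp
 qed
qed (rule tbl_cong, blast)

lemma valid_comp: assumes p: "pe permutes {..<sum_list a}" and v: "valid a ta" shows "valid a (ta \<circ> pe)"
 using v by (simp add: valid_def permutes_less[OF p])

lemma image_tbl: assumes p: "pe permutes {..<sum_list a}"
 shows "map (image pe) (tbl a ta) = tbl a (ta \<circ> inv pe)"
proof -
 have "pe ` {y. y < sum_list a \<and> ta y = i} = {y. y < sum_list a \<and> ta (inv pe y) = i}" for i
 proof
  show "pe ` {y. y < sum_list a \<and> ta y = i} \<subseteq> {y. y < sum_list a \<and> ta (inv pe y) = i}"
   by (auto simp: permutes_inverses[OF p] permutes_less[OF p])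
  show "{y. y < sum_list a \<and> ta (inv pe y) = i} \<subseteq> pe ` {y. y < sum_list a \<and> ta y = i}"
  proof
   fix y assume y: "y \<in> {y. y < sum_list a \<and> ta (inv pe y) = i}"
   have "y = pe (inv pe y)" by (simp add: permutes_inverses[OF p])
   moreover have "inv pe y < sum_list a" using y by (simp add: permutes_less[OF permutes_inv[OF p]])
   ultimately show "y \<in> pe ` {y. y < sum_list a \<and> ta y = i}" using y by blast
  qed
 qed
 thus ?thesis by (simp add: tbl_def comp_def)
qed

lemma cells_Sigma: "cells a = Sigma {..<length a} (\<lambda>i. {..<a ! i})"
 by (auto simp: cells_def)

lemma finite_cells: "finite (cells a)" and card_cells: "card (cells a) = sum_list a"
 by (auto simp: cells_Sigma sum_list_sum_nth atLeast0LessThan)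

lemma tableau_inverse:
 assumes T: "T \<in> tableaux a" and y: "y < sum_list a"
 shows "(rowT a T y, colT a T y) \<in> cells a" "T (rowT a T y, colT a T y) = y"
proof -
 have "y \<in> T ` cells a" using T y by (auto simp: tableaux_def bij_betw_def)
 from inv_into_into[OF this] f_inv_into_f[OF this]
 show "(rowT a T y, colT a T y) \<in> cells a" "T (rowT a T y, colT a T y) = y" by (simp_all add: rowT_def colT_def)
qed

lemma tableau_cell:
 assumes T: "T \<in> tableaux a" and c: "(i, j) \<in> cells a"
 shows "T (i, j) < sum_list a" "rowT a T (T (i, j)) = i" "colT a T (T (i, j)) = j"
proof -
 have inj: "inj_on T (cells a)" and im: "T ` cells a = {..<sum_list a}" using T by (auto simp: tableaux_def bij_betw_def)
 show "T (i, j) < sum_list a" using im c by blast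
 show "rowT a T (T (i, j)) = i" "colT a T (T (i, j)) = j"
  by (simp_all add: rowT_def colT_def inv_into_f_f[OF inj c])
qed

lemma tabloid_tbl: assumes T: "T \<in> tableaux a" shows "tabloid a T = tbl a (rowT a T)" "valid a (rowT a T)"
proof -
 have "T ` {c \<in> cells a. fst c = i} = {y. y < sum_list a \<and> rowT a T y = i}" for i
 proof
  show "T ` {c \<in> cells a. fst c = i} \<subseteq> {y. y < sum_list a \<and> rowT a T y = i}"
   using tableau_cell[OF T] by auto
  show "{y. y < sum_list a \<and> rowT a T y = i} \<subseteq> T ` {c \<in> cells a. fst c = i}"
  proof
   fix y assume y: "y \<in> {y. y < sum_list a \<and> rowT a T y = i}"
   hence l: "y < sum_list a" by simp
   have "y = T (rowT a T y, colT a T y)" using tableau_inverse(2)[OF T l] by simp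
   thus "y \<in> T ` {c \<in> cells a. fst c = i}" using tableau_inverse(1)[OF T l] y by auto
  qed
 qed
 thus "tabloid a T = tbl a (rowT a T)" by (simp add: tabloid_def tbl_def)
 show "valid a (rowT a T)" using tableau_inverse(1)[OF T] by (auto simp: valid_def cells_def)
qed

lemma column_stabilizer_eq: assumes T: "T \<in> tableaux a"
 shows "column_stabilizer a T = {pe. pe permutes {..<sum_list a} \<and> (\<forall>y<sum_list a. colT a T (pe y) = colT a T y)}"
proof -
 have img: "T ` {c \<in> cells a. snd c = b} = {y. y < sum_list a \<and> colT a T y = b}" for b
 proof
  show "T ` {c \<in> cells a. snd c = b} \<subseteq> {y. y < sum_list a \<and> colT a T y = b}"
   using tableau_cell[OF T] by auto
  show "{y. y < sum_list a \<and> colT a T y = b} \<subseteq> T ` {c \<in> cells a. snd c = b}"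
  proof
   fix y assume y: "y \<in> {y. y < sum_list a \<and> colT a T y = b}"
   hence l: "y < sum_list a" by simp
   have "y = T (rowT a T y, colT a T y)" using tableau_inverse(2)[OF T l] by simp
   thus "y \<in> T ` {c \<in> cells a. snd c = b}" using tableau_inverse(1)[OF T l] y by auto
  qed
 qed
 have "(\<forall>b. pe ` {y. y < sum_list a \<and> colT a T y = b} = {y. y < sum_list a \<and> colT a T y = b}) \<longleftrightarrow>
   (\<forall>y<sum_list a. colT a T (pe y) = colT a T y)" if p: "pe permutes {..<sum_list a}" for pe
 proof
  assume h: "\<forall>b. pe ` {y. y < sum_list a \<and> colT a T y = b} = {y. y < sum_list a \<and> colT a T y = b}"
  show "\<forall>y<sum_list a. colT a T (pe y) = colT a T y"
  proof (intro allI impI)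
   fix y assume "y < sum_list a"
   hence "pe y \<in> pe ` {x. x < sum_list a \<and> colT a T x = colT a T y}" by blast
   thus "colT a T (pe y) = colT a T y" using h by blast
  qed
 next
  assume h: "\<forall>y<sum_list a. colT a T (pe y) = colT a T y"
  show "\<forall>b. pe ` {y. y < sum_list a \<and> colT a T y = b} = {y. y < sum_list a \<and> colT a T y = b}"
  proof
   fix b
   show "pe ` {y. y < sum_list a \<and> colT a T y = b} = {y. y < sum_list a \<and> colT a T y = b}"
   proof (rule card_subset_eq)
    show "pe ` {y. y < sum_list a \<and> colT a T y = b} \<subseteq> {y. y < sum_list a \<and> colT a T y = b}"
     using h by (auto simp: permutes_less[OF p])
    show "card (pe ` {y. y < sum_list a \<and> colT a T y = b}) = card {y. y < sum_list a \<and> colT a T y = b}"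
     by (rule card_image) (rule permutes_inj_on[OF p])
   qed simp
  qed
 qed
 thus ?thesis unfolding column_stabilizer_def img by blast
qed

lemma polytabloid_apply: assumes T: "T \<in> tableaux a"
 shows "polytabloid a T t = (\<Sum>pe\<in>column_stabilizer a T. if t = tbl a (rowT a T \<circ> inv pe) then of_int (sign pe) else 0)"
 unfolding polytabloid_def sum_fun_apply fscale_apply
proof (rule sum.cong[OF refl])
 fix pe assume "pe \<in> column_stabilizer a T"
 hence p: "pe permutes {..<sum_list a}" by (simp add: column_stabilizer_def)
 show "of_int (sign pe) * basis_vec (map ((`) pe) (tabloid a T)) t = (if t = tbl a (rowT a T \<circ> inv pe) then of_int (sign pe) else 0)"
  unfolding tabloid_tbl(1)[OF T] image_tbl[OF p] by (simp add: basis_vec_def)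
qed

text \<open>Equality of tabloids becomes the pointwise condition on row functions used in
  \<open>pdet\<close>, so that Specht modules can be compared with the word model value by
  value.\<close>

lemma polytabloid_tbl: assumes T: "T \<in> tableaux a" and v: "valid a ta"
 shows "polytabloid a T (tbl a ta) = pdet {..<sum_list a} ta (rowT a T) (colT a T)"
 unfolding polytabloid_apply[OF T] pdet_def
proof (rule sum.mono_neutral_cong_left)
 show "finite {pe. pe permutes {..<sum_list a}}" by (simp add: finite_permutations)
 show "column_stabilizer a T \<subseteq> {pe. pe permutes {..<sum_list a}}" by (auto simp: column_stabilizer_def)
 show "\<forall>pe\<in>{pe. pe permutes {..<sum_list a}} - column_stabilizer a T.
   (if \<forall>y\<in>{..<sum_list a}. colT a T (pe y) = colT a T y \<and> ta (pe y) = rowT a T y then of_int (sign pe) else 0 :: complex) = 0"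
 proof
  fix pe assume "pe \<in> {pe. pe permutes {..<sum_list a}} - column_stabilizer a T"
  hence "\<not> (\<forall>y\<in>{..<sum_list a}. colT a T (pe y) = colT a T y \<and> ta (pe y) = rowT a T y)"
   unfolding column_stabilizer_eq[OF T] by blast
  thus "(if \<forall>y\<in>{..<sum_list a}. colT a T (pe y) = colT a T y \<and> ta (pe y) = rowT a T y then of_int (sign pe) else 0 :: complex) = 0"
   by (simp only: if_False)
 qed
 fix pe assume p: "pe \<in> column_stabilizer a T"
 hence pp: "pe permutes {..<sum_list a}" by (simp add: column_stabilizer_def)
 have "tbl a ta = tbl a (rowT a T \<circ> inv pe) \<longleftrightarrow> (\<forall>y<sum_list a. ta y = rowT a T (inv pe y))"
  by (subst tbl_eq_iff[OF v valid_comp[OF permutes_inv[OF pp] tabloid_tbl(2)[OF T]]]) simp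
 also have "... \<longleftrightarrow> (\<forall>y\<in>{..<sum_list a}. ta (pe y) = rowT a T y)"
 proof
  assume h: "\<forall>y<sum_list a. ta y = rowT a T (inv pe y)"
  show "\<forall>y\<in>{..<sum_list a}. ta (pe y) = rowT a T y"
  proof
   fix y assume "y \<in> {..<sum_list a}"
   hence "pe y < sum_list a" by (simp add: permutes_less[OF pp])
   with h show "ta (pe y) = rowT a T y" by (simp add: permutes_inverses[OF pp])
  qed
 next
  assume h: "\<forall>y\<in>{..<sum_list a}. ta (pe y) = rowT a T y"
  show "\<forall>y<sum_list a. ta y = rowT a T (inv pe y)"
  proof (intro allI impI)
   fix y assume "y < sum_list a"
   hence "inv pe y \<in> {..<sum_list a}" by (simp add: permutes_less[OF permutes_inv[OF pp]])
   hence "ta (pe (inv pe y)) = rowT a T (inv pe y)" using h by blast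
   thus "ta y = rowT a T (inv pe y)" by (simp only: permutes_inverses[OF pp])
  qed
 qed
 also have "... \<longleftrightarrow> (\<forall>y\<in>{..<sum_list a}. colT a T (pe y) = colT a T y \<and> ta (pe y) = rowT a T y)"
  using p unfolding column_stabilizer_eq[OF T] by blast
 finally show "(if tbl a ta = tbl a (rowT a T \<circ> inv pe) then of_int (sign pe) else 0 :: complex) =
   (if \<forall>y\<in>{..<sum_list a}. colT a T (pe y) = colT a T y \<and> ta (pe y) = rowT a T y then of_int (sign pe) else 0)"
  by (simp only:)
qed

lemma polytabloid_invalid: assumes T: "T \<in> tableaux a" and v: "\<And>ta. valid a ta ==> t \<noteq> tbl a ta"
 shows "polytabloid a T t = 0"
 unfolding polytabloid_apply[OF T]
proof (rule sum.neutral, rule ballI)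
 fix pe assume "pe \<in> column_stabilizer a T"
 hence pp: "pe permutes {..<sum_list a}" by (simp add: column_stabilizer_def)
 have "t \<noteq> tbl a (rowT a T \<circ> inv pe)" by (rule v[OF valid_comp[OF permutes_inv[OF pp] tabloid_tbl(2)[OF T]]])
 thus "(if t = tbl a (rowT a T \<circ> inv pe) then of_int (sign pe) else 0 :: complex) = 0" by simp
qed

text \<open>Each point is sent to the cell (\<open>rw\<close>, \<open>cw\<close>). Closure to the
  left bounds its column by the row length, so the cell lies in the diagram, and equal cardinalities
  make the map a bijection.\<close>

lemma tableau_exists:
 fixes rw cw :: "nat => nat"
 assumes inj: "\<And>x y. x < sum_list a ==> y < sum_list a ==> rw x = rw y ==> cw x = cw y ==> x = y"
  and dn: "\<And>y j. y < sum_list a ==> j < cw y ==> \<exists>x<sum_list a. rw x = rw y \<and> cw x = j"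
  and cnt: "\<And>i. card {y. y < sum_list a \<and> rw y = i} = (if i < length a then a ! i else 0)"
 shows "\<exists>T\<in>tableaux a. \<forall>y<sum_list a. rowT a T y = rw y \<and> colT a T y = cw y"
proof -
 define f where "f y = (rw y, cw y)" for y
 have injf: "inj_on f {..<sum_list a}" using inj by (auto simp: inj_on_def f_def)
 have cell: "f y \<in> cells a" if y: "y < sum_list a" for y
 proof -
  let ?R = "{x. x < sum_list a \<and> rw x = rw y}"
  have fin: "finite ?R" by simp
  have yR: "y \<in> ?R" using y by simp
  hence "card ?R \<noteq> 0" using fin by (metis card_0_eq empty_iff)
  hence 1: "rw y < length a" "card ?R = a ! rw y" using cnt[of "rw y"] by (auto split: if_splits)
  have "{..cw y} \<subseteq> cw ` ?R"
  proof
   fix j assume "j \<in> {..cw y}"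
   then consider "j = cw y" | "j < cw y" by fastforce
   thus "j \<in> cw ` ?R"
   proof cases
    case 1 thus ?thesis using yR by blast
   next
    case 2 thus ?thesis using dn[OF y 2] by blast
   qed
  qed
  hence "card {..cw y} \<le> card (cw ` ?R)" by (intro card_mono) (use fin in auto)
  also have "... \<le> card ?R" by (rule card_image_le[OF fin])
  finally have "cw y < a ! rw y" using 1 by simp
  thus ?thesis using 1(1) by (simp add: f_def cells_def)
 qed
 have im: "f ` {..<sum_list a} = cells a"
  by (rule card_subset_eq[OF finite_cells]) (use cell card_image[OF injf] in \<open>auto simp: card_cells\<close>)
 have bij: "bij_betw f {..<sum_list a} (cells a)" using injf im by (simp add: bij_betw_def)
 define T where "T = inv_into {..<sum_list a} f"
 have T: "T \<in> tableaux a" unfolding tableaux_def T_def using bij_betw_inv_into[OF bij] by simp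
 moreover have "rowT a T y = rw y \<and> colT a T y = cw y" if y: "y < sum_list a" for y
 proof -
  have Tf: "T (rw y, cw y) = y" unfolding T_def using inv_into_f_f[OF injf, of y] y by (simp add: f_def)
  have "(rw y, cw y) \<in> cells a" using cell[OF y] by (simp add: f_def)
  from tableau_cell(2,3)[OF T this] show ?thesis unfolding Tf by simp
 qed
 ultimately show ?thesis by blast
qed

text \<open>The cell above a given one belongs to the diagram because row lengths weakly decrease;
  the rest is bookkeeping with the inverse of \<open>T\<close>.\<close>

lemma tableau_props:
 assumes a: "is_partition a" and T: "T \<in> tableaux a"
 shows "x < sum_list a ==> y < sum_list a ==> rowT a T x = rowT a T y ==> colT a T x = colT a T y ==> x = y"
  and "y < sum_list a ==> j < colT a T y ==> \<exists>x<sum_list a. rowT a T x = rowT a T y \<and> colT a T x = j"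
  and "y < sum_list a ==> i < rowT a T y ==> \<exists>x<sum_list a. colT a T x = colT a T y \<and> rowT a T x = i"
  and "card {y. y < sum_list a \<and> rowT a T y = i} = (if i < length a then a ! i else 0)"
proof -
 show "x = y" if "x < sum_list a" "y < sum_list a" "rowT a T x = rowT a T y" "colT a T x = colT a T y"
  using tableau_inverse(2)[OF T that(1)] tableau_inverse(2)[OF T that(2)] that(3,4) by metis
 show "\<exists>x<sum_list a. rowT a T x = rowT a T y \<and> colT a T x = j" if "y < sum_list a" "j < colT a T y"
 proof -
  have "(rowT a T y, j) \<in> cells a" using tableau_inverse(1)[OF T that(1)] that(2) by (auto simp: cells_def)
  from tableau_cell[OF T this] show ?thesis by blast
 qed
 show "\<exists>x<sum_list a. colT a T x = colT a T y \<and> rowT a T x = i" if "y < sum_list a" "i < rowT a T y"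
 proof -
  have c: "rowT a T y < length a" "colT a T y < a ! rowT a T y"
   using tableau_inverse(1)[OF T that(1)] by (auto simp: cells_def)
  have "a ! rowT a T y \<le> a ! i"
   using a that(2) c(1) by (auto simp: is_partition_def sorted_wrt_iff_nth_less)
  hence "(i, colT a T y) \<in> cells a" using c that(2) by (auto simp: cells_def)
  from tableau_cell[OF T this] show ?thesis by blast
 qed
 have "{y. y < sum_list a \<and> rowT a T y = i} = (\<lambda>j. T (i, j)) ` {j. (i, j) \<in> cells a}"
 proof
  show "{y. y < sum_list a \<and> rowT a T y = i} \<subseteq> (\<lambda>j. T (i, j)) ` {j. (i, j) \<in> cells a}"
  proof
   fix y assume y: "y \<in> {y. y < sum_list a \<and> rowT a T y = i}"
   hence l: "y < sum_list a" "rowT a T y = i" by auto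
   have "y = T (i, colT a T y)" "(i, colT a T y) \<in> cells a" using tableau_inverse[OF T l(1)] l(2) by auto
   thus "y \<in> (\<lambda>j. T (i, j)) ` {j. (i, j) \<in> cells a}" by blast
  qed
 qed (use tableau_cell[OF T] in auto)
 moreover have "inj_on (\<lambda>j. T (i, j)) {j. (i, j) \<in> cells a}"
  using T by (auto simp: tableaux_def bij_betw_def inj_on_def)
 moreover have "{j. (i, j) \<in> cells a} = (if i < length a then {..<a ! i} else {})" by (auto simp: cells_def)
 ultimately show "card {y. y < sum_list a \<and> rowT a T y = i} = (if i < length a then a ! i else 0)"
  by (simp add: card_image)
qed

lemma block_prod: "(\<Prod>y<sum_list ns. f (bcol ns y) (bloc ns y)) = (\<Prod>c<length ns. \<Prod>l<ns ! c. f c l :: complex)"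
proof -
 have "(\<Prod>c<length ns. \<Prod>l<ns ! c. f c l) = (\<Prod>(c, l)\<in>Sigma {..<length ns} (\<lambda>c. {..<ns ! c}). f c l)"
  by (rule prod.Sigma) auto
 also have "... = (\<Prod>y<sum_list ns. f (bcol ns y) (bloc ns y))"
  by (rule prod.reindex_bij_witness[of _ "\<lambda>y. (bcol ns y, bloc ns y)" "\<lambda>(c, l). off ns c + l"])
   (auto simp: block_join block_split)
 finally show ?thesis ..
qed

lemma block_image: assumes "c < length ns"
 shows "(\<lambda>l. off ns c + l) ` {l. l < ns ! c \<and> P (off ns c + l)} = {y. y < sum_list ns \<and> bcol ns y = c \<and> P y}"
proof
 show "(\<lambda>l. off ns c + l) ` {l. l < ns ! c \<and> P (off ns c + l)} \<subseteq> {y. y < sum_list ns \<and> bcol ns y = c \<and> P y}"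
  using block_join[OF assms] by auto
 show "{y. y < sum_list ns \<and> bcol ns y = c \<and> P y} \<subseteq> (\<lambda>l. off ns c + l) ` {l. l < ns ! c \<and> P (off ns c + l)}"
 proof
  fix y assume y: "y \<in> {y. y < sum_list ns \<and> bcol ns y = c \<and> P y}"
  hence "y < sum_list ns" by simp
  note B = block_split[OF this]
  have "y = off ns c + bloc ns y" "bloc ns y < ns ! c" using B y by auto
  thus "y \<in> (\<lambda>l. off ns c + l) ` {l. l < ns ! c \<and> P (off ns c + l)}" using y by (intro image_eqI) auto
 qed
qed

lemma block_card: assumes "c < length ns"
 shows "card {y. y < sum_list ns \<and> bcol ns y = c \<and> P y} = card {l. l < ns ! c \<and> P (off ns c + l)}"
 unfolding block_image[OF assms, symmetric] by (rule card_image) (simp add: inj_on_def)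

lemma block_UN: "(\<Union>c<length ns. (\<lambda>l. off ns c + l) ` {..<ns ! c}) = {..<sum_list ns}"
proof -
 have "(\<lambda>l. off ns c + l) ` {..<ns ! c} = {y. y < sum_list ns \<and> bcol ns y = c}" if "c < length ns" for c
  using block_image[OF that, of "\<lambda>_. True"] by (simp add: lessThan_def)
 hence "(\<Union>c<length ns. (\<lambda>l. off ns c + l) ` {..<ns ! c}) = (\<Union>c<length ns. {y. y < sum_list ns \<and> bcol ns y = c})"
  by (intro SUP_cong) auto
 also have "... = {..<sum_list ns}" using block_split(1) by auto
 finally show ?thesis .
qed

text \<open>Row lengths padded by 0, in the same form as \<open>cnt\<close>, so that a tuple of
  partitions and the shape of a word are compared as functions.\<close>

definition cntl :: "nat list list => nat => nat => nat" where
 "cntl lam c i = (if c < length lam \<and> i < length (lam ! c) then lam ! c ! i else 0)"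

lemma cntl_out: "length lam \<le> c ==> cntl lam c i = 0"
 by (simp add: cntl_def)

lemma pure_tensor_upd:
 assumes "j < k"
 shows "pure_tensor k (v(j := fscale c a + b)) = fscale c (pure_tensor k (v(j := a))) + pure_tensor k (v(j := b))"
proof
 fix o'
 have e: "pure_tensor k (v(j := w)) o' = w (o' j) * (\<Prod>i\<in>{..<k} - {j}. v i (o' i))" for w
 proof -
  have "pure_tensor k (v(j := w)) o' = (\<Prod>i\<in>insert j ({..<k} - {j}). (v(j := w)) i (o' i))"
   unfolding pure_tensor_def by (rule prod.cong) (use assms in auto)
  also have "... = w (o' j) * (\<Prod>i\<in>{..<k} - {j}. (v(j := w)) i (o' i))" by (subst prod.insert) auto
  also have "(\<Prod>i\<in>{..<k} - {j}. (v(j := w)) i (o' i)) = (\<Prod>i\<in>{..<k} - {j}. v i (o' i))"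
   by (rule prod.cong) auto
  finally show ?thesis .
 qed
 show "pure_tensor k (v(j := fscale c a + b)) o' = (fscale c (pure_tensor k (v(j := a))) + pure_tensor k (v(j := b))) o'"
  unfolding plus_fun_apply fscale_apply e by (simp add: algebra_simps)
qed

text \<open>One factor is expanded at a time: in stage \<open>j\<close> of the induction the first
  \<open>j\<close> factors are arbitrary in their spans while the others are still
  generators.\<close>

lemma pure_tensor_span:
 assumes "\<And>i. i < k ==> v i \<in> cfun.span (S i)"
 shows "pure_tensor k v \<in> cfun.span {pure_tensor k u | u. \<forall>i<k. u i \<in> S i}" (is "_ \<in> ?Sp")
proof -
 have "\<forall>v. (\<forall>i<k. v i \<in> (if i < j then cfun.span (S i) else S i)) \<longrightarrow> pure_tensor k v \<in> ?Sp" if "j \<le> k" for j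
  using that
 proof (induct j)
  case 0
  show ?case
  proof (intro allI impI, rule cfun.span_base)
   fix v assume "\<forall>i<k. v i \<in> (if i < 0 then cfun.span (S i) else S i)"
   hence "\<forall>i<k. v i \<in> S i" by simp
   thus "pure_tensor k v \<in> {pure_tensor k u | u. \<forall>i<k. u i \<in> S i}" by blast
  qed
 next
  case (Suc j)
  hence j: "j < k" by simp
  show ?case
  proof (intro allI impI)
   fix v assume v: "\<forall>i<k. v i \<in> (if i < Suc j then cfun.span (S i) else S i)"
   have "pure_tensor k (v(j := a)) \<in> ?Sp" if "a \<in> cfun.span (S j)" for a
    using that
   proof (induction rule: cfun.span_induct_alt)
    case base
    have "pure_tensor k (v(j := 0)) = 0"
    proof
     fix o'
     have "\<exists>i\<in>{..<k}. (v(j := 0)) i (o' i) = 0" using j by (intro bexI[of _ j]) auto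
     thus "pure_tensor k (v(j := 0)) o' = 0 o'" unfolding pure_tensor_def by (simp add: prod_zero)
    qed
    thus ?case using cfun.span_zero by metis
   next
    case (step c x y)
    have "pure_tensor k (v(j := x)) \<in> ?Sp"
    proof (rule Suc.hyps[rule_format])
     show "j \<le> k" using j by simp
     fix i assume "i < k"
     thus "(v(j := x)) i \<in> (if i < j then cfun.span (S i) else S i)"
      using v step(1) by (auto split: if_splits)
    qed
    thus ?case unfolding pure_tensor_upd[OF j] by (rule cfun.span_add[OF cfun.span_scale step(2)])
   qed
   moreover have "v j \<in> cfun.span (S j)" using v[rule_format, OF j] by simp
   ultimately have "pure_tensor k (v(j := v j)) \<in> ?Sp" by blast
   thus "pure_tensor k v \<in> ?Sp" by (simp only: fun_upd_triv)
  qed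
 qed
 note * = this[OF order_refl, rule_format]
 show ?thesis by (rule *) (simp add: assms)
qed

text \<open>Each factor acts by a scalar times a substitution of the argument; in the tensor product
  the scalars multiply and the substitutions act on separate coordinates.\<close>

lemma outer_tensor_act:
 fixes G :: "nat => ('g, 'b) rep"
 assumes "\<And>i f t. i < k ==> ract (G i) (gs i) f t = c i * f (h i t)"
 shows "ract (outer_tensor_rep k G) gs F b = (\<Prod>i<k. c i) * F (\<lambda>i. if i < k then h i (b i) else b i)"
proof -
 have "fold (\<lambda>i. apply_at i (ract (G i) (gs i))) [0..<j] F b = (\<Prod>i<j. c i) * F (\<lambda>i. if i < j then h i (b i) else b i)"
  if "j \<le> k" for j b
  using that
 proof (induct j arbitrary: b)
  case (Suc j)
  hence j: "j < k" by simp
  have e: "(\<lambda>i. if i < j then h i ((b(j := h j (b j))) i) else (b(j := h j (b j))) i) = (\<lambda>i. if i < Suc j then h i (b i) else b i)"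
   by (auto simp: fun_eq_iff less_Suc_eq)
  have "fold (\<lambda>i. apply_at i (ract (G i) (gs i))) [0..<Suc j] F b =
    c j * fold (\<lambda>i. apply_at i (ract (G i) (gs i))) [0..<j] F (b(j := h j (b j)))"
   by (simp add: apply_at_def assms[OF j])
  also have "... = c j * ((\<Prod>i<j. c i) * F (\<lambda>i. if i < Suc j then h i (b i) else b i))"
   by (simp only: Suc.hyps[OF less_imp_le[OF j]] e)
  finally show ?case by simp
 qed simp
 thus ?thesis by (simp add: outer_tensor_rep_def)
qed

section \<open>Induced representations realised on words\<close>

locale vmod = gel m s for m s :: nat +
 fixes lam :: "nat list list"
 assumes len: "length lam = 2 * s" and parts: "\<And>a. a \<in> set lam ==> is_partition a"
  and sum_lam: "(\<Sum>a\<leftarrow>lam. sum_list a) = m"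
begin

sublocale grn "2 * s" m using s_pos by unfold_locales simp

abbreviation ns where "ns \<equiv> map sum_list lam"

lemma ns_simps: "sum_list ns = m" "length ns = r" "c < r ==> ns ! c = sum_list (lam ! c)"
 using len sum_lam by simp_all

lemma part: "c < r ==> is_partition (lam ! c)"
 using parts len by simp

lemma blk: "y < m ==> bcol ns y < r" "y < m ==> bloc ns y < sum_list (lam ! bcol ns y)"
  "y < m ==> off ns (bcol ns y) + bloc ns y = y"
  "c < r ==> l < sum_list (lam ! c) ==> bcol ns (off ns c + l) = c"
  "c < r ==> l < sum_list (lam ! c) ==> bloc ns (off ns c + l) = l"
  "c < r ==> l < sum_list (lam ! c) ==> off ns c + l < m"
 using block_split[of y ns] block_join[of c ns l] ns_simps by auto

text \<open>The base colouring, in which block c of the positions has colour c. A monomial matrix is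
  block diagonal exactly when its permutation preserves this colouring.\<close>

definition z1 :: "nat => nat" where "z1 y = (if y < m then bcol ns y else 0)"

text \<open>The tuples whose components below \<open>r\<close> are tabloids of the prescribed
  shapes; tensors of polytabloids vanish at all other tuples.\<close>

definition proper :: "(nat => nat set list) => bool" where
 "proper b \<longleftrightarrow> (\<forall>c<r. \<exists>ta. valid (lam ! c) ta \<and> b c = tbl (lam ! c) ta)"

definition wordb :: "(nat => nat set list) => nat => nat" where
 "wordb b y = (if y < m then rowof (b (bcol ns y)) (bloc ns y) else 0)"

text \<open>The coset of \<open>x\<close> modulo the block diagonal subgroup is recorded by the
  colouring \<open>z1 \<circ> perm_of x\<close>, the tabloids in \<open>b\<close> by the rows. The
  weight accounts for the entries of \<open>x\<close>, which a word does not see.\<close>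

definition xi :: "(wd => complex) => complex mat \<times> (nat => nat set list) => complex" where
 "xi ph = (\<lambda>(x, b). if x \<in> carrier (Grn r m) \<and> proper b
   then wt x z1 * ph (z1 \<circ> perm_of x, wordb b \<circ> perm_of x) else 0)"

lemma xi_add: "xi (ph + ps) = xi ph + xi ps"
 and xi_fscale: "xi (fscale c ph) = fscale c (xi ph)"
 and xi_zero: "xi 0 = 0"
 by (auto simp: xi_def fun_eq_iff algebra_simps)

lemma proper_word:
 assumes b: "proper b" and c: "c < r"
 shows "valid (lam ! c) (\<lambda>l. wordb b (off ns c + l))" "b c = tbl (lam ! c) (\<lambda>l. wordb b (off ns c + l))"
proof -
 obtain ta where t: "valid (lam ! c) ta" "b c = tbl (lam ! c) ta" using b c unfolding proper_def by blast
 have e: "wordb b (off ns c + l) = ta l" if "l < sum_list (lam ! c)" for l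
  unfolding wordb_def using blk(4-6)[OF c that] rowof_tbl[OF t(1) that] by (simp add: t(2))
 show "valid (lam ! c) (\<lambda>l. wordb b (off ns c + l))" using t(1) e by (simp add: valid_def)
 show "b c = tbl (lam ! c) (\<lambda>l. wordb b (off ns c + l))" unfolding t(2) by (rule tbl_cong) (simp add: e)
qed

lemma word_exists:
 assumes "\<And>y. y < m ==> bw y < length (lam ! bcol ns y)" "\<And>y. m \<le> y ==> bw y = 0"
 shows "\<exists>b. proper b \<and> wordb b = bw"
proof -
 define b where "b c = tbl (lam ! c) (\<lambda>l. bw (off ns c + l))" for c
 have v: "valid (lam ! c) (\<lambda>l. bw (off ns c + l))" if c: "c < r" for c
  unfolding valid_def
 proof (intro allI impI)
  fix l assume l: "l < sum_list (lam ! c)"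
  show "bw (off ns c + l) < length (lam ! c)" using assms(1)[OF blk(6)[OF c l]] by (simp only: blk(4)[OF c l])
 qed
 have "proper b" unfolding proper_def b_def using v by blast
 moreover have "wordb b = bw"
 proof
  fix y show "wordb b y = bw y"
  proof (cases "y < m")
   case True
   have "rowof (b (bcol ns y)) (bloc ns y) = bw (off ns (bcol ns y) + bloc ns y)"
    unfolding b_def by (rule rowof_tbl[OF v[OF blk(1)[OF True]] blk(2)[OF True]])
   thus ?thesis using True by (simp add: wordb_def blk(3)[OF True])
  qed (use assms(2) in \<open>simp add: wordb_def\<close>)
 qed
 ultimately show ?thesis by blast
qed

text \<open>Different blocks have different colours and hence no common column, so the signed sum
  factors over the blocks, each factor being a polytabloid.\<close>

lemma evec_tensor:
 assumes T: "\<And>c. c < r ==> T c \<in> tableaux (lam ! c)"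
  and rw: "\<And>c l. c < r ==> l < sum_list (lam ! c) ==> rw (off ns c + l) = rowT (lam ! c) (T c) l"
  and cw: "\<And>c l. c < r ==> l < sum_list (lam ! c) ==> cw (off ns c + l) = colT (lam ! c) (T c) l"
  and 0: "\<And>y. m \<le> y ==> rw y = 0" and b: "proper b"
 shows "evec z1 rw cw (z1, wordb b) = pure_tensor r (\<lambda>c. polytabloid (lam ! c) (T c)) b"
proof -
 let ?C = "\<lambda>x. (z1 x, cw x)"
 let ?Y = "\<lambda>c. (\<lambda>l. off ns c + l) ` {..<sum_list (lam ! c)}"
 have z1c: "z1 x = c" if "x \<in> ?Y c" "c < r" for x c using that blk(4,6) by (auto simp: z1_def)
 have U: "(\<Union>c<r. ?Y c) = {..<m}" using block_UN[of ns] by (simp add: ns_simps(1,2) len)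
 have "evec z1 rw cw (z1, wordb b) = pdet {..<m} (wordb b) rw ?C"
  by (rule evec_pdet) (auto simp: 0 wordb_def)
 also have "... = (\<Prod>c<r. pdet (?Y c) (wordb b) rw ?C)"
  unfolding U[symmetric]
 proof (rule pdet_UN)
  fix c c' x y assume h: "c \<in> {..<r}" "c' \<in> {..<r}" "c \<noteq> c'" "x \<in> ?Y c" "y \<in> ?Y c'"
  have "z1 x = c" "z1 y = c'" by (rule z1c[OF h(4)], use h in simp, rule z1c[OF h(5)], use h in simp)
  thus "(z1 x, cw x) \<noteq> (z1 y, cw y)" using h(3) by simp
 qed auto
 also have "... = (\<Prod>c<r. polytabloid (lam ! c) (T c) (b c))"
 proof (rule prod.cong[OF refl])
  fix c assume "c \<in> {..<r}"
  hence c: "c < r" by simp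
  have "pdet (?Y c) (wordb b) rw ?C = pdet {..<sum_list (lam ! c)} (wordb b \<circ> (\<lambda>l. off ns c + l)) (rw \<circ> (\<lambda>l. off ns c + l)) (?C \<circ> (\<lambda>l. off ns c + l))"
   by (rule pdet_reindex) (auto simp: inj_on_def)
  also have "... = pdet {..<sum_list (lam ! c)} (\<lambda>l. wordb b (off ns c + l)) (rowT (lam ! c) (T c)) (colT (lam ! c) (T c))"
  proof (rule pdet_cong)
   fix x y assume xy: "x \<in> {..<sum_list (lam ! c)}" "y \<in> {..<sum_list (lam ! c)}"
   hence "z1 (off ns c + x) = c" "z1 (off ns c + y) = c" using z1c[OF _ c] by auto
   thus "((?C \<circ> (\<lambda>l. off ns c + l)) x = (?C \<circ> (\<lambda>l. off ns c + l)) y) = (colT (lam ! c) (T c) x = colT (lam ! c) (T c) y)"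
    using cw[OF c] xy by simp
  qed (use rw[OF c] in auto)
  also have "... = polytabloid (lam ! c) (T c) (tbl (lam ! c) (\<lambda>l. wordb b (off ns c + l)))"
   by (rule polytabloid_tbl[OF T[OF c] proper_word(1)[OF b c], symmetric])
  also have "tbl (lam ! c) (\<lambda>l. wordb b (off ns c + l)) = b c" by (rule proper_word(2)[OF b c, symmetric])
  finally show "pdet (?Y c) (wordb b) rw ?C = polytabloid (lam ! c) (T c) (b c)" .
 qed
 finally show ?thesis by (simp only: pure_tensor_def)
qed

lemma xi_evec_tensor:
 assumes x: "x \<in> carrier (Grn r m)" and T: "\<And>c. c < r ==> T c \<in> tableaux (lam ! c)"
  and rw: "\<And>c l. c < r ==> l < sum_list (lam ! c) ==> rw (off ns c + l) = rowT (lam ! c) (T c) l"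
  and cw: "\<And>c l. c < r ==> l < sum_list (lam ! c) ==> cw (off ns c + l) = colT (lam ! c) (T c) l"
  and 0: "\<And>y. m \<le> y ==> rw y = 0"
  and e: "z \<circ> inv (perm_of x) = z1" "rw' \<circ> inv (perm_of x) = rw" "cw' \<circ> inv (perm_of x) = cw"
 shows "xi (evec z rw' cw') (x, b) = wt x z1 * pure_tensor r (\<lambda>c. polytabloid (lam ! c) (T c)) b"
proof (cases "proper b")
 case True
 have "evec z rw' cw' (z1 \<circ> perm_of x, wordb b \<circ> perm_of x) = pure_tensor r (\<lambda>c. polytabloid (lam ! c) (T c)) b"
  unfolding evec_shift_perm[OF Grn_mono(2)[OF x]] e by (rule evec_tensor[OF T rw cw 0 True])
 thus ?thesis using x True by (simp add: xi_def)
next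
 case False
 then obtain c where c: "c < r" "\<And>ta. valid (lam ! c) ta ==> b c \<noteq> tbl (lam ! c) ta" unfolding proper_def by blast
 have "polytabloid (lam ! c) (T c) (b c) = 0" by (rule polytabloid_invalid[OF T[OF c(1)] c(2)])
 hence "pure_tensor r (\<lambda>c. polytabloid (lam ! c) (T c)) b = 0"
  unfolding pure_tensor_def using c(1) by (intro prod_zero) auto
 thus ?thesis using False by (simp add: xi_def)
qed

text \<open>With the base colouring the colour classes are the blocks, so a multitableau restricts
  to one tableau in the local coordinates of each block.\<close>

lemma word_tableaux:
 assumes t: "Tab z1 rw cw" and cn: "cnt z1 rw = cntl lam"
 shows "\<exists>T. \<forall>c<r. T c \<in> tableaux (lam ! c) \<and> (\<forall>l<sum_list (lam ! c).
   rw (off ns c + l) = rowT (lam ! c) (T c) l \<and> cw (off ns c + l) = colT (lam ! c) (T c) l)"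
proof -
 have tab: "tab {..<m} z1 rw cw" using t by (simp add: Tab_def)
 have "\<exists>T\<in>tableaux (lam ! c). \<forall>l<sum_list (lam ! c). rowT (lam ! c) T l = rw (off ns c + l) \<and> colT (lam ! c) T l = cw (off ns c + l)"
  if c: "c < r" for c
 proof (rule tableau_exists)
  note B = blk(4,6)[OF c]
  have z: "z1 (off ns c + l) = c" if "l < sum_list (lam ! c)" for l using B[OF that] by (simp add: z1_def)
  show "x = y" if h: "x < sum_list (lam ! c)" "y < sum_list (lam ! c)" "rw (off ns c + x) = rw (off ns c + y)" "cw (off ns c + x) = cw (off ns c + y)" for x y
  proof -
   have "inj3 {..<m} z1 rw cw" using tab by (simp add: tab_def)
   from inj3D[OF this, of "off ns c + x" "off ns c + y"] show ?thesis
    using B(2)[OF h(1)] B(2)[OF h(2)] z[OF h(1)] z[OF h(2)] h(3,4) by simp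
  qed
  show "\<exists>x<sum_list (lam ! c). rw (off ns c + x) = rw (off ns c + y) \<and> cw (off ns c + x) = j"
   if h: "y < sum_list (lam ! c)" "j < cw (off ns c + y)" for y j
  proof -
   have "off ns c + y \<in> {..<m}" using B(2)[OF h(1)] by simp
   then obtain x where x: "x < m" "z1 x = z1 (off ns c + y)" "rw x = rw (off ns c + y)" "cw x = j"
    using tab h(2) unfolding tab_def by blast
   have cx: "bcol ns x = c" using x(1,2) z[OF h(1)] by (simp add: z1_def)
   have "off ns c + bloc ns x = x" "bloc ns x < sum_list (lam ! c)" using blk(2,3)[OF x(1)] by (simp_all only: cx)
   thus ?thesis using x(3,4) by metis
  qed
  show "card {l. l < sum_list (lam ! c) \<and> rw (off ns c + l) = i} = (if i < length (lam ! c) then lam ! c ! i else 0)" for i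
  proof -
   have "card {l. l < sum_list (lam ! c) \<and> rw (off ns c + l) = i} = card {y. y < m \<and> bcol ns y = c \<and> rw y = i}"
    using block_card[of c ns "\<lambda>y. rw y = i"] c len ns_simps by simp
   also have "{y. y < m \<and> bcol ns y = c \<and> rw y = i} = {x\<in>{..<m}. z1 x = c \<and> rw x = i}" by (auto simp: z1_def)
   also have "card ... = cntl lam c i" using fun_cong[OF fun_cong[OF cn]] by (simp only: cnt_def)
   finally show ?thesis using c len by (simp add: cntl_def)
  qed
 qed
 hence "\<forall>c. \<exists>T. c < r \<longrightarrow> T \<in> tableaux (lam ! c) \<and> (\<forall>l<sum_list (lam ! c).
   rw (off ns c + l) = rowT (lam ! c) T l \<and> cw (off ns c + l) = colT (lam ! c) T l)" by metis
 from choice[OF this] show ?thesis by blast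
qed

text \<open>The converse gluing. That the components of \<open>lam\<close> are partitions gives the
  closure under moving up in a column.\<close>

lemma tableaux_word:
 assumes T: "\<And>c. c < r ==> T c \<in> tableaux (lam ! c)"
 shows "\<exists>rw cw. Tab z1 rw cw \<and> cnt z1 rw = cntl lam \<and> (\<forall>c<r. \<forall>l<sum_list (lam ! c).
   rw (off ns c + l) = rowT (lam ! c) (T c) l \<and> cw (off ns c + l) = colT (lam ! c) (T c) l)"
proof -
 define rw where "rw y = (if y < m then rowT (lam ! bcol ns y) (T (bcol ns y)) (bloc ns y) else 0)" for y
 define cw where "cw y = colT (lam ! bcol ns y) (T (bcol ns y)) (bloc ns y)" for y
 have val: "rw (off ns c + l) = rowT (lam ! c) (T c) l \<and> cw (off ns c + l) = colT (lam ! c) (T c) l \<and> z1 (off ns c + l) = c"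
  if "c < r" "l < sum_list (lam ! c)" for c l
  using blk(4-6)[OF that] by (simp add: rw_def cw_def z1_def)
 have tab: "tab {..<m} z1 rw cw"
  unfolding tab_def
 proof (intro conjI ballI allI impI)
  show "inj3 {..<m} z1 rw cw"
  proof (rule inj_onI)
   fix x y assume h: "x \<in> {..<m}" "y \<in> {..<m}" "(z1 x, rw x, cw x) = (z1 y, rw y, cw y)"
   hence xy: "x < m" "y < m" by auto
   have c: "bcol ns x = bcol ns y" using h(3) xy by (simp add: z1_def)
   have rg: "rw x = rw y" "cw x = cw y" using h(3) by blast+
   have "rowT (lam ! bcol ns y) (T (bcol ns y)) (bloc ns x) = rowT (lam ! bcol ns y) (T (bcol ns y)) (bloc ns y)"
    using rg(1) unfolding rw_def c by (simp only: xy if_True)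
   moreover have "colT (lam ! bcol ns y) (T (bcol ns y)) (bloc ns x) = colT (lam ! bcol ns y) (T (bcol ns y)) (bloc ns y)"
    using rg(2) unfolding cw_def c .
   moreover have "bloc ns x < sum_list (lam ! bcol ns y)" using blk(2)[OF xy(1)] unfolding c .
   ultimately have bl: "bloc ns x = bloc ns y"
    using tableau_props(1)[OF part[OF blk(1)[OF xy(2)]] T[OF blk(1)[OF xy(2)]] _ blk(2)[OF xy(2)]] by blast
   have "x = off ns (bcol ns x) + bloc ns x" by (rule blk(3)[OF xy(1), symmetric])
   also have "... = y" unfolding c bl by (rule blk(3)[OF xy(2)])
   finally show "x = y" .
  qed
  fix y j assume "y \<in> {..<m}"
  hence y: "y < m" by simp
  let ?c = "bcol ns y"
  note P = tableau_props[OF part[OF blk(1)[OF y]] T[OF blk(1)[OF y]]]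
  have vy: "rw y = rowT (lam ! ?c) (T ?c) (bloc ns y)" "cw y = colT (lam ! ?c) (T ?c) (bloc ns y)" "z1 y = ?c"
   using y by (simp_all add: rw_def cw_def z1_def)
  show "\<exists>x\<in>{..<m}. z1 x = z1 y \<and> rw x = rw y \<and> cw x = j" if jg: "j < cw y"
  proof -
   obtain l where l: "l < sum_list (lam ! ?c)" "rowT (lam ! ?c) (T ?c) l = rowT (lam ! ?c) (T ?c) (bloc ns y)" "colT (lam ! ?c) (T ?c) l = j"
    using P(2)[OF blk(2)[OF y], of j] jg unfolding vy by blast
   have "off ns ?c + l \<in> {..<m}" using blk(6)[OF blk(1)[OF y] l(1)] by simp
   thus ?thesis
    using val[OF blk(1)[OF y] l(1)] unfolding l(2,3) vy by blast
  qed
  show "\<exists>x\<in>{..<m}. z1 x = z1 y \<and> cw x = cw y \<and> rw x = j" if jr: "j < rw y"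
  proof -
   obtain l where l: "l < sum_list (lam ! ?c)" "colT (lam ! ?c) (T ?c) l = colT (lam ! ?c) (T ?c) (bloc ns y)" "rowT (lam ! ?c) (T ?c) l = j"
    using P(3)[OF blk(2)[OF y], of j] jr unfolding vy by blast
   have "off ns ?c + l \<in> {..<m}" using blk(6)[OF blk(1)[OF y] l(1)] by simp
   thus ?thesis
    using val[OF blk(1)[OF y] l(1)] unfolding l(2,3) vy by blast
  qed
 qed
 have "Tab z1 rw cw" using tab blk(1) by (simp add: Tab_def z1_def rw_def)
 moreover have "cnt z1 rw c i = cntl lam c i" for c i
 proof (cases "c < r")
  case True
  have "{x\<in>{..<m}. z1 x = c \<and> rw x = i} = {y. y < m \<and> bcol ns y = c \<and> rw y = i}" by (auto simp: z1_def)
  hence "cnt z1 rw c i = card {l. l < sum_list (lam ! c) \<and> rw (off ns c + l) = i}"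
   using block_card[of c ns "\<lambda>y. rw y = i"] True len ns_simps by (simp add: cnt_def)
  also have "{l. l < sum_list (lam ! c) \<and> rw (off ns c + l) = i} = {l. l < sum_list (lam ! c) \<and> rowT (lam ! c) (T c) l = i}"
   using val[OF True] by (intro Collect_cong conj_cong refl) simp
  also have "card ... = (if i < length (lam ! c) then lam ! c ! i else 0)"
   by (rule tableau_props(4)[OF part[OF True] T[OF True]])
  finally show ?thesis using True len by (simp add: cntl_def)
 next
  case False
  hence "{x\<in>{..<m}. z1 x = c \<and> rw x = i} = {}" using blk(1) by (auto simp: z1_def)
  thus ?thesis using False len by (simp add: cnt_def cntl_out)
 qed
 hence "cnt z1 rw = cntl lam" by (intro ext)
 ultimately show ?thesis using val by blast
qed

end

context vmod
begin

definition Sl where "Sl = cfun.span {evec z rw cw |z rw cw. Tab z rw cw \<and> cnt z rw = cntl lam}"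
definition Wsp where "Wsp = cfun.span {pure_tensor r v |v. \<forall>i<r. v i \<in> rspace (specht (lam ! i))}"
definition pullb :: "(nat => complex mat) => (nat => nat set list) => nat => nat set list" where
 "pullb gs b = (\<lambda>i. if i < r then map (image (inv (perm_of (gs i)))) (b i) else b i)"
abbreviation "iota gs \<equiv> diag_block_mat (map gs [0..<r])"
abbreviation "Kc \<equiv> Pi\<^sub>E {..<r} (\<lambda>i. carrier (Grn r (sum_list (lam ! i))))"

lemma rho_space: "f \<in> rspace (rho r lam) \<longleftrightarrow>
  (\<forall>x\<in>carrier (Grn r m). (\<lambda>b. f (x, b)) \<in> Wsp) \<and> (\<forall>x b. x \<notin> carrier (Grn r m) \<longrightarrow> f (x, b) = 0) \<and>
  (\<forall>gs\<in>Kc. \<forall>x\<in>carrier (Grn r m). \<forall>b.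
   f (iota gs * x, b) = (\<Prod>i<r. (zeta r powi zsum r (gs i)) ^ i) * f (x, pullb gs b))"
proof -
 have act: "ract (outer_tensor_rep r (\<lambda>i. specht_twist r i (lam ! i))) gs F b =
   (\<Prod>i<r. (zeta r powi zsum r (gs i)) ^ i) * F (pullb gs b)" for gs F b
  unfolding pullb_def by (rule outer_tensor_act) (simp add: specht_twist_def specht_def)
 have W: "rspace (outer_tensor_rep r (\<lambda>i. specht_twist r i (lam ! i))) = Wsp"
  by (simp add: outer_tensor_rep_def Wsp_def specht_twist_def)
 have eq: "(\<lambda>b. f (y, b)) = ract (outer_tensor_rep r (\<lambda>i. specht_twist r i (lam ! i))) gs (\<lambda>b. f (x, b)) \<longleftrightarrow>
   (\<forall>b. f (y, b) = (\<Prod>i<r. (zeta r powi zsum r (gs i)) ^ i) * f (x, pullb gs b))" for x y gs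
  unfolding fun_eq_iff[of "\<lambda>b. f (y, b)"] act ..
 show ?thesis unfolding rho_def sum_lam induced_rep_def rep.simps W mem_Collect_eq Grn_simps carrier_product_group eq ..
qed

lemma rho_act: "ract (rho r lam) g f (x, b) = (if x \<in> carrier (Grn r m) then f (x * g, b) else 0)"
 unfolding rho_def sum_lam induced_rep_def by simp

text \<open>A block diagonal matrix keeps the base colouring, so it acts on words only by moving
  rows within blocks, and its weight is the product of the scalars by which the powers of gamma
  twist the Specht modules. These facts are the covariance condition of the induced
  representation.\<close>

lemma iota_facts:
 assumes gs: "gs \<in> Kc"
 shows "iota gs \<in> carrier (Grn r m)" "z1 \<circ> perm_of (iota gs) = z1"
  "wt (iota gs) z1 = (\<Prod>i<r. (zeta r powi zsum r (gs i)) ^ i)"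
  "proper (pullb gs b) \<longleftrightarrow> proper b"
  "proper b ==> wordb (pullb gs b) = wordb b \<circ> perm_of (iota gs)"
proof -
 have g: "gs c \<in> carrier (Grn r (sum_list (lam ! c)))" if "c < r" for c using gs that by (auto simp: PiE_iff)
 define si where "si c = perm_of (gs c)" for c
 have s: "si c permutes {..<sum_list (lam ! c)}" if "c < r" for c unfolding si_def by (rule Grn_mono(2)[OF g[OF that]])
 have gl: "length (map gs [0..<r]) = length ns" by (simp add: len)
 have gc: "map gs [0..<r] ! c \<in> carrier (Grn r (ns ! c))" if "c < length ns" for c using g that len by simp
 show D1: "iota gs \<in> carrier (Grn r m)"
  by (rule diag_block_mono(1)[OF r_pos gl, unfolded ns_simps(1)]) (erule gc)
 have D2: "perm_of (iota gs) = bperm ns (\<lambda>c. perm_of (map gs [0..<r] ! c))"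
  by (rule diag_block_mono(2)[OF r_pos gl]) (erule gc)
 have D3: "ent (iota gs) y = ent (map gs [0..<r] ! bcol ns y) (bloc ns y)" if "y < m" for y
  by (rule diag_block_mono(3)[OF r_pos gl, unfolded ns_simps(1)]) (erule gc, rule that)
 have bp: "bcol ns (perm_of (iota gs) y) = bcol ns y \<and> bloc ns (perm_of (iota gs) y) = si (bcol ns y) (bloc ns y)" if y: "y < m" for y
 proof -
  have p: "(\<lambda>c. perm_of (map gs [0..<r] ! c)) c permutes {..<ns ! c}" if "c < length ns" for c
   using s[of c] that len by (simp add: si_def)
  have "bcol ns (bperm ns (\<lambda>c. perm_of (map gs [0..<r] ! c)) y) = bcol ns y \<and>
    bloc ns (bperm ns (\<lambda>c. perm_of (map gs [0..<r] ! c)) y) = (\<lambda>c. perm_of (map gs [0..<r] ! c)) (bcol ns y) (bloc ns y)"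
   by (rule bperm_permutes(2)) (erule p, simp add: ns_simps(1) y)
  thus ?thesis unfolding D2[symmetric] using blk(1)[OF y] by (simp add: si_def)
 qed
 have pl: "perm_of (iota gs) y < m \<longleftrightarrow> y < m" for y by (rule permutes_less[OF Grn_mono(2)[OF D1]])
 show z: "z1 \<circ> perm_of (iota gs) = z1" using bp pl by (auto simp: z1_def fun_eq_iff)
 have "wt (iota gs) z1 = (\<Prod>y<m. ent (gs (bcol ns y)) (bloc ns y) ^ bcol ns y)"
  unfolding wt_def
 proof (rule prod.cong[OF refl])
  fix y assume "y \<in> {..<m}"
  hence y: "y < m" by simp
  have "z1 (perm_of (iota gs) y) = bcol ns y" using fun_cong[OF z, of y] y by (simp add: z1_def)
  moreover have "ent (iota gs) y = ent (gs (bcol ns y)) (bloc ns y)" using D3[OF y] blk(1)[OF y] by simp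
  ultimately show "ent (iota gs) y ^ z1 (perm_of (iota gs) y) = ent (gs (bcol ns y)) (bloc ns y) ^ bcol ns y" by simp
 qed
 also have "... = (\<Prod>c<r. \<Prod>l<sum_list (lam ! c). ent (gs c) l ^ c)"
  using block_prod[of "\<lambda>c l. ent (gs c) l ^ c" ns] by (simp add: ns_simps(1) len)
 also have "... = (\<Prod>i<r. (zeta r powi zsum r (gs i)) ^ i)"
 proof (rule prod.cong[OF refl])
  fix c assume "c \<in> {..<r}"
  hence c: "c < r" by simp
  interpret h: grn r "sum_list (lam ! c)" using r_pos by unfold_locales simp
  show "(\<Prod>l<sum_list (lam ! c). ent (gs c) l ^ c) = (zeta r powi zsum r (gs c)) ^ c"
   unfolding h.zsum_ent[OF g[OF c]] prod_power_distrib ..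
 qed
 finally show "wt (iota gs) z1 = (\<Prod>i<r. (zeta r powi zsum r (gs i)) ^ i)" .
 have pb: "pullb gs b c = tbl (lam ! c) (ta \<circ> si c)" if "c < r" "b c = tbl (lam ! c) ta" for b c ta
 proof -
  have "pullb gs b c = map (image (inv (si c))) (tbl (lam ! c) ta)" using that by (simp add: pullb_def si_def)
  thus ?thesis unfolding image_tbl[OF permutes_inv[OF s[OF that(1)]]] permutes_inv_inv[OF s[OF that(1)]] .
 qed
 show "proper (pullb gs b) \<longleftrightarrow> proper b"
 proof
  assume p: "proper b"
  show "proper (pullb gs b)" unfolding proper_def
  proof (intro allI impI)
   fix c assume c: "c < r"
   show "\<exists>ta. valid (lam ! c) ta \<and> pullb gs b c = tbl (lam ! c) ta"
    using pb[of c b, OF c proper_word(2)[OF p c]] valid_comp[OF s[OF c] proper_word(1)[OF p c]] by blast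
  qed
 next
  assume p: "proper (pullb gs b)"
  show "proper b" unfolding proper_def
  proof (intro allI impI)
   fix c assume c: "c < r"
   let ?ta = "\<lambda>l. wordb (pullb gs b) (off ns c + l)"
   have "image (si c) \<circ> image (inv (si c)) = id"
    by (auto simp: fun_eq_iff image_comp permutes_inv_o(1)[OF s[OF c]])
   hence "b c = map (image (si c)) (pullb gs b c)"
    using c by (simp add: pullb_def si_def)
   also have "... = tbl (lam ! c) (?ta \<circ> inv (si c))"
    unfolding image_tbl[OF s[OF c], symmetric] by (rule arg_cong[OF proper_word(2)[OF p c]])
   finally have "b c = tbl (lam ! c) (?ta \<circ> inv (si c))" .
   thus "\<exists>ta. valid (lam ! c) ta \<and> b c = tbl (lam ! c) ta"
    using valid_comp[OF permutes_inv[OF s[OF c]] proper_word(1)[OF p c]] by blast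
  qed
 qed
 show "wordb (pullb gs b) = wordb b \<circ> perm_of (iota gs)" if p: "proper b"
 proof
  fix y show "wordb (pullb gs b) y = (wordb b \<circ> perm_of (iota gs)) y"
  proof (cases "y < m")
   case True
   let ?c = "bcol ns y"
   let ?ta = "\<lambda>l. wordb b (off ns ?c + l)"
   note c = blk(1)[OF True]
   have "wordb (pullb gs b) y = rowof (tbl (lam ! ?c) (?ta \<circ> si ?c)) (bloc ns y)"
    using True by (simp only: wordb_def if_True pb[of ?c b, OF c proper_word(2)[OF p c]])
   also have "... = wordb b (off ns ?c + si ?c (bloc ns y))"
    by (simp only: rowof_tbl[OF valid_comp[OF s[OF c] proper_word(1)[OF p c]] blk(2)[OF True]] comp_apply)
   also have "off ns ?c + si ?c (bloc ns y) = perm_of (iota gs) y"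
    using blk(3)[of "perm_of (iota gs) y"] True bp[OF True] pl by simp
   finally show ?thesis by simp
  next
   case False
   thus ?thesis using pl[of y] by (simp add: wordb_def)
  qed
 qed
qed

lemma xi_cov:
 assumes gs: "gs \<in> Kc" and x: "x \<in> carrier (Grn r m)"
 shows "xi ph (iota gs * x, b) = (\<Prod>i<r. (zeta r powi zsum r (gs i)) ^ i) * xi ph (x, pullb gs b)"
proof -
 note I = iota_facts[OF gs]
 note M = mult_Grn[OF I(1) x]
 show ?thesis
 proof (cases "proper b")
  case True
  have "wt (iota gs * x) z1 = (\<Prod>i<r. (zeta r powi zsum r (gs i)) ^ i) * wt x z1"
   unfolding wt_mult[OF I(1) x] I(2) I(3) ..
  moreover have "z1 \<circ> perm_of (iota gs * x) = z1 \<circ> perm_of x" unfolding M(2) comp_assoc[symmetric] I(2) ..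
  moreover have "wordb b \<circ> perm_of (iota gs * x) = wordb (pullb gs b) \<circ> perm_of x"
   unfolding M(2) comp_assoc[symmetric] I(5)[OF True] ..
  ultimately show ?thesis using True M(1) x I(4)[of b] unfolding xi_def by simp
 next
  case False
  thus ?thesis using I(4)[of b] by (simp add: xi_def)
 qed
qed

lemma subspace_Wsp: "cfun.subspace Wsp"
 unfolding Wsp_def by (rule cfun.subspace_span)

lemma xi_in: assumes "ph \<in> Sl" shows "xi ph \<in> rspace (rho r lam)"
proof -
 have "(\<lambda>b. xi ph (x, b)) \<in> Wsp" if x: "x \<in> carrier (Grn r m)" for x
  using assms unfolding Sl_def
 proof (induction rule: cfun.span_induct_alt)
  case base
  have "(\<lambda>b. xi 0 (x, b)) = 0" by (simp add: xi_zero fun_eq_iff)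
  thus ?case using cfun.subspace_0[OF subspace_Wsp] by metis
 next
  case (step c e y)
  then obtain z rw cw where e: "e = evec z rw cw" "Tab z rw cw" "cnt z rw = cntl lam" by blast
  note p = Grn_mono(2)[OF x]
  have A: "(\<lambda>b. xi e (x, b)) \<in> Wsp"
  proof (cases "z = z1 \<circ> perm_of x")
   case True
   let ?i = "inv (perm_of x)"
   have zi: "z \<circ> ?i = z1" unfolding True comp_assoc permutes_inv_o(1)[OF p] by simp
   have T: "Tab z1 (rw \<circ> ?i) (cw \<circ> ?i)" using Tab_comp[OF permutes_inv[OF p] e(2)] by (simp only: zi)
   have C: "cnt z1 (rw \<circ> ?i) = cntl lam" using cnt_comp2[OF permutes_inv[OF p], of z rw] by (simp only: zi e(3))
   obtain T where T': "\<forall>c<r. T c \<in> tableaux (lam ! c) \<and> (\<forall>l<sum_list (lam ! c).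
    (rw \<circ> ?i) (off ns c + l) = rowT (lam ! c) (T c) l \<and> (cw \<circ> ?i) (off ns c + l) = colT (lam ! c) (T c) l)"
    using word_tableaux[OF T C] by blast
   have "xi e (x, b) = wt x z1 * pure_tensor r (\<lambda>c. polytabloid (lam ! c) (T c)) b" for b
    unfolding e(1)
    by (rule xi_evec_tensor[OF x _ _ _ _ zi refl refl]) (use T' T in \<open>auto simp: Tab_def\<close>)
   hence "(\<lambda>b. xi e (x, b)) = fscale (wt x z1) (pure_tensor r (\<lambda>c. polytabloid (lam ! c) (T c)))"
    by (intro ext) (simp only: fscale_apply)
   moreover have "pure_tensor r (\<lambda>c. polytabloid (lam ! c) (T c)) \<in> Wsp" unfolding Wsp_def
   proof (intro cfun.span_base CollectI exI[of _ "\<lambda>c. polytabloid (lam ! c) (T c)"] conjI refl allI impI)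
    fix i assume "i < r"
    thus "polytabloid (lam ! i) (T i) \<in> rspace (specht (lam ! i))"
     unfolding specht_def rep.simps by (intro cfun.span_base imageI) (use T' in blast)
   qed
   ultimately show ?thesis using cfun.subspace_scale[OF subspace_Wsp] by simp
  next
   case False
   hence "z1 \<circ> perm_of x \<noteq> z" by blast
   hence "(\<lambda>b. xi e (x, b)) = 0" unfolding e(1) by (intro ext) (simp add: xi_def evec_colour)
   thus ?thesis using cfun.subspace_0[OF subspace_Wsp] by simp
  qed
  have eq: "(\<lambda>b. xi (fscale c e + y) (x, b)) = fscale c (\<lambda>b. xi e (x, b)) + (\<lambda>b. xi y (x, b))"
   unfolding xi_add xi_fscale by (intro ext) (simp only: fscale_apply plus_fun_apply)
  show ?case unfolding eq
   by (rule cfun.subspace_add[OF subspace_Wsp cfun.subspace_scale[OF subspace_Wsp A] step(2)])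
 qed
 thus ?thesis unfolding rho_space
 proof (intro conjI ballI allI impI)
  show "xi ph (x, b) = 0" if "x \<notin> carrier (Grn r m)" for x b using that by (simp add: xi_def)
 qed ((rule xi_cov; assumption) | blast)+
qed

lemma subspace_Sl: "cfun.subspace Sl"
 unfolding Sl_def by (rule cfun.subspace_span)

text \<open>A polytabloid word has a single colouring, so its image is supported on a single coset.
  Values can therefore be prescribed on one coset at a time.\<close>

lemma xi_local:
 assumes y: "y \<in> carrier (Grn r m)" and w: "w \<in> Wsp"
 shows "\<exists>ph\<in>Sl. (\<forall>b. xi ph (y, b) = w b) \<and> (\<forall>x b. z1 \<circ> perm_of x \<noteq> z1 \<circ> perm_of y \<longrightarrow> xi ph (x, b) = 0)"
proof -
 let ?PT = "{pure_tensor r u |u. \<forall>i<r. u i \<in> polytabloid (lam ! i) ` tableaux (lam ! i)}"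
 have "Wsp \<subseteq> cfun.span ?PT" unfolding Wsp_def
 proof (rule cfun.span_minimal[OF _ cfun.subspace_span], rule subsetI)
  fix w assume "w \<in> {pure_tensor r v |v. \<forall>i<r. v i \<in> rspace (specht (lam ! i))}"
  then obtain v where "w = pure_tensor r v" "\<forall>i<r. v i \<in> cfun.span (polytabloid (lam ! i) ` tableaux (lam ! i))"
   by (auto simp: specht_def)
  thus "w \<in> cfun.span ?PT" using pure_tensor_span[of r v "\<lambda>i. polytabloid (lam ! i) ` tableaux (lam ! i)"] by simp
 qed
 hence "w \<in> cfun.span ?PT" using w by blast
 thus ?thesis
 proof (induction rule: cfun.span_induct_alt)
  case base
  show ?case
  proof (rule bexI[OF _ cfun.subspace_0[OF subspace_Sl]])
   show "(\<forall>b. xi 0 (y, b) = 0 b) \<and> (\<forall>x b. z1 \<circ> perm_of x \<noteq> z1 \<circ> perm_of y \<longrightarrow> xi 0 (x, b) = 0)"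
    unfolding xi_zero by simp
  qed
 next
  case (step c e w')
  then obtain u where u: "e = pure_tensor r u" "\<forall>i<r. u i \<in> polytabloid (lam ! i) ` tableaux (lam ! i)" by blast
  hence "\<forall>i. \<exists>T. i < r \<longrightarrow> u i = polytabloid (lam ! i) T \<and> T \<in> tableaux (lam ! i)" by blast
  from choice[OF this] obtain T where T: "\<And>i. i < r ==> u i = polytabloid (lam ! i) (T i)" "\<And>i. i < r ==> T i \<in> tableaux (lam ! i)"
   by blast
  from tableaux_word[OF T(2)] obtain rw cw where P: "Tab z1 rw cw" "cnt z1 rw = cntl lam"
   "\<forall>c<r. \<forall>l<sum_list (lam ! c). rw (off ns c + l) = rowT (lam ! c) (T c) l \<and> cw (off ns c + l) = colT (lam ! c) (T c) l"
   by blast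
  note p = Grn_mono(2)[OF y]
  define E where "E = evec (z1 \<circ> perm_of y) (rw \<circ> perm_of y) (cw \<circ> perm_of y)"
  have ci: "f \<circ> perm_of y \<circ> inv (perm_of y) = f" for f :: "nat => nat"
   unfolding comp_assoc permutes_inv_o(1)[OF p] by simp
  have ES: "E \<in> Sl" unfolding Sl_def E_def
   by (intro cfun.span_base CollectI exI conjI, rule refl, rule Tab_comp[OF p P(1)])
    (simp only: cnt_comp2[OF p] P(2))
  have Ey: "xi E (y, b) = wt y z1 * e b" for b
  proof -
   have "xi E (y, b) = wt y z1 * pure_tensor r (\<lambda>c. polytabloid (lam ! c) (T c)) b"
    unfolding E_def by (rule xi_evec_tensor[OF y T(2) _ _ _ ci ci ci]) (use P in \<open>auto simp: Tab_def\<close>)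
   also have "pure_tensor r (\<lambda>c. polytabloid (lam ! c) (T c)) b = e b"
    unfolding u(1) pure_tensor_def by (rule prod.cong) (simp_all add: T(1))
   finally show ?thesis .
  qed
  have E0: "xi E (x, b) = 0" if "z1 \<circ> perm_of x \<noteq> z1 \<circ> perm_of y" for x b
   using that by (simp add: xi_def E_def evec_colour)
  from step obtain ps where ps: "ps \<in> Sl" "\<forall>b. xi ps (y, b) = w' b" "\<forall>x b. z1 \<circ> perm_of x \<noteq> z1 \<circ> perm_of y \<longrightarrow> xi ps (x, b) = 0"
   by blast
  show ?case
  proof (rule bexI[of _ "fscale (c * inverse (wt y z1)) E + ps"], intro conjI allI impI)
   show "fscale (c * inverse (wt y z1)) E + ps \<in> Sl"
    by (rule cfun.subspace_add[OF subspace_Sl cfun.subspace_scale[OF subspace_Sl ES] ps(1)])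
   show "xi (fscale (c * inverse (wt y z1)) E + ps) (y, b) = (fscale c e + w') b" for b
    unfolding xi_add xi_fscale plus_fun_apply fscale_apply Ey using ps(2) wt_nz[OF y] by simp
   show "xi (fscale (c * inverse (wt y z1)) E + ps) (x, b) = 0" if "z1 \<circ> perm_of x \<noteq> z1 \<circ> perm_of y" for x b
    unfolding xi_add xi_fscale plus_fun_apply fscale_apply using ps(3) E0[OF that] that by simp
  qed
 qed
qed

text \<open>\<open>x\<close> times the inverse of \<open>y\<close> preserves the base colouring and
  is block diagonal by \<open>block_factorisation\<close>.\<close>

lemma same_pattern:
 assumes x: "x \<in> carrier (Grn r m)" and y: "y \<in> carrier (Grn r m)" and e: "z1 \<circ> perm_of x = z1 \<circ> perm_of y"
 shows "\<exists>gs\<in>Kc. x = iota gs * y"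
proof -
 interpret G: group "Grn r m" by (rule group_Grn)
 define h where "h = m_inv (Grn r m) y"
 have h: "h \<in> carrier (Grn r m)" "h * y = 1\<^sub>m m" "y * h = 1\<^sub>m m"
  using G.inv_closed[OF y] G.l_inv[OF y] G.r_inv[OF y] by (simp_all add: h_def)
 define g where "g = x * h"
 have g: "g \<in> carrier (Grn r m)" unfolding g_def by (rule mult_Grn(1)[OF x h(1)])
 have xg: "x = g * y"
  using G.m_assoc[OF x h(1) y] G.r_one[OF x] by (simp add: g_def h(2))
 have yh: "perm_of y \<circ> perm_of h = id" using mult_Grn(2)[OF y h(1)] one_Grn(2) by (simp add: h(3))
 have zg: "z1 \<circ> perm_of g = z1"
  unfolding g_def mult_Grn(2)[OF x h(1)] comp_assoc[symmetric] e unfolding comp_assoc yh by simp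
 have b: "bcol ns (perm_of g u) = bcol ns u" if "u < m" for u
  using that fun_cong[OF zg, of u] permutes_less[OF Grn_mono(2)[OF g], of u] by (simp add: z1_def)
 obtain gl where gl: "length gl = length ns" "\<forall>c<length ns. gl ! c \<in> carrier (Grn r (ns ! c))" "g = diag_block_mat gl"
  using block_factorisation[OF r_pos, of g ns] g b by (auto simp: ns_simps(1))
 have "(\<lambda>i\<in>{..<r}. gl ! i) \<in> Kc" using gl(2) len by auto
 moreover have "map (\<lambda>i\<in>{..<r}. gl ! i) [0..<r] = gl"
  using gl(1) len by (intro nth_equalityI) auto
 ultimately show ?thesis using xg gl(3) by metis
qed

lemma xi_sum: "xi (\<Sum>i\<in>A. f i) = (\<Sum>i\<in>A. xi (f i))"
 by (induct A rule: infinite_finite_induct) (simp_all only: sum.infinite sum.empty sum.insert xi_zero xi_add not_False_eq_True)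

text \<open>Local solutions at one representative for each colouring have disjoint supports and can
  be added; covariance extends the agreement from the representatives to their cosets.\<close>

lemma xi_surj: assumes f: "f \<in> rspace (rho r lam)" shows "\<exists>ph\<in>Sl. f = xi ph"
proof -
 let ?Z = "(\<lambda>x. z1 \<circ> perm_of x) ` carrier (Grn r m)"
 have finZ: "finite ?Z" using finite_Grn by simp
 have f1: "(\<lambda>b. f (x, b)) \<in> Wsp" if "x \<in> carrier (Grn r m)" for x using f that unfolding rho_space by blast
 have f2: "f (x, b) = 0" if "x \<notin> carrier (Grn r m)" for x b using f that unfolding rho_space by blast
 have f3: "f (iota gs * x, b) = (\<Prod>i<r. (zeta r powi zsum r (gs i)) ^ i) * f (x, pullb gs b)"
  if "gs \<in> Kc" "x \<in> carrier (Grn r m)" for gs x b using f that unfolding rho_space by blast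
 have "\<forall>z. \<exists>y. z \<in> ?Z \<longrightarrow> y \<in> carrier (Grn r m) \<and> z1 \<circ> perm_of y = z" by blast
 from choice[OF this] obtain Y where Y: "\<And>z. z \<in> ?Z ==> Y z \<in> carrier (Grn r m)" "\<And>z. z \<in> ?Z ==> z1 \<circ> perm_of (Y z) = z"
  by blast
 have "\<exists>ph. z \<in> ?Z \<longrightarrow> ph \<in> Sl \<and> (\<forall>b. xi ph (Y z, b) = f (Y z, b)) \<and> (\<forall>x b. z1 \<circ> perm_of x \<noteq> z \<longrightarrow> xi ph (x, b) = 0)" for z
 proof (cases "z \<in> ?Z")
  case True
  from xi_local[OF Y(1)[OF True] f1[OF Y(1)[OF True]]] show ?thesis unfolding Y(2)[OF True] by blast
 qed blast
 hence "\<forall>z. \<exists>ph. z \<in> ?Z \<longrightarrow> ph \<in> Sl \<and> (\<forall>b. xi ph (Y z, b) = f (Y z, b)) \<and> (\<forall>x b. z1 \<circ> perm_of x \<noteq> z \<longrightarrow> xi ph (x, b) = 0)" by blast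
 from choice[OF this] obtain \<Phi> where \<Phi>: "\<And>z. z \<in> ?Z ==> \<Phi> z \<in> Sl" "\<And>z b. z \<in> ?Z ==> xi (\<Phi> z) (Y z, b) = f (Y z, b)"
  "\<And>z x b. z \<in> ?Z ==> z1 \<circ> perm_of x \<noteq> z ==> xi (\<Phi> z) (x, b) = 0" by blast
 define ph where "ph = (\<Sum>z\<in>?Z. \<Phi> z)"
 have S: "ph \<in> Sl" unfolding ph_def by (rule cfun.subspace_sum[OF subspace_Sl \<Phi>(1)])
 have at: "xi ph (Y z, b) = f (Y z, b)" if z: "z \<in> ?Z" for z b
 proof -
  have "xi ph (Y z, b) = (\<Sum>z'\<in>?Z. xi (\<Phi> z') (Y z, b))" by (simp only: ph_def xi_sum sum_fun_apply)
  also have "... = (\<Sum>z'\<in>?Z. if z' = z then f (Y z, b) else 0)"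
  proof (rule sum.cong[OF refl])
   fix z' assume z': "z' \<in> ?Z"
   show "xi (\<Phi> z') (Y z, b) = (if z' = z then f (Y z, b) else 0)"
   proof (cases "z' = z")
    case True thus ?thesis using \<Phi>(2)[OF z] by simp
   next
    case False
    hence "z1 \<circ> perm_of (Y z) \<noteq> z'" unfolding Y(2)[OF z] by blast
    from \<Phi>(3)[OF z' this] False show ?thesis by simp
   qed
  qed
  also have "... = f (Y z, b)" using finZ z by (simp only: sum.delta if_True)
  finally show ?thesis .
 qed
 have "f (x, b) = xi ph (x, b)" for x b
 proof (cases "x \<in> carrier (Grn r m)")
  case True
  define z where "z = z1 \<circ> perm_of x"
  have z: "z \<in> ?Z" using True by (auto simp: z_def)
  have "z1 \<circ> perm_of x = z1 \<circ> perm_of (Y z)" by (rule trans[OF z_def[symmetric] Y(2)[OF z, symmetric]])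
  from same_pattern[OF True Y(1)[OF z] this] obtain gs where gs: "gs \<in> Kc" "x = iota gs * Y z" by blast
  show ?thesis unfolding gs(2) f3[OF gs(1) Y(1)[OF z]] xi_cov[OF gs(1) Y(1)[OF z]] at[OF z] ..
 next
  case False
  thus ?thesis using f2 by (simp add: xi_def)
 qed
 hence "f = xi ph" by (intro ext) auto
 thus ?thesis using S by blast
qed

theorem rho_rspace: "rspace (rho r lam) = xi ` Sl"
 using xi_in xi_surj by blast

end

section \<open>The split representations\<close>

text \<open>Equal fibre sizes say that the multisets of values agree.\<close>

lemma fibre_permutation:
 assumes A: "finite A" and c: "\<And>y. card {x\<in>A. f x = y} = card {x\<in>A. g x = y}"
 shows "\<exists>p. p permutes A \<and> (\<forall>x\<in>A. f x = g (p x))"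
proof -
 have "count (image_mset h (mset_set A)) y = card {x\<in>A. h x = y}" for h :: "'a => 'b" and y
 proof -
  have "{x. x \<in># mset_set A \<and> y = h x} = {x\<in>A. h x = y}" using A by auto
  thus ?thesis using A by (simp add: count_image_mset')
 qed
 hence "image_mset f (mset_set A) = image_mset g (mset_set A)" by (intro multiset_eqI) (simp only: c)
 from image_mset_eq_implies_permutes[OF A this] show ?thesis by blast
qed

lemma tableaux_nonempty: "\<exists>T. T \<in> tableaux a"
 unfolding tableaux_def using finite_same_card_bij[of "cells a" "{..<sum_list a}"] finite_cells card_cells by auto

text \<open>Any word of shape \<open>lam\<close> is a rearrangement of one with the base colouring.
  So every such word occurs as an argument in \<open>xi\<close>, which later shows that no value of
  a function is lost.\<close>

lemma (in vmod) pattern_exists: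
 assumes c: "cnt z bw = cntl lam" and 0: "\<And>y. m \<le> y ==> z y = 0" "\<And>y. m \<le> y ==> bw y = 0"
 shows "\<exists>x b. x \<in> carrier (Grn r m) \<and> proper b \<and> z = z1 \<circ> perm_of x \<and> bw = wordb b \<circ> perm_of x"
proof -
 have "\<forall>c. \<exists>T. T \<in> tableaux (lam ! c)" using tableaux_nonempty by blast
 from choice[OF this] obtain T where T: "\<And>c. T c \<in> tableaux (lam ! c)" by blast
 from tableaux_word[of T, OF T] obtain rw cw where P: "Tab z1 rw cw" "cnt z1 rw = cntl lam"
  "\<forall>c<r. \<forall>l<sum_list (lam ! c). rw (off ns c + l) = rowT (lam ! c) (T c) l \<and> cw (off ns c + l) = colT (lam ! c) (T c) l"
  by blast
 have card: "card {x\<in>{..<m}. (z x, bw x) = y} = card {x\<in>{..<m}. (z1 x, rw x) = y}" for y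
 proof -
  obtain c i where y: "y = (c, i)" by (cases y)
  have "cnt z bw c i = cnt z1 rw c i" by (simp only: c P(2))
  thus ?thesis unfolding y cnt_def prod.inject .
 qed
 obtain pe where p: "pe permutes {..<m}" "\<forall>x\<in>{..<m}. (z x, bw x) = (z1 (pe x), rw (pe x))"
  using fibre_permutation[OF finite_lessThan card] by blast
 have rw0: "rw y = 0" if "m \<le> y" for y using P(1) that by (simp add: Tab_def)
 have "rw y < length (lam ! bcol ns y)" if y: "y < m" for y
 proof -
  have "rw (off ns (bcol ns y) + bloc ns y) = rowT (lam ! bcol ns y) (T (bcol ns y)) (bloc ns y)"
   using P(3) blk(1,2)[OF y] by blast
  thus ?thesis using tabloid_tbl(2)[OF T] blk(2)[OF y] unfolding blk(3)[OF y] by (simp add: valid_def)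
 qed
 from word_exists[OF this rw0] obtain b where b: "proper b" "wordb b = rw" by blast
 define x where "x = monm m pe (\<lambda>_. 1)"
 have x: "x \<in> carrier (Grn r m)" "perm_of x = pe" unfolding x_def using mono_Grn[OF p(1), of "\<lambda>_. 1"] by simp_all
 have "z = z1 \<circ> pe \<and> bw = rw \<circ> pe"
 proof (intro conjI ext)
  fix y
  show "z y = (z1 \<circ> pe) y" "bw y = (rw \<circ> pe) y"
   using p(2) permutes_not_in[OF p(1), of y] 0[of y] rw0[of y] by (cases "y < m"; simp add: z1_def)+
 qed
 thus ?thesis using x b by metis
qed

section \<open>Shuffles and the factorisation of monomial matrices\<close>

lemma strict_mono_image_unique:
 fixes f g :: "nat => nat"
 assumes "strict_mono_on {a..<b} f" "strict_mono_on {a..<b} g" "f ` {a..<b} = g ` {a..<b}" "x \<in> {a..<b}"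
 shows "f x = g x"
proof -
 have s: "sorted (map h [a..<b])" "distinct (map h [a..<b])" if h: "strict_mono_on {a..<b} h" for h :: "nat => nat"
 proof -
  show "sorted (map h [a..<b])"
   unfolding sorted_iff_nth_mono_less
  proof (intro allI impI)
   fix i j assume ij: "i < j" "j < length (map h [a..<b])"
   have "h (a + i) < h (a + j)" by (rule strict_mono_onD[OF h]) (use ij in auto)
   thus "map h [a..<b] ! i \<le> map h [a..<b] ! j" using ij by simp
  qed
  show "distinct (map h [a..<b])" using strict_mono_on_imp_inj_on[OF h] by (simp add: distinct_map)
 qed
 have "map f [a..<b] = map g [a..<b]"
  by (rule sorted_distinct_set_unique[OF s[OF assms(1)] s[OF assms(2)]]) (use assms(3) in simp)
 thus ?thesis using assms(4) by (simp add: map_eq_conv)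
qed

text \<open>The image of the second half is the complement of the image of the first, and on either
  half an increasing function is determined by its image.\<close>

lemma shuffle_unique:
 assumes t: "t \<in> shuffles_n (2 * m)" and u: "u \<in> shuffles_n (2 * m)" and e: "t ` {..<m} = u ` {..<m}"
 shows "t = u"
proof
 fix x
 have T: "t permutes {..<2 * m}" "strict_mono_on {0..<m} t" "strict_mono_on {m..<2 * m} t"
  using t by (auto simp: shuffles_n_def atLeast0LessThan)
 have U: "u permutes {..<2 * m}" "strict_mono_on {0..<m} u" "strict_mono_on {m..<2 * m} u"
  using u by (auto simp: shuffles_n_def atLeast0LessThan)
 have sp: "{m..<2 * m} = {..<2 * m} - {..<m}" by auto
 have c: "v ` {m..<2 * m} = {..<2 * m} - v ` {..<m}" if v: "v permutes {..<2 * m}" for v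
  unfolding sp image_set_diff[OF permutes_inj[OF v]] permutes_image[OF v] ..
 have i: "t ` {m..<2 * m} = u ` {m..<2 * m}" unfolding c[OF T(1)] c[OF U(1)] e ..
 consider "x \<in> {0..<m}" | "x \<in> {m..<2 * m}" | "x \<notin> {..<2 * m}" by fastforce
 thus "t x = u x"
 proof cases
  case 1 thus ?thesis using strict_mono_image_unique[OF T(2) U(2)] e by (simp add: atLeast0LessThan)
 next
  case 2 thus ?thesis by (rule strict_mono_image_unique[OF T(3) U(3) i])
 next
  case 3 thus ?thesis using permutes_not_in[OF T(1)] permutes_not_in[OF U(1)] by simp
 qed
qed

lemma shuffle_exists:
 assumes A: "A \<subseteq> {..<2 * m}" and cA: "card A = m"
 shows "\<exists>t\<in>shuffles_n (2 * m). t ` {..<m} = A"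
proof -
 define B where "B = {..<2 * m} - A"
 have fA: "finite A" using A finite_subset by blast
 have B: "finite B" "card B = m" using cA card_Diff_subset[OF fA A] by (auto simp: B_def)
 obtain f where f: "bij_betw f {..<m} A" "strict_mono_on {..<m} f" using ex_bij_betw_strict_mono_card[OF fA] cA by metis
 obtain g where g: "bij_betw g {..<m} B" "strict_mono_on {..<m} g" using ex_bij_betw_strict_mono_card[OF B(1)] B(2) by metis
 define t where "t j = (if j < m then f j else if j < 2 * m then g (j - m) else j)" for j
 have fm: "f j \<in> A" "g j \<in> B" if "j < m" for j using f(1) g(1) that by (auto simp: bij_betw_def)
 have fi: "f i = f j ==> i = j" "g i = g j ==> i = j" if "i < m" "j < m" for i j
  using f(1) g(1) that by (auto simp: bij_betw_def inj_on_def)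
 have "t permutes {..<2 * m}"
 proof (rule inj_imp_permutes)
  show "inj_on t {..<2 * m}"
  proof (rule inj_onI)
   fix x y assume h: "x \<in> {..<2 * m}" "y \<in> {..<2 * m}" "t x = t y"
   have AB: "a \<in> A ==> b \<in> B ==> a \<noteq> b" for a b by (auto simp: B_def)
   have lt: "\<not> x < m ==> x - m < m" "\<not> y < m ==> y - m < m" using h by auto
   show "x = y"
   proof (cases "x < m"; cases "y < m")
    assume "x < m" "y < m" thus ?thesis using h fi(1) by (simp add: t_def)
   next
    assume a: "x < m" "\<not> y < m"
    hence "f x = g (y - m)" using h by (simp add: t_def)
    thus ?thesis using AB[OF fm(1)[OF a(1)] fm(2)[OF lt(2)[OF a(2)]]] by simp
   next
    assume a: "\<not> x < m" "y < m"
    hence "f y = g (x - m)" using h by (simp add: t_def)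
    thus ?thesis using AB[OF fm(1)[OF a(2)] fm(2)[OF lt(1)[OF a(1)]]] by simp
   next
    assume a: "\<not> x < m" "\<not> y < m"
    hence "g (x - m) = g (y - m)" using h by (simp add: t_def)
    hence "x - m = y - m" by (rule fi(2)[OF lt(1)[OF a(1)] lt(2)[OF a(2)]])
    thus ?thesis using a by simp
   qed
  qed
  fix x assume x: "x \<in> {..<2 * m}"
  show "t x \<in> {..<2 * m}"
  proof (cases "x < m")
   case True thus ?thesis using fm(1)[OF True] A by (auto simp: t_def)
  next
   case False
   hence "x - m < m" using x by auto
   thus ?thesis using fm(2) x False by (auto simp: t_def B_def)
  qed
 qed (auto simp: t_def)
 moreover have "strict_mono_on {..<m} t" using f(2) by (auto simp: t_def strict_mono_on_def)
 moreover have "strict_mono_on {m..<2 * m} t"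
 proof (rule strict_mono_onI)
  fix x y assume h: "x \<in> {m..<2 * m}" "y \<in> {m..<2 * m}" "x < y"
  have "g (x - m) < g (y - m)" by (rule strict_mono_onD[OF g(2)]) (use h in auto)
  thus "t x < t y" using h by (simp add: t_def)
 qed
 moreover have "t ` {..<m} = A" using f(1) by (auto simp: t_def bij_betw_def)
 ultimately show ?thesis by (intro bexI[of _ t]) (auto simp: shuffles_n_def)
qed

text \<open>The value is 0 from \<open>2 * m\<close> on, as required of words; \<open>dsum\<close>,
  which concatenates permutations, is the identity there instead.\<close>

definition cat :: "nat => (nat => nat) => (nat => nat) => nat => nat" where
 "cat m f g j = (if j < m then f j else if j < 2 * m then g (j - m) else 0)"

definition dsum :: "nat => (nat => nat) => (nat => nat) => nat => nat" where
 "dsum m f g j = (if j < m then f j else if j < 2 * m then m + g (j - m) else j)"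

lemma cat_dsum:
 assumes "q1 permutes {..<m}" "q2 permutes {..<m}"
 shows "cat m f g \<circ> dsum m q1 q2 = cat m (f \<circ> q1) (g \<circ> q2)"
proof
 fix j
 show "(cat m f g \<circ> dsum m q1 q2) j = cat m (f \<circ> q1) (g \<circ> q2) j"
  using permutes_less[OF assms(1), of j] permutes_less[OF assms(2), of "j - m"]
  by (cases "j < m"; cases "j < 2 * m") (simp_all add: cat_def dsum_def)
qed

lemma dsum_image: assumes "q1 permutes {..<m}" shows "dsum m q1 q2 ` {..<m} = {..<m}"
proof -
 have "dsum m q1 q2 ` {..<m} = q1 ` {..<m}" by (rule image_cong) (auto simp: dsum_def)
 thus ?thesis by (simp only: permutes_image[OF assms])
qed

lemma diag2:
 assumes r: "0 < r" and y: "y1 \<in> carrier (Grn r m)" "y2 \<in> carrier (Grn r m)"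
 shows "diag_block_mat [y1, y2] \<in> carrier (Grn r (2 * m))"
  "perm_of (diag_block_mat [y1, y2]) = dsum m (perm_of y1) (perm_of y2)"
  "\<And>j. j < m ==> ent (diag_block_mat [y1, y2]) j = ent y1 j"
  "\<And>j. j < m ==> ent (diag_block_mat [y1, y2]) (m + j) = ent y2 j"
proof -
 have sl: "sum_list [m, m] = 2 * m" by simp
 have g: "[y1, y2] ! c \<in> carrier (Grn r ([m, m] ! c))" if "c < length [m, m]" for c
  using that y by (auto simp: less_Suc_eq)
 note r' = r
 show "diag_block_mat [y1, y2] \<in> carrier (Grn r (2 * m))"
  by (rule diag_block_mono(1)[OF r, of "[y1, y2]" "[m, m]", unfolded sl]) (simp, erule g)
 have P: "perm_of (diag_block_mat [y1, y2]) = bperm [m, m] (\<lambda>c. perm_of ([y1, y2] ! c))"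
  by (rule diag_block_mono(2)[OF r]) (simp, erule g)
 show "perm_of (diag_block_mat [y1, y2]) = dsum m (perm_of y1) (perm_of y2)"
  unfolding P by (auto simp: fun_eq_iff bperm_def dsum_def off_def)
 have E: "ent (diag_block_mat [y1, y2]) j = ent ([y1, y2] ! bcol [m, m] j) (bloc [m, m] j)" if "j < 2 * m" for j
  by (rule diag_block_mono(3)[OF r, of "[y1, y2]" "[m, m]", unfolded sl]) (simp, erule g, rule that)
 show "ent (diag_block_mat [y1, y2]) j = ent y1 j" if "j < m" for j using E[of j] that by simp
 show "ent (diag_block_mat [y1, y2]) (m + j) = ent y2 j" if "j < m" for j using E[of "m + j"] that by simp
qed

lemma perm_mat_Grn: assumes "0 < r" "t permutes {..<n}"
 shows "perm_mat n t \<in> carrier (Grn r n)" "perm_of (perm_mat n t) = t" "\<And>j. j < n ==> ent (perm_mat n t) j = 1"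
proof -
 interpret grn r n using assms(1) by unfold_locales
 show "perm_mat n t \<in> carrier (Grn r n)" "perm_of (perm_mat n t) = t" "\<And>j. j < n ==> ent (perm_mat n t) j = 1"
  unfolding perm_mat_mono using mono_Grn[OF assms(2), of "\<lambda>_. 1"] by simp_all
qed

lemma factor_iff:
 assumes r: "0 < r" and x: "x \<in> carrier (Grn r (2 * m))" and t: "t permutes {..<2 * m}" "t' permutes {..<2 * m}"
  and y: "y1 \<in> carrier (Grn r m)" "y2 \<in> carrier (Grn r m)"
 shows "x * perm_mat (2 * m) t = perm_mat (2 * m) t' * diag_block_mat [y1, y2] \<longleftrightarrow>
  perm_of x \<circ> t = t' \<circ> dsum m (perm_of y1) (perm_of y2) \<and> (\<forall>j<m. ent x (t j) = ent y1 j \<and> ent x (t (m + j)) = ent y2 j)"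
proof -
 interpret grn r "2 * m" using r by unfold_locales
 note P = perm_mat_Grn[OF r t(1)] and P' = perm_mat_Grn[OF r t(2)] and D = diag2[OF r y]
 let ?L = "x * perm_mat (2 * m) t" and ?R = "perm_mat (2 * m) t' * diag_block_mat [y1, y2]"
 note mL = mult_Grn[OF x P(1)] and mR = mult_Grn[OF P'(1) D(1)]
 have eL: "ent ?L j = ent x (t j)" if "j < 2 * m" for j using mL(3)[OF that] that by (simp add: P(2,3))
 have eR: "ent ?R j = ent (diag_block_mat [y1, y2]) j" if "j < 2 * m" for j
  using mR(3)[OF that] that permutes_less[OF Grn_mono(2)[OF D(1)], of j] by (simp add: P'(3))
 have eq: "?L = ?R \<longleftrightarrow> perm_of ?L = perm_of ?R \<and> (\<forall>j<2 * m. ent ?L j = ent ?R j)"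
  using Grn_eqI[OF mL(1) mR(1)] by metis
 have "(\<forall>j<2 * m. ent ?L j = ent ?R j) \<longleftrightarrow> (\<forall>j<2 * m. ent x (t j) = ent (diag_block_mat [y1, y2]) j)"
  using eL eR by simp
 also have "... \<longleftrightarrow> (\<forall>j<m. ent x (t j) = ent y1 j \<and> ent x (t (m + j)) = ent y2 j)"
 proof
  assume a: "\<forall>j<2 * m. ent x (t j) = ent (diag_block_mat [y1, y2]) j"
  show "\<forall>j<m. ent x (t j) = ent y1 j \<and> ent x (t (m + j)) = ent y2 j"
   using a D(3,4) by simp
 next
  assume a: "\<forall>j<m. ent x (t j) = ent y1 j \<and> ent x (t (m + j)) = ent y2 j"
  show "\<forall>j<2 * m. ent x (t j) = ent (diag_block_mat [y1, y2]) j"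
  proof (intro allI impI)
   fix j assume j: "j < 2 * m"
   show "ent x (t j) = ent (diag_block_mat [y1, y2]) j"
   proof (cases "j < m")
    case True thus ?thesis using a D(3) by simp
   next
    case False
    hence "j = m + (j - m)" "j - m < m" using j by auto
    thus ?thesis using a D(4) by metis
   qed
  qed
 qed
 finally show ?thesis unfolding eq mL(2) mR(2) P(2) P'(2) D(2) by blast
qed

text \<open>\<open>t'\<close> is the shuffle for which the image of the first half is that of
  \<open>perm_of x \<circ> t\<close>. What remains preserves the halves and splits into
  \<open>q1\<close> and \<open>q2\<close>. Uniqueness must be shown as well because
  \<open>factor\<close> is a definite description.\<close>

lemma factor_facts:
 assumes r: "0 < r" and x: "x \<in> carrier (Grn r (2 * m))" and t: "t \<in> shuffles_n (2 * m)"
 shows "\<exists>t' y1 y2. factor r (2 * m) x t = (t', y1, y2) \<and> t' \<in> shuffles_n (2 * m) \<and> y1 \<in> carrier (Grn r m) \<and>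
  y2 \<in> carrier (Grn r m) \<and> perm_of x \<circ> t = t' \<circ> dsum m (perm_of y1) (perm_of y2) \<and>
  (\<forall>j<m. ent x (t j) = ent y1 j \<and> ent x (t (m + j)) = ent y2 j)"
proof -
 interpret h: grn r m using r by unfold_locales
 note G = Grn_mono[OF x]
 have tp: "t permutes {..<2 * m}" using t by (simp add: shuffles_n_def)
 have sp: "v permutes {..<2 * m}" if "v \<in> shuffles_n (2 * m)" for v using that by (simp add: shuffles_n_def)
 have up: "perm_of x \<circ> t permutes {..<2 * m}" by (rule permutes_compose[OF tp G(2)])
 have "(perm_of x \<circ> t) ` {..<m} \<subseteq> (perm_of x \<circ> t) ` {..<2 * m}" by (rule image_mono) auto
 hence "(perm_of x \<circ> t) ` {..<m} \<subseteq> {..<2 * m}" by (simp only: permutes_image[OF up])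
 moreover have "card ((perm_of x \<circ> t) ` {..<m}) = m" using card_image[OF permutes_inj_on[OF up, of "{..<m}"]] by simp
 ultimately obtain t' where t': "t' \<in> shuffles_n (2 * m)" "t' ` {..<m} = (perm_of x \<circ> t) ` {..<m}"
  using shuffle_exists by blast
 note t'p = sp[OF t'(1)]
 define w where "w = inv t' \<circ> (perm_of x \<circ> t)"
 have wp: "w permutes {..<2 * m}" unfolding w_def by (rule permutes_compose[OF up permutes_inv[OF t'p]])
 have tw: "t' \<circ> w = perm_of x \<circ> t" unfolding w_def comp_assoc[symmetric] permutes_inv_o(1)[OF t'p] by simp
 have wi: "w ` {..<m} = {..<m}"
  unfolding w_def image_comp[symmetric] t'(2)[symmetric, unfolded image_comp[symmetric]]
  by (simp add: image_comp permutes_inv_o(2)[OF t'p])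
 have wm: "w j < m \<longleftrightarrow> j < m" for j using inj_image_mem_iff[OF permutes_inj[OF wp], of j "{..<m}"] unfolding wi by simp
 have w2: "w j < 2 * m \<longleftrightarrow> j < 2 * m" for j by (rule permutes_less[OF wp])
 have winj: "w i = w j ==> i = j" for i j using permutes_inj[OF wp] by (rule injD)
 define q1 q2 where "q1 j = (if j < m then w j else j)" and "q2 j = (if j < m then w (m + j) - m else j)" for j
 have q1: "q1 permutes {..<m}"
  by (rule inj_imp_permutes) (use wm winj in \<open>auto simp: q1_def inj_on_def\<close>)
 have q2w: "w (m + j) = m + q2 j" "q2 j < m" if "j < m" for j
  using wm[of "m + j"] w2[of "m + j"] that by (auto simp: q2_def)
 have q2: "q2 permutes {..<m}"
 proof (rule inj_imp_permutes)
  show "inj_on q2 {..<m}"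
  proof (rule inj_onI)
   fix i j assume h: "i \<in> {..<m}" "j \<in> {..<m}" "q2 i = q2 j"
   hence "w (m + i) = w (m + j)" using q2w(1)[of i] q2w(1)[of j] by simp
   from winj[OF this] show "i = j" by simp
  qed
 qed (use q2w in \<open>auto simp: q2_def\<close>)
 define y1 y2 where "y1 = monm m q1 (\<lambda>j. ent x (t j))" and "y2 = monm m q2 (\<lambda>j. ent x (t (m + j)))"
 have e1: "ent x (t j) ^ r = 1" "ent x (t (m + j)) ^ r = 1" if "j < m" for j
  using G(3)[of "t j"] G(3)[of "t (m + j)"] that permutes_less[OF tp] by simp_all
 have Y1: "y1 \<in> carrier (Grn r m)" "perm_of y1 = q1" "\<And>j. j < m ==> ent y1 j = ent x (t j)"
  unfolding y1_def by (rule h.mono_Grn[OF q1], erule e1, rule h.mono_Grn[OF q1], erule e1, rule h.mono_Grn[OF q1], erule e1)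
 have Y2: "y2 \<in> carrier (Grn r m)" "perm_of y2 = q2" "\<And>j. j < m ==> ent y2 j = ent x (t (m + j))"
  unfolding y2_def by (rule h.mono_Grn[OF q2], erule e1, rule h.mono_Grn[OF q2], erule e1, rule h.mono_Grn[OF q2], erule e1)
 have ds: "dsum m q1 q2 = w"
 proof
  fix j show "dsum m q1 q2 j = w j"
   using q2w(1)[of "j - m"] w2[of j] permutes_not_in[OF wp, of j] by (auto simp: dsum_def q1_def)
 qed
 have F: "perm_of x \<circ> t = t' \<circ> dsum m (perm_of y1) (perm_of y2)" unfolding Y1(2) Y2(2) ds tw ..
 have E: "\<forall>j<m. ent x (t j) = ent y1 j \<and> ent x (t (m + j)) = ent y2 j" using Y1(3) Y2(3) by simp
 have fac: "factor r (2 * m) x t = (t', y1, y2)"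
  unfolding factor_def nonzero_mult_div_cancel_left[OF zero_neq_numeral[symmetric]]
 proof (rule the_equality)
  show "case (t', y1, y2) of (t', x1, x2) => t' \<in> shuffles_n (2 * m) \<and> x1 \<in> carrier (Grn r m) \<and> x2 \<in> carrier (Grn r m) \<and>
    x * perm_mat (2 * m) t = perm_mat (2 * m) t' * diag_block_mat [x1, x2]"
   unfolding prod.case factor_iff[OF r x tp t'p Y1(1) Y2(1)] using F E t'(1) Y1(1) Y2(1) by blast
 next
  fix u assume u: "case u of (t', x1, x2) => t' \<in> shuffles_n (2 * m) \<and> x1 \<in> carrier (Grn r m) \<and> x2 \<in> carrier (Grn r m) \<and>
    x * perm_mat (2 * m) t = perm_mat (2 * m) t' * diag_block_mat [x1, x2]"
  obtain t'' z1 z2 where uu: "u = (t'', z1, z2)" by (cases u)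
  have U: "t'' \<in> shuffles_n (2 * m)" "z1 \<in> carrier (Grn r m)" "z2 \<in> carrier (Grn r m)"
   "x * perm_mat (2 * m) t = perm_mat (2 * m) t'' * diag_block_mat [z1, z2]" using u unfolding uu by simp_all
  note U4 = U(4)[unfolded factor_iff[OF r x tp sp[OF U(1)] U(2,3)]]
  note Z1 = Grn_mono[OF U(2)] and Z2 = Grn_mono[OF U(3)]
  have "t'' ` {..<m} = (t'' \<circ> dsum m (perm_of z1) (perm_of z2)) ` {..<m}"
   unfolding image_comp[symmetric] dsum_image[OF Z1(2)] ..
  also have "... = t' ` {..<m}" unfolding t'(2) using U4 by simp
  finally have tt: "t'' = t'" by (rule shuffle_unique[OF U(1) t'(1)])
  have "t' \<circ> dsum m (perm_of z1) (perm_of z2) = t' \<circ> w" using U4 tw unfolding tt by simp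
  hence dz: "dsum m (perm_of z1) (perm_of z2) j = w j" for j
   using injD[OF permutes_inj[OF t'p]] by (metis comp_apply)
  have "perm_of z1 = perm_of y1"
  proof
   fix j show "perm_of z1 j = perm_of y1 j"
    using dz[of j] perm_of_ge[OF U(2), of j] perm_of_ge[OF Y1(1), of j] unfolding Y1(2) q1_def
    by (cases "j < m") (simp_all add: dsum_def)
  qed
  moreover have "perm_of z2 = perm_of y2"
  proof
   fix j show "perm_of z2 j = perm_of y2 j"
    using dz[of "m + j"] q2w(1)[of j] perm_of_ge[OF U(3), of j] perm_of_ge[OF Y2(1), of j] unfolding Y2(2)
    by (cases "j < m") (simp_all add: dsum_def)
  qed
  ultimately have "z1 = y1" "z2 = y2"
   using U4 E by (intro Grn_eqI[OF U(2) Y1(1)] Grn_eqI[OF U(3) Y2(1)]; simp)+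
  thus "u = (t', y1, y2)" unfolding uu tt by simp
 qed
 show ?thesis
  by (rule exI[of _ t'], rule exI[of _ y1], rule exI[of _ y2]) (use fac t'(1) Y1(1) Y2(1) F E in blast)
qed

lemma tab_alt: "tab Y z rw cw \<longleftrightarrow>
  (\<forall>y\<in>Y. \<forall>x\<in>Y. z x = z y \<and> rw x = rw y \<and> cw x = cw y \<longrightarrow> x = y) \<and>
  (\<forall>y\<in>Y. \<forall>j<cw y. \<exists>x\<in>Y. z x = z y \<and> rw x = rw y \<and> cw x = j) \<and>
  (\<forall>y\<in>Y. \<forall>i<rw y. \<exists>x\<in>Y. z x = z y \<and> cw x = cw y \<and> rw x = i)"
 unfolding tab_def inj_on_def by auto

lemma tab_Un:
 assumes sep: "\<And>x y. x \<in> Y ==> y \<in> Y' ==> z x \<noteq> z y"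
 shows "tab (Y \<union> Y') z rw cw \<longleftrightarrow> tab Y z rw cw \<and> tab Y' z rw cw"
proof -
 have e1: "(\<exists>x\<in>Y \<union> Y'. z x = z y \<and> Q x) \<longleftrightarrow> (\<exists>x\<in>Y. z x = z y \<and> Q x)"
  and a1: "(\<forall>x\<in>Y \<union> Y'. z x = z y \<and> Q x \<longrightarrow> R x) \<longleftrightarrow> (\<forall>x\<in>Y. z x = z y \<and> Q x \<longrightarrow> R x)" if "y \<in> Y" for y Q R
  using sep[OF that] by force+
 have e2: "(\<exists>x\<in>Y \<union> Y'. z x = z y \<and> Q x) \<longleftrightarrow> (\<exists>x\<in>Y'. z x = z y \<and> Q x)"
  and a2: "(\<forall>x\<in>Y \<union> Y'. z x = z y \<and> Q x \<longrightarrow> R x) \<longleftrightarrow> (\<forall>x\<in>Y'. z x = z y \<and> Q x \<longrightarrow> R x)" if "y \<in> Y'" for y Q R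
  using sep[OF _ that] by force+
 have s: "(\<forall>y\<in>Y \<union> Y'. P y) \<longleftrightarrow> (\<forall>y\<in>Y. P y) \<and> (\<forall>y\<in>Y'. P y)" for P by blast
 show ?thesis
  unfolding tab_alt s[of "\<lambda>y. \<forall>x\<in>Y \<union> Y'. z x = z y \<and> rw x = rw y \<and> cw x = cw y \<longrightarrow> x = y"]
   s[of "\<lambda>y. \<forall>j<cw y. \<exists>x\<in>Y \<union> Y'. z x = z y \<and> rw x = rw y \<and> cw x = j"]
   s[of "\<lambda>y. \<forall>i<rw y. \<exists>x\<in>Y \<union> Y'. z x = z y \<and> cw x = cw y \<and> rw x = i"]
  by (simp only: e1 e2 a1 a2 cong: ball_cong) blast
qed

lemma tab_image:
 assumes f: "inj_on f Y"
 shows "tab (f ` Y) z rw cw \<longleftrightarrow> tab Y (z \<circ> f) (rw \<circ> f) (cw \<circ> f)"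
proof -
 have "f x = f y \<longleftrightarrow> x = y" if "x \<in> Y" "y \<in> Y" for x y using f that by (auto dest: inj_onD)
 thus ?thesis unfolding tab_alt by (simp cong: ball_cong)
qed

lemma tab_cong_eq:
 assumes "\<And>x y. x \<in> Y ==> y \<in> Y ==> z x = z y \<longleftrightarrow> z' x = z' y" "\<And>y. y \<in> Y ==> rw y = rw' y" "\<And>y. y \<in> Y ==> cw y = cw' y"
 shows "tab Y z rw cw \<longleftrightarrow> tab Y z' rw' cw'"
 unfolding tab_alt using assms by (simp cong: ball_cong bex_cong)

lemma (in gel) evec_cong:
 assumes "\<And>x. x < n ==> cw x = cw' x"
 shows "evec z rw cw = evec z rw cw'"
proof -
 have "St X (pairf z cw) = St X (pairf z cw')"
  unfolding St_def
 proof (rule Collect_cong, rule conj_cong[OF refl])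
  fix pe assume p: "pe permutes X"
  show "(\<forall>x\<in>X. (z (pe x), cw (pe x)) = (z x, cw x)) \<longleftrightarrow> (\<forall>x\<in>X. (z (pe x), cw' (pe x)) = (z x, cw' x))"
   using assms permutes_less[OF p] by (intro ball_cong refl) simp
 qed
 thus ?thesis by (intro ext) (simp only: evec_def w.symm_apply)
qed

lemma finite_shuffles: "finite (shuffles_n n)"
 by (rule finite_subset[OF _ finite_permutations[of "{..<n}"]]) (auto simp: shuffles_n_def)

section \<open>The realisation on T, V, V and its involution S\<close>

locale dmod = gelp n s p for n s p :: nat +
 fixes m :: nat and mu :: "nat list list"
 assumes n2: "n = 2 * m" and mu: "mu \<in> Fer s m"
begin

sublocale V: vmod m s "mu @ replicate s []"
proof
 show "length (mu @ replicate s []) = 2 * s" using mu by (simp add: Fer_def)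
 show "is_partition a" if "a \<in> set (mu @ replicate s [])" for a
  using mu that by (auto simp: Fer_def is_partition_def)
 show "(\<Sum>a\<leftarrow>mu @ replicate s []. sum_list a) = m" using mu by (simp add: Fer_def map_replicate_const sum_list_replicate)
qed

abbreviation "lam \<equiv> mu @ replicate s []"
abbreviation "G \<equiv> carrier (Grn r m)"
abbreviation "Sh \<equiv> shuffles_n n"
abbreviation "ct \<equiv> cat m"
text \<open>Both tensor factors use only colours below \<open>s\<close>, because the components of
  \<open>lam\<close> from \<open>s\<close> on are empty. Raising the colours of the second factor by
  \<open>s\<close> therefore keeps the two apart.\<close>

abbreviation "zc f g \<equiv> cat m f (\<lambda>j. g j + s)"

lemma len_mu: "length mu = s" using mu by (simp add: Fer_def)

lemma Sh_permutes: "t \<in> Sh ==> t permutes {..<n}"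
 by (simp add: shuffles_n_def)

lemma sh_unique: "t \<in> Sh ==> u \<in> Sh ==> t ` {..<m} = u ` {..<m} ==> t = u"
 unfolding n2 by (rule shuffle_unique)

lemma sh_exists: "A \<subseteq> {..<n} ==> card A = m ==> \<exists>t\<in>Sh. t ` {..<m} = A"
 unfolding n2 by (rule shuffle_exists)

lemma z1_less: assumes "y < m" shows "V.z1 y < s"
proof (rule ccontr)
 assume "\<not> V.z1 y < s"
 hence c: "s \<le> bcol V.ns y" "bcol V.ns y < r" using assms V.blk(1)[OF assms] by (simp_all add: V.z1_def)
 hence "lam ! bcol V.ns y = []" by (simp add: nth_append len_mu)
 thus False using V.blk(2)[OF assms] by simp
qed

lemma cntl_lam: "cntl lam = cntl mu"
proof (intro ext)
 fix c i
 show "cntl lam c i = cntl mu c i"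
  by (cases "c < s"; cases "c < 2 * s") (simp_all add: cntl_def nth_append len_mu)
qed

lemma cntl_double: "cntl (mu @ mu) c i = (if c < s then cntl mu c i else cntl mu (c - s) i)"
 by (auto simp: cntl_def nth_append len_mu)

text \<open>The shuffle tells which positions carry the letters of the first factor, so the
  concatenated word is read through \<open>inv t\<close>; on each factor the recipe is that of
  \<open>xi\<close>.\<close>

definition Xi :: "(wd => complex) =>
  (nat => nat) \<times> (complex mat \<times> (nat => nat set list)) \<times> (complex mat \<times> (nat => nat set list)) => complex" where
 "Xi ph = (\<lambda>(t, (x1, b1), (x2, b2)).
   if t \<in> Sh \<and> x1 \<in> G \<and> x2 \<in> G \<and> V.proper b1 \<and> V.proper b2
   then V.wt x1 V.z1 * V.wt x2 V.z1 *
    ph (zc (V.z1 \<circ> perm_of x1) (V.z1 \<circ> perm_of x2) \<circ> inv t,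
     ct (V.wordb b1 \<circ> perm_of x1) (V.wordb b2 \<circ> perm_of x2) \<circ> inv t)
   else 0)"

lemma Xi_add: "Xi (ph + ps) = Xi ph + Xi ps"
 and Xi_fscale: "Xi (fscale c ph) = fscale c (Xi ph)"
 and Xi_zero: "Xi 0 = 0"
 by (auto simp: Xi_def fun_eq_iff algebra_simps)

text \<open>Colourings that occur in one tensor factor. They vanish from \<open>m\<close> on, so
  that concatenation loses nothing.\<close>

definition low :: "(nat => nat) => bool" where
 "low f \<longleftrightarrow> (\<forall>y<m. f y < s) \<and> (\<forall>y\<ge>m. f y = 0)"

lemma low_z1: assumes "x \<in> G" shows "low (V.z1 \<circ> perm_of x)"
 using z1_less perm_of_ge[OF assms] permutes_less[OF Grn_mono(2)[OF assms]]
 by (simp add: low_def V.z1_def)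

lemma van_word: assumes "x \<in> G" "m \<le> y" shows "(V.wordb b \<circ> perm_of x) y = 0"
 using perm_of_ge[OF assms] assms(2) by (simp add: V.wordb_def)

lemma zc_eq: assumes "low f" "low g" "low f'" "low g'" "zc f g = zc f' g'" shows "f = f' \<and> g = g'"
proof (intro conjI ext)
 fix y
 show "f y = f' y"
  using fun_cong[OF assms(5), of y] assms(1,3) by (cases "y < m") (simp_all add: cat_def low_def)
 show "g y = g' y"
  using fun_cong[OF assms(5), of "m + y"] assms(2,4) by (cases "y < m") (simp_all add: cat_def low_def)
qed

text \<open>The positions with colour below \<open>s\<close> form the image of the first half, from
  which the shuffle is recovered.\<close>

lemma low_set: assumes "low f" "t \<in> Sh" shows "{x. x < n \<and> (zc f g \<circ> inv t) x < s} = t ` {..<m}"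
proof -
 note p = Sh_permutes[OF assms(2)]
 have z: "zc f g y < s \<longleftrightarrow> y < m" if "y < n" for y using assms(1) that n2 by (auto simp: cat_def low_def)
 show ?thesis
 proof
  show "t ` {..<m} \<subseteq> {x. x < n \<and> (zc f g \<circ> inv t) x < s}"
  proof
   fix x assume "x \<in> t ` {..<m}"
   then obtain j where j: "x = t j" "j < m" by blast
   have jn: "j < n" using j(2) n2 by simp
   have "t j < n" by (simp only: permutes_less[OF p] jn)
   moreover have "(zc f g \<circ> inv t) (t j) < s" using z[OF jn] j(2) by (simp add: permutes_inverses[OF p])
   ultimately show "x \<in> {x. x < n \<and> (zc f g \<circ> inv t) x < s}" by (simp add: j(1))
  qed
  show "{x. x < n \<and> (zc f g \<circ> inv t) x < s} \<subseteq> t ` {..<m}"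
  proof
   fix x assume x: "x \<in> {x. x < n \<and> (zc f g \<circ> inv t) x < s}"
   hence "inv t x < m" using z[of "inv t x"] by (simp add: permutes_less[OF permutes_inv[OF p]])
   moreover have "x = t (inv t x)" by (simp add: permutes_inverses[OF p])
   ultimately show "x \<in> t ` {..<m}" by blast
  qed
 qed
qed

lemma halves: "{..<n} = {..<m} \<union> (\<lambda>j. m + j) ` {..<m}"
proof -
 have "x \<in> (\<lambda>j. m + j) ` {..<m}" if "x < n" "\<not> x < m" for x
  using that n2 by (intro image_eqI[of _ _ "x - m"]) auto
 thus ?thesis using n2 by auto
qed

text \<open>Colours below \<open>s\<close> and colours from \<open>s\<close> on share no column, so
  the signed sum factors; if the colourings differ, both sides vanish.\<close>

lemma join_evec:
 assumes L: "low z1" "low z2" "low u1" "low u2"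
  and v: "\<And>y. m \<le> y ==> rw1 y = 0" "\<And>y. m \<le> y ==> rw2 y = 0" "\<And>y. m \<le> y ==> bw1 y = 0" "\<And>y. m \<le> y ==> bw2 y = 0"
 shows "evec (zc z1 z2) (ct rw1 rw2) (ct cw1 cw2) (zc u1 u2, ct bw1 bw2) =
  V.evec z1 rw1 cw1 (u1, bw1) * V.evec z2 rw2 cw2 (u2, bw2)"
proof (cases "z1 = u1 \<and> z2 = u2")
 case False
 hence "zc u1 u2 \<noteq> zc z1 z2" using zc_eq[OF L(3,4,1,2)] by blast
 moreover have "V.evec z1 rw1 cw1 (u1, bw1) = 0 \<or> V.evec z2 rw2 cw2 (u2, bw2) = 0"
  using False V.evec_colour by metis
 ultimately show ?thesis using evec_colour by auto
next
 case True
 let ?C = "\<lambda>x. (zc z1 z2 x, ct cw1 cw2 x)"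
 let ?Y = "(\<lambda>j. m + j) ` {..<m}"
 have "evec (zc z1 z2) (ct rw1 rw2) (ct cw1 cw2) (zc z1 z2, ct bw1 bw2) = pdet {..<n} (ct bw1 bw2) (ct rw1 rw2) ?C"
  by (rule evec_pdet) (simp_all add: cat_def n2)
 also have "... = pdet {..<m} (ct bw1 bw2) (ct rw1 rw2) ?C * pdet ?Y (ct bw1 bw2) (ct rw1 rw2) ?C"
  unfolding halves
 proof (rule pdet_Un)
  fix x y assume x: "x \<in> {..<m}" and y: "y \<in> ?Y"
  then obtain j where j: "y = m + j" "j < m" by auto
  have "zc z1 z2 x < s" using x L(1) by (simp add: cat_def low_def)
  moreover have "s \<le> zc z1 z2 y" using j by (simp add: cat_def)
  ultimately show "?C x \<noteq> ?C y" by auto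
 qed auto
 also have "pdet {..<m} (ct bw1 bw2) (ct rw1 rw2) ?C = pdet {..<m} bw1 rw1 (pairf z1 cw1)"
  by (rule pdet_cong) (auto simp: cat_def)
 also have "... = V.evec z1 rw1 cw1 (z1, bw1)" by (rule V.evec_pdet[symmetric]) (simp_all add: v)
 also have "pdet ?Y (ct bw1 bw2) (ct rw1 rw2) ?C = pdet {..<m} (ct bw1 bw2 \<circ> (\<lambda>j. m + j)) (ct rw1 rw2 \<circ> (\<lambda>j. m + j)) (?C \<circ> (\<lambda>j. m + j))"
  by (rule pdet_reindex) auto
 also have "... = pdet {..<m} bw2 rw2 (pairf z2 cw2)"
  by (rule pdet_cong) (auto simp: cat_def)
 also have "... = V.evec z2 rw2 cw2 (z2, bw2)" by (rule V.evec_pdet[symmetric]) (simp_all add: v)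
 finally show ?thesis using True by simp
qed

lemma cat_Tab:
 assumes L: "low z1" "low z2" and v: "\<And>y. m \<le> y ==> rw1 y = 0" "\<And>y. m \<le> y ==> rw2 y = 0"
 shows "Tab (zc z1 z2) (ct rw1 rw2) (ct cw1 cw2) \<longleftrightarrow> V.Tab z1 rw1 cw1 \<and> V.Tab z2 rw2 cw2"
proof -
 let ?Y = "(\<lambda>j. m + j) ` {..<m}"
 have "tab {..<n} (zc z1 z2) (ct rw1 rw2) (ct cw1 cw2) \<longleftrightarrow>
   tab {..<m} (zc z1 z2) (ct rw1 rw2) (ct cw1 cw2) \<and> tab ?Y (zc z1 z2) (ct rw1 rw2) (ct cw1 cw2)"
  unfolding halves
 proof (rule tab_Un)
  fix x y assume x: "x \<in> {..<m}" and y: "y \<in> ?Y"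
  then obtain j where j: "y = m + j" "j < m" by auto
  have "zc z1 z2 x < s" using x L(1) by (simp add: cat_def low_def)
  moreover have "s \<le> zc z1 z2 y" using j by (simp add: cat_def)
  ultimately show "zc z1 z2 x \<noteq> zc z1 z2 y" by simp
 qed
 also have "tab {..<m} (zc z1 z2) (ct rw1 rw2) (ct cw1 cw2) \<longleftrightarrow> tab {..<m} z1 rw1 cw1"
  by (rule tab_cong_eq) (auto simp: cat_def)
 also have "tab ?Y (zc z1 z2) (ct rw1 rw2) (ct cw1 cw2) \<longleftrightarrow>
   tab {..<m} (zc z1 z2 \<circ> (\<lambda>j. m + j)) (ct rw1 rw2 \<circ> (\<lambda>j. m + j)) (ct cw1 cw2 \<circ> (\<lambda>j. m + j))"
  by (rule tab_image) auto
 also have "... \<longleftrightarrow> tab {..<m} z2 rw2 cw2"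
  by (rule tab_cong_eq) (auto simp: cat_def)
 finally have T: "tab {..<n} (zc z1 z2) (ct rw1 rw2) (ct cw1 cw2) \<longleftrightarrow> tab {..<m} z1 rw1 cw1 \<and> tab {..<m} z2 rw2 cw2" .
 have c: "zc z1 z2 x < r" if x: "x < n" for x
 proof (cases "x < m")
  case True
  hence "z1 x < s" using L(1) by (simp add: low_def)
  thus ?thesis using True by (simp add: cat_def)
 next
  case False
  hence "x - m < m" using x n2 by simp
  hence "z2 (x - m) < s" using L(2) by (simp add: low_def)
  thus ?thesis using False x n2 by (simp add: cat_def)
 qed
 have "(\<forall>x<n. zc z1 z2 x < r) \<and> (\<forall>x\<ge>n. zc z1 z2 x = 0 \<and> ct rw1 rw2 x = 0)" using c by (auto simp: cat_def n2)
 moreover have "(\<forall>x<m. z x < r) \<and> (\<forall>x\<ge>m. z x = 0)" if "low z" for z using that by (auto simp: low_def)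
 ultimately show ?thesis unfolding Tab_def V.Tab_def T using L v by blast
qed

lemma cat_cnt:
 assumes L: "low z1" "low z2"
 shows "cnt (zc z1 z2) (ct rw1 rw2) c i = (if c < s then V.cnt z1 rw1 c i else V.cnt z2 rw2 (c - s) i)"
proof (cases "c < s")
 case True
 have "{x\<in>{..<n}. zc z1 z2 x = c \<and> ct rw1 rw2 x = i} = {x\<in>{..<m}. z1 x = c \<and> rw1 x = i}"
  using True n2 by (auto simp: cat_def split: if_splits)
 thus ?thesis using True by (simp add: cnt_def V.cnt_def)
next
 case False
 have "{x\<in>{..<n}. zc z1 z2 x = c \<and> ct rw1 rw2 x = i} = (\<lambda>j. m + j) ` {x\<in>{..<m}. z2 x = c - s \<and> rw2 x = i}"
 proof
  show "{x\<in>{..<n}. zc z1 z2 x = c \<and> ct rw1 rw2 x = i} \<subseteq> (\<lambda>j. m + j) ` {x\<in>{..<m}. z2 x = c - s \<and> rw2 x = i}"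
  proof
   fix x assume x: "x \<in> {x\<in>{..<n}. zc z1 z2 x = c \<and> ct rw1 rw2 x = i}"
   have "\<not> x < m" using x False L(1) by (auto simp: cat_def low_def)
   thus "x \<in> (\<lambda>j. m + j) ` {x\<in>{..<m}. z2 x = c - s \<and> rw2 x = i}"
    using x n2 by (intro image_eqI[of _ _ "x - m"]) (auto simp: cat_def)
  qed
 qed (use False n2 in \<open>auto simp: cat_def\<close>)
 hence "cnt (zc z1 z2) (ct rw1 rw2) c i = card {x\<in>{..<m}. z2 x = c - s \<and> rw2 x = i}"
  by (simp add: cnt_def card_image)
 thus ?thesis using False by (simp add: V.cnt_def)
qed

lemma V_cnt_high: assumes "low z" "s \<le> c" shows "V.cnt z rw c i = 0"
proof -
 have "{x\<in>{..<m}. z x = c \<and> rw x = i} = {}" using assms by (auto simp: low_def)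
 thus ?thesis by (simp add: V.cnt_def)
qed

lemma cntl_mu_high: "s \<le> c ==> cntl mu c i = 0"
 by (simp add: cntl_def len_mu)

lemma cat_cnt_iff:
 assumes L: "low z1" "low z2"
 shows "cnt (zc z1 z2) (ct rw1 rw2) = cntl (mu @ mu) \<longleftrightarrow> V.cnt z1 rw1 = cntl lam \<and> V.cnt z2 rw2 = cntl lam"
proof
 assume h: "cnt (zc z1 z2) (ct rw1 rw2) = cntl (mu @ mu)"
 have e: "(if c < s then V.cnt z1 rw1 c i else V.cnt z2 rw2 (c - s) i) = (if c < s then cntl mu c i else cntl mu (c - s) i)" for c i
  unfolding cat_cnt[OF L, symmetric] cntl_double[symmetric] h ..
 have "V.cnt z1 rw1 c i = cntl lam c i" for c i
  using e[of c i] V_cnt_high[OF L(1)] cntl_mu_high[of c i] unfolding cntl_lam by (cases "c < s") simp_all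
 moreover have "V.cnt z2 rw2 c i = cntl lam c i" for c i
  using e[of "c + s" i] unfolding cntl_lam by simp
 ultimately show "V.cnt z1 rw1 = cntl lam \<and> V.cnt z2 rw2 = cntl lam" by (intro conjI ext)
next
 assume "V.cnt z1 rw1 = cntl lam \<and> V.cnt z2 rw2 = cntl lam"
 thus "cnt (zc z1 z2) (ct rw1 rw2) = cntl (mu @ mu)"
  by (intro ext) (simp add: cat_cnt[OF L] cntl_double cntl_lam)
qed

text \<open>A letter of colour at least \<open>s\<close> would belong to a row of an empty
  component.\<close>

lemma low_of_cnt: assumes t: "V.Tab z rw cw" and c: "V.cnt z rw = cntl lam" shows "low z"
 unfolding low_def
proof (intro conjI allI impI)
 show "z y = 0" if "m \<le> y" for y using t that by (simp add: V.Tab_def)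
 show "z y < s" if y: "y < m" for y
 proof (rule ccontr)
  assume "\<not> z y < s"
  hence "V.cnt z rw (z y) (rw y) = 0" unfolding c cntl_lam by (simp add: cntl_mu_high)
  hence "{x\<in>{..<m}. z x = z y \<and> rw x = rw y} = {}" unfolding V.cnt_def by (subst (asm) card_0_eq) simp_all
  thus False using y by blast
 qed
qed

end

context dmod
begin

text \<open>A word of shape (mu, mu) is a rearrangement of two concatenated standard words, so
  exactly \<open>m\<close> of its letters have colour below \<open>s\<close>; their positions
  determine the shuffle.\<close>

lemma split_word:
 assumes Z: "\<And>x. n \<le> x ==> Z x = 0" "\<And>x. n \<le> x ==> R x = 0" and c: "cnt Z R = cntl (mu @ mu)"
 shows "\<exists>t z1 z2 rw1 rw2. t \<in> Sh \<and> low z1 \<and> low z2 \<and> (\<forall>y\<ge>m. rw1 y = 0 \<and> rw2 y = 0) \<and>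
  Z = zc z1 z2 \<circ> inv t \<and> R = ct rw1 rw2 \<circ> inv t"
proof -
 have "\<forall>c. \<exists>T. T \<in> tableaux (lam ! c)" using tableaux_nonempty by blast
 from choice[OF this] obtain T where T: "\<And>c. T c \<in> tableaux (lam ! c)" by blast
 from V.tableaux_word[of T, OF T] obtain rw cw where P: "V.Tab V.z1 rw cw" "V.cnt V.z1 rw = cntl lam" by blast
 have l1: "low V.z1" using low_of_cnt[OF P] .
 have c0: "cnt (zc V.z1 V.z1) (ct rw rw) = cntl (mu @ mu)" unfolding cat_cnt_iff[OF l1 l1] using P(2) by simp
 have card: "card {x\<in>{..<n}. (Z x, R x) = y} = card {x\<in>{..<n}. (zc V.z1 V.z1 x, ct rw rw x) = y}" for y
 proof -
  obtain a i where y: "y = (a, i)" by (cases y)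
  have "cnt Z R a i = cnt (zc V.z1 V.z1) (ct rw rw) a i" by (simp only: c c0)
  thus ?thesis unfolding y cnt_def prod.inject .
 qed
 obtain pe where p: "pe permutes {..<n}" "\<forall>x\<in>{..<n}. (Z x, R x) = (zc V.z1 V.z1 (pe x), ct rw rw (pe x))"
  using fibre_permutation[OF finite_lessThan card] by blast
 note ip = permutes_inv[OF p(1)]
 have "inv pe ` {..<m} \<subseteq> inv pe ` {..<n}" by (rule image_mono) (use n2 in auto)
 hence sub: "inv pe ` {..<m} \<subseteq> {..<n}" by (simp only: permutes_image[OF ip])
 have "card (inv pe ` {..<m}) = m" using card_image[OF permutes_inj_on[OF ip, of "{..<m}"]] by simp
 from sh_exists[OF sub this] obtain t where t: "t \<in> Sh" "t ` {..<m} = inv pe ` {..<m}" by blast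
 note tp = Sh_permutes[OF t(1)]
 have pt: "pe (t j) < m \<longleftrightarrow> j < m" for j
 proof -
  have "pe (t j) < m \<longleftrightarrow> t j \<in> inv pe ` {..<m}"
   using inj_image_mem_iff[OF permutes_inj[OF ip], of "pe (t j)" "{..<m}"] by (simp add: permutes_inverses[OF p(1)])
  also have "... \<longleftrightarrow> j < m" unfolding t(2)[symmetric] using inj_image_mem_iff[OF permutes_inj[OF tp], of j "{..<m}"] by simp
  finally show ?thesis .
 qed
 have Zt: "Z (t j) = zc V.z1 V.z1 (pe (t j))" if "j < n" for j using p(2) that by (simp add: permutes_less[OF tp])
 define z1 z2 rw1 rw2 where "z1 j = (if j < m then Z (t j) else 0)" and "z2 j = (if j < m then Z (t (m + j)) - s else 0)"
  and "rw1 j = (if j < m then R (t j) else 0)" and "rw2 j = (if j < m then R (t (m + j)) else 0)" for j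
 have lt: "Z (t j) < s" if j: "j < m" for j
  using Zt[of j] pt[of j] l1 j n2 by (simp add: cat_def low_def)
 have gt: "s \<le> Z (t (m + j)) \<and> Z (t (m + j)) < s + s" if j: "j < m" for j
 proof -
  have jn: "m + j < n" using j n2 by simp
  have "\<not> pe (t (m + j)) < m" unfolding pt by simp
  moreover have "pe (t (m + j)) < 2 * m" using jn unfolding n2[symmetric] by (simp add: permutes_less[OF tp] permutes_less[OF p(1)])
  moreover hence "V.z1 (pe (t (m + j)) - m) < s" using l1 \<open>\<not> pe (t (m + j)) < m\<close> by (simp add: low_def)
  ultimately show ?thesis using Zt[OF jn] by (simp add: cat_def)
 qed
 have gt2: "Z (t (m + j)) - s < s" "Z (t (m + j)) - s + s = Z (t (m + j))" if "j < m" for j using gt[OF that] by linarith+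
 have low: "low z1" "low z2" using lt gt2(1) by (simp_all add: low_def z1_def z2_def)
 have Zc: "Z \<circ> t = zc z1 z2 \<and> R \<circ> t = ct rw1 rw2"
 proof (intro conjI ext)
  fix j
  consider "j < m" | i where "j = m + i" "i < m" | "n \<le> j"
  proof -
   assume *: "j < m ==> thesis" "\<And>i. j = m + i ==> i < m ==> thesis" "n \<le> j ==> thesis"
   show thesis using *(1,3) *(2)[of "j - m"] n2 by (cases "j < m"; cases "j < n"; simp)
  qed
  hence "(Z \<circ> t) j = zc z1 z2 j \<and> (R \<circ> t) j = ct rw1 rw2 j"
  proof cases
   case 1
   thus ?thesis by (simp add: cat_def z1_def rw1_def)
  next
   case 2
   thus ?thesis using gt2(2)[OF 2(2)] by (simp add: cat_def z2_def rw2_def)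
  next
   case 3
   hence "t j = j" using permutes_not_in[OF tp, of j] by simp
   thus ?thesis using 3 Z n2 by (simp add: cat_def)
  qed
  thus "(Z \<circ> t) j = zc z1 z2 j" "(R \<circ> t) j = ct rw1 rw2 j" by blast+
 qed
 have c: "f = f \<circ> t \<circ> inv t" for f :: "nat => nat" unfolding comp_assoc permutes_inv_o(1)[OF tp] by simp
 have "Z = zc z1 z2 \<circ> inv t" "R = ct rw1 rw2 \<circ> inv t" using c[of Z] c[of R] unfolding conjunct1[OF Zc] conjunct2[OF Zc] .
 thus ?thesis using t(1) low
  by (intro exI[of _ t] exI[of _ z1] exI[of _ z2] exI[of _ rw1] exI[of _ rw2]) (simp add: rw1_def rw2_def)
qed

text \<open>Different shuffles give different colourings, on which \<open>evec\<close> vanishes;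
  this accounts for the basis vector of \<open>t\<close> in the tensor.\<close>

lemma Xi_join:
 assumes t: "t \<in> Sh" and T: "V.Tab z1 rw1 cw1" "V.Tab z2 rw2 cw2"
  and c: "V.cnt z1 rw1 = cntl lam" "V.cnt z2 rw2 = cntl lam"
 shows "Xi (evec (zc z1 z2 \<circ> inv t) (ct rw1 rw2 \<circ> inv t) (ct cw1 cw2 \<circ> inv t)) =
  tensor_TVV t (V.xi (V.evec z1 rw1 cw1)) (V.xi (V.evec z2 rw2 cw2))"
proof -
 note tp = Sh_permutes[OF t]
 note L = low_of_cnt[OF T(1) c(1)] low_of_cnt[OF T(2) c(2)]
 have "Xi (evec (zc z1 z2 \<circ> inv t) (ct rw1 rw2 \<circ> inv t) (ct cw1 cw2 \<circ> inv t)) (u, (x1, b1), (x2, b2)) =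
  tensor_TVV t (V.xi (V.evec z1 rw1 cw1)) (V.xi (V.evec z2 rw2 cw2)) (u, (x1, b1), (x2, b2))" for u x1 b1 x2 b2
 proof (cases "u \<in> Sh \<and> x1 \<in> G \<and> x2 \<in> G \<and> V.proper b1 \<and> V.proper b2")
  case False
  hence "basis_vec t u = 0 \<or> V.xi (V.evec z1 rw1 cw1) (x1, b1) = 0 \<or> V.xi (V.evec z2 rw2 cw2) (x2, b2) = 0"
   using t by (auto simp: basis_vec_def V.xi_def)
  thus ?thesis using False by (auto simp: Xi_def tensor_TVV_def)
 next
  case True
  hence x: "x1 \<in> G" "x2 \<in> G" by auto
  let ?w = "zc (V.z1 \<circ> perm_of x1) (V.z1 \<circ> perm_of x2)" and ?b = "ct (V.wordb b1 \<circ> perm_of x1) (V.wordb b2 \<circ> perm_of x2)"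
  note Lx = low_z1[OF x(1)] low_z1[OF x(2)]
  have e: "evec (zc z1 z2 \<circ> inv t) (ct rw1 rw2 \<circ> inv t) (ct cw1 cw2 \<circ> inv t) (?w \<circ> inv u, ?b \<circ> inv u) =
    basis_vec t u * (V.evec z1 rw1 cw1 (V.z1 \<circ> perm_of x1, V.wordb b1 \<circ> perm_of x1) *
     V.evec z2 rw2 cw2 (V.z1 \<circ> perm_of x2, V.wordb b2 \<circ> perm_of x2))"
  proof (cases "u = t")
   case True
   have ci: "f \<circ> inv t \<circ> inv (inv t) = f" for f :: "nat => nat"
    unfolding permutes_inv_inv[OF tp] comp_assoc permutes_inv_o(2)[OF tp] by simp
   have "evec (zc z1 z2 \<circ> inv t) (ct rw1 rw2 \<circ> inv t) (ct cw1 cw2 \<circ> inv t) (?w \<circ> inv t, ?b \<circ> inv t) =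
     evec (zc z1 z2) (ct rw1 rw2) (ct cw1 cw2) (?w, ?b)"
    unfolding evec_shift_perm[OF permutes_inv[OF tp]] ci ..
   also have "... = V.evec z1 rw1 cw1 (V.z1 \<circ> perm_of x1, V.wordb b1 \<circ> perm_of x1) *
     V.evec z2 rw2 cw2 (V.z1 \<circ> perm_of x2, V.wordb b2 \<circ> perm_of x2)"
    by (rule join_evec[OF L Lx _ _ van_word[OF x(1)] van_word[OF x(2)]]) (use T in \<open>auto simp: V.Tab_def\<close>)
   finally show ?thesis unfolding True by (simp add: basis_vec_def)
  next
   case False
   have "?w \<circ> inv u \<noteq> zc z1 z2 \<circ> inv t"
   proof
    assume e: "?w \<circ> inv u = zc z1 z2 \<circ> inv t"
    have uS: "u \<in> Sh" using True by simp
    have "u ` {..<m} = t ` {..<m}"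
     using low_set[OF Lx(1) uS, of "V.z1 \<circ> perm_of x2"] low_set[OF L(1) t, of z2] unfolding e by simp
    from sh_unique[OF uS t this] False show False by simp
   qed
   from evec_colour[OF this] show ?thesis using False by (simp add: basis_vec_def)
  qed
  have Xe: "Xi E (u, (x1, b1), (x2, b2)) = V.wt x1 V.z1 * V.wt x2 V.z1 * E (?w \<circ> inv u, ?b \<circ> inv u)" for E
   using True by (simp add: Xi_def)
  show ?thesis unfolding Xe e using True by (simp add: tensor_TVV_def V.xi_def)
 qed
 thus ?thesis by (intro ext) (auto simp: split_paired_all)
qed

abbreviation "K0 \<equiv> {cntl (mu @ mu)}"

lemma V_eq: "rho r (mu @ replicate (r div 2) []) = rho r lam" by simp

lemma Xi_in: assumes "ph \<in> SpK K0" shows "Xi ph \<in> rspace (rho_double r n mu)"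
proof -
 let ?S = "{tensor_TVV t v1 v2 |t v1 v2. t \<in> Sh \<and> v1 \<in> rspace (rho r lam) \<and> v2 \<in> rspace (rho r lam)}"
 have sp: "rspace (rho_double r n mu) = cfun.span ?S" unfolding rho_double_def V_eq by (simp add: Let_def)
 show ?thesis unfolding sp using assms unfolding SpK_def
 proof (induction rule: cfun.span_induct_alt)
  case base
  show ?case unfolding Xi_zero by (rule cfun.span_zero)
 next
  case (step c e y)
  then obtain Z R \<Gamma> where e: "e = evec Z R \<Gamma>" "Tab Z R \<Gamma>" "cnt Z R = cntl (mu @ mu)" by blast
  have o: "\<And>x. n \<le> x ==> Z x = 0" "\<And>x. n \<le> x ==> R x = 0" using e(2) by (auto simp: Tab_def)
  from split_word[OF o e(3)] obtain t z1 z2 rw1 rw2 where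
   w: "t \<in> Sh" "low z1" "low z2" "\<forall>y\<ge>m. rw1 y = 0 \<and> rw2 y = 0" "Z = zc z1 z2 \<circ> inv t" "R = ct rw1 rw2 \<circ> inv t" by blast
  note tp = Sh_permutes[OF w(1)]
  have ci: "f \<circ> inv t \<circ> t = f" for f :: "nat => nat" unfolding comp_assoc permutes_inv_o(2)[OF tp] by simp
  have Zt: "Z \<circ> t = zc z1 z2" "R \<circ> t = ct rw1 rw2" unfolding w(5,6) ci by simp_all
  define cw1 cw2 where "cw1 j = \<Gamma> (t j)" and "cw2 j = \<Gamma> (t (m + j))" for j
  have cw: "(\<Gamma> \<circ> t) x = ct cw1 cw2 x" if "x < n" for x using that n2 by (simp add: cat_def cw1_def cw2_def)
  have "Tab (zc z1 z2) (ct rw1 rw2) (\<Gamma> \<circ> t)" using Tab_comp[OF tp e(2)] unfolding Zt .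
  hence "Tab (zc z1 z2) (ct rw1 rw2) (ct cw1 cw2)"
   using tab_cong_eq[of X "zc z1 z2" "zc z1 z2" "ct rw1 rw2" "ct rw1 rw2" "\<Gamma> \<circ> t" "ct cw1 cw2"] cw by (simp add: Tab_def)
  hence T: "V.Tab z1 rw1 cw1" "V.Tab z2 rw2 cw2" using cat_Tab[OF w(2,3)] w(4) by blast+
  have "cnt (zc z1 z2) (ct rw1 rw2) = cntl (mu @ mu)" using cnt_comp2[OF tp, of Z R] unfolding Zt e(3) .
  hence C: "V.cnt z1 rw1 = cntl lam" "V.cnt z2 rw2 = cntl lam" using cat_cnt_iff[OF w(2,3)] by blast+
  have "e = evec Z R (ct cw1 cw2 \<circ> inv t)" unfolding e(1)
  proof (rule evec_cong)
   fix x assume x: "x < n"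
   have "\<Gamma> x = (\<Gamma> \<circ> t) (inv t x)" by (simp add: permutes_inverses[OF tp])
   also have "... = ct cw1 cw2 (inv t x)" by (rule cw) (simp add: permutes_less[OF permutes_inv[OF tp]] x)
   finally show "\<Gamma> x = (ct cw1 cw2 \<circ> inv t) x" by simp
  qed
  hence X: "Xi e = tensor_TVV t (V.xi (V.evec z1 rw1 cw1)) (V.xi (V.evec z2 rw2 cw2))"
   using Xi_join[OF w(1) T C] unfolding w(5,6) by simp
  have "V.evec z1 rw1 cw1 \<in> V.Sl" "V.evec z2 rw2 cw2 \<in> V.Sl"
   unfolding V.Sl_def by (intro cfun.span_base, use T C in blast)+
  hence "Xi e \<in> cfun.span ?S" unfolding X using w(1) V.xi_in by (intro cfun.span_base) blast
  thus ?case unfolding Xi_add Xi_fscale by (rule cfun.span_add[OF cfun.span_scale step(2)])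
 qed
qed

lemma subspace_SpK: "cfun.subspace (SpK K)"
 unfolding SpK_def by (rule cfun.subspace_span)

lemma subspace_Xi: assumes "cfun.subspace S" shows "cfun.subspace (Xi ` S)"
proof (rule cfun.subspaceI)
 show "0 \<in> Xi ` S" using imageI[OF cfun.subspace_0[OF assms], of Xi] unfolding Xi_zero .
 show "x + y \<in> Xi ` S" if xy: "x \<in> Xi ` S" "y \<in> Xi ` S" for x y
 proof -
  from xy obtain a b where "x = Xi a" "y = Xi b" "a \<in> S" "b \<in> S" by blast
  thus ?thesis using imageI[OF cfun.subspace_add[OF assms, of a b], of Xi] unfolding Xi_add by simp
 qed
 show "fscale c x \<in> Xi ` S" if x: "x \<in> Xi ` S" for c x
 proof -
  from x obtain a where "x = Xi a" "a \<in> S" by blast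
  thus ?thesis using imageI[OF cfun.subspace_scale[OF assms, of a c], of Xi] unfolding Xi_fscale by simp
 qed
qed

lemma tensor_linear:
 shows "tensor_TVV t (fscale c a + b) v = fscale c (tensor_TVV t a v) + tensor_TVV t b v"
  and "tensor_TVV t v (fscale c a + b) = fscale c (tensor_TVV t v a) + tensor_TVV t v b"
  and "tensor_TVV t 0 v = 0" and "tensor_TVV t v 0 = 0"
 by (auto simp: tensor_TVV_def fun_eq_iff algebra_simps)

text \<open>For the reverse inclusion, bilinearity is used in two stages, first for generators in
  both factors, then with one and finally with both factors arbitrary.\<close>

theorem Xi_image: "Xi ` SpK K0 = rspace (rho_double r n mu)"
proof (rule antisym)
 show "Xi ` SpK K0 \<subseteq> rspace (rho_double r n mu)" using Xi_in by blast
 let ?U = "Xi ` SpK K0"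
 note U = subspace_Xi[OF subspace_SpK[of K0]]
 have ee: "tensor_TVV t (V.xi e1) (V.xi e2) \<in> ?U"
  if t: "t \<in> Sh" and e: "e1 \<in> {V.evec z rw cw |z rw cw. V.Tab z rw cw \<and> V.cnt z rw = cntl lam}"
   "e2 \<in> {V.evec z rw cw |z rw cw. V.Tab z rw cw \<and> V.cnt z rw = cntl lam}" for t e1 e2
 proof -
  from e(1) obtain z1 rw1 cw1 where e1: "e1 = V.evec z1 rw1 cw1" "V.Tab z1 rw1 cw1" "V.cnt z1 rw1 = cntl lam" by blast
  from e(2) obtain z2 rw2 cw2 where e2: "e2 = V.evec z2 rw2 cw2" "V.Tab z2 rw2 cw2" "V.cnt z2 rw2 = cntl lam" by blast
  note L = low_of_cnt[OF e1(2,3)] low_of_cnt[OF e2(2,3)]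
  note ip = permutes_inv[OF Sh_permutes[OF t]]
  have "Tab (zc z1 z2) (ct rw1 rw2) (ct cw1 cw2)"
   by (subst cat_Tab[OF L]) (use e1(2) e2(2) in \<open>auto simp: V.Tab_def\<close>)
  from Tab_comp[OF ip this] have T: "Tab (zc z1 z2 \<circ> inv t) (ct rw1 rw2 \<circ> inv t) (ct cw1 cw2 \<circ> inv t)" .
  have "cnt (zc z1 z2) (ct rw1 rw2) = cntl (mu @ mu)" using cat_cnt_iff[OF L] e1(3) e2(3) by blast
  hence C: "cnt (zc z1 z2 \<circ> inv t) (ct rw1 rw2 \<circ> inv t) = cntl (mu @ mu)" unfolding cnt_comp2[OF ip] .
  have "evec (zc z1 z2 \<circ> inv t) (ct rw1 rw2 \<circ> inv t) (ct cw1 cw2 \<circ> inv t) \<in> SpK K0"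
   unfolding SpK_def by (rule cfun.span_base) (use T C in blast)
  from imageI[OF this, of Xi] show ?thesis unfolding Xi_join[OF t e1(2) e2(2) e1(3) e2(3)] e1(1) e2(1) .
 qed
 have ev: "tensor_TVV t (V.xi e1) (V.xi ph2) \<in> ?U"
  if t: "t \<in> Sh" and e: "e1 \<in> {V.evec z rw cw |z rw cw. V.Tab z rw cw \<and> V.cnt z rw = cntl lam}" and p: "ph2 \<in> V.Sl" for t e1 ph2
  using p unfolding V.Sl_def
 proof (induction rule: cfun.span_induct_alt)
  case base
  show ?case unfolding V.xi_zero tensor_linear(4) by (rule cfun.subspace_0[OF U])
 next
  case (step c x y)
  show ?case unfolding V.xi_add V.xi_fscale tensor_linear(2)
   by (rule cfun.subspace_add[OF U cfun.subspace_scale[OF U ee[OF t e step(1)]] step(2)])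
 qed
 have vv: "tensor_TVV t (V.xi ph1) (V.xi ph2) \<in> ?U" if t: "t \<in> Sh" and p1: "ph1 \<in> V.Sl" and p: "ph2 \<in> V.Sl" for t ph1 ph2
  using p1 unfolding V.Sl_def
 proof (induction rule: cfun.span_induct_alt)
  case base
  show ?case unfolding V.xi_zero tensor_linear(3) by (rule cfun.subspace_0[OF U])
 next
  case (step c x y)
  show ?case unfolding V.xi_add V.xi_fscale tensor_linear(1)
   by (rule cfun.subspace_add[OF U cfun.subspace_scale[OF U ev[OF t step(1) p]] step(2)])
 qed
 have sp: "rspace (rho_double r n mu) = cfun.span {tensor_TVV t v1 v2 |t v1 v2. t \<in> Sh \<and> v1 \<in> rspace (rho r lam) \<and> v2 \<in> rspace (rho r lam)}"
  unfolding rho_double_def V_eq by (simp add: Let_def)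
 show "rspace (rho_double r n mu) \<subseteq> ?U" unfolding sp V.rho_rspace
  by (rule cfun.span_minimal[OF _ U]) (use vv in blast)
qed

text \<open>Every word in the support of \<open>ph\<close> is the argument at some index of the
  tensor space, and the weights there are nonzero.\<close>

theorem Xi_injective: assumes p: "ph \<in> SpK K0" and 0: "Xi ph = 0" shows "ph = 0"
proof (rule ccontr)
 assume "ph \<noteq> 0"
 then obtain Z R where nz: "ph (Z, R) \<noteq> 0" by (auto simp: fun_eq_iff)
 note supp = SpK_support[OF p nz]
 have o: "\<And>x. n \<le> x ==> Z x = 0" "\<And>x. n \<le> x ==> R x = 0" and c: "cnt Z R = cntl (mu @ mu)" using supp by auto
 from split_word[OF o c] obtain t z1 z2 rw1 rw2 where
  w: "t \<in> Sh" "low z1" "low z2" "\<forall>y\<ge>m. rw1 y = 0 \<and> rw2 y = 0" "Z = zc z1 z2 \<circ> inv t" "R = ct rw1 rw2 \<circ> inv t" by blast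
 have "cnt (zc z1 z2) (ct rw1 rw2) = cntl (mu @ mu)"
  using cnt_comp2[OF permutes_inv[OF Sh_permutes[OF w(1)]], of "zc z1 z2" "ct rw1 rw2"] c unfolding w(5,6) by simp
 hence C: "V.cnt z1 rw1 = cntl lam" "V.cnt z2 rw2 = cntl lam" using cat_cnt_iff[OF w(2,3)] by blast+
 have l: "\<And>y. m \<le> y ==> z1 y = 0" "\<And>y. m \<le> y ==> z2 y = 0" "\<And>y. m \<le> y ==> rw1 y = 0" "\<And>y. m \<le> y ==> rw2 y = 0"
  using w(2-4) by (auto simp: low_def)
 obtain x1 b1 where 1: "x1 \<in> G" "V.proper b1" "z1 = V.z1 \<circ> perm_of x1" "rw1 = V.wordb b1 \<circ> perm_of x1"
  using V.pattern_exists[OF C(1) l(1,3)] by blast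
 obtain x2 b2 where 2: "x2 \<in> G" "V.proper b2" "z2 = V.z1 \<circ> perm_of x2" "rw2 = V.wordb b2 \<circ> perm_of x2"
  using V.pattern_exists[OF C(2) l(2,4)] by blast
 have "Xi ph (t, (x1, b1), (x2, b2)) = V.wt x1 V.z1 * V.wt x2 V.z1 * ph (Z, R)"
  unfolding Xi_def using w(1) 1(1,2) 2(1,2) by (simp add: w(5,6) 1(3,4) 2(3,4))
 moreover have "... \<noteq> 0" using nz V.wt_nz[OF 1(1)] V.wt_nz[OF 2(1)] by simp
 ultimately show False using 0 by simp
qed

end

context dmod
begin

lemma Xi_apply:
 assumes "t \<in> Sh" "x1 \<in> G" "x2 \<in> G" "V.proper b1" "V.proper b2"
 shows "Xi ph (t, (x1, b1), (x2, b2)) = V.wt x1 V.z1 * V.wt x2 V.z1 *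
   ph (zc (V.z1 \<circ> perm_of x1) (V.z1 \<circ> perm_of x2) \<circ> inv t,
     ct (V.wordb b1 \<circ> perm_of x1) (V.wordb b2 \<circ> perm_of x2) \<circ> inv t)"
 using assms by (simp add: Xi_def)

lemma Xi_apply_0:
 assumes "\<not> (t \<in> Sh \<and> x1 \<in> G \<and> x2 \<in> G \<and> V.proper b1 \<and> V.proper b2)"
 shows "Xi ph (t, (x1, b1), (x2, b2)) = 0"
 using assms by (auto simp: Xi_def)

text \<open>Since -1 = zeta^s, the sign of the exponent sum is the product of the
  \<open>s\<close>-th powers of the entries.\<close>

lemma delta_ent: assumes "y \<in> G" shows "delta r y = (\<Prod>j<m. ent y j ^ s)"
proof -
 have "(\<Prod>j<m. ent y j ^ s) = (zeta r powi zsum r y) ^ s"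
  unfolding V.zsum_ent[OF assms] prod_power_distrib ..
 also have "... = (zeta r powi zsum r y) powi int s" by (rule power_int_of_nat[symmetric])
 also have "... = zeta r powi (int s * zsum r y)" unfolding mult.commute[of "int s"] by (rule power_int_mult[symmetric])
 also have "... = (zeta r powi int s) powi zsum r y" by (rule power_int_mult)
 also have "... = (zeta r ^ s) powi zsum r y" by (simp only: power_int_of_nat)
 finally show ?thesis unfolding zeta_s delta_def ..
qed

text \<open>The raised colours of the second half contribute an extra \<open>s\<close>-th power of
  every entry of \<open>y2\<close>, and the product of these is \<open>delta r y2\<close>. This is
  the origin of the sign in the action on the tensor realisation.\<close>

lemma wt_split:
 assumes x: "x \<in> carrier (Grn r n)" and t: "t \<in> Sh" and u: "u \<in> Sh" and y: "y1 \<in> G" "y2 \<in> G"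
  and f: "perm_of x \<circ> t = u \<circ> dsum m (perm_of y1) (perm_of y2)"
  and e: "\<forall>j<m. ent x (t j) = ent y1 j \<and> ent x (t (m + j)) = ent y2 j"
 shows "wt x (zc z1 z2 \<circ> inv u) = V.wt y1 z1 * V.wt y2 z2 * delta r y2"
proof -
 note tp = Sh_permutes[OF t] and up = Sh_permutes[OF u]
 note q = Grn_mono(2)[OF y(1)] Grn_mono(2)[OF y(2)]
 let ?g = "\<lambda>j. ent x j ^ (zc z1 z2 \<circ> inv u) (perm_of x j)"
 have "zc z1 z2 \<circ> inv u \<circ> (perm_of x \<circ> t) = zc z1 z2 \<circ> dsum m (perm_of y1) (perm_of y2)"
  unfolding f comp_assoc[symmetric] unfolding comp_assoc[of _ "inv u" u] permutes_inv_o(2)[OF up] by simp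
 also have "... = ct (z1 \<circ> perm_of y1) ((\<lambda>j. z2 j + s) \<circ> perm_of y2)" by (rule cat_dsum[OF q])
 finally have Z: "(zc z1 z2 \<circ> inv u) (perm_of x (t j)) = ct (z1 \<circ> perm_of y1) ((\<lambda>j. z2 j + s) \<circ> perm_of y2) j" for j
  by (metis comp_apply)
 have "wt x (zc z1 z2 \<circ> inv u) = (\<Prod>j<n. ?g j)" unfolding wt_def ..
 also have "... = (\<Prod>j<n. ?g (t j))" using prod.permute[OF tp, of ?g] by (simp only: comp_def)
 also have "... = (\<Prod>j<m. ?g (t j)) * (\<Prod>j\<in>(\<lambda>j. m + j) ` {..<m}. ?g (t j))"
  unfolding halves by (rule prod.union_disjoint) auto
 also have "(\<Prod>j<m. ?g (t j)) = V.wt y1 z1"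
  unfolding V.wt_def Z by (rule prod.cong) (auto simp: e cat_def)
 also have "(\<Prod>j\<in>(\<lambda>j. m + j) ` {..<m}. ?g (t j)) = (\<Prod>j<m. ?g (t (m + j)))"
  by (subst prod.reindex) (auto simp: comp_def)
 also have "... = (\<Prod>j<m. ent y2 j ^ z2 (perm_of y2 j) * ent y2 j ^ s)"
  unfolding Z by (rule prod.cong) (auto simp: e cat_def power_add)
 also have "... = V.wt y2 z2 * delta r y2" unfolding prod.distrib V.wt_def delta_ent[OF y(2)] ..
 finally show ?thesis by (simp only: mult.assoc)
qed

lemma tensor2_rho:
 "tensor2 (ract (rho r lam) y1) (ract (rho r lam) y2) F ((x1, b1), (x2, b2)) =
  (if x1 \<in> G \<and> x2 \<in> G then F ((x1 * y1, b1), (x2 * y2, b2)) else 0)"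
 by (simp add: tensor2_def V.rho_act)

lemma double_act:
 "ract (rho_double r n mu) x F (u, b, c) = (\<Sum>t\<in>Sh. case factor r n x t of (t', y1, y2) =>
   delta r y2 * basis_vec t' u * tensor2 (ract (rho r lam) y1) (ract (rho r lam) y2) (\<lambda>(b', c'). F (t, b', c')) (b, c))"
 unfolding rho_double_def V_eq by (simp add: Let_def)

text \<open>Given \<open>u\<close>, only one shuffle \<open>t0\<close> is carried to
  \<open>u\<close> by \<open>x\<close>, so the sum over shuffles collapses to one term. The weights
  of that term are then compared by \<open>wt_split\<close>.\<close>

theorem Xi_eact:
 assumes x: "x \<in> carrier (Grn r n)"
 shows "ract (rho_double r n mu) x (Xi ph) = Xi (eact x ph)"
proof -
 note xp = Grn_mono(2)[OF x]
 have fac: "\<exists>t' y1 y2. factor r n x t = (t', y1, y2) \<and> t' \<in> Sh \<and> y1 \<in> G \<and> y2 \<in> G \<and>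
   perm_of x \<circ> t = t' \<circ> dsum m (perm_of y1) (perm_of y2) \<and>
   (\<forall>j<m. ent x (t j) = ent y1 j \<and> ent x (t (m + j)) = ent y2 j)" if "t \<in> Sh" for t
  using factor_facts[of r x m t] x that r_pos unfolding n2[symmetric] by blast
 have img: "t' ` {..<m} = perm_of x ` t ` {..<m}" if "perm_of x \<circ> t = t' \<circ> dsum m (perm_of y1) (perm_of y2)" "y1 \<in> G" for t t' y1 y2
  unfolding image_comp that(1) unfolding image_comp[symmetric] dsum_image[OF Grn_mono(2)[OF that(2)]] ..
 have "ract (rho_double r n mu) x (Xi ph) (u, (x1, b1), (x2, b2)) = Xi (eact x ph) (u, (x1, b1), (x2, b2))" for u x1 b1 x2 b2
 proof (cases "u \<in> Sh \<and> x1 \<in> G \<and> x2 \<in> G \<and> V.proper b1 \<and> V.proper b2")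
  case False
  have "ract (rho_double r n mu) x (Xi ph) (u, (x1, b1), (x2, b2)) = 0" unfolding double_act
  proof (rule sum.neutral, rule ballI)
   fix t assume "t \<in> Sh"
   from fac[OF this] obtain t' y1 y2 where f: "factor r n x t = (t', y1, y2)" "t' \<in> Sh" by blast
   show "(case factor r n x t of (t', y1, y2) => delta r y2 * basis_vec t' u *
     tensor2 (ract (rho r lam) y1) (ract (rho r lam) y2) (\<lambda>(b', c'). Xi ph (t, b', c')) ((x1, b1), (x2, b2))) = 0"
    unfolding f(1) prod.case tensor2_rho using False f(2) Xi_apply_0 by (auto simp: basis_vec_def)
  qed
  thus ?thesis using Xi_apply_0[OF False] by simp
 next
  case True
  hence u: "u \<in> Sh" and g: "x1 \<in> G" "x2 \<in> G" and b: "V.proper b1" "V.proper b2" by auto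
  note up = Sh_permutes[OF u]
  define A where "A = inv (perm_of x) ` u ` {..<m}"
  have "card (u ` {..<m}) = m" using card_image[OF permutes_inj_on[OF up, of "{..<m}"]] by simp
  hence "card A = m" unfolding A_def using card_image[OF permutes_inj_on[OF permutes_inv[OF xp], of "u ` {..<m}"]] by simp
  moreover have "A \<subseteq> inv (perm_of x) ` u ` {..<n}" unfolding A_def by (intro image_mono) (use n2 in auto)
  hence "A \<subseteq> {..<n}" by (simp only: permutes_image[OF up] permutes_image[OF permutes_inv[OF xp]])
  ultimately obtain t0 where t0: "t0 \<in> Sh" "t0 ` {..<m} = A" using sh_exists by blast
  have xA: "perm_of x ` A = u ` {..<m}" by (simp add: A_def image_image permutes_inverses[OF xp])
  from fac[OF t0(1)] obtain t' y1 y2 where f: "factor r n x t0 = (t', y1, y2)" "t' \<in> Sh" and y: "y1 \<in> G" "y2 \<in> G"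
   and pf: "perm_of x \<circ> t0 = t' \<circ> dsum m (perm_of y1) (perm_of y2)"
   and ef: "\<forall>j<m. ent x (t0 j) = ent y1 j \<and> ent x (t0 (m + j)) = ent y2 j" by blast
  have "t' ` {..<m} = u ` {..<m}" unfolding img[OF pf y(1)] t0(2) xA ..
  from sh_unique[OF f(2) u this] have t'u: "t' = u" .
  note pf = pf[unfolded t'u]
  let ?T = "\<lambda>t. case factor r n x t of (t', y1, y2) => delta r y2 * basis_vec t' u *
    tensor2 (ract (rho r lam) y1) (ract (rho r lam) y2) (\<lambda>(b', c'). Xi ph (t, b', c')) ((x1, b1), (x2, b2))"
  have "?T t = (if t = t0 then ?T t0 else 0)" if t: "t \<in> Sh" for t
  proof (cases "t = t0")
   case False
   from fac[OF t] obtain t'' w1 w2 where h: "factor r n x t = (t'', w1, w2)" "w1 \<in> G"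
    "perm_of x \<circ> t = t'' \<circ> dsum m (perm_of w1) (perm_of w2)" by blast
   have "t'' \<noteq> u"
   proof
    assume "t'' = u"
    hence "perm_of x ` t ` {..<m} = perm_of x ` t0 ` {..<m}" using img[OF h(3,2)] xA t0(2) by simp
    hence "t ` {..<m} = t0 ` {..<m}" unfolding inj_image_eq_iff[OF permutes_inj[OF xp]] .
    from sh_unique[OF t t0(1) this] False show False by simp
   qed
   thus ?thesis using False unfolding h(1) by (simp add: basis_vec_def)
  qed simp
  hence "ract (rho_double r n mu) x (Xi ph) (u, (x1, b1), (x2, b2)) = (\<Sum>t\<in>Sh. if t = t0 then ?T t0 else 0)"
   unfolding double_act by (rule sum.cong[OF refl])
  also have "... = ?T t0" using finite_shuffles[of n] t0(1) by (simp only: sum.delta if_True)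
  also have "... = delta r y2 * Xi ph (t0, (x1 * y1, b1), (x2 * y2, b2))"
   unfolding f(1) prod.case tensor2_rho t'u using g by (simp add: basis_vec_def)
  also have "... = Xi (eact x ph) (u, (x1, b1), (x2, b2))"
  proof -
   note M1 = V.mult_Grn[OF g(1) y(1)] and M2 = V.mult_Grn[OF g(2) y(2)]
   note q = Grn_mono(2)[OF y(1)] Grn_mono(2)[OF y(2)]
   note tp = Sh_permutes[OF t0(1)]
   have "inv u \<circ> perm_of x = inv u \<circ> (perm_of x \<circ> t0) \<circ> inv t0"
    unfolding comp_assoc permutes_inv_o(1)[OF tp] by simp
   also have "... = dsum m (perm_of y1) (perm_of y2) \<circ> inv t0"
    unfolding pf comp_assoc[symmetric] permutes_inv_o(2)[OF up] by simp
   finally have ux: "inv u \<circ> perm_of x = dsum m (perm_of y1) (perm_of y2) \<circ> inv t0" .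
   have cx: "ct f h \<circ> inv u \<circ> perm_of x = ct (f \<circ> perm_of y1) (h \<circ> perm_of y2) \<circ> inv t0" for f h
    unfolding comp_assoc ux unfolding comp_assoc[symmetric] cat_dsum[OF q] ..
   define z1 z2 where "z1 = V.z1 \<circ> perm_of x1" and "z2 = V.z1 \<circ> perm_of x2"
   define w1 w2 where "w1 = V.wordb b1 \<circ> perm_of x1" and "w2 = V.wordb b2 \<circ> perm_of x2"
   have zz: "(\<lambda>j. z2 j + s) \<circ> perm_of y2 = (\<lambda>j. (z2 \<circ> perm_of y2) j + s)" by auto
   have L: "w.L (perm_of x) ph (Z, B) = ph (Z \<circ> perm_of x, B \<circ> perm_of x)" for Z B
    by (simp add: w.L_def permutes_inv_inv[OF xp])
   have "Xi (eact x ph) (u, (x1, b1), (x2, b2)) = V.wt x1 V.z1 * V.wt x2 V.z1 * eact x ph (zc z1 z2 \<circ> inv u, ct w1 w2 \<circ> inv u)"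
    unfolding z1_def z2_def w1_def w2_def by (rule Xi_apply[OF u g b])
   also have "eact x ph (zc z1 z2 \<circ> inv u, ct w1 w2 \<circ> inv u) = V.wt y1 z1 * V.wt y2 z2 * delta r y2 *
     ph (zc (z1 \<circ> perm_of y1) (z2 \<circ> perm_of y2) \<circ> inv t0, ct (w1 \<circ> perm_of y1) (w2 \<circ> perm_of y2) \<circ> inv t0)"
    unfolding eact_def fst_conv wt_split[OF x t0(1) u y pf ef] L cx zz ..
   finally have R: "Xi (eact x ph) (u, (x1, b1), (x2, b2)) = V.wt x1 V.z1 * V.wt x2 V.z1 * (V.wt y1 z1 * V.wt y2 z2 * delta r y2 *
     ph (zc (z1 \<circ> perm_of y1) (z2 \<circ> perm_of y2) \<circ> inv t0, ct (w1 \<circ> perm_of y1) (w2 \<circ> perm_of y2) \<circ> inv t0))" .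
   have "Xi ph (t0, (x1 * y1, b1), (x2 * y2, b2)) = (V.wt x1 V.z1 * V.wt y1 z1) * (V.wt x2 V.z1 * V.wt y2 z2) *
     ph (zc (z1 \<circ> perm_of y1) (z2 \<circ> perm_of y2) \<circ> inv t0, ct (w1 \<circ> perm_of y1) (w2 \<circ> perm_of y2) \<circ> inv t0)"
    unfolding Xi_apply[OF t0(1) M1(1) M2(1) b] V.wt_mult[OF g(1) y(1)] V.wt_mult[OF g(2) y(2)] M1(2) M2(2)
     z1_def z2_def w1_def w2_def comp_assoc ..
   thus ?thesis unfolding R by simp
  qed
  finally show ?thesis .
 qed
 thus ?thesis by (intro ext) (auto simp: split_paired_all)
qed

definition sw :: "nat => nat" where "sw j = (if j < m then j + m else if j < n then j - m else j)"

lemma sw_sw: "sw (sw j) = j" unfolding sw_def using n2 by auto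

lemma sw_less: "j < n ==> sw j < n" unfolding sw_def using n2 by auto

lemma sw_permutes: "sw permutes {..<n}" "inv sw = sw"
proof -
 have e: "sw \<circ> sw = id" by (rule ext) (simp only: comp_apply sw_sw id_apply)
 show "inv sw = sw" by (rule inv_unique_comp[OF e e])
 show "sw permutes {..<n}"
 proof (rule inj_imp_permutes)
  show "inj_on sw {..<n}" by (rule inj_on_inverseI[of _ sw]) (rule sw_sw)
  show "sw x = x" if "x \<notin> {..<n}" for x using that n2 unfolding sw_def by simp
 qed (simp_all add: sw_less)
qed

lemma hat_sw: "hat n t = t \<circ> sw"
 unfolding hat_def sw_def fun_eq_iff comp_apply using n2 by auto

lemma hat_Sh: "hat n t \<in> Sh \<longleftrightarrow> t \<in> Sh"
proof -
 have 1: "hat n t \<in> Sh" if "t \<in> Sh" for t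
 proof -
  have t: "t permutes {..<n}" "strict_mono_on {..<m} t" "strict_mono_on {m..<n} t"
   using that by (auto simp: shuffles_n_def n2)
  have "hat n t permutes {..<n}" unfolding hat_sw by (rule permutes_compose[OF sw_permutes(1) t(1)])
  moreover have "strict_mono_on {..<m} (hat n t)"
  proof (rule strict_mono_onI)
   fix i j assume "i \<in> {..<m}" "j \<in> {..<m}" "i < j"
   thus "hat n t i < hat n t j" using strict_mono_onD[OF t(3), of "i + m" "j + m"] n2 by (simp add: hat_def)
  qed
  moreover have "strict_mono_on {m..<n} (hat n t)"
  proof (rule strict_mono_onI)
   fix i j assume "i \<in> {m..<n}" "j \<in> {m..<n}" "i < j"
   thus "hat n t i < hat n t j" using strict_mono_onD[OF t(2), of "i - m" "j - m"] n2 by (simp add: hat_def)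
  qed
  ultimately show ?thesis by (simp add: shuffles_n_def n2)
 qed
 have "hat n (hat n t) = t" unfolding hat_sw by (auto simp: fun_eq_iff sw_sw)
 thus ?thesis using 1[of t] 1[of "hat n t"] by auto
qed

text \<open>Exchanging the halves of the shuffle together with the two factors raises the colours of
  the first part instead of the second; modulo \<open>r\<close> this is the shift of all colours by
  \<open>s\<close>.\<close>

theorem Xi_S: "S_map n (Xi ph) = Xi (Zf s ph)"
proof -
 have "Xi ph (hat n t, (x2, b2), (x1, b1)) = Xi (Zf s ph) (t, (x1, b1), (x2, b2))" for t x1 b1 x2 b2
 proof (cases "t \<in> Sh \<and> x1 \<in> G \<and> x2 \<in> G \<and> V.proper b1 \<and> V.proper b2")
  case False
  hence "\<not> (hat n t \<in> Sh \<and> x2 \<in> G \<and> x1 \<in> G \<and> V.proper b2 \<and> V.proper b1)" unfolding hat_Sh by blast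
  from Xi_apply_0[OF this] show ?thesis unfolding Xi_apply_0[OF False] .
 next
  case True
  hence t: "t \<in> Sh" and g: "x1 \<in> G" "x2 \<in> G" and b: "V.proper b1" "V.proper b2" by auto
  note tp = Sh_permutes[OF t]
  define z1 z2 where "z1 = V.z1 \<circ> perm_of x1" and "z2 = V.z1 \<circ> perm_of x2"
  define w1 w2 where "w1 = V.wordb b1 \<circ> perm_of x1" and "w2 = V.wordb b2 \<circ> perm_of x2"
  have l: "low z1" "low z2" unfolding z1_def z2_def by (rule low_z1[OF g(1)], rule low_z1[OF g(2)])
  have ih: "inv (hat n t) = sw \<circ> inv t"
   unfolding hat_sw o_inv_distrib[OF permutes_bij[OF tp] permutes_bij[OF sw_permutes(1)]] sw_permutes(2) ..
  have cs: "ct f h \<circ> sw = ct h f" for f h unfolding fun_eq_iff comp_apply sw_def cat_def using n2 by auto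
  have wr: "\<forall>x<n. (zc z1 z2 \<circ> inv t) x < r"
  proof (intro allI impI)
   fix x assume "x < n"
   hence i: "inv t x < n" by (simp add: permutes_less[OF permutes_inv[OF tp]])
   show "(zc z1 z2 \<circ> inv t) x < r"
   proof (cases "inv t x < m")
    case True
    hence "z1 (inv t x) < s" using l(1) by (simp add: low_def)
    thus ?thesis using True by (simp add: cat_def)
   next
    case False
    hence "z2 (inv t x - m) < s" using l(2) i n2 by (simp add: low_def)
    thus ?thesis unfolding comp_apply cat_def using False i n2 by simp
   qed
  qed
  have sh: "shz s (zc z1 z2 \<circ> inv t) = ct (\<lambda>j. z1 j + s) z2 \<circ> inv t"
  proof
   fix x
   show "shz s (zc z1 z2 \<circ> inv t) x = (ct (\<lambda>j. z1 j + s) z2 \<circ> inv t) x"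
   proof (cases "x < n")
    case True
    hence i: "inv t x < n" by (simp add: permutes_less[OF permutes_inv[OF tp]])
    show ?thesis
    proof (cases "inv t x < m")
     case j: True
     hence "z1 (inv t x) < s" using l(1) by (simp add: low_def)
     thus ?thesis unfolding shz_def comp_apply cat_def using True j by simp
    next
     case j: False
     hence "z2 (inv t x - m) < s" using l(2) i n2 by (simp add: low_def)
     hence "(z2 (inv t x - m) + s + s) mod (2 * s) = z2 (inv t x - m)" by (simp add: mult_2[symmetric] add.assoc)
     thus ?thesis unfolding shz_def comp_apply cat_def using True j i n2 by simp
    qed
   next
    case False
    hence "inv t x = x" using permutes_not_in[OF permutes_inv[OF tp], of x] by simp
    thus ?thesis unfolding shz_def comp_apply cat_def using False n2 by simp
   qed
  qed
  have hS: "hat n t \<in> Sh" using hat_Sh t by blast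
  have "Xi ph (hat n t, (x2, b2), (x1, b1)) = V.wt x2 V.z1 * V.wt x1 V.z1 * ph (zc z2 z1 \<circ> inv (hat n t), ct w2 w1 \<circ> inv (hat n t))"
   unfolding z1_def z2_def w1_def w2_def by (rule Xi_apply[OF hS g(2,1) b(2,1)])
  also have "... = V.wt x1 V.z1 * V.wt x2 V.z1 * Zf s ph (zc z1 z2 \<circ> inv t, ct w1 w2 \<circ> inv t)"
   unfolding ih comp_assoc[symmetric] cs unfolding Zf_def fst_conv ZW_shz sh if_P[OF wr] by (simp only: mult.commute)
  also have "... = Xi (Zf s ph) (t, (x1, b1), (x2, b2))"
   unfolding z1_def z2_def w1_def w2_def by (rule Xi_apply[OF t g b, symmetric])
  finally show ?thesis .
 qed
 thus ?thesis by (intro ext) (auto simp: S_map_def split_paired_all)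
qed

text \<open>\<open>Xi\<close> is injective on \<open>SpK K0\<close>, and \<open>Zf s\<close>
  preserves this space because the shape is doubled, so the eigenvalue equation for S pulls back to
  the one that defines \<open>EK\<close>.\<close>

theorem split_rspace: "rspace (rho_split r n 1 mu) = Xi ` EK K0"
proof -
 have inj: "Xi a = Xi b \<longleftrightarrow> a = b" if ab: "a \<in> SpK K0" "b \<in> SpK K0" for a b
 proof
  assume e: "Xi a = Xi b"
  have "a + fscale (-1) b \<in> SpK K0"
   by (rule cfun.subspace_add[OF subspace_SpK ab(1) cfun.subspace_scale[OF subspace_SpK ab(2)]])
  moreover have "Xi (a + fscale (-1) b) = 0" unfolding Xi_add Xi_fscale e by (intro ext) (simp only: plus_fun_apply fscale_apply, simp)
  ultimately have z: "a + fscale (-1) b = 0" by (rule Xi_injective)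
  show "a = b"
  proof
   fix o' show "a o' = b o'" using fun_cong[OF z, of o'] by (simp only: plus_fun_apply fscale_apply) simp
  qed
 qed simp
 have Zs: "Zf s ph \<in> SpK K0" if "ph \<in> SpK K0" for ph
  using that unfolding SpK_def
 proof (induction rule: cfun.span_induct_alt)
  case base
  show ?case unfolding Zf_zero by (rule cfun.span_zero)
 next
  case (step c e y)
  then obtain z rw cw where e: "e = evec z rw cw" "Tab z rw cw" "cnt z rw \<in> K0" by blast
  have d: "doubled z rw" unfolding doubled_def using e(3)
   by (auto simp: cntl_double fun_eq_iff)
  have "Tab (shz s z) rw cw" by (rule Tab_shz[OF e(2)])
  moreover have "cnt (shz s z) rw \<in> K0" using cnt_shz_s[OF Tab_colour[OF e(2)] d] e(3) by simp
  moreover have "Zf s e = evec (shz s z) rw cw" unfolding e(1) Zf_evec[OF e(2)] using s_pos by simp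
  ultimately have "Zf s e \<in> cfun.span {evec z rw cw |z rw cw. Tab z rw cw \<and> cnt z rw \<in> K0}" by (intro cfun.span_base) blast
  thus ?case unfolding Zf_add Zf_fscale by (rule cfun.span_add[OF cfun.span_scale step(2)])
 qed
 have "rspace (rho_split r n 1 mu) = {F \<in> Xi ` SpK K0. S_map n F = fscale (-1) F}"
  unfolding rho_split_def Xi_image by simp
 also have "... = Xi ` {ph \<in> SpK K0. Xi (Zf s ph) = Xi (fscale (-1) ph)}"
  unfolding Xi_fscale Xi_S[symmetric] by blast
 also have "{ph \<in> SpK K0. Xi (Zf s ph) = Xi (fscale (-1) ph)} = EK K0"
  unfolding EK_def using inj Zs cfun.subspace_scale[OF subspace_SpK] by blast
 finally show ?thesis .
qed

end

section \<open>Orbits and the isomorphism\<close>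

text \<open>The parts of a partition are positive, so the padding by zeros reveals where it
  ends.\<close>

lemma cntl_inject:
 assumes "length lam = length lam'" "\<And>a. a \<in> set lam ==> is_partition a" "\<And>a. a \<in> set lam' ==> is_partition a"
  and e: "cntl lam = cntl lam'"
 shows "lam = lam'"
proof (rule nth_equalityI[OF assms(1)])
 fix c assume c: "c < length lam"
 hence c': "c < length lam'" using assms(1) by simp
 define a b where "a = lam ! c" and "b = lam' ! c"
 have pos: "0 < a ! i" if "i < length a" for i using assms(2)[OF nth_mem[OF c]] that by (auto simp: is_partition_def a_def)
 have pos': "0 < b ! i" if "i < length b" for i using assms(3)[OF nth_mem[OF c']] that by (auto simp: is_partition_def b_def)
 have ab: "(if i < length a then a ! i else 0) = (if i < length b then b ! i else 0)" for i
 proof -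
  have "cntl lam c i = cntl lam' c i" by (simp only: e)
  thus ?thesis by (simp only: cntl_def c c' a_def b_def simp_thms)
 qed
 have iff: "i < length a \<longleftrightarrow> i < length b" for i
  using ab[of i] pos[of i] pos'[of i] by (cases "i < length a"; cases "i < length b") auto
 have "length a = length b" using iff[of "length a"] iff[of "length b"] by simp
 hence "a = b"
 proof (rule nth_equalityI)
  fix i assume "i < length a"
  thus "a ! i = b ! i" using ab[of i] iff[of i] by simp
 qed
 thus "lam ! c = lam' ! c" by (simp add: a_def b_def)
qed

lemma finite_Fer: "finite (Fer r n)"
proof -
 let ?P = "{a. set a \<subseteq> {..n} \<and> length a \<le> n}"
 have fin: "finite {l. set l \<subseteq> ?P \<and> length l \<le> r}"
  by (intro finite_lists_length_le) simp
 have "a \<in> ?P" if lam: "lam \<in> Fer r n" and a: "a \<in> set lam" for lam a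
 proof -
  have "sum_list a \<le> n"
   using lam member_le_sum_list[of "sum_list a" "map sum_list lam"] a by (auto simp: Fer_def)
  moreover have "set a \<subseteq> {..sum_list a}" using member_le_sum_list by auto
  moreover have "length b \<le> sum_list b" if "\<forall>k\<in>set b. 0 < k" for b :: "nat list"
   using that by (induct b) auto
  hence "length a \<le> sum_list a" using lam a by (auto simp: Fer_def is_partition_def)
  ultimately show ?thesis by auto
 qed
 hence "Fer r n \<subseteq> {l. set l \<subseteq> ?P \<and> length l \<le> r}" by (auto simp: Fer_def)
 thus ?thesis using fin finite_subset by blast
qed

lemma rotate_double: "rotate k (xs @ xs) = rotate k xs @ rotate k xs"
proof (induct k)
 case (Suc k)
 have "rotate1 (ys @ ys) = rotate1 ys @ rotate1 ys" for ys :: "'a list" by (cases ys) auto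
 thus ?case using Suc by simp
qed simp

lemma rotate_Fer: assumes "lam \<in> Fer r n" shows "rotate k lam \<in> Fer r n"
proof -
 have "sum_list (map f (rotate k xs)) = (sum_list (map f xs) :: nat)" for f and xs :: "nat list list"
 proof (induct k)
  case (Suc k)
  have "sum_list (map f (rotate1 ys)) = sum_list (map f ys)" for ys :: "nat list list" by (cases ys) auto
  thus ?case using Suc by simp
 qed simp
 thus ?thesis using assms by (simp add: Fer_def)
qed

lemma double_Fer: assumes "mu \<in> Fer s m" shows "mu @ mu \<in> Fer (2 * s) (2 * m)"
 using assms by (auto simp: Fer_def)

context gelp
begin

text \<open>\<open>shift\<close> moves the last \<open>d\<close> components to the front, which is a
  left rotation by \<open>r - d\<close>.\<close>

lemma shift_rotate: assumes "length lam = r" shows "(shift r p ^^ k) lam = rotate (k * (r - d)) lam"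
proof (induct k)
 case (Suc k)
 have "d \<le> r" "r - d < r" using r_eq dp_pos by (simp_all add: Suc_le_eq)
 hence "shift r p xs = rotate (r - d) xs" if "length xs = r" for xs :: "nat list list"
  using that by (simp add: shift_def d_def[symmetric] rotate_drop_take)
 thus ?case using Suc assms by (simp add: rotate_rotate)
qed simp

text \<open>Adding \<open>d\<close> to every colour moves component c to place c + d modulo
  \<open>r\<close>, and this is one application of \<open>shift\<close>.\<close>

lemma cntl_shift:
 assumes z: "\<And>x. x < n ==> z x < r" and c: "cnt z rw = cntl lam" and l: "length lam = r"
 shows "cnt (shz (d * k) z) rw = cntl ((shift r p ^^ k) lam)"
proof (intro ext)
 fix c i
 let ?j = "k * (r - d)"
 have dr: "d \<le> r" using r_eq dp_pos by simp
 have r0: "0 < r" using s_pos by simp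
 show "cnt (shz (d * k) z) rw c i = cntl ((shift r p ^^ k) lam) c i"
 proof (cases "c < r")
  case True
  let ?a = "(?j + c) mod r"
  have a: "?a < r" using r0 by simp
  have "k * d + ?j = k * r" by (simp only: distrib_left[symmetric] le_add_diff_inverse[OF dr])
  hence "d * k + ?j = k * r" by (simp only: mult.commute[of d k])
  hence "(?a + d * k) mod r = (k * r + c) mod r" by (simp add: mod_simps add.commute add.left_commute)
  also have "... = c" using True by simp
  finally have "cnt (shz (d * k) z) rw c = cnt z rw ?a" using cnt_shz[OF z a, where k="d * k" and rw=rw] by simp
  moreover have "cntl (rotate ?j lam) c i = cntl lam ?a i"
   using True l a by (simp add: cntl_def nth_rotate)
  ultimately show ?thesis unfolding shift_rotate[OF l] c by simp
 next
  case False
  hence "{x \<in> X. shz (d * k) z x = c \<and> rw x = i} = {}" using shz_less by auto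
  thus ?thesis using False l unfolding shift_rotate[OF l] by (simp add: cnt_def cntl_out)
 qed
qed

lemma shift_period: assumes "length lam = r" shows "(shift r p ^^ (p * a)) lam = lam"
proof -
 have "p * (r - d) = r * (p - 1)" using r_eq dp_pos by (simp add: algebra_simps diff_mult_distrib diff_mult_distrib2)
 hence "p * (r - d) * a = r * (p - 1) * a" by (simp only:)
 hence e: "p * a * (r - d) = r * ((p - 1) * a)"
  unfolding mult.assoc[of r "p - 1" a, symmetric] mult.assoc[of p a] mult.commute[of a "r - d"] unfolding mult.assoc[of p "r - d" a, symmetric] .
 show ?thesis unfolding shift_rotate[OF assms] by (rule rotate_id) (simp only: assms e mod_mult_self1_is_0)
qed

text \<open>\<open>Fer_orbit\<close> iterates forwards only; as \<open>p\<close> applications of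
  \<open>shift\<close> are the identity, a backward step is also a forward one.\<close>

lemma orbit_eq: assumes l: "length l = r" and y: "y \<in> Fer_orbit r p l" shows "Fer_orbit r p y = Fer_orbit r p l"
proof -
 obtain a where a: "y = (shift r p ^^ a) l" using y by (auto simp: Fer_orbit_def)
 have "(shift r p ^^ k) y \<in> Fer_orbit r p l" for k
  unfolding a comp_apply[symmetric, of "shift r p ^^ k"] funpow_add[symmetric] by (auto simp: Fer_orbit_def)
 moreover have "(shift r p ^^ k) l \<in> Fer_orbit r p y" for k
 proof -
  have "a \<le> p * a" using dp_pos by simp
  hence e: "p * a - a + a = p * a" by simp
  have "(shift r p ^^ (p * a - a)) y = (shift r p ^^ (p * a)) l"
   unfolding a comp_apply[symmetric, of "shift r p ^^ (p * a - a)"] funpow_add[symmetric] e ..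
  hence "(shift r p ^^ (k + (p * a - a))) y = (shift r p ^^ k) l"
   by (simp add: funpow_add shift_period[OF l])
  thus ?thesis unfolding Fer_orbit_def by (metis (mono_tags, lifting) mem_Collect_eq)
 qed
 ultimately show ?thesis by (auto simp: Fer_orbit_def)
qed

lemma eact_apply: assumes g: "g \<in> carrier (Grn r n)"
 shows "eact g ph (z, bw) = wt g z * ph (z \<circ> perm_of g, bw \<circ> perm_of g)"
 by (simp add: eact_def w.L_def permutes_inv_inv[OF Grn_mono(2)[OF g]])

lemma eact_add: "eact g (a + b) = eact g a + eact g b"
 and eact_fscale: "eact g (fscale c a) = fscale c (eact g a)"
 and eact_zero: "eact g 0 = 0"
 unfolding eact_def w.L_add w.L_fscale w.L_zero by (auto simp: fun_eq_iff algebra_simps)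

lemma eact_one: "eact (1\<^sub>m n) ph = ph"
 by (intro ext) (auto simp: split_paired_all eact_apply[OF one_Grn(1)] wt_one one_Grn(2))

lemma eact_mult: assumes g: "g \<in> carrier (Grn r n)" and h: "h \<in> carrier (Grn r n)"
 shows "eact (g * h) ph = eact g (eact h ph)"
proof -
 have "eact (g * h) ph (z, bw) = eact g (eact h ph) (z, bw)" for z bw
  unfolding eact_apply[OF mult_Grn(1)[OF g h]] eact_apply[OF g] eact_apply[OF h] wt_mult[OF g h] mult_Grn(2)[OF g h]
   comp_assoc mult.assoc ..
 thus ?thesis by (intro ext) (auto simp: split_paired_all)
qed

lemma eact_SpK: assumes g: "g \<in> carrier (Grn r n)" and "ph \<in> SpK K" shows "eact g ph \<in> SpK K"
 using assms(2) unfolding SpK_def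
proof (induction rule: cfun.span_induct_alt)
 case base
 show ?case unfolding eact_zero by (rule cfun.span_zero)
next
 case (step c e y)
 then obtain z rw cw where e: "e = evec z rw cw" "Tab z rw cw" "cnt z rw \<in> K" by blast
 let ?i = "inv (perm_of g)"
 note ip = permutes_inv[OF Grn_mono(2)[OF g]]
 have "eact g e = fscale (wt g (z \<circ> ?i)) (evec (z \<circ> ?i) (rw \<circ> ?i) (cw \<circ> ?i))"
 proof -
  have "eact g e (z', bw) = fscale (wt g (z \<circ> ?i)) (evec (z \<circ> ?i) (rw \<circ> ?i) (cw \<circ> ?i)) (z', bw)" for z' bw
  proof (cases "z' = z \<circ> ?i")
   case True
   thus ?thesis unfolding eact_def e(1) L_evec[OF Grn_mono(2)[OF g]] by simp
  next
   case False
   thus ?thesis unfolding eact_def e(1) L_evec[OF Grn_mono(2)[OF g]] by (simp add: evec_colour)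
  qed
  thus ?thesis by (intro ext) (auto simp: split_paired_all)
 qed
 moreover have "evec (z \<circ> ?i) (rw \<circ> ?i) (cw \<circ> ?i) \<in> cfun.span {evec z rw cw |z rw cw. Tab z rw cw \<and> cnt z rw \<in> K}"
 proof -
  have "cnt (z \<circ> ?i) (rw \<circ> ?i) \<in> K" by (simp only: cnt_comp2[OF ip] e(3))
  thus ?thesis using Tab_comp[OF ip e(2)] by (intro cfun.span_base) blast
 qed
 ultimately have "eact g e \<in> cfun.span {evec z rw cw |z rw cw. Tab z rw cw \<and> cnt z rw \<in> K}" by (simp only: cfun.span_scale)
 thus ?case unfolding eact_add eact_fscale by (rule cfun.span_add[OF cfun.span_scale step(2)])
qed

text \<open>Shifting by \<open>s\<close> multiplies the weight by the product of the
  \<open>s\<close>-th powers of the entries. It is 1 on G(r,p,n) because \<open>s\<close> is a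
  multiple of \<open>d\<close>, whereas on G(r,n) it may be -1; this is why the eigenspaces are
  modules for the smaller group only.\<close>

lemma Zf_eact: assumes g: "g \<in> carrier (Grpn r p n)" shows "Zf s (eact g ph) = eact g (Zf s ph)"
proof -
 note G = prod_ent_d[OF g]
 note p = Grn_mono(2)[OF G(1)]
 have "(\<Prod>j<n. ent g j ^ s) = ((\<Prod>j<n. ent g j) ^ d) ^ (p div 2)"
  unfolding prod_power_distrib[symmetric] by (subst s_eq) (rule power_mult)
 hence e1: "(\<Prod>j<n. ent g j ^ s) = 1" by (simp add: G(2))
 have wts: "wt g (shz s z) = wt g z" if z: "\<forall>x<n. z x < r" for z
 proof -
  have "wt g (shz s z) = (\<Prod>j<n. ent g j ^ z (perm_of g j) * ent g j ^ s)"
   unfolding wt_def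
  proof (rule prod.cong[OF refl])
   fix j assume "j \<in> {..<n}"
   hence j: "j < n" by simp
   have pm: "a ^ (k mod r) = a ^ k" if "a ^ r = 1" for a :: complex and k
   proof -
    have "a ^ k = a ^ (r * (k div r) + k mod r)" by simp
    also have "... = (a ^ r) ^ (k div r) * a ^ (k mod r)" by (simp only: power_add power_mult)
    finally show ?thesis by (simp add: that)
   qed
   have "shz s z (perm_of g j) = (z (perm_of g j) + s) mod r" unfolding shz_def using permutes_less[OF p, of j] j by simp
   thus "ent g j ^ shz s z (perm_of g j) = ent g j ^ z (perm_of g j) * ent g j ^ s"
    unfolding power_add[symmetric] using pm[OF Grn_mono(3)[OF G(1) j]] by (simp only:)
  qed
  thus ?thesis unfolding prod.distrib e1 wt_def by simp
 qed
 have sc: "shz s z \<circ> perm_of g = shz s (z \<circ> perm_of g)" for z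
  by (auto simp: shz_def permutes_less[OF p])
 have zr: "(\<forall>x<n. (z \<circ> perm_of g) x < r) \<longleftrightarrow> (\<forall>x<n. z x < r)" for z
 proof
  assume a: "\<forall>x<n. (z \<circ> perm_of g) x < r"
  show "\<forall>x<n. z x < r"
  proof (intro allI impI)
   fix x assume "x < n"
   hence "inv (perm_of g) x < n" by (simp add: permutes_less[OF permutes_inv[OF p]])
   with a have "(z \<circ> perm_of g) (inv (perm_of g) x) < r" by blast
   thus "z x < r" by (simp add: permutes_inverses[OF p])
  qed
 qed (simp add: permutes_less[OF p])
 have "Zf s (eact g ph) (z, bw) = eact g (Zf s ph) (z, bw)" for z bw
 proof (cases "\<forall>x<n. z x < r")
  case True
  show ?thesis unfolding Zf_def eact_apply[OF G(1)] fst_conv ZW_shz zr sc if_P[OF True] wts[OF True] ..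
 next
  case False
  show ?thesis unfolding Zf_def eact_apply[OF G(1)] fst_conv ZW_shz zr sc if_not_P[OF False] by simp
 qed
 thus ?thesis by (intro ext) (auto simp: split_paired_all)
qed

lemma eact_EK: assumes g: "g \<in> carrier (Grpn r p n)" and "ph \<in> EK K" shows "eact g ph \<in> EK K"
 using assms(2) eact_SpK[OF prod_ent_d(1)[OF g], of ph K] unfolding EK_def mem_Collect_eq Zf_eact[OF g] by (simp only: eact_fscale)

lemma Grpn_closed:
 "1\<^sub>m n \<in> carrier (Grpn r p n)"
 "g \<in> carrier (Grpn r p n) ==> h \<in> carrier (Grpn r p n) ==> g * h \<in> carrier (Grpn r p n)"
proof -
 \<comment> \<open>The exponent sum is known from the product of the entries only modulo
   \<open>r\<close>, which is enough because \<open>p\<close> divides \<open>r\<close>.\<close>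
 have key: "int p dvd zsum r x" if x: "x \<in> carrier (Grn r n)" and t: "(\<Prod>j<n. ent x j) = zeta r powi t" "int p dvd t" "0 \<le> t" for x t
 proof -
  have nn: "0 \<le> zsum r x" unfolding zsum_def using zexp_ent(1)[OF x] Grn_mono(1)[OF x] by (intro sum_nonneg) auto
  have "zeta r ^ nat (zsum r x) = zeta r ^ nat t"
   using zsum_ent[OF x] t(1,3) nn by (simp add: power_int_def)
  hence "zeta r ^ (nat (zsum r x) mod r) = zeta r ^ (nat t mod r)" unfolding zeta_mod .
  hence "nat (zsum r x) mod r = nat t mod r" by (rule zeta_inj[rotated 2]) (use s_pos in simp_all)
  moreover have "p dvd nat t" using t(2,3) by (metis int_nat_eq nat_int_comparison(1) int_dvd_int_iff)
  ultimately have "p dvd nat (zsum r x)" using p_dvd by (metis dvd_mod_iff)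
  thus ?thesis using nn by (metis int_dvd_int_iff int_nat_eq)
 qed
 show "1\<^sub>m n \<in> carrier (Grpn r p n)"
  unfolding Grpn_def using one_Grn(1) key[OF one_Grn(1), of 0] one_Grn(3) by simp
 assume g: "g \<in> carrier (Grpn r p n)" and h: "h \<in> carrier (Grpn r p n)"
 have G: "g \<in> carrier (Grn r n)" "int p dvd zsum r g" and H: "h \<in> carrier (Grn r n)" "int p dvd zsum r h"
  using g h by (simp_all add: Grpn_def)
 note M = mult_Grn[OF G(1) H(1)]
 have nn: "0 \<le> zsum r x" if x: "x \<in> carrier (Grn r n)" for x
  unfolding zsum_def using zexp_ent(1)[OF x] Grn_mono(1)[OF x] by (intro sum_nonneg) auto
 have "(\<Prod>j<n. ent (g * h) j) = (\<Prod>j<n. ent g (perm_of h j)) * (\<Prod>j<n. ent h j)"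
  unfolding prod.distrib[symmetric] by (rule prod.cong) (auto simp: M(3))
 also have "(\<Prod>j<n. ent g (perm_of h j)) = (\<Prod>j<n. ent g j)"
  using prod.permute[OF Grn_mono(2)[OF H(1)], of "ent g"] by (simp add: comp_def)
 also have "(\<Prod>j<n. ent g j) * (\<Prod>j<n. ent h j) = zeta r powi (zsum r g + zsum r h)"
  unfolding zsum_ent[OF G(1), symmetric] zsum_ent[OF H(1), symmetric] using zeta_pow(2) by (simp add: power_int_add)
 finally have "int p dvd zsum r (g * h)" by (rule key[OF M(1)]) (use G(2) H(2) nn[OF G(1)] nn[OF H(1)] in auto)
 thus "g * h \<in> carrier (Grpn r p n)" using M(1) by (simp add: Grpn_def)
qed

end

text \<open>The representation axioms for \<open>S\<close> are carried over along the bijection, so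
  for the submodel and for the direct sum only a bijective linear intertwiner has to be
  supplied.\<close>

lemma rep_iso_transport:
 assumes R: "representation G R" and one: "\<one>\<^bsub>G\<^esub> \<in> carrier G"
  and mult: "\<And>g h. g \<in> carrier G ==> h \<in> carrier G ==> g \<otimes>\<^bsub>G\<^esub> h \<in> carrier G"
  and bij: "bij_betw ph (rspace R) (rspace S)" and lin: "linear_map_on (rspace R) ph"
  and eq: "\<And>g x. g \<in> carrier G ==> x \<in> rspace R ==> ph (ract R g x) = ract S g (ph x)"
 shows "rep_iso G R S"
proof -
 have im: "ph ` rspace R = rspace S" using bij by (simp add: bij_betw_def)
 note R' = R[unfolded representation_def]
 have subR: "cfun.subspace (rspace R)" using R' by blast
 have cl: "ract R g x \<in> rspace R" if "g \<in> carrier G" "x \<in> rspace R" for g x using R' that by blast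
 have lR: "ract R g (x + y) = ract R g x + ract R g y" "ract R g (fscale c x) = fscale c (ract R g x)"
  if "g \<in> carrier G" "x \<in> rspace R" "y \<in> rspace R" for g x y c using R' that unfolding linear_map_on_def by blast+
 have l: "ph (x + y) = ph x + ph y" "ph (fscale c x) = fscale c (ph x)" if "x \<in> rspace R" "y \<in> rspace R" for x y c
  using lin that unfolding linear_map_on_def by blast+
 have S: "representation G S" unfolding representation_def
 proof (intro conjI ballI)
  show "cfun.subspace (rspace S)"
  proof (rule cfun.subspaceI)
   note z = cfun.subspace_0[OF subR]
   have "ph 0 = 0" using l(2)[OF z z, of 0] unfolding cfun.scale_zero_left .
   thus "0 \<in> rspace S" using imageI[OF z, of ph] unfolding im by simp
   fix y assume "y \<in> rspace S"
   then obtain x where x: "x \<in> rspace R" "y = ph x" using im by blast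
   show "fscale c y \<in> rspace S" for c
    using imageI[OF cfun.subspace_scale[OF subR x(1), of c], of ph] unfolding im l(2)[OF x(1) x(1)] x(2) .
   fix y' assume "y' \<in> rspace S"
   then obtain x' where x': "x' \<in> rspace R" "y' = ph x'" using im by blast
   show "y + y' \<in> rspace S"
    using imageI[OF cfun.subspace_add[OF subR x(1) x'(1)], of ph] unfolding im l(1)[OF x(1) x'(1)] x(2) x'(2) .
  qed
  fix g assume g: "g \<in> carrier G"
  show "ract S g \<in> rspace S \<rightarrow> rspace S"
  proof
   fix y assume "y \<in> rspace S"
   then obtain x where x: "x \<in> rspace R" "y = ph x" using im by blast
   have "ph (ract R g x) \<in> rspace S" using cl[OF g x(1)] im by blast
   thus "ract S g y \<in> rspace S" unfolding x(2) eq[OF g x(1)] .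
  qed
  show "linear_map_on (rspace S) (ract S g)" unfolding linear_map_on_def
  proof (intro conjI ballI allI)
   fix y y' assume "y \<in> rspace S" "y' \<in> rspace S"
   then obtain x x' where x: "x \<in> rspace R" "y = ph x" "x' \<in> rspace R" "y' = ph x'" using im by blast
   have "ract S g (y + y') = ph (ract R g (x + x'))"
    unfolding x(2,4) l(1)[OF x(1,3), symmetric] eq[OF g cfun.subspace_add[OF subR x(1,3)]] ..
   also have "... = ract S g y + ract S g y'"
    unfolding lR(1)[OF g x(1,3)] l(1)[OF cl[OF g x(1)] cl[OF g x(3)]] eq[OF g x(1)] eq[OF g x(3)] x(2,4) ..
   finally show "ract S g (y + y') = ract S g y + ract S g y'" .
  next
   fix c y assume "y \<in> rspace S"
   then obtain x where x: "x \<in> rspace R" "y = ph x" using im by blast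
   have "ract S g (fscale c y) = ph (ract R g (fscale c x))"
    unfolding x(2) l(2)[OF x(1) x(1), symmetric] eq[OF g cfun.subspace_scale[OF subR x(1)]] ..
   also have "... = fscale c (ract S g y)"
    unfolding lR(2)[OF g x(1) x(1)] l(2)[OF cl[OF g x(1)] cl[OF g x(1)]] eq[OF g x(1)] x(2) ..
   finally show "ract S g (fscale c y) = fscale c (ract S g y)" .
  qed
 next
  fix y assume "y \<in> rspace S"
  then obtain x where x: "x \<in> rspace R" "y = ph x" using im by blast
  have "ract R \<one>\<^bsub>G\<^esub> x = x" using R' x(1) by blast
  thus "ract S \<one>\<^bsub>G\<^esub> y = y" unfolding x(2) eq[OF one x(1), symmetric] by simp
 next
  fix g h y assume g: "g \<in> carrier G" and h: "h \<in> carrier G" and "y \<in> rspace S"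
  then obtain x where x: "x \<in> rspace R" "y = ph x" using im by blast
  have "ract R (g \<otimes>\<^bsub>G\<^esub> h) x = ract R g (ract R h x)" using R' x(1) g h by blast
  thus "ract S (g \<otimes>\<^bsub>G\<^esub> h) y = ract S g (ract S h y)"
   unfolding x(2) eq[OF mult[OF g h] x(1), symmetric] eq[OF h x(1), symmetric] eq[OF g cl[OF h x(1)], symmetric] by simp
 qed
 show ?thesis unfolding rep_iso_def using R S bij lin eq by blast
qed

text \<open>Both sides are compared with a common third representation, which avoids an explicit
  inverse of either isomorphism.\<close>

lemma rep_iso_common:
 assumes M: "rep_iso G E M" and N: "rep_iso G E N"
 shows "rep_iso G M N"
proof -
 from M obtain ph where RE: "representation G E" "representation G M" and p: "bij_betw ph (rspace E) (rspace M)"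
  "linear_map_on (rspace E) ph" "\<And>g x. g \<in> carrier G ==> x \<in> rspace E ==> ph (ract E g x) = ract M g (ph x)"
  unfolding rep_iso_def by blast
 from N obtain ps where RN: "representation G N" and q: "bij_betw ps (rspace E) (rspace N)"
  "linear_map_on (rspace E) ps" "\<And>g x. g \<in> carrier G ==> x \<in> rspace E ==> ps (ract E g x) = ract N g (ps x)"
  unfolding rep_iso_def by blast
 define \<theta> where "\<theta> y = ps (inv_into (rspace E) ph y)" for y
 have inj: "inj_on ph (rspace E)" and im: "ph ` rspace E = rspace M" using p(1) by (auto simp: bij_betw_def)
 have th: "\<theta> (ph x) = ps x" if "x \<in> rspace E" for x unfolding \<theta>_def inv_into_f_f[OF inj that] ..
 have subE: "cfun.subspace (rspace E)" using RE(1) by (simp add: representation_def)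
 have cl: "ract E g x \<in> rspace E" if "g \<in> carrier G" "x \<in> rspace E" for g x
  using RE(1) that unfolding representation_def by blast
 have "bij_betw (ps \<circ> inv_into (rspace E) ph) (rspace M) (rspace N)"
  by (rule bij_betw_trans[OF bij_betw_inv_into[OF p(1)] q(1)])
 hence b: "bij_betw \<theta> (rspace M) (rspace N)" by (simp add: comp_def \<theta>_def[abs_def])
 have "linear_map_on (rspace M) \<theta>" unfolding linear_map_on_def
 proof (intro conjI ballI allI)
  fix y y' assume "y \<in> rspace M" "y' \<in> rspace M"
  then obtain x x' where x: "x \<in> rspace E" "y = ph x" "x' \<in> rspace E" "y' = ph x'" using im by blast
  have "ph (x + x') = ph x + ph x'" "ps (x + x') = ps x + ps x'" using p(2) q(2) x unfolding linear_map_on_def by blast+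
  thus "\<theta> (y + y') = \<theta> y + \<theta> y'"
   using th[OF cfun.subspace_add[OF subE x(1,3)]] unfolding x(2,4) th[OF x(1)] th[OF x(3)] by simp
 next
  fix c y assume "y \<in> rspace M"
  then obtain x where x: "x \<in> rspace E" "y = ph x" using im by blast
  have e2: "ph (fscale c x) = fscale c (ph x)" "ps (fscale c x) = fscale c (ps x)" using p(2) q(2) x unfolding linear_map_on_def by blast+
  show "\<theta> (fscale c y) = fscale c (\<theta> y)"
   using th[OF cfun.subspace_scale[OF subE x(1), of c]] unfolding e2 x(2) th[OF x(1)] .
 qed
 moreover have "\<theta> (ract M g y) = ract N g (\<theta> y)" if g: "g \<in> carrier G" and y: "y \<in> rspace M" for g y
 proof -
  obtain x where x: "x \<in> rspace E" "y = ph x" using im y by blast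
  show ?thesis unfolding x(2) p(3)[OF g x(1), symmetric] th[OF x(1)] th[OF cl[OF g x(1)]] q(3)[OF g x(1)] ..
 qed
 ultimately show ?thesis unfolding rep_iso_def using RE(2) RN b by blast
qed

text \<open>The number of nonzero rows when \<open>f\<close> decreases weakly. \<open>LEAST\<close>
  requires some zero, which for a tableau is found at \<open>n\<close>, since all its rows are below
  \<open>n\<close>.\<close>

definition rowlen :: "(nat => nat) => nat" where "rowlen f = (LEAST i. f i = 0)"

section \<open>Assembling the two isomorphisms over the doubled orbits\<close>

locale asm = gelp n s p for n s p :: nat +
 fixes m :: nat and mm :: "nat list list set => nat list list"
 assumes n2: "n = 2 * m" and gcd2: "gcd p n = 2"
  and rep: "\<And>c. c \<in> doubled_orbits (2 * s) p n ==> mm c \<in> Fer s m \<and> mm c @ mm c \<in> c"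
begin

abbreviation "DO \<equiv> doubled_orbits r p n"
definition "kk c = cntl (mm c @ mm c)"
definition "KK = kk ` DO"

lemma halves2: "r div 2 = s" "n div 2 = m" using n2 by simp_all

lemma DO_iff: "c \<in> DO \<longleftrightarrow> (\<exists>lam\<in>Fer r n. c = Fer_orbit r p lam) \<and> (\<forall>lam\<in>c. \<exists>mu\<in>Fer s m. lam = mu @ mu)"
 unfolding doubled_orbits_def Fer_proj_def halves2 by blast

lemma finite_DO: "finite DO"
 by (rule finite_subset[OF _ finite_imageI[OF finite_Fer[of r n], of "Fer_orbit r p"]]) (auto simp: DO_iff)

lemma double_Fer_n: "mu \<in> Fer s m ==> mu @ mu \<in> Fer r n"
 unfolding n2 by (rule double_Fer)

lemma Fer_D: assumes "lam \<in> Fer a b" shows "length lam = a" "\<And>x. x \<in> set lam ==> is_partition x"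
 using assms by (auto simp: Fer_def)

lemma DO_orbit: assumes "c \<in> DO" shows "c = Fer_orbit r p (mm c @ mm c)"
proof -
 obtain lam where l: "lam \<in> Fer r n" "c = Fer_orbit r p lam" using assms DO_iff by blast
 have "mm c @ mm c \<in> Fer_orbit r p lam" using rep[OF assms] unfolding l(2) by blast
 from orbit_eq[OF Fer_D(1)[OF l(1)] this] show ?thesis using l(2) by simp
qed

text \<open>\<open>cntl\<close> is injective on tuples of partitions, so equality of row lengths
  after shifting puts both representatives in one orbit.\<close>

lemma kk_eq: assumes c: "c \<in> DO" "c' \<in> DO" and e: "cntl ((shift r p ^^ k) (mm c @ mm c)) = kk c'" shows "c = c'"
proof -
 have F: "mm c @ mm c \<in> Fer r n" "mm c' @ mm c' \<in> Fer r n" using double_Fer_n rep c by blast+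
 have S: "(shift r p ^^ k) (mm c @ mm c) \<in> Fer r n"
  unfolding shift_rotate[OF Fer_D(1)[OF F(1)]] by (rule rotate_Fer[OF F(1)])
 have "(shift r p ^^ k) (mm c @ mm c) = mm c' @ mm c'"
  by (rule cntl_inject[OF _ Fer_D(2)[OF S] Fer_D(2)[OF F(2)] e[unfolded kk_def]])
   (simp_all only: Fer_D(1)[OF S] Fer_D(1)[OF F(2)])
 hence "mm c' @ mm c' \<in> Fer_orbit r p (mm c @ mm c)" unfolding Fer_orbit_def by (metis (mono_tags, lifting) mem_Collect_eq)
 from orbit_eq[OF Fer_D(1)[OF F(1)] this] show ?thesis using DO_orbit[OF c(1)] DO_orbit[OF c(2)] by simp
qed

lemma kk_inj: assumes "c \<in> DO" "c' \<in> DO" "kk c = kk c'" shows "c = c'"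
 by (rule kk_eq[OF assms(1,2), of 0]) (use assms(3) in \<open>simp add: kk_def\<close>)

lemma doubled_kk: assumes c: "c \<in> DO" and e: "cnt z rw = kk c" shows "doubled z rw"
proof -
 have "length (mm c) = s" using rep[OF c] Fer_D(1) by blast
 hence "kk c a = kk c (a + s)" if "a < s" for a using that by (auto simp: kk_def cntl_def nth_append fun_eq_iff)
 thus ?thesis unfolding doubled_def e by blast
qed

text \<open>Closure under moving up makes the row lengths of each colour weakly decreasing, and
  doubling makes colours \<open>c\<close> and \<open>c + s\<close> agree; counting all
  \<open>n\<close> letters leaves \<open>m\<close> for one half.\<close>

lemma partition_of_tableau:
 assumes T: "Tab z rw cw" and D: "doubled z rw"
 shows "\<exists>mu\<in>Fer s m. cnt z rw = cntl (mu @ mu)"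
proof -
 have tab: "tab X z rw cw" using T by (simp add: Tab_def)
 have mono: "cnt z rw c j \<le> cnt z rw c i" if ij: "i \<le> j" for c i j
 proof -
  let ?R = "\<lambda>i. {x\<in>X. z x = c \<and> rw x = i}"
  have cd: "card (?R i) = card (cw ` ?R i)" for i
  proof (rule card_image[symmetric], rule inj_onI)
   fix x y assume h: "x \<in> ?R i" "y \<in> ?R i" "cw x = cw y"
   have "inj3 X z rw cw" using tab by (simp add: tab_def)
   from inj3D[OF this, of x y] show "x = y" using h by simp
  qed
  have "cw ` ?R j \<subseteq> cw ` ?R i"
  proof
   fix g assume "g \<in> cw ` ?R j"
   then obtain y where y: "y \<in> X" "z y = c" "rw y = j" "g = cw y" by blast
   show "g \<in> cw ` ?R i"
   proof (cases "i = j")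
    case False
    hence "i < rw y" using ij y(3) by simp
    then obtain x where "x \<in> X" "z x = z y" "cw x = cw y" "rw x = i" using tab y(1) unfolding tab_def by blast
    thus ?thesis using y by (intro image_eqI[of _ _ x]) auto
   qed (use y in blast)
  qed
  thus ?thesis unfolding cnt_def cd by (intro card_mono) auto
 qed
 have ex0: "cnt z rw c n = 0" for c
 proof -
  have "{x\<in>X. z x = c \<and> rw x = n} = {}" using Tab_Rw[OF T] by (auto simp: Rw_def)
  thus ?thesis by (simp add: cnt_def)
 qed
 have L0: "cnt z rw c i = 0 \<longleftrightarrow> rowlen (cnt z rw c) \<le> i" for c i
 proof
  assume "cnt z rw c i = 0" thus "rowlen (cnt z rw c) \<le> i" unfolding rowlen_def by (rule Least_le)
 next
  have "cnt z rw c (rowlen (cnt z rw c)) = 0" unfolding rowlen_def by (rule LeastI[of _ n]) (rule ex0)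
  thus "cnt z rw c i = 0" if "rowlen (cnt z rw c) \<le> i" using mono[OF that, of c] by simp
 qed
 define F where "F c = map (cnt z rw c) [0..<rowlen (cnt z rw c)]" for c
 define mu where "mu = map F [0..<s]"
 have part: "is_partition (F c)" for c
  unfolding is_partition_def sorted_wrt_iff_nth_less
 proof (intro conjI allI impI ballI)
  fix i j assume "i < j" "j < length (F c)"
  thus "F c ! i \<ge> F c ! j" using mono[of i j c] by (simp add: F_def)
 next
  fix k assume "k \<in> set (F c)"
  then obtain i where "i < rowlen (cnt z rw c)" "k = cnt z rw c i" by (auto simp: F_def)
  thus "0 < k" using L0[of c i] by simp
 qed
 have Fs: "F (c + s) = F c" if "c < s" for c using D that by (simp add: doubled_def F_def)
 have row: "sum_list (F c) = card {x\<in>X. z x = c}" for c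
 proof -
  have lt: "rw x < rowlen (cnt z rw c)" if "x \<in> X" "z x = c" for x
  proof (rule ccontr)
   assume "\<not> ?thesis"
   hence "cnt z rw c (rw x) = 0" using L0[of c "rw x"] by simp
   hence "{y\<in>X. z y = c \<and> rw y = rw x} = {}" unfolding cnt_def by (subst (asm) card_0_eq) simp_all
   thus False using that by blast
  qed
  have "card {x\<in>X. z x = c} = (\<Sum>x\<in>{x\<in>X. z x = c}. 1)" by simp
  also have "... = (\<Sum>i<rowlen (cnt z rw c). \<Sum>x\<in>{x\<in>{x\<in>X. z x = c}. rw x = i}. 1)"
   by (rule sum.group[symmetric]) (use lt in auto)
  also have "... = (\<Sum>i<rowlen (cnt z rw c). cnt z rw c i)"
  proof (rule sum.cong[OF refl])
   fix i
   have "{x\<in>{x\<in>X. z x = c}. rw x = i} = {x\<in>X. z x = c \<and> rw x = i}" by auto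
   thus "(\<Sum>x\<in>{x\<in>{x\<in>X. z x = c}. rw x = i}. 1) = cnt z rw c i" by (simp add: cnt_def)
  qed
  finally show ?thesis by (simp add: F_def interv_sum_list_conv_sum_set_nat atLeast0LessThan)
 qed
 have "n = (\<Sum>x\<in>X. 1)" by simp
 also have "... = (\<Sum>c<r. \<Sum>x\<in>{x\<in>X. z x = c}. 1)" by (rule sum.group[symmetric]) (use Tab_colour[OF T] in auto)
 also have "... = (\<Sum>c<s + s. sum_list (F c))" by (simp add: row mult_2)
 also have "... = (\<Sum>c<s. sum_list (F c)) + (\<Sum>c<s. sum_list (F (c + s)))"
  unfolding lessThan_atLeast0 by (subst sum.atLeastLessThan_concat[of 0 s, symmetric], simp, simp)
   (use sum.shift_bounds_nat_ivl[of "\<lambda>c. sum_list (F c)" 0 s s] in simp)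
 also have "... = 2 * (\<Sum>c<s. sum_list (F c))" using Fs by (simp add: mult_2)
 finally have "(\<Sum>c<s. sum_list (F c)) = m" using n2 by simp
 hence "(\<Sum>a\<leftarrow>mu. sum_list a) = m"
  by (simp add: mu_def comp_def interv_sum_list_conv_sum_set_nat atLeast0LessThan)
 hence "mu \<in> Fer s m" using part by (auto simp: Fer_def mu_def)
 moreover have "cnt z rw c i = cntl (mu @ mu) c i" for c i
 proof (cases "c < r")
  case True
  have nth: "(mu @ mu) ! c = F c"
  proof (cases "c < s")
   case False
   hence "c - s < s" using True by simp
   thus ?thesis using Fs[of "c - s"] False by (simp add: nth_append mu_def)
  qed (simp add: nth_append mu_def)
  have "length (mu @ mu) = r" by (simp add: mu_def)
  thus ?thesis unfolding cntl_def nth using True L0[of c i] by (simp add: F_def not_less)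
 next
  case False
  hence "{x\<in>X. z x = c \<and> rw x = i} = {}" using Tab_colour[OF T] by auto
  thus ?thesis using False by (simp add: cnt_def cntl_out mu_def)
 qed
 hence "cnt z rw = cntl (mu @ mu)" by (intro ext)
 ultimately show ?thesis by blast
qed

text \<open>Colour shifts of words are shifts of tuples by \<open>cntl_shift\<close>. So a doubled
  shape can be shifted to the representative of its orbit, and two chosen representatives related by
  a shift belong to the same orbit and coincide.\<close>

sublocale gelK n s p KK
proof
 show "doubled z rw" if "cnt z rw \<in> KK" for z rw using that doubled_kk unfolding KK_def by blast
 show "\<exists>k. cnt (shz (d * k) z) rw \<in> KK" if T: "Tab z rw cw" "doubled z rw" for z rw cw
 proof -
  obtain mu where mu: "mu \<in> Fer s m" "cnt z rw = cntl (mu @ mu)" using partition_of_tableau[OF T] by blast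
  note F = double_Fer_n[OF mu(1)]
  let ?c = "Fer_orbit r p (mu @ mu)"
  have "\<exists>mu'\<in>Fer s m. lam = mu' @ mu'" if lc: "lam \<in> ?c" for lam
  proof -
   obtain k where "lam = (shift r p ^^ k) (mu @ mu)" using lc unfolding Fer_orbit_def by blast
   hence "lam = rotate (k * (r - d)) mu @ rotate (k * (r - d)) mu"
    unfolding shift_rotate[OF Fer_D(1)[OF F]] rotate_double .
   thus ?thesis using rotate_Fer[OF mu(1)] by blast
  qed
  hence c: "?c \<in> DO" unfolding DO_iff using F by blast
  hence "mm ?c @ mm ?c \<in> ?c" using rep by blast
  then obtain k where k: "mm ?c @ mm ?c = (shift r p ^^ k) (mu @ mu)" unfolding Fer_orbit_def by blast
  have "cnt (shz (d * k) z) rw = kk ?c"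
   unfolding kk_def k by (rule cntl_shift[OF Tab_colour[OF T(1)] mu(2) Fer_D(1)[OF F]])
  thus ?thesis using c unfolding KK_def by blast
 qed
 show "cnt (shz (d * k) z) bw = cnt z bw"
  if z: "\<And>x. x < n ==> z x < r" and K: "cnt z bw \<in> KK" "cnt (shz (d * k) z) bw \<in> KK" for z bw k
 proof -
  obtain c c' where c: "c \<in> DO" "c' \<in> DO" "cnt z bw = kk c" "cnt (shz (d * k) z) bw = kk c'" using K unfolding KK_def by blast
  have "length (mm c @ mm c) = r" using double_Fer_n rep[OF c(1)] Fer_D(1) by blast
  from cntl_shift[OF z c(3)[unfolded kk_def] this, of k]
  have "cntl ((shift r p ^^ k) (mm c @ mm c)) = kk c'" unfolding c(4) by simp
  from kk_eq[OF c(1,2) this] show ?thesis using c(3,4) by simp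
 qed
qed (rule gcd2)

text \<open>The middle term of the comparison: \<open>Theta\<close> maps it to the submodel and
  \<open>Om\<close> to the direct sum.\<close>

definition E :: "(complex mat, wd) rep" where
 "E = \<lparr>rspace = EK KK, ract = eact\<rparr>"

lemma E_simps: "rspace E = EK KK" "ract E = eact" by (simp_all add: E_def)

lemma Grpn_ops: "\<one>\<^bsub>Grpn r p n\<^esub> = 1\<^sub>m n" "x \<otimes>\<^bsub>Grpn r p n\<^esub> y = x * y"
 by (simp_all add: Grpn_def)

lemma representation_E: "Defs.representation (Grpn r p n) E"
 unfolding representation_def E_simps Grpn_ops
proof (intro conjI ballI)
 show "cfun.subspace (EK KK)" by (rule subspace_EK)
 show "eact g \<in> EK KK \<rightarrow> EK KK" if "g \<in> carrier (Grpn r p n)" for g using eact_EK[OF that] by blast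
 show "linear_map_on (EK KK) (eact g)" for g unfolding linear_map_on_def by (intro conjI ballI allI eact_add eact_fscale)
 show "eact (1\<^sub>m n) x = x" for x by (rule eact_one)
 show "eact (g * h) x = eact g (eact h x)" if "g \<in> carrier (Grpn r p n)" "h \<in> carrier (Grpn r p n)" for g h x
  by (rule eact_mult[OF prod_ent_d(1)[OF that(1)] prod_ent_d(1)[OF that(2)]])
qed

lemma kernel_inj:
 assumes add: "\<And>a b. f (a + b) = f a + f b" and sc: "\<And>c a. f (fscale c a) = fscale c (f a)"
  and ker: "\<And>ph. ph \<in> EK KK ==> f ph = 0 ==> ph = 0"
 shows "inj_on f (EK KK)"
proof (rule inj_onI)
 fix a b assume ab: "a \<in> EK KK" "b \<in> EK KK" "f a = f b"
 have "a + fscale (-1) b \<in> EK KK"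
  by (rule cfun.subspace_add[OF subspace_EK ab(1) cfun.subspace_scale[OF subspace_EK ab(2)]])
 moreover have "f (a + fscale (-1) b) = 0" unfolding add sc ab(3) by (intro ext) (simp only: plus_fun_apply fscale_apply, simp)
 ultimately have z: "a + fscale (-1) b = 0" by (rule ker)
 show "a = b"
 proof
  fix o' show "a o' = b o'" using fun_cong[OF z, of o'] by (simp only: plus_fun_apply fscale_apply) simp
 qed
qed

lemma iso_submodel: "rep_iso (Grpn r p n) E (antisymmetric_submodel r p n)"
proof (rule rep_iso_transport[OF representation_E, where ph=Theta])
 show "\<one>\<^bsub>Grpn r p n\<^esub> \<in> carrier (Grpn r p n)" unfolding Grpn_ops by (rule Grpn_closed(1))
 show "g \<otimes>\<^bsub>Grpn r p n\<^esub> h \<in> carrier (Grpn r p n)" if "g \<in> carrier (Grpn r p n)" "h \<in> carrier (Grpn r p n)" for g h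
  unfolding Grpn_ops by (rule Grpn_closed(2)[OF that])
 have "rspace (antisymmetric_submodel r p n) = cfun.span (basis_vec ` AS)"
  by (simp add: antisymmetric_submodel_def AS_def)
 thus "bij_betw Theta (rspace E) (rspace (antisymmetric_submodel r p n))"
  unfolding bij_betw_def E_simps using kernel_inj[of Theta, OF Theta_add Theta_fscale Theta_injective] Theta_image by simp
 show "linear_map_on (rspace E) Theta" unfolding linear_map_on_def by (intro conjI ballI allI Theta_add Theta_fscale)
 show "Theta (ract E g x) = ract (antisymmetric_submodel r p n) g (Theta x)" if "g \<in> carrier (Grpn r p n)" for g x
  unfolding E_simps Theta_eact[OF that] by (simp add: antisymmetric_submodel_def)
qed

text \<open>The projection to one shape. It commutes with the action, which permutes letters, and
  with the shift by \<open>s\<close>, which fixes doubled shapes; hence it splits the eigenspace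
  along the orbits.\<close>

definition res :: "(nat => nat => nat) => (wd => complex) => wd => complex" where
 "res k ph = (\<lambda>(z, bw). if cnt z bw = k then ph (z, bw) else 0)"

lemma res_add: "res k (a + b) = res k a + res k b"
 and res_fscale: "res k (fscale c a) = fscale c (res k a)"
 and res_zero: "res k 0 = 0"
 by (auto simp: res_def fun_eq_iff)

lemma res_one: assumes "ph \<in> SpK {k'}" shows "res k ph = (if k' = k then ph else 0)"
proof -
 have "res k ph (z, bw) = (if k' = k then ph else 0) (z, bw)" for z bw
  using SpK_support[OF assms, of z bw] by (auto simp: res_def)
 thus ?thesis by (intro ext) (auto simp: split_paired_all)
qed

lemma evec_SpK: "Tab z rw cw ==> evec z rw cw \<in> SpK {cnt z rw}"
 unfolding SpK_def by (rule cfun.span_base) blast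

lemma sub_SpK: "cfun.subspace (SpK K)"
 unfolding SpK_def by (rule cfun.subspace_span)

lemma res_SpK: assumes "ph \<in> SpK KK"
 shows "res k ph \<in> SpK {k}" "Zf s (res k ph) = res k (Zf s ph)"
proof -
 have "res k ph \<in> SpK {k} \<and> Zf s (res k ph) = res k (Zf s ph)"
  using assms unfolding SpK_def[of KK]
 proof (induction rule: cfun.span_induct_alt)
  case base
  show ?case unfolding res_zero Zf_zero using cfun.subspace_0[OF sub_SpK] by blast
 next
  case (step c e y)
  then obtain z rw cw where e: "e = evec z rw cw" "Tab z rw cw" "cnt z rw \<in> KK" by blast
  note r1 = res_one[OF evec_SpK[OF e(2)], of k]
  have d: "cnt (shz s z) rw = cnt z rw" by (rule cnt_shz_s[OF Tab_colour[OF e(2)] K1[OF e(2,3)]])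
  have ze: "Zf s e = evec (shz s z) rw cw" unfolding e(1) Zf_evec[OF e(2)] using s_pos by simp
  note r2 = res_one[OF evec_SpK[OF Tab_shz[OF e(2), of s]], of k, unfolded d]
  have "res k e \<in> SpK {k}" unfolding e(1) r1 using evec_SpK[OF e(2)] cfun.subspace_0[OF sub_SpK] by (auto split: if_splits)
  moreover have "Zf s (res k e) = res k (Zf s e)"
  proof (cases "cnt z rw = k")
   case True
   hence "res k e = e" "res k (Zf s e) = Zf s e" unfolding ze r2 unfolding e(1) r1 by simp_all
   thus ?thesis by simp
  next
   case False
   hence "res k e = 0" "res k (Zf s e) = 0" unfolding ze r2 unfolding e(1) r1 by (simp_all only: if_False)
   thus ?thesis by (simp only: Zf_zero)
  qed
  ultimately show ?case unfolding res_add res_fscale Zf_add Zf_fscale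
   using step(2) cfun.subspace_add[OF sub_SpK cfun.subspace_scale[OF sub_SpK]] by (simp only: simp_thms)
 qed
 thus "res k ph \<in> SpK {k}" "Zf s (res k ph) = res k (Zf s ph)" by blast+
qed

lemma res_EK: assumes "ph \<in> EK KK" shows "res k ph \<in> EK {k}"
 using assms res_SpK[of ph k] unfolding EK_def mem_Collect_eq by (simp only: res_fscale simp_thms)

lemma res_eact: assumes g: "g \<in> carrier (Grn r n)" shows "res k (eact g ph) = eact g (res k ph)"
proof -
 have "res k (eact g ph) (z, bw) = eact g (res k ph) (z, bw)" for z bw
  unfolding eact_apply[OF g] res_def prod.case cnt_comp2[OF Grn_mono(2)[OF g]] eact_apply[OF g] by simp
 thus ?thesis by (intro ext) (auto simp: split_paired_all)
qed

lemma dm: "c \<in> DO ==> dmod n s p m (mm c)"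
 using rep n2 by (intro dmod.intro gelp_axioms dmod_axioms.intro) auto

abbreviation "XI c \<equiv> dmod.Xi n s m (mm c)"

definition Om where "Om ph = (\<lambda>(c, o'). if c \<in> DO then XI c (res (kk c) ph) o' else 0)"

lemma Om_at: "c \<in> DO ==> (\<lambda>b. Om ph (c, b)) = XI c (res (kk c) ph)"
 by (simp add: Om_def)

lemma Om_add: "Om (a + b) = Om a + Om b"
proof -
 have "Om (a + b) (c, o') = (Om a + Om b) (c, o')" for c o'
  by (cases "c \<in> DO") (simp_all only: Om_def prod.case if_True if_False res_add dmod.Xi_add[OF dm] plus_fun_apply add_0_right)
 thus ?thesis by (intro ext) (auto simp: split_paired_all)
qed

lemma Om_fscale: "Om (fscale k a) = fscale k (Om a)"
proof -
 have "Om (fscale k a) (c, o') = fscale k (Om a) (c, o')" for c o'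
  by (cases "c \<in> DO") (simp_all only: Om_def prod.case if_True if_False res_fscale dmod.Xi_fscale[OF dm] fscale_apply mult_zero_right)
 thus ?thesis by (intro ext) (auto simp: split_paired_all)
qed

lemma Om_ker: assumes p: "ph \<in> EK KK" and 0: "Om ph = 0" shows "ph = 0"
proof (rule ccontr)
 assume "ph \<noteq> 0"
 then obtain z bw where nz: "ph (z, bw) \<noteq> 0" by (auto simp: fun_eq_iff)
 have pS: "ph \<in> SpK KK" using p by (simp add: EK_def)
 then obtain c where c: "c \<in> DO" "cnt z bw = kk c" using SpK_support[OF pS nz] unfolding KK_def by blast
 have "XI c (res (kk c) ph) = 0" unfolding Om_at[OF c(1), symmetric] 0 by (intro ext) simp
 moreover have "res (kk c) ph \<in> SpK {cntl (mm c @ mm c)}" using res_SpK(1)[OF pS, of "kk c"] by (simp only: kk_def)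
 ultimately have "res (kk c) ph = 0" using dmod.Xi_injective[OF dm[OF c(1)]] by blast
 hence "res (kk c) ph (z, bw) = 0" by simp
 thus False using nz c(2) by (simp add: res_def)
qed

lemma res_sum: "res k (\<Sum>i\<in>A. f i) = (\<Sum>i\<in>A. res k (f i))"
 by (induct A rule: infinite_finite_induct) (simp_all only: sum.infinite sum.empty sum.insert res_zero res_add not_False_eq_True)

abbreviation "N \<equiv> direct_sum_rep DO (\<lambda>c. rho_split r n 1 (mm c))"

lemma split_space: "c \<in> DO ==> rspace (rho_split r n 1 (mm c)) = XI c ` EK {kk c}"
 unfolding kk_def by (rule dmod.split_rspace[OF dm])

text \<open>Distinct orbits have distinct shapes, so the components may be summed: each projection
  \<open>res\<close> recovers its own component and kills the others.\<close>

lemma Om_image: "Om ` EK KK = rspace N"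
proof (rule antisym)
 show "Om ` EK KK \<subseteq> rspace N"
 proof
  fix f assume "f \<in> Om ` EK KK"
  then obtain ph where f: "f = Om ph" "ph \<in> EK KK" by blast
  have "(\<lambda>b. f (c, b)) \<in> rspace (rho_split r n 1 (mm c))" if "c \<in> DO" for c
   unfolding f(1) Om_at[OF that] split_space[OF that] by (rule imageI) (rule res_EK[OF f(2)])
  thus "f \<in> rspace N" by (simp add: direct_sum_rep_def f(1) Om_def)
 qed
 show "rspace N \<subseteq> Om ` EK KK"
 proof
  fix f assume "f \<in> rspace N"
  hence f: "(\<forall>i\<in>DO. (\<lambda>b. f (i, b)) \<in> rspace (rho_split r n 1 (mm i))) \<and> (\<forall>i b. i \<notin> DO \<longrightarrow> f (i, b) = 0)"
   unfolding direct_sum_rep_def rep.simps mem_Collect_eq .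
  have f1: "(\<lambda>b. f (c, b)) \<in> XI c ` EK {kk c}" if c: "c \<in> DO" for c
   using bspec[OF conjunct1[OF f] c] unfolding split_space[OF c] .
  have f0: "f (c, b) = 0" if c: "c \<notin> DO" for c b using conjunct2[OF f] c by blast
  have "\<forall>c. \<exists>ph. c \<in> DO \<longrightarrow> ph \<in> EK {kk c} \<and> (\<lambda>b. f (c, b)) = XI c ph" using f1 by blast
  from choice[OF this] obtain \<Phi> where P: "\<And>c. c \<in> DO ==> \<Phi> c \<in> EK {kk c}" "\<And>c. c \<in> DO ==> (\<lambda>b. f (c, b)) = XI c (\<Phi> c)"
   by blast
  have PS: "\<Phi> c \<in> SpK {kk c}" if "c \<in> DO" for c using P(1)[OF that] by (simp add: EK_def)
  define ph where "ph = (\<Sum>c\<in>DO. \<Phi> c)"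
  have "EK {kk c} \<subseteq> EK KK" if "c \<in> DO" for c
  proof -
   have "SpK {kk c} \<subseteq> SpK KK" unfolding SpK_def by (rule cfun.span_mono) (use that in \<open>unfold KK_def, blast\<close>)
   thus ?thesis by (auto simp: EK_def)
  qed
  hence pE: "ph \<in> EK KK" unfolding ph_def using P(1) by (intro cfun.subspace_sum[OF subspace_EK]) blast
  have rc: "res (kk c) ph = \<Phi> c" if c: "c \<in> DO" for c
  proof -
   have "res (kk c) ph = (\<Sum>c'\<in>DO. if c' = c then \<Phi> c else 0)"
    unfolding ph_def res_sum
   proof (rule sum.cong[OF refl])
    fix c' assume c': "c' \<in> DO"
    show "res (kk c) (\<Phi> c') = (if c' = c then \<Phi> c else 0)"
    proof (cases "c' = c")
     case True
     thus ?thesis using res_one[OF PS[OF c], of "kk c"] by simp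
    next
     case False
     hence "kk c' \<noteq> kk c" using kk_inj[OF c' c] by blast
     thus ?thesis using res_one[OF PS[OF c'], of "kk c"] False by (simp only: if_False)
    qed
   qed
   thus ?thesis using finite_DO c by (simp only: sum.delta if_True)
  qed
  have "f (c, b) = Om ph (c, b)" for c b
  proof (cases "c \<in> DO")
   case True
   thus ?thesis using fun_cong[OF P(2)[OF True], of b] by (simp add: Om_def rc)
  next
   case False
   thus ?thesis using f0 by (simp add: Om_def)
  qed
  hence "f = Om ph" by (intro ext) (auto simp: split_paired_all)
  thus "f \<in> Om ` EK KK" using pE by blast
 qed
qed

lemma iso_sum: "rep_iso (Grpn r p n) E N"
proof (rule rep_iso_transport[OF representation_E, where ph=Om])
 show "\<one>\<^bsub>Grpn r p n\<^esub> \<in> carrier (Grpn r p n)" unfolding Grpn_ops by (rule Grpn_closed(1))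
 show "g \<otimes>\<^bsub>Grpn r p n\<^esub> h \<in> carrier (Grpn r p n)" if "g \<in> carrier (Grpn r p n)" "h \<in> carrier (Grpn r p n)" for g h
  unfolding Grpn_ops by (rule Grpn_closed(2)[OF that])
 show "bij_betw Om (rspace E) (rspace N)"
  unfolding bij_betw_def E_simps using kernel_inj[of Om, OF Om_add Om_fscale Om_ker] Om_image by simp
 show "linear_map_on (rspace E) Om" unfolding linear_map_on_def by (intro conjI ballI allI Om_add Om_fscale)
 show "Om (ract E g x) = ract N g (Om x)" if g: "g \<in> carrier (Grpn r p n)" for g x
 proof -
  note G = prod_ent_d(1)[OF g]
  have "Om (eact g x) (c, b) = ract N g (Om x) (c, b)" for c b
  proof (cases "c \<in> DO")
   case True
   have "ract N g (Om x) (c, b) = ract (rho_double r n (mm c)) g (\<lambda>b'. Om x (c, b')) b"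
    using True by (simp add: direct_sum_rep_def rho_split_def)
   also have "... = XI c (eact g (res (kk c) x)) b" unfolding Om_at[OF True] dmod.Xi_eact[OF dm[OF True] G] ..
   also have "... = Om (eact g x) (c, b)" using True by (simp add: Om_def res_eact[OF G])
   finally show ?thesis ..
  next
   case False
   thus ?thesis by (simp add: Om_def direct_sum_rep_def)
  qed
  thus ?thesis unfolding E_simps by (intro ext) (auto simp: split_paired_all)
 qed
qed

lemmas submodel_iso = rep_iso_common[OF iso_submodel iso_sum]

end

theorem theorem7p1:
  fixes r p n :: nat and m :: "nat list list set \<Rightarrow> nat list list"
  assumes "0 < r" and "0 < p" and "0 < n"
    and "p dvd r" and "gcd p n = 2"
    and representatives: "\<And>c. c \<in> doubled_orbits r p n \<Longrightarrow>
           m c \<in> Fer (r div 2) (n div 2) \<and> m c @ m c \<in> c"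
  shows "rep_iso (Grpn r p n)
           (antisymmetric_submodel r p n)
           (direct_sum_rep (doubled_orbits r p n) (\<lambda>c. rho_split r n 1 (m c)))"
proof -
 have ev: "even p" "even n" using assms(5) by (metis gcd_dvd1, metis gcd_dvd2)
 hence "even r" using assms(4) dvd_trans by blast
 hence r2: "2 * (r div 2) = r" by simp
 interpret asm n "r div 2" p "n div 2" m
 proof
  show "0 < r div 2" using assms(1) r2 by linarith
  show "p dvd 2 * (r div 2)" unfolding r2 by (rule assms(4))
  show "n = 2 * (n div 2)" using ev(2) by simp
  show "m c \<in> Fer (r div 2) (n div 2) \<and> m c @ m c \<in> c" if "c \<in> doubled_orbits (2 * (r div 2)) p n" for c
   using representatives that unfolding r2 .
 qed (use assms ev in auto)
 show ?thesis using submodel_iso unfolding r2 .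
qed

end
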